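(* Let $A,B$ be dg algebras over a field $k$ and suppose that $\psi\colon A\to B$ is a morphism of dg algebras inducing a flat epimorphism $\psi^*\colon H^*A\to H^*B$ in cohomology. Then the map $$\Gamma\colon\mathrm{HH}^{*,*}(H^*A)\longrightarrow\mathrm{HH}^{*,*}(H^*B)$$ satisfies $\Gamma(\mu_A)=\mu_B$.
   Context: Graded means $\mathbb Z$-graded; dg algebras have differentials of degree $+1$. A morphism of graded algebras $\varphi\colon R\to T$ is a flat epimorphism if it is an epimorphism in the category of rings and $T$ is flat both as left and as right $R$-module. Hochschild cohomology. For a graded $k$-algebra $\Lambda$ put $\Lambda^e=\Lambda^{\mathrm{op}}\otimes_k\Lambda$ (with Koszul signs). $\mathrm{HH}^{s,t}(\Lambda)=H^s(\mathrm{Hom}^t_{\Lambda^e}(\mathbb B(\Lambda),\Lambda))=\mathrm{Ext}^{s,t}_{\Lambda^e}(\Lambda,\Lambda)$, where $\mathbb B(\Lambda)_n=\Lambda^{\otimes(n+2)}$ is the graded bar resolution with $d(\lambda_0,\dots,\lambda_{n+1})=\sum_{i=0}^n(-1)^i(\dots,\lambda_i\lambda_{i+1},\dots)$. Cochains $f\in\mathrm{Hom}_k^t(\Lambda^{\otimes s},\Lambda)$ of the usual Hochschild complex correspond to $\tilde f(\lambda_0,\dots,\lambda_{s+1})=(-1)^{t|\lambda_0|}\lambda_0f(\lambda_1,\dots,\lambda_s)\lambda_{s+1}$. The map $\Gamma$. If $\varphi\colon R\to T$ is a flat epimorphism of graded $k$-algebras, then $T\otimes_R\mathbb B(R)\otimes_RT$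 is a $T^e$-projective resolution of $T\otimes_RR\otimes_RT\cong T$, hence $\mathrm{Hom}^l_{T^e}(T\otimes_R\mathbb B(R)\otimes_RT,T)$ computes $\mathrm{HH}^{*,l}(T)$, and $\Gamma\colon\mathrm{HH}^{*,*}(R)\to\mathrm{HH}^{*,*}(T)$ is induced by $\zeta\mapsto T\otimes_R\zeta\otimes_RT$, i.e. $(t,b,t')\mapsto(-1)^{|\zeta||t|}t\,\varphi(\zeta(b))\,t'$. Canonical class. For a dg algebra $B$ over $k$ with differential $d$, choose a $k$-linear degree $0$ map $f_1\colon H^*B\to B$ picking a representing cocycle of each class, and a $k$-linear degree $-1$ map $f_2\colon H^*B\otimes H^*B\to B$ with $d f_2(x,y)=f_1(xy)-f_1(x)f_1(y)$. Let $m_3(x,y,z)$ be the class of $(-1)^{|x|}f_1(x)f_2(y,z)-f_2(x,y)f_1(z)-f_2(xy,z)+f_2(x,yz)$. This is a $(3,-1)$-Hochschild cocycle of $H^*B$ whose class $\mu_B\in\mathrm{HH}^{3,-1}(H^*B)$ is independent of the choices. *)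

theory Defs
  imports "HOL-Algebra.Free_Abelian_Groups" "HOL-Algebra.QuotRing" "HOL-Algebra.Module"
begin

section \<open>Graded algebras and dg algebras over a field\<close>

text \<open>
  A graded algebra is the total object: a (not necessarily commutative) \<open>K\<close>-algebra together
  with an internal direct sum decomposition into the submodules \<open>part A n\<close>, \<open>n\<close> an integer.
\<close>

record ('k, 'a) graded_alg = "('k, 'a) module" +
  part :: "int \<Rightarrow> 'a set"

record ('k, 'a) dg_alg = "('k, 'a) graded_alg" +
  differential :: "'a \<Rightarrow> 'a"

locale field_algebra = K?: field K + module K A + ring A
  for K (structure) and A (structure) +
  assumes smult_mult_left:
      "\<lbrakk>c \<in> carrier K; x \<in> carrier A; y \<in> carrier A\<rbrakk> \<Longrightarrow>
        (c \<odot>\<^bsub>A\<^esub> x) \<otimes>\<^bsub>A\<^esub> y = c \<odot>\<^bsub>A\<^esub> (x \<otimes>\<^bsub>A\<^esub> y)"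
    and smult_mult_right:
      "\<lbrakk>c \<in> carrier K; x \<in> carrier A; y \<in> carrier A\<rbrakk> \<Longrightarrow>
        x \<otimes>\<^bsub>A\<^esub> (c \<odot>\<^bsub>A\<^esub> y) = c \<odot>\<^bsub>A\<^esub> (x \<otimes>\<^bsub>A\<^esub> y)"

definition homogeneous_decomposition ::
    "('k, 'a, 'z) graded_alg_scheme \<Rightarrow> 'a \<Rightarrow> (int \<Rightarrow> 'a) \<Rightarrow> bool" where
  "homogeneous_decomposition A x c \<longleftrightarrow>
     (\<forall>n. c n \<in> part A n) \<and> finite {n. c n \<noteq> \<zero>\<^bsub>A\<^esub>} \<and> x = finsum A c {n. c n \<noteq> \<zero>\<^bsub>A\<^esub>}"

locale graded_algebra = field_algebra K A
  for K (structure) and A :: "('k, 'a, 'z) graded_alg_scheme" (structure) +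
  assumes part_submodule: "submodule (part A n) K A"
    and ex1_decomposition: "x \<in> carrier A \<Longrightarrow> \<exists>!c. homogeneous_decomposition A x c"
    and one_part: "\<one>\<^bsub>A\<^esub> \<in> part A 0"
    and mult_part: "\<lbrakk>x \<in> part A m; y \<in> part A n\<rbrakk> \<Longrightarrow> x \<otimes>\<^bsub>A\<^esub> y \<in> part A (m + n)"

text \<open>The element \<open>(-1)\<^sup>e x\<close> of an abelian group that is written multiplicatively.\<close>

definition signed :: "('a, 'z) monoid_scheme \<Rightarrow> int \<Rightarrow> 'a \<Rightarrow> 'a" where
  "signed G e x = (if even e then x else inv\<^bsub>G\<^esub> x)"

text \<open>
  The additive extension of \<open>x \<mapsto> (-1)\<^bsup>e|x|\<^esup> x\<close> from homogeneous to arbitrary elements.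
\<close>

definition koszul :: "('k, 'a, 'z) graded_alg_scheme \<Rightarrow> int \<Rightarrow> 'a \<Rightarrow> 'a" where
  "koszul A e x =
     (let c = (THE c. homogeneous_decomposition A x c)
      in finsum A (\<lambda>n. signed (add_monoid A) (e * n) (c n)) {n. c n \<noteq> \<zero>\<^bsub>A\<^esub>})"

definition graded_alg_hom :: "('k, 'p) ring_scheme \<Rightarrow> ('k, 'a, 'y) graded_alg_scheme
    \<Rightarrow> ('k, 'b, 'z) graded_alg_scheme \<Rightarrow> ('a \<Rightarrow> 'b) \<Rightarrow> bool" where
  "graded_alg_hom K A B \<phi> \<longleftrightarrow>
     \<phi> \<in> ring_hom A B \<and>
     (\<forall>c \<in> carrier K. \<forall>x \<in> carrier A. \<phi> (c \<odot>\<^bsub>A\<^esub> x) = c \<odot>\<^bsub>B\<^esub> \<phi> x) \<and>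
     (\<forall>n. \<forall>x \<in> part A n. \<phi> x \<in> part B n)"

locale dg_algebra = graded_algebra K A
  for K (structure) and A :: "('k, 'a) dg_alg" (structure) +
  assumes differential_add: "\<lbrakk>x \<in> carrier A; y \<in> carrier A\<rbrakk> \<Longrightarrow>
        differential A (x \<oplus>\<^bsub>A\<^esub> y) = differential A x \<oplus>\<^bsub>A\<^esub> differential A y"
    and differential_smult: "\<lbrakk>c \<in> carrier K; x \<in> carrier A\<rbrakk> \<Longrightarrow>
        differential A (c \<odot>\<^bsub>A\<^esub> x) = c \<odot>\<^bsub>A\<^esub> differential A x"
    and differential_part: "x \<in> part A n \<Longrightarrow> differential A x \<in> part A (n + 1)"
    and differential_square: "x \<in> carrier A \<Longrightarrow> differential A (differential A x) = \<zero>\<^bsub>A\<^esub>"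
    and Leibniz: "\<lbrakk>x \<in> part A n; y \<in> carrier A\<rbrakk> \<Longrightarrow>
        differential A (x \<otimes>\<^bsub>A\<^esub> y) =
          (differential A x \<otimes>\<^bsub>A\<^esub> y) \<oplus>\<^bsub>A\<^esub> signed (add_monoid A) n (x \<otimes>\<^bsub>A\<^esub> differential A y)"

definition dg_hom :: "('k, 'p) ring_scheme \<Rightarrow> ('k, 'a) dg_alg \<Rightarrow> ('k, 'b) dg_alg
    \<Rightarrow> ('a \<Rightarrow> 'b) \<Rightarrow> bool" where
  "dg_hom K A B \<psi> \<longleftrightarrow> graded_alg_hom K A B \<psi> \<and>
     (\<forall>x \<in> carrier A. \<psi> (differential A x) = differential B (\<psi> x))"

definition dg_cocycles :: "('k, 'a) dg_alg \<Rightarrow> 'a set" where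
  "dg_cocycles A = {x \<in> carrier A. differential A x = \<zero>\<^bsub>A\<^esub>}"

definition dg_coboundaries :: "('k, 'a) dg_alg \<Rightarrow> 'a set" where
  "dg_coboundaries A = differential A ` carrier A"

definition dg_class :: "('k, 'a) dg_alg \<Rightarrow> 'a \<Rightarrow> 'a set" where
  "dg_class A x = dg_coboundaries A +>\<^bsub>A\<^esub> x"

definition cohomology :: "('k, 'a) dg_alg \<Rightarrow> ('k, 'a set) graded_alg" where
  "cohomology A =
     \<lparr>carrier = dg_class A ` dg_cocycles A,
      mult = rcoset_mult A (dg_coboundaries A),
      one = dg_class A \<one>\<^bsub>A\<^esub>,
      zero = dg_coboundaries A,
      add = set_add A,
      smult = (\<lambda>c X. \<Union>x\<in>X. dg_class A (c \<odot>\<^bsub>A\<^esub> x)),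
      part = (\<lambda>n. dg_class A ` (part A n \<inter> dg_cocycles A))\<rparr>"

definition cohomology_map :: "('k, 'a) dg_alg \<Rightarrow> ('k, 'b) dg_alg \<Rightarrow> ('a \<Rightarrow> 'b)
    \<Rightarrow> 'a set \<Rightarrow> 'b set" where
  "cohomology_map A B \<psi> = (\<lambda>X \<in> carrier (cohomology A). \<Union>x\<in>X. dg_class B (\<psi> x))"


section \<open>Abelian groups given by generators and relations\<close>

text \<open>
  The additive groups of modules and tensor products are multiplicative \<^type>\<open>monoid\<close>
  records, as \<^const>\<open>free_Abelian_group\<close> is.
\<close>

definition presented_group :: "'x set \<Rightarrow> ('x \<Rightarrow>\<^sub>0 int) set \<Rightarrow> ('x \<Rightarrow>\<^sub>0 int) set monoid" where
  "presented_group S P = free_Abelian_group S Mod generate (free_Abelian_group S) P"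

definition generator :: "'x set \<Rightarrow> ('x \<Rightarrow>\<^sub>0 int) set \<Rightarrow> 'x \<Rightarrow> ('x \<Rightarrow>\<^sub>0 int) set" where
  "generator S P x = generate (free_Abelian_group S) P #>\<^bsub>free_Abelian_group S\<^esub> frag_of x"

text \<open>Meaningful when the values \<open>g\<close> on the generators respect the relations \<open>P\<close>.\<close>

definition lift :: "'x set \<Rightarrow> ('x \<Rightarrow>\<^sub>0 int) set \<Rightarrow> ('h, 'z) monoid_scheme \<Rightarrow> ('x \<Rightarrow> 'h)
    \<Rightarrow> ('x \<Rightarrow>\<^sub>0 int) set \<Rightarrow> 'h" where
  "lift S P H g =
     (THE h. h \<in> hom (presented_group S P) H \<inter> extensional (carrier (presented_group S P)) \<and>
             (\<forall>s \<in> S. h (generator S P s) = g s))"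


section \<open>Bimodules and tensor products\<close>

record ('l, 'm, 'r) bimod = "'m monoid" +
  lact :: "'l \<Rightarrow> 'm \<Rightarrow> 'm"
  ract :: "'m \<Rightarrow> 'r \<Rightarrow> 'm"

record ('l, 'm, 'r) gr_bimod = "('l, 'm, 'r) bimod" +
  gr :: "int \<Rightarrow> 'm set"

definition left_module :: "('r, 'y) ring_scheme \<Rightarrow> ('r, 'm, 's, 'z) bimod_scheme \<Rightarrow> bool" where
  "left_module R M \<longleftrightarrow> comm_group M \<and>
     (\<forall>r \<in> carrier R. \<forall>m \<in> carrier M. lact M r m \<in> carrier M) \<and>
     (\<forall>r \<in> carrier R. \<forall>m \<in> carrier M. \<forall>n \<in> carrier M.
        lact M r (m \<otimes>\<^bsub>M\<^esub> n) = lact M r m \<otimes>\<^bsub>M\<^esub> lact M r n) \<and>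
     (\<forall>r \<in> carrier R. \<forall>s \<in> carrier R. \<forall>m \<in> carrier M.
        lact M (r \<oplus>\<^bsub>R\<^esub> s) m = lact M r m \<otimes>\<^bsub>M\<^esub> lact M s m \<and>
        lact M (r \<otimes>\<^bsub>R\<^esub> s) m = lact M r (lact M s m)) \<and>
     (\<forall>m \<in> carrier M. lact M \<one>\<^bsub>R\<^esub> m = m)"

definition right_module :: "('r, 'y) ring_scheme \<Rightarrow> ('l, 'm, 'r, 'z) bimod_scheme \<Rightarrow> bool" where
  "right_module R M \<longleftrightarrow> comm_group M \<and>
     (\<forall>r \<in> carrier R. \<forall>m \<in> carrier M. ract M m r \<in> carrier M) \<and>
     (\<forall>r \<in> carrier R. \<forall>m \<in> carrier M. \<forall>n \<in> carrier M.
        ract M (m \<otimes>\<^bsub>M\<^esub> n) r = ract M m r \<otimes>\<^bsub>M\<^esub> ract M n r) \<and>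
     (\<forall>r \<in> carrier R. \<forall>s \<in> carrier R. \<forall>m \<in> carrier M.
        ract M m (r \<oplus>\<^bsub>R\<^esub> s) = ract M m r \<otimes>\<^bsub>M\<^esub> ract M m s \<and>
        ract M m (r \<otimes>\<^bsub>R\<^esub> s) = ract M (ract M m r) s) \<and>
     (\<forall>m \<in> carrier M. ract M m \<one>\<^bsub>R\<^esub> = m)"

text \<open>The ring \<open>T\<close>, regarded as a bimodule by restriction along \<open>\<alpha>\<close> (left) and \<open>\<beta>\<close> (right).\<close>

definition restricted_bimod :: "('k, 't, 'z) graded_alg_scheme \<Rightarrow> ('l \<Rightarrow> 't) \<Rightarrow> ('r \<Rightarrow> 't)
    \<Rightarrow> ('l, 't, 'r) gr_bimod" where
  "restricted_bimod T \<alpha> \<beta> =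
     \<lparr>carrier = carrier T, mult = add T, one = zero T,
      lact = (\<lambda>l x. \<alpha> l \<otimes>\<^bsub>T\<^esub> x), ract = (\<lambda>x r. x \<otimes>\<^bsub>T\<^esub> \<beta> r), gr = part T\<rparr>"

definition tensor_rels :: "('r, 'p) ring_scheme \<Rightarrow> ('l, 'm, 'r, 'y) bimod_scheme
    \<Rightarrow> ('r, 'n, 's, 'z) bimod_scheme \<Rightarrow> ('m \<times> 'n \<Rightarrow>\<^sub>0 int) set" where
  "tensor_rels R M N =
     {frag_of (m \<otimes>\<^bsub>M\<^esub> m', n) - frag_of (m, n) - frag_of (m', n) | m m' n.
        m \<in> carrier M \<and> m' \<in> carrier M \<and> n \<in> carrier N} \<union>
     {frag_of (m, n \<otimes>\<^bsub>N\<^esub> n') - frag_of (m, n) - frag_of (m, n') | m n n'.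
        m \<in> carrier M \<and> n \<in> carrier N \<and> n' \<in> carrier N} \<union>
     {frag_of (ract M m r, n) - frag_of (m, lact N r n) | m r n.
        m \<in> carrier M \<and> r \<in> carrier R \<and> n \<in> carrier N}"

definition tensor_group :: "('r, 'p) ring_scheme \<Rightarrow> ('l, 'm, 'r, 'y) bimod_scheme
    \<Rightarrow> ('r, 'n, 's, 'z) bimod_scheme \<Rightarrow> ('m \<times> 'n \<Rightarrow>\<^sub>0 int) set monoid" where
  "tensor_group R M N = presented_group (carrier M \<times> carrier N) (tensor_rels R M N)"

definition pure_tensor :: "('r, 'p) ring_scheme \<Rightarrow> ('l, 'm, 'r, 'y) bimod_scheme
    \<Rightarrow> ('r, 'n, 's, 'z) bimod_scheme \<Rightarrow> 'm \<Rightarrow> 'n \<Rightarrow> ('m \<times> 'n \<Rightarrow>\<^sub>0 int) set" where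
  "pure_tensor R M N m n = generator (carrier M \<times> carrier N) (tensor_rels R M N) (m, n)"

definition tensor_lift :: "('r, 'p) ring_scheme \<Rightarrow> ('l, 'm, 'r, 'y) bimod_scheme
    \<Rightarrow> ('r, 'n, 's, 'z) bimod_scheme \<Rightarrow> ('h, 'q) monoid_scheme \<Rightarrow> ('m \<Rightarrow> 'n \<Rightarrow> 'h)
    \<Rightarrow> ('m \<times> 'n \<Rightarrow>\<^sub>0 int) set \<Rightarrow> 'h" where
  "tensor_lift R M N H g =
     lift (carrier M \<times> carrier N) (tensor_rels R M N) H (\<lambda>(m, n). g m n)"

definition tensor_map :: "('r, 'p) ring_scheme
    \<Rightarrow> ('l, 'm, 'r, 'y) bimod_scheme \<Rightarrow> ('r, 'n, 's, 'z) bimod_scheme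
    \<Rightarrow> ('l', 'm', 'r, 'y') bimod_scheme \<Rightarrow> ('r, 'n', 's', 'z') bimod_scheme
    \<Rightarrow> ('m \<Rightarrow> 'm') \<Rightarrow> ('n \<Rightarrow> 'n') \<Rightarrow> ('m \<times> 'n \<Rightarrow>\<^sub>0 int) set \<Rightarrow> ('m' \<times> 'n' \<Rightarrow>\<^sub>0 int) set" where
  "tensor_map R M N M' N' f g =
     tensor_lift R M N (tensor_group R M' N') (\<lambda>m n. pure_tensor R M' N' (f m) (g n))"

definition tensor :: "('r, 'p) ring_scheme \<Rightarrow> ('l, 'm, 'r, 'y) gr_bimod_scheme
    \<Rightarrow> ('r, 'n, 's, 'z) gr_bimod_scheme \<Rightarrow> ('l, ('m \<times> 'n \<Rightarrow>\<^sub>0 int) set, 's) gr_bimod" where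
  "tensor R M N =
     \<lparr>carrier = carrier (tensor_group R M N),
      mult = mult (tensor_group R M N),
      one = one (tensor_group R M N),
      lact = (\<lambda>l. tensor_map R M N M N (lact M l) id),
      ract = (\<lambda>u s. tensor_map R M N M N id (\<lambda>n. ract N n s) u),
      gr = (\<lambda>d. generate (tensor_group R M N)
                  {pure_tensor R M N m n | m n. \<exists>i j. m \<in> gr M i \<and> n \<in> gr N j \<and> i + j = d})\<rparr>"


section \<open>Flat epimorphisms\<close>

text \<open>
  HOL cannot quantify over all types inside a formula, so the test modules and test rings range
  over all structures whose carrier lies in one fixed type \<open>'u\<close>.
\<close>

definition flat_as_left_module ::
    "'u itself \<Rightarrow> ('r, 'y) ring_scheme \<Rightarrow> ('r, 't, 's, 'z) bimod_scheme \<Rightarrow> bool" where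
  "flat_as_left_module (_ :: 'u itself) R T \<longleftrightarrow>
     (\<forall>(M :: (unit, 'u, 'r) bimod) (N :: (unit, 'u, 'r) bimod) f.
        right_module R M \<and> right_module R N \<and> f \<in> hom M N \<and>
        (\<forall>m \<in> carrier M. \<forall>r \<in> carrier R. f (ract M m r) = ract N (f m) r) \<and>
        inj_on f (carrier M) \<longrightarrow>
        inj_on (tensor_map R M T N T f id) (carrier (tensor_group R M T)))"

definition flat_as_right_module ::
    "'u itself \<Rightarrow> ('r, 'y) ring_scheme \<Rightarrow> ('s, 't, 'r, 'z) bimod_scheme \<Rightarrow> bool" where
  "flat_as_right_module (_ :: 'u itself) R T \<longleftrightarrow>
     (\<forall>(M :: ('r, 'u, unit) bimod) (N :: ('r, 'u, unit) bimod) f.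
        left_module R M \<and> left_module R N \<and> f \<in> hom M N \<and>
        (\<forall>m \<in> carrier M. \<forall>r \<in> carrier R. f (lact M r m) = lact N r (f m)) \<and>
        inj_on f (carrier M) \<longrightarrow>
        inj_on (tensor_map R T M T N id f) (carrier (tensor_group R T M)))"

definition ring_epimorphism ::
    "'u itself \<Rightarrow> ('r, 'y) ring_scheme \<Rightarrow> ('t, 'z) ring_scheme \<Rightarrow> ('r \<Rightarrow> 't) \<Rightarrow> bool" where
  "ring_epimorphism (_ :: 'u itself) R T \<phi> \<longleftrightarrow> \<phi> \<in> ring_hom R T \<and>
     (\<forall>(S :: 'u ring) g h.
        ring S \<and> g \<in> ring_hom T S \<and> h \<in> ring_hom T S \<and>
        (\<forall>r \<in> carrier R. g (\<phi> r) = h (\<phi> r)) \<longrightarrow>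
        (\<forall>t \<in> carrier T. g t = h t))"

text \<open>
  The test universe for \<open>R \<rightarrow> T\<close>. Sending an element to its full set of representatives embeds
  into this type every quotient of a free abelian group on words in elements of \<open>R\<close> and \<open>T\<close>.
  This covers every finitely generated \<open>R\<close>-module and every ring generated by two homomorphic
  images of \<open>T\<close>, up to isomorphism. Failure of flatness, respectively of right cancellation, is
  always witnessed by such modules, respectively rings, so the notions below coincide with
  those that refer to all modules and all rings.
\<close>

type_synonym ('r, 't) test_universe = "(('r + 't) list \<Rightarrow>\<^sub>0 int) set"

definition flat_epimorphism :: "('k, 'p) ring_scheme \<Rightarrow> ('k, 'r, 'y) graded_alg_scheme
    \<Rightarrow> ('k, 't, 'z) graded_alg_scheme \<Rightarrow> ('r \<Rightarrow> 't) \<Rightarrow> bool" where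
  "flat_epimorphism K R T \<phi> \<longleftrightarrow>
     graded_alg_hom K R T \<phi> \<and>
     ring_epimorphism TYPE(('r, 't) test_universe) R T \<phi> \<and>
     flat_as_left_module TYPE(('r, 't) test_universe) R (restricted_bimod T \<phi> id) \<and>
     flat_as_right_module TYPE(('r, 't) test_universe) R (restricted_bimod T id \<phi>)"


section \<open>The graded bar resolution\<close>

definition words :: "('a, 'z) ring_scheme \<Rightarrow> nat \<Rightarrow> 'a list set" where
  "words \<Lambda> n = {xs. length xs = n \<and> set xs \<subseteq> carrier \<Lambda>}"

text \<open>
  Defining relations of the \<open>n\<close>-fold tensor power over \<open>K\<close> on the words of length \<open>n\<close>; only
  \<open>n \<ge> 1\<close> is used, where the \<open>K\<close>-action need not be added by hand.
\<close>

definition tensor_power_rels :: "('k, 'p) ring_scheme \<Rightarrow> ('k, 'a, 'z) module_scheme \<Rightarrow> nat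
    \<Rightarrow> ('a list \<Rightarrow>\<^sub>0 int) set" where
  "tensor_power_rels K \<Lambda> n =
     {frag_of (xs[i := x \<oplus>\<^bsub>\<Lambda>\<^esub> y]) - frag_of (xs[i := x]) - frag_of (xs[i := y]) | xs i x y.
        xs \<in> words \<Lambda> n \<and> i < n \<and> x \<in> carrier \<Lambda> \<and> y \<in> carrier \<Lambda>} \<union>
     {frag_of (xs[i := c \<odot>\<^bsub>\<Lambda>\<^esub> xs ! i]) - frag_of (xs[j := c \<odot>\<^bsub>\<Lambda>\<^esub> xs ! j]) | xs i j c.
        xs \<in> words \<Lambda> n \<and> i < n \<and> j < n \<and> c \<in> carrier K}"

definition tensor_power :: "('k, 'p) ring_scheme \<Rightarrow> ('k, 'a, 'z) module_scheme \<Rightarrow> nat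
    \<Rightarrow> ('a list \<Rightarrow>\<^sub>0 int) set monoid" where
  "tensor_power K \<Lambda> n = presented_group (words \<Lambda> n) (tensor_power_rels K \<Lambda> n)"

definition pure_word :: "('k, 'p) ring_scheme \<Rightarrow> ('k, 'a, 'z) module_scheme \<Rightarrow> nat
    \<Rightarrow> 'a list \<Rightarrow> ('a list \<Rightarrow>\<^sub>0 int) set" where
  "pure_word K \<Lambda> n xs = generator (words \<Lambda> n) (tensor_power_rels K \<Lambda> n) xs"

definition word_lift :: "('k, 'p) ring_scheme \<Rightarrow> ('k, 'a, 'z) module_scheme \<Rightarrow> nat
    \<Rightarrow> ('h, 'q) monoid_scheme \<Rightarrow> ('a list \<Rightarrow> 'h) \<Rightarrow> ('a list \<Rightarrow>\<^sub>0 int) set \<Rightarrow> 'h" where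
  "word_lift K \<Lambda> n H g = lift (words \<Lambda> n) (tensor_power_rels K \<Lambda> n) H g"

definition bar :: "('k, 'p) ring_scheme \<Rightarrow> ('k, 'a, 'z) graded_alg_scheme \<Rightarrow> nat
    \<Rightarrow> ('a, ('a list \<Rightarrow>\<^sub>0 int) set, 'a) gr_bimod" where
  "bar K \<Lambda> n =
     \<lparr>carrier = carrier (tensor_power K \<Lambda> (n + 2)),
      mult = mult (tensor_power K \<Lambda> (n + 2)),
      one = one (tensor_power K \<Lambda> (n + 2)),
      lact = (\<lambda>a. word_lift K \<Lambda> (n + 2) (tensor_power K \<Lambda> (n + 2))
                    (\<lambda>xs. pure_word K \<Lambda> (n + 2) (xs[0 := a \<otimes>\<^bsub>\<Lambda>\<^esub> xs ! 0]))),
      ract = (\<lambda>u a. word_lift K \<Lambda> (n + 2) (tensor_power K \<Lambda> (n + 2))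
                    (\<lambda>xs. pure_word K \<Lambda> (n + 2) (xs[n + 1 := xs ! (n + 1) \<otimes>\<^bsub>\<Lambda>\<^esub> a])) u),
      gr = (\<lambda>d. generate (tensor_power K \<Lambda> (n + 2))
                  {pure_word K \<Lambda> (n + 2) xs | xs. length xs = n + 2 \<and>
                     (\<exists>e. (\<forall>i < n + 2. xs ! i \<in> part \<Lambda> (e i)) \<and> (\<Sum>i < n + 2. e i) = d)})\<rparr>"

definition multiply_at :: "('a, 'z) ring_scheme \<Rightarrow> nat \<Rightarrow> 'a list \<Rightarrow> 'a list" where
  "multiply_at \<Lambda> i xs = take i xs @ (xs ! i \<otimes>\<^bsub>\<Lambda>\<^esub> xs ! (i + 1)) # drop (i + 2) xs"

text \<open>\<open>bar_diff K \<Lambda> n\<close> is the differential from degree \<open>n + 1\<close> to degree \<open>n\<close>.\<close>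

definition bar_diff :: "('k, 'p) ring_scheme \<Rightarrow> ('k, 'a, 'z) graded_alg_scheme \<Rightarrow> nat
    \<Rightarrow> ('a list \<Rightarrow>\<^sub>0 int) set \<Rightarrow> ('a list \<Rightarrow>\<^sub>0 int) set" where
  "bar_diff K \<Lambda> n =
     word_lift K \<Lambda> (n + 3) (bar K \<Lambda> n)
       (\<lambda>xs. finprod (bar K \<Lambda> n)
               (\<lambda>i. signed (bar K \<Lambda> n) (int i) (pure_word K \<Lambda> (n + 2) (multiply_at \<Lambda> i xs)))
               {..n + 1})"


section \<open>Hochschild cohomology\<close>

text \<open>
  \<open>gr_hom \<Lambda> t M N\<close> is the group of homogeneous maps of degree \<open>t\<close> over the graded enveloping
  algebra of \<open>\<Lambda>\<close>. A module over it is a graded bimodule, and a map of degree \<open>t\<close> satisfies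
  \<open>f (a m) = (-1)\<^bsup>t|a|\<^esup> a f(m)\<close> and \<open>f (m a) = f(m) a\<close>. Maps are extensional, so that equality
  of maps is equality on the carrier.
\<close>

definition gr_hom :: "('k, 'a, 'y) graded_alg_scheme \<Rightarrow> int \<Rightarrow> ('a, 'm, 'a) gr_bimod
    \<Rightarrow> ('a, 'n, 'a) gr_bimod \<Rightarrow> ('m \<Rightarrow> 'n) monoid" where
  "gr_hom \<Lambda> t M N =
     \<lparr>carrier = {f \<in> hom M N \<inter> extensional (carrier M).
         (\<forall>n. \<forall>m \<in> gr M n. f m \<in> gr N (n + t)) \<and>
         (\<forall>n. \<forall>a \<in> part \<Lambda> n. \<forall>m \<in> carrier M. f (lact M a m) = signed N (t * n) (lact N a (f m))) \<and>
         (\<forall>a \<in> carrier \<Lambda>. \<forall>m \<in> carrier M. f (ract M m a) = ract N (f m) a)},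
      mult = (\<lambda>f g. \<lambda>m \<in> carrier M. f m \<otimes>\<^bsub>N\<^esub> g m),
      one = (\<lambda>m \<in> carrier M. \<one>\<^bsub>N\<^esub>)\<rparr>"

text \<open>
  Cohomology of \<open>gr_hom \<Lambda> t X N\<close> for a chain complex \<open>X\<close> of bimodules, with
  \<open>D n\<close> the differential from \<open>X (n + 1)\<close> to \<open>X n\<close>.
\<close>

definition hom_cocycles :: "('k, 'a, 'y) graded_alg_scheme \<Rightarrow> (nat \<Rightarrow> ('a, 'm, 'a) gr_bimod)
    \<Rightarrow> (nat \<Rightarrow> 'm \<Rightarrow> 'm) \<Rightarrow> ('a, 'n, 'a) gr_bimod \<Rightarrow> nat \<Rightarrow> int \<Rightarrow> ('m \<Rightarrow> 'n) set" where
  "hom_cocycles \<Lambda> X D N s t =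
     {f \<in> carrier (gr_hom \<Lambda> t (X s) N).
        compose (carrier (X (Suc s))) f (D s) = one (gr_hom \<Lambda> t (X (Suc s)) N)}"

definition hom_coboundaries :: "('k, 'a, 'y) graded_alg_scheme \<Rightarrow> (nat \<Rightarrow> ('a, 'm, 'a) gr_bimod)
    \<Rightarrow> (nat \<Rightarrow> 'm \<Rightarrow> 'm) \<Rightarrow> ('a, 'n, 'a) gr_bimod \<Rightarrow> nat \<Rightarrow> int \<Rightarrow> ('m \<Rightarrow> 'n) set" where
  "hom_coboundaries \<Lambda> X D N s t =
     (case s of 0 \<Rightarrow> {one (gr_hom \<Lambda> t (X 0) N)}
      | Suc r \<Rightarrow> (\<lambda>f. compose (carrier (X s)) f (D r)) ` carrier (gr_hom \<Lambda> t (X r) N))"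

definition hom_class :: "('k, 'a, 'y) graded_alg_scheme \<Rightarrow> (nat \<Rightarrow> ('a, 'm, 'a) gr_bimod)
    \<Rightarrow> (nat \<Rightarrow> 'm \<Rightarrow> 'm) \<Rightarrow> ('a, 'n, 'a) gr_bimod \<Rightarrow> nat \<Rightarrow> int \<Rightarrow> ('m \<Rightarrow> 'n) \<Rightarrow> ('m \<Rightarrow> 'n) set"
  where
  "hom_class \<Lambda> X D N s t f = hom_coboundaries \<Lambda> X D N s t #>\<^bsub>gr_hom \<Lambda> t (X s) N\<^esub> f"

definition hom_cohomology :: "('k, 'a, 'y) graded_alg_scheme \<Rightarrow> (nat \<Rightarrow> ('a, 'm, 'a) gr_bimod)
    \<Rightarrow> (nat \<Rightarrow> 'm \<Rightarrow> 'm) \<Rightarrow> ('a, 'n, 'a) gr_bimod \<Rightarrow> nat \<Rightarrow> int \<Rightarrow> ('m \<Rightarrow> 'n) set monoid" where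
  "hom_cohomology \<Lambda> X D N s t =
     (gr_hom \<Lambda> t (X s) N)\<lparr>carrier := hom_cocycles \<Lambda> X D N s t\<rparr> Mod hom_coboundaries \<Lambda> X D N s t"

definition regular_bimod :: "('k, 'a, 'z) graded_alg_scheme \<Rightarrow> ('a, 'a, 'a) gr_bimod" where
  "regular_bimod \<Lambda> = restricted_bimod \<Lambda> id id"

definition HH :: "('k, 'p) ring_scheme \<Rightarrow> ('k, 'a, 'z) graded_alg_scheme \<Rightarrow> nat \<Rightarrow> int
    \<Rightarrow> (('a list \<Rightarrow>\<^sub>0 int) set \<Rightarrow> 'a) set monoid" where
  "HH K \<Lambda> s t = hom_cohomology \<Lambda> (bar K \<Lambda>) (bar_diff K \<Lambda>) (regular_bimod \<Lambda>) s t"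

definition HH_class :: "('k, 'p) ring_scheme \<Rightarrow> ('k, 'a, 'z) graded_alg_scheme \<Rightarrow> nat \<Rightarrow> int
    \<Rightarrow> (('a list \<Rightarrow>\<^sub>0 int) set \<Rightarrow> 'a) \<Rightarrow> (('a list \<Rightarrow>\<^sub>0 int) set \<Rightarrow> 'a) set" where
  "HH_class K \<Lambda> s t f = hom_class \<Lambda> (bar K \<Lambda>) (bar_diff K \<Lambda>) (regular_bimod \<Lambda>) s t f"

text \<open>
  The bimodule map on \<open>bar K \<Lambda> s\<close> that belongs to a cochain \<open>f\<close> of degree \<open>t\<close> of the usual
  Hochschild complex; \<open>f\<close> is a \<open>K\<close>-multilinear function on words of length \<open>s\<close>.
\<close>

definition bar_extension :: "('k, 'p) ring_scheme \<Rightarrow> ('k, 'a, 'z) graded_alg_scheme \<Rightarrow> nat \<Rightarrow> int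
    \<Rightarrow> ('a list \<Rightarrow> 'a) \<Rightarrow> ('a list \<Rightarrow>\<^sub>0 int) set \<Rightarrow> 'a" where
  "bar_extension K \<Lambda> s t f =
     word_lift K \<Lambda> (s + 2) (regular_bimod \<Lambda>)
       (\<lambda>xs. koszul \<Lambda> t (xs ! 0) \<otimes>\<^bsub>\<Lambda>\<^esub> f (take s (drop 1 xs)) \<otimes>\<^bsub>\<Lambda>\<^esub> xs ! (s + 1))"


section \<open>The map on Hochschild cohomology induced by a flat epimorphism\<close>

text \<open>The complex \<open>T \<otimes>\<^sub>R bar R \<otimes>\<^sub>R T\<close>, bracketed to the left.\<close>

definition half_base_change :: "('k, 'p) ring_scheme \<Rightarrow> ('k, 'r, 'y) graded_alg_scheme
    \<Rightarrow> ('k, 't, 'z) graded_alg_scheme \<Rightarrow> ('r \<Rightarrow> 't) \<Rightarrow> nat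
    \<Rightarrow> ('t, ('t \<times> ('r list \<Rightarrow>\<^sub>0 int) set \<Rightarrow>\<^sub>0 int) set, 'r) gr_bimod" where
  "half_base_change K R T \<phi> n = tensor R (restricted_bimod T id \<phi>) (bar K R n)"

definition base_change :: "('k, 'p) ring_scheme \<Rightarrow> ('k, 'r, 'y) graded_alg_scheme
    \<Rightarrow> ('k, 't, 'z) graded_alg_scheme \<Rightarrow> ('r \<Rightarrow> 't) \<Rightarrow> nat
    \<Rightarrow> ('t, (('t \<times> ('r list \<Rightarrow>\<^sub>0 int) set \<Rightarrow>\<^sub>0 int) set \<times> 't \<Rightarrow>\<^sub>0 int) set, 't) gr_bimod" where
  "base_change K R T \<phi> n = tensor R (half_base_change K R T \<phi> n) (restricted_bimod T \<phi> id)"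

definition base_change_diff :: "('k, 'p) ring_scheme \<Rightarrow> ('k, 'r, 'y) graded_alg_scheme
    \<Rightarrow> ('k, 't, 'z) graded_alg_scheme \<Rightarrow> ('r \<Rightarrow> 't) \<Rightarrow> nat
    \<Rightarrow> (('t \<times> ('r list \<Rightarrow>\<^sub>0 int) set \<Rightarrow>\<^sub>0 int) set \<times> 't \<Rightarrow>\<^sub>0 int) set
    \<Rightarrow> (('t \<times> ('r list \<Rightarrow>\<^sub>0 int) set \<Rightarrow>\<^sub>0 int) set \<times> 't \<Rightarrow>\<^sub>0 int) set" where
  "base_change_diff K R T \<phi> n =
     tensor_map R (half_base_change K R T \<phi> (Suc n)) (restricted_bimod T \<phi> id)
                  (half_base_change K R T \<phi> n) (restricted_bimod T \<phi> id)
       (tensor_map R (restricted_bimod T id \<phi>) (bar K R (Suc n))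
                     (restricted_bimod T id \<phi>) (bar K R n) id (bar_diff K R n))
       id"

text \<open>The map \<open>t \<otimes> b \<otimes> t' \<mapsto> (-1)\<^bsup>e|t|\<^esup> t \<alpha>(b) t'\<close> into a \<open>T\<close>-bimodule \<open>N\<close>.\<close>

definition sandwich :: "('k, 'p) ring_scheme \<Rightarrow> ('k, 'r, 'y) graded_alg_scheme
    \<Rightarrow> ('k, 't, 'z) graded_alg_scheme \<Rightarrow> ('r \<Rightarrow> 't) \<Rightarrow> nat \<Rightarrow> ('t, 'n, 't) gr_bimod \<Rightarrow> int
    \<Rightarrow> (('r list \<Rightarrow>\<^sub>0 int) set \<Rightarrow> 'n)
    \<Rightarrow> (('t \<times> ('r list \<Rightarrow>\<^sub>0 int) set \<Rightarrow>\<^sub>0 int) set \<times> 't \<Rightarrow>\<^sub>0 int) set \<Rightarrow> 'n" where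
  "sandwich K R T \<phi> n N e \<alpha> =
     tensor_lift R (half_base_change K R T \<phi> n) (restricted_bimod T \<phi> id) N
       (\<lambda>u t'. ract N
          (tensor_lift R (restricted_bimod T id \<phi>) (bar K R n) N
             (\<lambda>t b. lact N (koszul T e t) (\<alpha> b)) u) t')"

text \<open>
  The chain map \<open>t \<otimes> (r\<^sub>0, \<dots>, r\<^sub>n\<^sub>+\<^sub>1) \<otimes> t' \<mapsto> (t \<phi>(r\<^sub>0), \<phi>(r\<^sub>1), \<dots>, \<phi>(r\<^sub>n\<^sub>+\<^sub>1) t')\<close> from
  \<open>T \<otimes>\<^sub>R bar R \<otimes>\<^sub>R T\<close> to \<open>bar T\<close>. It lifts the multiplication map from \<open>T \<otimes>\<^sub>R R \<otimes>\<^sub>R T\<close> to \<open>T\<close>,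
  so for a flat epimorphism it is the comparison map, unique up to homotopy, between two
  projective resolutions of \<open>T\<close>.
\<close>

definition comparison :: "('k, 'p) ring_scheme \<Rightarrow> ('k, 'r, 'y) graded_alg_scheme
    \<Rightarrow> ('k, 't, 'z) graded_alg_scheme \<Rightarrow> ('r \<Rightarrow> 't) \<Rightarrow> nat
    \<Rightarrow> (('t \<times> ('r list \<Rightarrow>\<^sub>0 int) set \<Rightarrow>\<^sub>0 int) set \<times> 't \<Rightarrow>\<^sub>0 int) set
    \<Rightarrow> ('t list \<Rightarrow>\<^sub>0 int) set" where
  "comparison K R T \<phi> n =
     sandwich K R T \<phi> n (bar K T n) 0
       (word_lift K R (n + 2) (bar K T n) (\<lambda>xs. pure_word K T (n + 2) (map \<phi> xs)))"

definition base_change_class :: "('k, 'p) ring_scheme \<Rightarrow> ('k, 'r, 'y) graded_alg_scheme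
    \<Rightarrow> ('k, 't, 'z) graded_alg_scheme \<Rightarrow> ('r \<Rightarrow> 't) \<Rightarrow> nat \<Rightarrow> int
    \<Rightarrow> ((('t \<times> ('r list \<Rightarrow>\<^sub>0 int) set \<Rightarrow>\<^sub>0 int) set \<times> 't \<Rightarrow>\<^sub>0 int) set \<Rightarrow> 't)
    \<Rightarrow> ((('t \<times> ('r list \<Rightarrow>\<^sub>0 int) set \<Rightarrow>\<^sub>0 int) set \<times> 't \<Rightarrow>\<^sub>0 int) set \<Rightarrow> 't) set" where
  "base_change_class K R T \<phi> s t f =
     hom_class T (base_change K R T \<phi>) (base_change_diff K R T \<phi>) (regular_bimod T) s t f"

text \<open>
  The map from \<open>HH K T s t\<close> to the cohomology of the homomorphisms from \<open>T \<otimes>\<^sub>R bar R \<otimes>\<^sub>R T\<close> to \<open>T\<close>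
  induced by the comparison map; \<open>Gamma\<close> inverts it.
\<close>

definition comparison_pullback :: "('k, 'p) ring_scheme \<Rightarrow> ('k, 'r, 'y) graded_alg_scheme
    \<Rightarrow> ('k, 't, 'z) graded_alg_scheme \<Rightarrow> ('r \<Rightarrow> 't) \<Rightarrow> nat \<Rightarrow> int
    \<Rightarrow> (('t list \<Rightarrow>\<^sub>0 int) set \<Rightarrow> 't) set
    \<Rightarrow> ((('t \<times> ('r list \<Rightarrow>\<^sub>0 int) set \<Rightarrow>\<^sub>0 int) set \<times> 't \<Rightarrow>\<^sub>0 int) set \<Rightarrow> 't) set" where
  "comparison_pullback K R T \<phi> s t Y =
     (\<Union>\<eta>\<in>Y. base_change_class K R T \<phi> s t
               (compose (carrier (base_change K R T \<phi> s)) \<eta> (comparison K R T \<phi> s)))"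

definition Gamma :: "('k, 'p) ring_scheme \<Rightarrow> ('k, 'r, 'y) graded_alg_scheme
    \<Rightarrow> ('k, 't, 'z) graded_alg_scheme \<Rightarrow> ('r \<Rightarrow> 't) \<Rightarrow> nat \<Rightarrow> int
    \<Rightarrow> (('r list \<Rightarrow>\<^sub>0 int) set \<Rightarrow> 'r) set \<Rightarrow> (('t list \<Rightarrow>\<^sub>0 int) set \<Rightarrow> 't) set" where
  "Gamma K R T \<phi> s t X =
     inv_into (carrier (HH K T s t)) (comparison_pullback K R T \<phi> s t)
       (\<Union>\<zeta>\<in>X. base_change_class K R T \<phi> s t
                 (sandwich K R T \<phi> s (regular_bimod T) t (\<lambda>b. \<phi> (\<zeta> b))))"


section \<open>The canonical class of a dg algebra\<close>

definition cocycle_section :: "('k, 'p) ring_scheme \<Rightarrow> ('k, 'b) dg_alg \<Rightarrow> ('b set \<Rightarrow> 'b) \<Rightarrow> bool"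
  where
  "cocycle_section K B f1 \<longleftrightarrow>
     (let H = cohomology B in
       (\<forall>x \<in> carrier H. f1 x \<in> dg_cocycles B \<and> dg_class B (f1 x) = x) \<and>
       (\<forall>x \<in> carrier H. \<forall>y \<in> carrier H. f1 (x \<oplus>\<^bsub>H\<^esub> y) = f1 x \<oplus>\<^bsub>B\<^esub> f1 y) \<and>
       (\<forall>c \<in> carrier K. \<forall>x \<in> carrier H. f1 (c \<odot>\<^bsub>H\<^esub> x) = c \<odot>\<^bsub>B\<^esub> f1 x) \<and>
       (\<forall>n. \<forall>x \<in> part H n. f1 x \<in> part B n))"

text \<open>The linear map \<open>f\<^sub>2\<close> on the tensor square is given as a bilinear map.\<close>

definition multiplicativity_homotopy :: "('k, 'p) ring_scheme \<Rightarrow> ('k, 'b) dg_alg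
    \<Rightarrow> ('b set \<Rightarrow> 'b) \<Rightarrow> ('b set \<Rightarrow> 'b set \<Rightarrow> 'b) \<Rightarrow> bool" where
  "multiplicativity_homotopy K B f1 f2 \<longleftrightarrow>
     (let H = cohomology B in
       (\<forall>x \<in> carrier H. \<forall>y \<in> carrier H. f2 x y \<in> carrier B \<and>
          differential B (f2 x y) = f1 (x \<otimes>\<^bsub>H\<^esub> y) \<ominus>\<^bsub>B\<^esub> f1 x \<otimes>\<^bsub>B\<^esub> f1 y) \<and>
       (\<forall>x \<in> carrier H. \<forall>x' \<in> carrier H. \<forall>y \<in> carrier H.
          f2 (x \<oplus>\<^bsub>H\<^esub> x') y = f2 x y \<oplus>\<^bsub>B\<^esub> f2 x' y \<and>
          f2 y (x \<oplus>\<^bsub>H\<^esub> x') = f2 y x \<oplus>\<^bsub>B\<^esub> f2 y x') \<and>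
       (\<forall>c \<in> carrier K. \<forall>x \<in> carrier H. \<forall>y \<in> carrier H.
          f2 (c \<odot>\<^bsub>H\<^esub> x) y = c \<odot>\<^bsub>B\<^esub> f2 x y \<and> f2 x (c \<odot>\<^bsub>H\<^esub> y) = c \<odot>\<^bsub>B\<^esub> f2 x y) \<and>
       (\<forall>m n. \<forall>x \<in> part H m. \<forall>y \<in> part H n. f2 x y \<in> part B (m + n - 1)))"

definition m3 :: "('k, 'b) dg_alg \<Rightarrow> ('b set \<Rightarrow> 'b) \<Rightarrow> ('b set \<Rightarrow> 'b set \<Rightarrow> 'b)
    \<Rightarrow> 'b set \<Rightarrow> 'b set \<Rightarrow> 'b set \<Rightarrow> 'b set" where
  "m3 B f1 f2 x y z =
     (let H = cohomology B in
       dg_class B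
         (((koszul B 1 (f1 x) \<otimes>\<^bsub>B\<^esub> f2 y z \<ominus>\<^bsub>B\<^esub> f2 x y \<otimes>\<^bsub>B\<^esub> f1 z)
            \<ominus>\<^bsub>B\<^esub> f2 (x \<otimes>\<^bsub>H\<^esub> y) z) \<oplus>\<^bsub>B\<^esub> f2 x (y \<otimes>\<^bsub>H\<^esub> z)))"

definition canonical_class :: "('k, 'p) ring_scheme \<Rightarrow> ('k, 'b) dg_alg
    \<Rightarrow> (('b set list \<Rightarrow>\<^sub>0 int) set \<Rightarrow> 'b set) set" where
  "canonical_class K B =
     (THE \<mu>. \<exists>f1 f2. cocycle_section K B f1 \<and> multiplicativity_homotopy K B f1 f2 \<and>
        \<mu> = HH_class K (cohomology B) 3 (- 1)
              (bar_extension K (cohomology B) 3 (- 1)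
                 (\<lambda>xs. m3 B f1 f2 (xs ! 0) (xs ! 1) (xs ! 2))))"

end

theory Submission
  imports Defs "HOL-Algebra.Weak_Morphisms"
begin

text \<open>
  Let \<open>R \<rightarrow> T\<close> be the map of cohomology algebras induced by \<open>\<psi>\<close>. Comparing \<open>\<psi> f\<^sub>1\<close> and \<open>\<psi> f\<^sub>2\<close> with the
  choices made for \<open>B\<close> yields a map \<open>\<omega>\<close> of degree \<open>-1\<close> on pairs of elements of \<open>R\<close> such that
  \<open>\<phi> m\<^sub>3\<close> and \<open>m\<^sub>3\<close> of \<open>B\<close> restricted along \<open>\<phi>\<close> differ by the Hochschild coboundary of \<open>\<omega>\<close>. The case
  \<open>\<psi> = id\<close> shows that the canonical class is well defined. In general, base change turns this
  into the statement that the base change of \<open>\<mu>\<^sub>A\<close> and the pullback of \<open>\<mu>\<^sub>B\<close> along the comparison map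
  agree in the cohomology of \<open>T \<otimes>\<^sub>R bar R \<otimes>\<^sub>R T\<close>.

  It remains to see that this pullback is injective on cohomology. Flatness makes
  \<open>T \<otimes>\<^sub>R bar R \<otimes>\<^sub>R T\<close> exact in positive degrees, and since \<open>T \<otimes>\<^sub>R T \<cong> T\<close> for an epimorphism, it resolves
  \<open>T\<close>. As \<open>bar T\<close> is projective over \<open>T\<^sup>e\<close>, the identity of \<open>T\<close> lifts to a chain map from \<open>bar T\<close> back to
  this complex, whose composite with the comparison map is homotopic to the identity of \<open>bar T\<close>.
  These lifts need not be homogeneous, so the resulting cochain is replaced by its component of
  the right degree.
\<close>

section \<open>Group homomorphisms\<close>

text \<open>Flatness and right cancellation are assumed only against modules and rings whose carrier
  lies in one fixed type. Each module or ring to which they are applied is therefore generated by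
  elements indexed by words, and is copied into that type by sending an element to its set of
  representatives.

  Exactness is obtained one tensor factor at a time. Appending a unit at the right end of a word is
  left linear, so this contraction of the bar complex survives \<open>T \<otimes>\<^sub>R _\<close>;
  flatness then carries exactness through \<open>_ \<otimes>\<^sub>R T\<close>.

  \<open>Gamma\<close> is defined by \<open>inv_into\<close>. Its value is found by recognising the
  class of \<open>B\<close> as a preimage and by injectivity of the pullback along the comparison
  map.

  Signs of the form (-1)^|x| are carried by the additive operator \<open>koszul\<close>. The
  identities between representatives thus hold for arbitrary elements and become identities in a
  noncommutative ring.\<close>

abbreviation (input) op_mult ("_ *\<^sub>_ _" [70, 1000, 71] 70) where "x *\<^sub>G y \<equiv> x \<otimes>\<^bsub>G\<^esub> y"
abbreviation (input) op_add ("_ +\<^sub>_ _" [65, 1000, 66] 65) where "x +\<^sub>R y \<equiv> x \<oplus>\<^bsub>R\<^esub> y"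
abbreviation (input) op_minus ("_ -\<^sub>_ _" [65, 1000, 66] 65) where "x -\<^sub>R y \<equiv> x \<ominus>\<^bsub>R\<^esub> y"
abbreviation (input) op_uminus ("-\<^sub>_ _" [1000, 81] 80) where "-\<^sub>R x \<equiv> \<ominus>\<^bsub>R\<^esub> x"
abbreviation (input) op_smult ("_ \<cdot>\<^sub>_ _" [70, 1000, 71] 70) where "c \<cdot>\<^sub>M x \<equiv> c \<odot>\<^bsub>M\<^esub> x"
abbreviation (input) op_elem (infix "<:" 50) where "x <: G \<equiv> x \<in> carrier G"
abbreviation (input) op_one ("1\<^sub>_" [1000] 1000) where "1\<^sub>G \<equiv> \<one>\<^bsub>G\<^esub>"
abbreviation (input) op_zero ("0\<^sub>_" [1000] 1000) where "0\<^sub>R \<equiv> \<zero>\<^bsub>R\<^esub>"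

text \<open>Degrees are kept as iterated successors because the lemmas on words and on the bar
  complex are stated for \<open>Suc n\<close> and \<open>Suc (Suc n)\<close>.\<close>

abbreviation (input) "n2 \<equiv> Suc (Suc 0)"
abbreviation (input) "n3 \<equiv> Suc n2"
abbreviation (input) "n4 \<equiv> Suc n3"
abbreviation (input) "n5 \<equiv> Suc n4"
abbreviation (input) "n6 \<equiv> Suc n5"

text \<open>\<open>m_inv\<close> reads only these three fields, so inverses can be compared across
  record types that differ in their further fields.\<close>

lemma m_inv_cong:
  assumes "carrier G = carrier H" "mult G = mult H" "one G = one H"
  shows "m_inv G = m_inv H"
  using assms by (simp add: m_inv_def fun_eq_iff)

lemma comm_group_cong:
  assumes "carrier G = carrier H" "mult G = mult H" "one G = one H" "comm_group G"
  shows "comm_group H"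
proof -
  interpret comm_group G by fact
  have *: "carrier H = carrier G" "mult H = mult G" "one H = one G" using assms by auto
  show ?thesis
    by (rule comm_groupI) (auto simp: * m_assoc intro: m_comm l_inv_ex)
qed

lemma hom_mult: "f \<in> hom G H ==> x <: G ==> y <: G ==> f (x *\<^sub>G y) = f x *\<^sub>H f y"
  by (simp add: hom_def)

lemma hom_closed: "f \<in> hom G H ==> x <: G ==> f x <: H"
  by (auto simp: hom_def)

lemma hom_inv:
  assumes "f \<in> hom G H" "group G" "group H" "x <: G"
  shows "f (inv\<^bsub>G\<^esub> x) = inv\<^bsub>H\<^esub> (f x)"
  using assms group_hom.hom_inv[of G H f x] by (simp add: group_hom_def group_hom_axioms_def)

lemma hom_signed:
  assumes "f \<in> hom G H" "group G" "group H" "x <: G"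
  shows "f (signed G e x) = signed H e (f x)"
  using hom_inv[OF assms] by (simp add: signed_def)

lemma hom_generate:
  assumes "f \<in> hom G H" "group G" "group H" "S \<subseteq> carrier G" "subgroup W H"
    "!!s. s \<in> S ==> f s \<in> W" "x \<in> generate G S"
  shows "f x \<in> W"
  using assms(7)
proof (induction rule: generate.induct)
  case one
  then show ?case using assms(1-3,5) by (simp add: hom_one subgroup.one_closed)
next
  case (incl h) then show ?case using assms(6) by simp
next
  case (inv h)
  then have "f (inv\<^bsub>G\<^esub> h) = inv\<^bsub>H\<^esub> (f h)" using hom_inv[OF assms(1-3)] assms(4) by auto
  then show ?case using assms(6)[OF inv] assms(5) by (simp add: subgroup.m_inv_closed)
next
  case (eng h1 h2)
  then have "h1 <: G" "h2 <: G"
    using group.generate_in_carrier[OF assms(2,4)] by auto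
  then show ?case using eng assms(1,5) by (simp add: hom_mult subgroup.m_closed)
qed

lemma (in comm_group) hom_eq_one_on_generate:
  assumes "h \<in> hom G H" "group H" "P \<subseteq> carrier G" "!!p. p \<in> P ==> h p = 1\<^sub>H" "x \<in> generate G P"
  shows "h x = 1\<^sub>H"
  using hom_generate[OF assms(1) is_group assms(2,3) group.triv_subgroup[OF assms(2)] _ assms(5)] assms(4)
  by simp

section \<open>Presented groups\<close>

locale presentation =
  fixes S :: "'x set" and P :: "('x \<Rightarrow>\<^sub>0 int) set"
  assumes rels: "P \<subseteq> carrier (free_Abelian_group S)"
begin

abbreviation (input) "PG \<equiv> presented_group S P"
abbreviation "Fr \<equiv> free_Abelian_group S"
abbreviation "Nn \<equiv> generate (free_Abelian_group S) P"

lemma sub: "subgroup Nn Fr"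
  using group.generate_is_subgroup[OF group_free_Abelian_group rels] .

lemma nrm: "Nn \<lhd> Fr"
  using comm_group.normal_iff_subgroup[OF abelian_free_Abelian_group] sub by blast

lemma comm_group: "comm_group (PG)"
  unfolding presented_group_def by (rule comm_group.abelian_FactGroup[OF abelian_free_Abelian_group sub])

lemma group: "group (PG)"
  using comm_group by (simp add: comm_group_def)

lemma proj_hom: "(%a. Nn #>\<^bsub>Fr\<^esub> a) \<in> hom Fr (PG)"
  unfolding presented_group_def by (rule normal.r_coset_hom_Mod[OF nrm])

lemma carrier_eq: "carrier (PG) = (%a. Nn #>\<^bsub>Fr\<^esub> a) ` carrier Fr"
  by (simp add: presented_group_def carrier_FactGroup)

lemma generator_closed [simp, intro]: "s \<in> S ==> generator S P s <: PG"
  by (auto simp: generator_def carrier_eq)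

text \<open>Generators and differences suffice because they already exhaust the free abelian group
  that projects onto the quotient.\<close>

lemma induct [consumes 1, case_names one gen diff]:
  assumes x: "x <: PG"
    and one: "Q 1\<^sub>(PG)"
    and gen: "!!s. s \<in> S ==> Q (generator S P s)"
    and diff: "!!a b. [|a <: PG; b <: PG; Q a; Q b|]
       ==> Q (a *\<^sub>(PG) inv\<^bsub>PG\<^esub> b)"
  shows "Q x"
proof -
  let ?p = "%a. Nn #>\<^bsub>Fr\<^esub> a"
  obtain w where w: "w <: Fr" "x = ?p w" using x by (auto simp: carrier_eq)
  have "Poly_Mapping.keys w \<subseteq> S \<and> Q (?p w)"
  proof (rule free_Abelian_group_induct[where P="%w. Poly_Mapping.keys w \<subseteq> S \<and> Q (?p w)" and S=S])
    show "Poly_Mapping.keys w \<subseteq> S" using w by simp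
    show "Poly_Mapping.keys 0 \<subseteq> S \<and> Q (?p 0)"
      using one hom_one[OF proj_hom] group by auto
    show "Poly_Mapping.keys (frag_of a) \<subseteq> S \<and> Q (?p (frag_of a))" if "a \<in> S" for a
      using gen[OF that] that by (simp add: generator_def)
    fix a b assume ab: "Poly_Mapping.keys a \<subseteq> S" "Poly_Mapping.keys b \<subseteq> S"
      "Poly_Mapping.keys a \<subseteq> S \<and> Q (?p a)" "Poly_Mapping.keys b \<subseteq> S \<and> Q (?p b)"
    have "a - b = a *\<^sub>Fr inv\<^bsub>Fr\<^esub> b" using ab by simp
    moreover have "?p (a *\<^sub>Fr inv\<^bsub>Fr\<^esub> b) = ?p a *\<^sub>(PG) inv\<^bsub>PG\<^esub> (?p b)"
      using ab group hom_mult[OF proj_hom] hom_inv[OF proj_hom]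
      by (metis carrier_free_Abelian_group_iff group_free_Abelian_group group.inv_closed)
    moreover have "?p a <: PG" "?p b <: PG"
      using ab by (auto simp: carrier_eq)
    moreover have "Poly_Mapping.keys (a - b) \<subseteq> S" using keys_diff[of a b] ab by blast
    ultimately show "Poly_Mapping.keys (a - b) \<subseteq> S \<and> Q (?p (a - b))"
      using diff ab by metis
  qed
  then show ?thesis using w by simp
qed

lemma hom_eqI:
  assumes "h \<in> hom (PG) H" "h' \<in> hom (PG) H" "group H"
    "!!s. s \<in> S ==> h (generator S P s) = h' (generator S P s)" "x <: PG"
  shows "h x = h' x"
  using assms(5)
proof (induction rule: induct)
  case one then show ?case using hom_one[OF assms(1) group assms(3)] hom_one[OF assms(2) group assms(3)] by simp
next
  case (gen s) then show ?case using assms(4) by simp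
next
  case (diff a b)
  then show ?case using assms(1-3) group by (simp add: hom_mult hom_inv)
qed

lemma hom_in_subgroup:
  assumes "h \<in> hom (PG) H" "subgroup W H" "group H"
    "!!s. s \<in> S ==> h (generator S P s) \<in> W" "x <: PG"
  shows "h x \<in> W"
  using assms(5)
proof (induction rule: induct)
  case one then show ?case using hom_one[OF assms(1) group assms(3)] subgroup.one_closed[OF assms(2)] by simp
next
  case (gen s) then show ?case using assms(4) by simp
next
  case (diff a b)
  then show ?case using assms(1-3) group by (simp add: hom_mult hom_inv subgroup.m_closed subgroup.m_inv_closed)
qed

context
  fixes H :: "('h, 'z) monoid_scheme" and g :: "'x => 'h"
  assumes H: "comm_group H" and g: "!!s. s \<in> S ==> g s <: H"
    and respects: "!!h p. [|h \<in> hom Fr H; !!s. s \<in> S ==> h (frag_of s) = g s; p \<in> P|] ==> h p = 1\<^sub>H"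
begin

text \<open>The free abelian group provides a homomorphism; by \<open>respects\<close> it kills the
  relators and hence the subgroup they generate, so it descends to the quotient. Cutting it down to
  the carrier makes it the only extensional one, as the description operator in \<open>lift\<close>
  demands.\<close>

lemma ex_lift: "\<exists>!h. h \<in> hom (PG) H \<inter> extensional (carrier (PG)) \<and>
             (\<forall>s\<in>S. h (generator S P s) = g s)"
proof -
  have grH: "group H" using H by (simp add: comm_group_def)
  obtain h where h: "h \<in> hom Fr H" "!!x. x \<in> S ==> h (frag_of x) = g x"
    using comm_group.free_Abelian_group_universal[OF H, of g S] g by blast
  have kill: "h x = 1\<^sub>H" if "x \<in> Nn" for x
    using comm_group.hom_eq_one_on_generate[OF abelian_free_Abelian_group h(1) grH rels _ that] respects[OF h]
    by blast
  have eq: "h x = h y" if "x <: Fr" "y <: Fr" "Nn #>\<^bsub>Fr\<^esub> x = Nn #>\<^bsub>Fr\<^esub> y" for x y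
  proof -
    have "x \<in> Nn #>\<^bsub>Fr\<^esub> y" using that sub by (metis group.rcos_self group_free_Abelian_group)
    then obtain n where n: "n \<in> Nn" "x = n *\<^sub>Fr y" by (auto simp: r_coset_def)
    then have "h x = h n *\<^sub>H h y" using that hom_mult[OF h(1)] subgroup.mem_carrier[OF sub] by metis
    then show ?thesis using kill[OF n(1)] grH that hom_closed[OF h(1)] by (simp add: group.is_monoid)
  qed
  obtain k where k: "k \<in> hom (Fr Mod Nn) H" "!!x. x <: Fr ==> k (Nn #>\<^bsub>Fr\<^esub> x) = h x"
    using FactGroup_universal[OF h(1) nrm, of] eq by metis
  define k' where "k' = restrict k (carrier (PG))"
  have k': "k' \<in> hom (PG) H"
    using k(1) group.is_monoid[OF group] by (auto simp: hom_def k'_def presented_group_def[symmetric] Pi_def monoid.m_closed)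
  have gen: "k' (generator S P s) = g s" if "s \<in> S" for s
  proof -
    have "generator S P s <: PG" using that by blast
    then show ?thesis using k(2)[of "frag_of s"] that h(2) by (simp add: k'_def generator_def)
  qed
  show ?thesis
  proof (rule ex1I[of _ k'])
    show "k' \<in> hom (PG) H \<inter> extensional (carrier (PG)) \<and>
      (\<forall>s\<in>S. k' (generator S P s) = g s)" using k' gen by (simp add: k'_def)
    fix l assume l: "l \<in> hom (PG) H \<inter> extensional (carrier (PG)) \<and>
       (\<forall>s\<in>S. l (generator S P s) = g s)"
    show "l = k'"
    proof (rule extensionalityI)
      show "l \<in> extensional (carrier (PG))" using l by blast
      show "k' \<in> extensional (carrier (PG))" by (simp add: k'_def)
      show "l x = k' x" if "x <: PG" for x
        using hom_eqI[OF _ k' grH _ that, of l] l gen by simp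
    qed
  qed
qed

lemma lift_hom: "lift S P H g \<in> hom (PG) H"
  and lift_extensional: "lift S P H g \<in> extensional (carrier (PG))"
  and lift_generator: "s \<in> S ==> lift S P H g (generator S P s) = g s"
  using theI'[OF ex_lift] by (auto simp: lift_def)

end

lemma generator_rel:
  assumes "p \<in> P" shows "Nn #>\<^bsub>Fr\<^esub> p = 1\<^sub>(PG)"
proof -
  have "p \<in> Nn" using assms by (rule generate.incl)
  then show ?thesis unfolding presented_group_def
    using group.coset_join2[OF group_free_Abelian_group subgroup.mem_carrier[OF sub] sub] by simp
qed

lemma generator_eqI:
  assumes "frag_of a - frag_of b \<in> P" "a \<in> S" "b \<in> S"
  shows "generator S P a = generator S P b"
proof -
  have c: "frag_of a <: Fr" "frag_of b <: Fr" using assms by auto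
  have e: "frag_of a = (frag_of a - frag_of b) *\<^sub>Fr frag_of b" by simp
  have r: "frag_of a - frag_of b <: Fr" using rels assms(1) by blast
  have "generator S P a = (Nn #>\<^bsub>Fr\<^esub> (frag_of a - frag_of b)) *\<^sub>(PG) generator S P b"
    unfolding generator_def using hom_mult[OF proj_hom r c(2)] unfolding e[symmetric] .
  then show ?thesis using generator_rel[OF assms(1)] assms group.is_monoid[OF group] by (simp add: monoid.l_one)
qed

lemma generator_multI:
  assumes "frag_of a - frag_of b - frag_of c \<in> P" "a \<in> S" "b \<in> S" "c \<in> S"
  shows "generator S P a = generator S P b *\<^sub>(PG) generator S P c"
proof -
  let ?r = "frag_of a - frag_of b - frag_of c"
  have c: "frag_of a <: Fr" "frag_of b <: Fr" "frag_of c <: Fr" using assms by auto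
  then have bc: "frag_of b + frag_of c <: Fr"
    using keys_add[of "frag_of b" "frag_of c"] by auto
  have e: "frag_of a = ?r *\<^sub>Fr (frag_of b + frag_of c)" by simp
  have r: "?r <: Fr" using rels assms(1) by blast
  have "generator S P a = (Nn #>\<^bsub>Fr\<^esub> ?r) *\<^sub>(PG) (Nn #>\<^bsub>Fr\<^esub> (frag_of b + frag_of c))"
    unfolding generator_def using hom_mult[OF proj_hom r bc] unfolding e[symmetric] .
  also have "Nn #>\<^bsub>Fr\<^esub> (frag_of b + frag_of c) = generator S P b *\<^sub>(PG) generator S P c"
    unfolding generator_def using hom_mult[OF proj_hom c(2,3)] by simp
  finally show ?thesis using generator_rel[OF assms(1)] assms group.is_monoid[OF group]
    by (simp add: monoid.l_one monoid.m_closed)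
qed

end

text \<open>The relators of tensor products and tensor powers are differences of these two shapes.
  Evaluating a homomorphism on them turns a relation into an equation between values on
  generators.\<close>

lemma hom_frag_eqs:
  assumes "h \<in> hom (free_Abelian_group S) H" "comm_group H"
  shows "[|a \<in> S; b \<in> S; h (frag_of a) = h (frag_of b)|] ==> h (frag_of a - frag_of b) = 1\<^sub>H"
    and "[|a \<in> S; b \<in> S; c \<in> S; h (frag_of a) = h (frag_of b) *\<^sub>H h (frag_of c)|]
      ==> h (frag_of a - frag_of b - frag_of c) = 1\<^sub>H"
proof -
  interpret H: comm_group H by fact
  let ?F = "free_Abelian_group S"
  have grp: "group ?F" by simp
  { fix x y assume "x <: ?F" "y <: ?F"
    then have "x - y = x *\<^sub>?F inv\<^bsub>?F\<^esub> y" "inv\<^bsub>?F\<^esub> y <: ?F"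
      using group.inv_closed[OF grp] by auto
    then have "h (x - y) = h x *\<^sub>H inv\<^bsub>H\<^esub> h y"
      using \<open>x <: ?F\<close> \<open>y <: ?F\<close> hom_mult[OF assms(1)] hom_inv[OF assms(1)] H.is_group
      by (metis group_free_Abelian_group) }
  note d = this
  have f: "frag_of a <: ?F" if "a \<in> S" for a using that by simp
  have hc: "h (frag_of a) <: H" if "a \<in> S" for a using hom_closed[OF assms(1) f[OF that]] .
  show "h (frag_of a - frag_of b) = 1\<^sub>H" if "a \<in> S" "b \<in> S" "h (frag_of a) = h (frag_of b)"
    using d[OF f f] that hc by simp
  show "h (frag_of a - frag_of b - frag_of c) = 1\<^sub>H"
    if "a \<in> S" "b \<in> S" "c \<in> S" "h (frag_of a) = h (frag_of b) *\<^sub>H h (frag_of c)"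
  proof -
    have "frag_of a - frag_of b <: ?F"
      using keys_diff[of "frag_of a" "frag_of b"] f[OF that(1)] f[OF that(2)] by auto
    then have "h (frag_of a - frag_of b - frag_of c) = (h (frag_of b) *\<^sub>H h (frag_of c) *\<^sub>H inv\<^bsub>H\<^esub> h (frag_of b)) *\<^sub>H inv\<^bsub>H\<^esub> h (frag_of c)"
      using d f that by simp
    also have "h (frag_of b) *\<^sub>H h (frag_of c) = h (frag_of c) *\<^sub>H h (frag_of b)"
      using that hc by (simp add: H.m_comm)
    finally show ?thesis using that hc by (simp add: H.m_assoc)
  qed
qed

lemma frag_diff_closed:
  "[|a \<in> S; b \<in> S|] ==> frag_of a - frag_of b <: free_Abelian_group S"
  "[|a \<in> S; b \<in> S; c \<in> S|] ==> frag_of a - frag_of b - frag_of c <: free_Abelian_group S"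
  using keys_diff[of "frag_of a" "frag_of b :: _ \<Rightarrow>\<^sub>0 int"]
    keys_diff[of "frag_of a - frag_of b" "frag_of c :: _ \<Rightarrow>\<^sub>0 int"] by auto

lemma hom_prod:
  assumes "comm_group H" "f \<in> hom G H" "g \<in> hom G H"
  shows "(%x. f x *\<^sub>H g x) \<in> hom G H"
proof -
  interpret H: comm_group H by fact
  have c: "f x <: H" "g x <: H" if "x <: G" for x using assms that by (auto simp: hom_def)
  show ?thesis using assms c by (auto simp: hom_def H.m_ac)
qed

lemma hom_comp: "[|f \<in> hom G H; g \<in> hom H I|] ==> (%x. g (f x)) \<in> hom G I"
  by (auto simp: hom_def Pi_iff)

lemma hom_inverse:
  assumes "comm_group H" "f \<in> hom G H"
  shows "(%x. inv\<^bsub>H\<^esub> (f x)) \<in> hom G H"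
proof -
  interpret H: comm_group H by fact
  have c: "f x <: H" if "x <: G" for x using assms that by (auto simp: hom_def)
  show ?thesis using assms c by (auto simp: hom_def H.inv_mult)
qed

lemma hom_signed_fun:
  assumes "comm_group H" "f \<in> hom G H"
  shows "(%x. signed H e (f x)) \<in> hom G H"
  using assms hom_inverse[OF assms] by (cases "even e") (simp_all add: signed_def)

lemma hom_const_one: "group H ==> (%x. 1\<^sub>H) \<in> hom G H"
  by (auto simp: hom_def group.is_monoid)

lemma hom_restrict:
  assumes "f \<in> hom G H" "group G" shows "restrict f (carrier G) \<in> hom G H"
proof -
  interpret group G by fact
  show ?thesis using assms by (auto simp: hom_def)
qed

section \<open>Modules and bimodules\<close>

lemma left_moduleD:
  assumes "left_module R M"
  shows lm_comm_group: "comm_group M"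
    and lm_group: "group M"
    and lm_closed: "[|r <: R; m <: M|] ==> lact M r m <: M"
    and lm_hom: "r <: R ==> lact M r \<in> hom M M"
    and lm_dist: "[|r <: R; m <: M; n <: M|] ==>
        lact M r (m *\<^sub>M n) = lact M r m *\<^sub>M lact M r n"
    and lm_add: "[|r <: R; s <: R; m <: M|] ==>
        lact M (r +\<^sub>R s) m = lact M r m *\<^sub>M lact M s m"
    and lm_assoc: "[|r <: R; s <: R; m <: M|] ==>
        lact M (r *\<^sub>R s) m = lact M r (lact M s m)"
    and lm_one: "m <: M ==> lact M 1\<^sub>R m = m"
  using assms by (auto simp: left_module_def comm_group_def hom_def)

lemma right_moduleD:
  assumes "right_module R M"
  shows rm_comm_group: "comm_group M"
    and rm_group: "group M"
    and rm_closed: "[|r <: R; m <: M|] ==> ract M m r <: M"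
    and rm_hom: "r <: R ==> (%m. ract M m r) \<in> hom M M"
    and rm_dist: "[|r <: R; m <: M; n <: M|] ==>
        ract M (m *\<^sub>M n) r = ract M m r *\<^sub>M ract M n r"
    and rm_add: "[|r <: R; s <: R; m <: M|] ==>
        ract M m (r +\<^sub>R s) = ract M m r *\<^sub>M ract M m s"
    and rm_assoc: "[|r <: R; s <: R; m <: M|] ==>
        ract M m (r *\<^sub>R s) = ract M (ract M m r) s"
    and rm_one: "m <: M ==> ract M m 1\<^sub>R = m"
  using assms by (auto simp: right_module_def comm_group_def hom_def)

lemma lm_act_hom:
  assumes "left_module R M" "m <: M"
  shows "(%r. lact M r m) \<in> hom (add_monoid R) M"
  using assms by (auto simp: hom_def lm_closed lm_add)

lemma rm_act_hom:
  assumes "right_module R M" "m <: M"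
  shows "(%r. ract M m r) \<in> hom (add_monoid R) M"
  using assms by (auto simp: hom_def rm_closed rm_add)

definition bimodule :: "('l, 'y) ring_scheme => ('r, 'p) ring_scheme => ('l, 'm, 'r, 'z) bimod_scheme => bool" where
  "bimodule L R M \<longleftrightarrow> left_module L M \<and> right_module R M \<and>
     (\<forall>a\<in>carrier L. \<forall>b\<in>carrier R. \<forall>m\<in>carrier M. lact M a (ract M m b) = ract M (lact M a m) b)"

lemma bimodule_left: "bimodule L R M ==> left_module L M"
  and bimodule_right: "bimodule L R M ==> right_module R M"
  and bimodule_assoc: "[|bimodule L R M; a <: L; b <: R; m <: M|]
      ==> lact M a (ract M m b) = ract M (lact M a m) b"
  by (auto simp: bimodule_def)

section \<open>Tensor products\<close>

definition balanced :: "('r, 'p) ring_scheme => ('l, 'm, 'r, 'y) bimod_scheme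
    => ('r, 'n, 's, 'z) bimod_scheme => ('h, 'q) monoid_scheme => ('m => 'n => 'h) => bool" where
  "balanced R M N H g \<longleftrightarrow>
     (\<forall>n\<in>carrier N. (%m. g m n) \<in> hom M H) \<and> (\<forall>m\<in>carrier M. g m \<in> hom N H) \<and>
     (\<forall>m\<in>carrier M. \<forall>r\<in>carrier R. \<forall>n\<in>carrier N. g (ract M m r) n = g m (lact N r n))"

lemma balancedI:
  assumes "!!n. n <: N ==> (%m. g m n) \<in> hom M H" "!!m. m <: M ==> g m \<in> hom N H"
    "!!m r n. [|m <: M; r <: R; n <: N|] ==> g (ract M m r) n = g m (lact N r n)"
  shows "balanced R M N H g"
  using assms by (simp add: balanced_def)

locale tensor_product =
  fixes R :: "('r, 'p) ring_scheme" and M :: "('l, 'm, 'r, 'y) bimod_scheme"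
    and N :: "('r, 'n, 's, 'z) bimod_scheme"
  assumes right: "right_module R M" and left: "left_module R N"
begin

lemma MN: "comm_group M" "comm_group N" "group M" "group N"
  using rm_comm_group[OF right] lm_comm_group[OF left] rm_group[OF right] lm_group[OF left] .

sublocale pres: presentation "carrier M \<times> carrier N" "tensor_rels R M N"
proof
  have c: "m *\<^sub>M m' <: M" if "m <: M" "m' <: M" for m m'
    using that MN by (simp add: group.is_monoid monoid.m_closed)
  have d: "m *\<^sub>N m' <: N" if "m <: N" "m' <: N" for m m'
    using that MN by (simp add: group.is_monoid monoid.m_closed)
  show "tensor_rels R M N \<subseteq> carrier (free_Abelian_group (carrier M \<times> carrier N))"
    unfolding tensor_rels_def
    using c d rm_closed[OF right] lm_closed[OF left]
    by (auto simp del: carrier_free_Abelian_group_iff intro!: frag_diff_closed)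
qed

lemma comm_group_tensor: "comm_group (tensor_group R M N)"
  unfolding tensor_group_def by (rule pres.comm_group)

lemma group_tensor: "group (tensor_group R M N)"
  unfolding tensor_group_def by (rule pres.group)

lemma pure_closed: "[|m <: M; n <: N|] ==> pure_tensor R M N m n <: tensor_group R M N"
  unfolding tensor_group_def pure_tensor_def by blast

lemma pure_balanced: "balanced R M N (tensor_group R M N) (pure_tensor R M N)"
proof (rule balancedI)
  have c: "m *\<^sub>M m' <: M" if "m <: M" "m' <: M" for m m'
    using that MN by (simp add: group.is_monoid monoid.m_closed)
  have d: "m *\<^sub>N m' <: N" if "m <: N" "m' <: N" for m m'
    using that MN by (simp add: group.is_monoid monoid.m_closed)
  show "(%m. pure_tensor R M N m n) \<in> hom M (tensor_group R M N)" if "n <: N" for n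
  proof (rule homI)
    show "pure_tensor R M N (x *\<^sub>M y) n = pure_tensor R M N x n *\<^sub>(tensor_group R M N) pure_tensor R M N y n"
      if "x <: M" "y <: M" for x y
      unfolding tensor_group_def pure_tensor_def
      by (rule pres.generator_multI) (use that \<open>n <: N\<close> c in \<open>auto simp: tensor_rels_def\<close>)
  qed (use that pure_closed in auto)
  show "pure_tensor R M N m \<in> hom N (tensor_group R M N)" if "m <: M" for m
  proof (rule homI)
    show "pure_tensor R M N m (x *\<^sub>N y) = pure_tensor R M N m x *\<^sub>(tensor_group R M N) pure_tensor R M N m y"
      if "x <: N" "y <: N" for x y
      unfolding tensor_group_def pure_tensor_def
      by (rule pres.generator_multI) (use that \<open>m <: M\<close> d in \<open>auto simp: tensor_rels_def\<close>)
  qed (use that pure_closed in auto)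
  show "pure_tensor R M N (ract M m r) n = pure_tensor R M N m (lact N r n)"
    if "m <: M" "r <: R" "n <: N" for m r n
    unfolding pure_tensor_def
    by (rule pres.generator_eqI)
       (use that rm_closed[OF right] lm_closed[OF left] in \<open>auto simp: tensor_rels_def\<close>)
qed

lemma induct [consumes 1, case_names one pure diff]:
  assumes "x <: tensor_group R M N" "Q 1\<^sub>(tensor_group R M N)"
    "!!m n. [|m <: M; n <: N|] ==> Q (pure_tensor R M N m n)"
    "!!a b. [|a <: tensor_group R M N; b <: tensor_group R M N; Q a; Q b|]
       ==> Q (a *\<^sub>(tensor_group R M N) inv\<^bsub>tensor_group R M N\<^esub> b)"
  shows "Q x"
  using assms unfolding tensor_group_def pure_tensor_def by (intro pres.induct[of x Q]) auto

lemma hom_eqI: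
  assumes "h \<in> hom (tensor_group R M N) H" "h' \<in> hom (tensor_group R M N) H" "group H"
    "!!m n. [|m <: M; n <: N|] ==> h (pure_tensor R M N m n) = h' (pure_tensor R M N m n)"
    "x <: tensor_group R M N"
  shows "h x = h' x"
  using assms unfolding tensor_group_def pure_tensor_def by (intro pres.hom_eqI[of h H h' x]) auto

lemma hom_in_subgroup:
  assumes "h \<in> hom (tensor_group R M N) H" "subgroup W H" "group H"
    "!!m n. [|m <: M; n <: N|] ==> h (pure_tensor R M N m n) \<in> W"
    "x <: tensor_group R M N"
  shows "h x \<in> W"
  using assms unfolding tensor_group_def pure_tensor_def by (intro pres.hom_in_subgroup[of h H W x]) auto

context
  fixes H :: "('h, 'q) monoid_scheme" and g :: "'m => 'n => 'h"
  assumes H: "comm_group H" and bal: "balanced R M N H g"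
begin

lemma respects:
  assumes h: "h \<in> hom (free_Abelian_group (carrier M \<times> carrier N)) H"
    "!!s. s \<in> carrier M \<times> carrier N ==> h (frag_of s) = (%(m, n). g m n) s" and p: "p \<in> tensor_rels R M N"
  shows "h p = 1\<^sub>H"
proof -
  have c: "m *\<^sub>M m' <: M" if "m <: M" "m' <: M" for m m'
    using that MN by (simp add: group.is_monoid monoid.m_closed)
  have d: "m *\<^sub>N m' <: N" if "m <: N" "m' <: N" for m m'
    using that MN by (simp add: group.is_monoid monoid.m_closed)
  have g1: "g (m *\<^sub>M m') n = g m n *\<^sub>H g m' n" if "m <: M" "m' <: M" "n <: N" for m m' n
    using bal that by (simp add: balanced_def hom_def)
  have g2: "g m (n *\<^sub>N n') = g m n *\<^sub>H g m n'" if "m <: M" "n <: N" "n' <: N" for m n n'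
    using bal that by (simp add: balanced_def hom_def)
  have g3: "g (ract M m r) n = g m (lact N r n)" if "m <: M" "r <: R" "n <: N" for m r n
    using bal that by (simp add: balanced_def)
  consider (1) m m' n where "p = frag_of (m *\<^sub>M m', n) - frag_of (m, n) - frag_of (m', n)"
       "m <: M" "m' <: M" "n <: N"
    | (2) m n n' where "p = frag_of (m, n *\<^sub>N n') - frag_of (m, n) - frag_of (m, n')"
       "m <: M" "n <: N" "n' <: N"
    | (3) m r n where "p = frag_of (ract M m r, n) - frag_of (m, lact N r n)"
       "m <: M" "r <: R" "n <: N"
    using p unfolding tensor_rels_def by blast
  then show ?thesis
  proof cases
    case 1 then show ?thesis using c g1 h(2)
      by (auto intro!: hom_frag_eqs(2)[OF h(1) H])
  next
    case 2 then show ?thesis using d g2 h(2)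
      by (auto intro!: hom_frag_eqs(2)[OF h(1) H])
  next
    case 3 then show ?thesis using rm_closed[OF right] lm_closed[OF left] g3 h(2)
      by (auto intro!: hom_frag_eqs(1)[OF h(1) H])
  qed
qed

lemma vals: "s \<in> carrier M \<times> carrier N ==> (%(m, n). g m n) s <: H"
  using bal by (auto simp: balanced_def hom_def)

lemma tensor_lift_hom: "tensor_lift R M N H g \<in> hom (tensor_group R M N) H"
  and tensor_lift_extensional: "tensor_lift R M N H g \<in> extensional (carrier (tensor_group R M N))"
  and tensor_lift_pure: "[|m <: M; n <: N|] ==> tensor_lift R M N H g (pure_tensor R M N m n) = g m n"
proof -
  let ?g = "%(m, n). g m n"
  show "tensor_lift R M N H g \<in> hom (tensor_group R M N) H"
    unfolding tensor_lift_def tensor_group_def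
    by (rule pres.lift_hom[where g="?g", OF H]) (use vals respects in blast)+
  show "tensor_lift R M N H g \<in> extensional (carrier (tensor_group R M N))"
    unfolding tensor_lift_def tensor_group_def
    by (rule pres.lift_extensional[where g="?g", OF H]) (use vals respects in blast)+
  have "s \<in> carrier M \<times> carrier N ==> lift (carrier M \<times> carrier N) (tensor_rels R M N) H ?g
      (generator (carrier M \<times> carrier N) (tensor_rels R M N) s) = ?g s" for s
    by (rule pres.lift_generator[where g="?g", OF H]) (use vals respects in blast)+
  from this[of "(m, n)"] show "[|m <: M; n <: N|] ==> tensor_lift R M N H g (pure_tensor R M N m n) = g m n"
    unfolding tensor_lift_def pure_tensor_def by simp
qed

end

end

lemma tensor_simps [simp]:
  "carrier (tensor R M N) = carrier (tensor_group R M N)"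
  "mult (tensor R M N) = mult (tensor_group R M N)"
  "one (tensor R M N) = one (tensor_group R M N)"
  "m_inv (tensor R M N) = m_inv (tensor_group R M N)"
  "signed (tensor R M N) = signed (tensor_group R M N)"
proof -
  show 1: "m_inv (tensor R M N) = m_inv (tensor_group R M N)" by (rule m_inv_cong) (simp_all add: tensor_def)
  show "signed (tensor R M N) = signed (tensor_group R M N)" by (simp add: signed_def fun_eq_iff 1)
qed (simp_all add: tensor_def)

lemma tensor_lact: "lact (tensor R M N) l = tensor_map R M N M N (lact M l) id"
  and tensor_ract: "ract (tensor R M N) u s = tensor_map R M N M N id (%n. ract N n s) u"
  by (simp_all add: tensor_def)

lemma hom_tensor [simp]:
  "hom (tensor R M N) H = hom (tensor_group R M N) H"
  "hom H (tensor R M N) = hom H (tensor_group R M N)"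
  by (simp_all add: hom_def)

context
  fixes R :: "('r, 'p) ring_scheme"
    and M :: "('l, 'm, 'r, 'y) bimod_scheme" and N :: "('r, 'n, 's, 'z) bimod_scheme"
    and M' :: "('l1, 'm1, 'r, 'y1) bimod_scheme" and N' :: "('r, 'n1, 's1, 'z1) bimod_scheme"
    and f g
  assumes MN: "tensor_product R M N" and MN': "tensor_product R M' N'"
    and f: "f \<in> hom M M'" "!!m r. [|m <: M; r <: R|] ==> f (ract M m r) = ract M' (f m) r"
    and g: "g \<in> hom N N'" "!!n r. [|n <: N; r <: R|] ==> g (lact N r n) = lact N' r (g n)"
begin

interpretation MN: tensor_product R M N by (rule MN)
interpretation MN': tensor_product R M' N' by (rule MN')

lemma tensor_map_balanced: "balanced R M N (tensor_group R M' N') (%m n. pure_tensor R M' N' (f m) (g n))"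
proof (rule balancedI)
  have p: "(%m. pure_tensor R M' N' m n) \<in> hom M' (tensor_group R M' N')" if "n <: N'" for n
    using MN'.pure_balanced that by (simp add: balanced_def)
  have q: "pure_tensor R M' N' m \<in> hom N' (tensor_group R M' N')" if "m <: M'" for m
    using MN'.pure_balanced that by (simp add: balanced_def)
  show "(%m. pure_tensor R M' N' (f m) (g n)) \<in> hom M (tensor_group R M' N')" if "n <: N" for n
    using hom_comp[OF f(1) p] hom_closed[OF g(1) that] .
  show "(%n. pure_tensor R M' N' (f m) (g n)) \<in> hom N (tensor_group R M' N')" if "m <: M" for m
    using hom_comp[OF g(1) q] hom_closed[OF f(1) that] .
  show "pure_tensor R M' N' (f (ract M m r)) (g n) = pure_tensor R M' N' (f m) (g (lact N r n))"
    if "m <: M" "r <: R" "n <: N" for m r n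
    using MN'.pure_balanced that hom_closed[OF f(1)] hom_closed[OF g(1)] f(2) g(2) by (simp add: balanced_def)
qed

lemma tensor_map_hom: "tensor_map R M N M' N' f g \<in> hom (tensor_group R M N) (tensor_group R M' N')"
  and tensor_map_pure: "[|m <: M; n <: N|] ==>
     tensor_map R M N M' N' f g (pure_tensor R M N m n) = pure_tensor R M' N' (f m) (g n)"
  using MN.tensor_lift_hom[OF MN'.comm_group_tensor tensor_map_balanced]
    MN.tensor_lift_pure[OF MN'.comm_group_tensor tensor_map_balanced]
  by (simp_all add: tensor_map_def)

end

lemma tensor_productI: "[|bimodule L R M; bimodule R S N|] ==> tensor_product R M N"
  by (simp add: tensor_product_def bimodule_def)

context
  fixes L :: "('l, 'w) ring_scheme" and R :: "('r, 'p) ring_scheme" and S :: "('s, 'q) ring_scheme"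
    and M :: "('l, 'm, 'r, 'y) gr_bimod_scheme" and N :: "('r, 'n, 's, 'z) gr_bimod_scheme"
  assumes M: "bimodule L R M" and N: "bimodule R S N"
begin

interpretation MN: tensor_product R M N by (rule tensor_productI[OF M N])

lemma tensor_lact_hom: "a <: L ==> lact (tensor R M N) a \<in> hom (tensor_group R M N) (tensor_group R M N)"
  and tensor_lact_pure: "[|a <: L; m <: M; n <: N|] ==>
    lact (tensor R M N) a (pure_tensor R M N m n) = pure_tensor R M N (lact M a m) n"
proof -
  have id: "id \<in> hom N N" by (simp add: hom_def)
  have "tensor_map R M N M N (lact M a) id \<in> hom (tensor_group R M N) (tensor_group R M N)"
    if "a <: L" for a
    by (rule tensor_map_hom[OF MN.tensor_product_axioms MN.tensor_product_axioms _ _ id])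
       (use that M in \<open>auto simp: bimodule_def lm_hom\<close>)
  then show "a <: L ==> lact (tensor R M N) a \<in> hom (tensor_group R M N) (tensor_group R M N)" by (simp add: tensor_lact)
  show "[|a <: L; m <: M; n <: N|] ==>
    lact (tensor R M N) a (pure_tensor R M N m n) = pure_tensor R M N (lact M a m) n"
    using tensor_map_pure[OF MN.tensor_product_axioms MN.tensor_product_axioms _ _ id, of "lact M a" m n] M
    by (auto simp: bimodule_def lm_hom tensor_lact)
qed

lemma tensor_ract_hom: "a <: S ==> (%u. ract (tensor R M N) u a) \<in> hom (tensor_group R M N) (tensor_group R M N)"
  and tensor_ract_pure: "[|a <: S; m <: M; n <: N|] ==>
    ract (tensor R M N) (pure_tensor R M N m n) a = pure_tensor R M N m (ract N n a)"
proof -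
  have id: "id \<in> hom M M" by (simp add: hom_def)
  have *: "tensor_map R M N M N id (%n. ract N n a) \<in> hom (tensor_group R M N) (tensor_group R M N)"
    if "a <: S" for a
    by (rule tensor_map_hom[OF MN.tensor_product_axioms MN.tensor_product_axioms id])
       (use that N in \<open>auto simp: bimodule_def rm_hom\<close>)
  show "a <: S ==> (%u. ract (tensor R M N) u a) \<in> hom (tensor_group R M N) (tensor_group R M N)"
    using * by (simp add: tensor_ract)
  show "[|a <: S; m <: M; n <: N|] ==>
    ract (tensor R M N) (pure_tensor R M N m n) a = pure_tensor R M N m (ract N n a)"
    using tensor_map_pure[OF MN.tensor_product_axioms MN.tensor_product_axioms id, of "%n. ract N n a" m n] N
    by (auto simp: bimodule_def rm_hom tensor_ract)
qed

text \<open>Each axiom is an equation between additive maps and is checked on pure tensors, where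
  the module axioms come down to those of one factor and the two actions touch different
  factors.\<close>

lemma bimodule_tensor:
  assumes "ring L" "ring S"
  shows "bimodule L S (tensor R M N)"
proof -
  interpret L: ring L by fact
  interpret S: ring S by fact
  let ?T = "tensor R M N" and ?G = "tensor_group R M N"
  note LM = bimodule_left[OF M] and RN = bimodule_right[OF N]
  note G = MN.group_tensor
  have cg: "comm_group ?T"
    by (rule comm_group_cong[OF _ _ _ MN.comm_group_tensor]) auto
  have hom: "(%u. lact ?T a u *\<^sub>?G lact ?T b u) \<in> hom ?G ?G" if "a <: L" "b <: L" for a b
    using that by (intro hom_prod MN.comm_group_tensor tensor_lact_hom)
  have hom': "(%u. ract ?T u a *\<^sub>?G ract ?T u b) \<in> hom ?G ?G" if "a <: S" "b <: S" for a b
    using that by (intro hom_prod MN.comm_group_tensor tensor_ract_hom)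
  have bl: "pure_tensor R M N (m *\<^sub>M m') n = pure_tensor R M N m n *\<^sub>?G pure_tensor R M N m' n"
    if "m <: M" "m' <: M" "n <: N" for m m' n
    using that MN.pure_balanced by (simp add: balanced_def hom_def)
  have br: "pure_tensor R M N m (n *\<^sub>N n') = pure_tensor R M N m n *\<^sub>?G pure_tensor R M N m n'"
    if "m <: M" "n <: N" "n' <: N" for m n n'
    using that MN.pure_balanced by (simp add: balanced_def hom_def)
  have id: "(%u. u) \<in> hom ?G ?G" by (simp add: hom_def)
  note cl = hom_closed[OF tensor_lact_hom] hom_closed[OF tensor_ract_hom]
  note lh = hom_mult[OF tensor_lact_hom] note rh = hom_mult[OF tensor_ract_hom]
  have 1: "lact ?T (r +\<^sub>L s) m = lact ?T r m *\<^sub>?G lact ?T s m"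
    if "r <: L" "s <: L" "m <: ?G" for r s m
    by (rule MN.hom_eqI[OF tensor_lact_hom hom G _ that(3)])
       (use that in \<open>simp_all add: tensor_lact_pure lm_add[OF LM] bl lm_closed[OF LM]\<close>)
  have 2: "lact ?T (r *\<^sub>L s) m = lact ?T r (lact ?T s m)"
    if "r <: L" "s <: L" "m <: ?G" for r s m
    by (rule MN.hom_eqI[OF tensor_lact_hom hom_comp[OF tensor_lact_hom tensor_lact_hom] G _ that(3)])
       (use that in \<open>simp_all add: tensor_lact_pure lm_assoc[OF LM] lm_closed[OF LM]\<close>)
  have 3: "lact ?T 1\<^sub>L m = m" if "m <: ?G" for m
    by (rule MN.hom_eqI[OF tensor_lact_hom id G _ that])
       (use that in \<open>simp_all add: tensor_lact_pure lm_one[OF LM]\<close>)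
  have 4: "ract ?T m (r +\<^sub>S s) = ract ?T m r *\<^sub>?G ract ?T m s"
    if "r <: S" "s <: S" "m <: ?G" for r s m
    by (rule MN.hom_eqI[OF tensor_ract_hom hom' G _ that(3)])
       (use that in \<open>simp_all add: tensor_ract_pure rm_add[OF RN] br rm_closed[OF RN]\<close>)
  have 5: "ract ?T m (r *\<^sub>S s) = ract ?T (ract ?T m r) s"
    if "r <: S" "s <: S" "m <: ?G" for r s m
    by (rule MN.hom_eqI[OF tensor_ract_hom hom_comp[OF tensor_ract_hom tensor_ract_hom] G _ that(3)])
       (use that in \<open>simp_all add: tensor_ract_pure rm_assoc[OF RN] rm_closed[OF RN]\<close>)
  have 6: "ract ?T m 1\<^sub>S = m" if "m <: ?G" for m
    by (rule MN.hom_eqI[OF tensor_ract_hom id G _ that])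
       (use that in \<open>simp_all add: tensor_ract_pure rm_one[OF RN]\<close>)
  have 7: "lact ?T a (ract ?T m b) = ract ?T (lact ?T a m) b"
    if "a <: L" "b <: S" "m <: ?G" for a b m
    by (rule MN.hom_eqI[OF hom_comp[OF tensor_ract_hom tensor_lact_hom] hom_comp[OF tensor_lact_hom tensor_ract_hom] G _ that(3)])
       (use that in \<open>simp_all add: tensor_ract_pure tensor_lact_pure rm_closed[OF RN] lm_closed[OF LM]\<close>)
  show ?thesis
    unfolding bimodule_def left_module_def right_module_def
    using cg 1 2 3 4 5 6 7 cl lh rh by simp
qed

end

section \<open>Tensor powers\<close>

lemma words_update: "[|xs \<in> words L n; x <: L|] ==> xs[i := x] \<in> words L n"
  unfolding words_def by (auto dest: set_update_subset_insert[THEN subsetD])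

lemma words_length: "xs \<in> words L n ==> length xs = n"
  by (simp add: words_def)

lemma words_nth: "[|xs \<in> words L n; i < n|] ==> xs ! i <: L"
  unfolding words_def by auto

lemma words_Cons: "x # xs \<in> words L (Suc n) \<longleftrightarrow> x <: L \<and> xs \<in> words L n"
  by (auto simp: words_def)

lemma words_Nil [simp]: "xs \<in> words L 0 \<longleftrightarrow> xs = []"
  by (auto simp: words_def)

text \<open>\<open>H\<close> is only a group, so linearity over \<open>K\<close> is expressed by
  moving a scalar from one slot to another. This is what the relators of the tensor power
  say.\<close>

definition multilinear :: "('k, 'p) ring_scheme => ('k, 'a, 'z) module_scheme => nat
    => ('h, 'q) monoid_scheme => ('a list => 'h) => bool" where
  "multilinear K L n H g \<longleftrightarrow> (\<forall>xs\<in>words L n. g xs <: H) \<and>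
     (\<forall>xs\<in>words L n. \<forall>i < n. \<forall>x\<in>carrier L. \<forall>y\<in>carrier L.
        g (xs[i := x +\<^sub>L y]) = g (xs[i := x]) *\<^sub>H g (xs[i := y])) \<and>
     (\<forall>xs\<in>words L n. \<forall>i < n. \<forall>j < n. \<forall>c\<in>carrier K.
        g (xs[i := c \<cdot>\<^sub>L xs ! i]) = g (xs[j := c \<cdot>\<^sub>L xs ! j]))"

lemma multilinearI:
  assumes "!!xs. xs \<in> words L n ==> g xs <: H"
    "!!xs i x y. [|xs \<in> words L n; i < n; x <: L; y <: L|] ==>
       g (xs[i := x +\<^sub>L y]) = g (xs[i := x]) *\<^sub>H g (xs[i := y])"
    "!!xs i j c. [|xs \<in> words L n; i < n; j < n; c <: K|] ==>
       g (xs[i := c \<cdot>\<^sub>L xs ! i]) = g (xs[j := c \<cdot>\<^sub>L xs ! j])"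
  shows "multilinear K L n H g"
  unfolding multilinear_def by (intro conjI ballI allI impI assms)

lemma multilinearD:
  assumes "multilinear K L n H g"
  shows "xs \<in> words L n ==> g xs <: H"
    "[|xs \<in> words L n; i < n; x <: L; y <: L|] ==>
       g (xs[i := x +\<^sub>L y]) = g (xs[i := x]) *\<^sub>H g (xs[i := y])"
    "[|xs \<in> words L n; i < n; j < n; c <: K|] ==>
       g (xs[i := c \<cdot>\<^sub>L xs ! i]) = g (xs[j := c \<cdot>\<^sub>L xs ! j])"
  using assms unfolding multilinear_def by blast+

locale tensor_powers = module K L
  for K (structure) and L (structure) +
  fixes n :: nat
begin

sublocale pres: presentation "words L n" "tensor_power_rels K L n"
proof
  show "tensor_power_rels K L n \<subseteq> carrier (free_Abelian_group (words L n))"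
    unfolding tensor_power_rels_def
    by (auto simp del: carrier_free_Abelian_group_iff intro!: frag_diff_closed words_update words_nth smult_closed)
qed

lemma comm_group_power: "comm_group (tensor_power K L n)"
  unfolding tensor_power_def by (rule pres.comm_group)

lemma group_power: "group (tensor_power K L n)"
  unfolding tensor_power_def by (rule pres.group)

lemma pure_multilinear: "multilinear K L n (tensor_power K L n) (pure_word K L n)"
proof (rule multilinearI)
  show "pure_word K L n xs <: tensor_power K L n" if "xs \<in> words L n" for xs
    using that unfolding tensor_power_def pure_word_def by blast
  show "pure_word K L n (xs[i := x +\<^sub>L y]) =
      pure_word K L n (xs[i := x]) *\<^sub>(tensor_power K L n) pure_word K L n (xs[i := y])"
    if "xs \<in> words L n" "i < n" "x <: L" "y <: L" for xs i x y
    unfolding tensor_power_def pure_word_def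
    by (rule pres.generator_multI) (use that in \<open>auto simp: tensor_power_rels_def intro!: words_update\<close>)
  show "pure_word K L n (xs[i := c \<cdot>\<^sub>L xs ! i]) = pure_word K L n (xs[j := c \<cdot>\<^sub>L xs ! j])"
    if "xs \<in> words L n" "i < n" "j < n" "c <: K" for xs i j c
    unfolding pure_word_def
    by (rule pres.generator_eqI)
       (use that in \<open>auto simp: tensor_power_rels_def intro!: words_update words_nth smult_closed\<close>)
qed

lemmas pure_word_closed = multilinearD(1)[OF pure_multilinear]

lemma induct [consumes 1, case_names one pure diff]:
  assumes "x <: tensor_power K L n" "Q 1\<^sub>(tensor_power K L n)"
    "!!xs. xs \<in> words L n ==> Q (pure_word K L n xs)"
    "!!a b. [|a <: tensor_power K L n; b <: tensor_power K L n; Q a; Q b|]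
       ==> Q (a *\<^sub>(tensor_power K L n) inv\<^bsub>tensor_power K L n\<^esub> b)"
  shows "Q x"
  using assms unfolding tensor_power_def pure_word_def by (intro pres.induct[of x Q]) auto

lemma hom_eqI:
  assumes "h \<in> hom (tensor_power K L n) H" "h' \<in> hom (tensor_power K L n) H" "group H"
    "!!xs. xs \<in> words L n ==> h (pure_word K L n xs) = h' (pure_word K L n xs)"
    "x <: tensor_power K L n"
  shows "h x = h' x"
  using assms unfolding tensor_power_def pure_word_def by (intro pres.hom_eqI[of h H h' x]) auto

context
  fixes H :: "('h, 'q) monoid_scheme" and g :: "'c list => 'h"
  assumes H: "comm_group H" and ml: "multilinear K L n H g"
begin

lemma respects:
  assumes h: "h \<in> hom (free_Abelian_group (words L n)) H"
    "!!s. s \<in> words L n ==> h (frag_of s) = g s" and p: "p \<in> tensor_power_rels K L n"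
  shows "h p = 1\<^sub>H"
proof -
  consider (1) xs i x y where "p = frag_of (xs[i := x +\<^sub>L y]) - frag_of (xs[i := x]) - frag_of (xs[i := y])"
        "xs \<in> words L n" "i < n" "x <: L" "y <: L"
    | (2) xs i j c where "p = frag_of (xs[i := c \<cdot>\<^sub>L xs ! i]) - frag_of (xs[j := c \<cdot>\<^sub>L xs ! j])"
       "xs \<in> words L n" "i < n" "j < n" "c <: K"
    using p unfolding tensor_power_rels_def by blast
  then show ?thesis
  proof cases
    case 1 then show ?thesis using multilinearD(2)[OF ml] h(2)
      by (auto intro!: hom_frag_eqs(2)[OF h(1) H] simp: words_update)
  next
    case 2
    then have "xs[i := c \<cdot>\<^sub>L xs ! i] \<in> words L n" "xs[j := c \<cdot>\<^sub>L xs ! j] \<in> words L n"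
      by (auto intro!: words_update smult_closed words_nth)
    then show ?thesis unfolding 2(1) using multilinearD(3)[OF ml 2(2-5)] h(2)
      by (intro hom_frag_eqs(1)[OF h(1) H]) auto
  qed
qed

lemma word_lift_hom: "word_lift K L n H g \<in> hom (tensor_power K L n) H"
  and word_lift_extensional: "word_lift K L n H g \<in> extensional (carrier (tensor_power K L n))"
  and word_lift_pure: "xs \<in> words L n ==> word_lift K L n H g (pure_word K L n xs) = g xs"
  unfolding word_lift_def tensor_power_def pure_word_def
  by (rule pres.lift_hom[where g=g, OF H] pres.lift_extensional[where g=g, OF H] pres.lift_generator[where g=g, OF H],
      (use multilinearD(1)[OF ml] respects in blast)+)+

end

lemma hom_multilinear:
  assumes "h \<in> hom (tensor_power K L n) H"
  shows "multilinear K L n H (%xs. h (pure_word K L n xs))"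
proof (rule multilinearI)
  note p = multilinearD[OF pure_multilinear]
  show "h (pure_word K L n xs) <: H" if "xs \<in> words L n" for xs
    using hom_closed[OF assms p(1)[OF that]] .
  show "h (pure_word K L n (xs[i := x +\<^sub>L y])) =
      h (pure_word K L n (xs[i := x])) *\<^sub>H h (pure_word K L n (xs[i := y]))"
    if "xs \<in> words L n" "i < n" "x <: L" "y <: L" for xs i x y
    unfolding p(2)[OF that] by (intro hom_mult[OF assms] p(1) words_update that)
  show "h (pure_word K L n (xs[i := c \<cdot>\<^sub>L xs ! i])) = h (pure_word K L n (xs[j := c \<cdot>\<^sub>L xs ! j]))"
    if "xs \<in> words L n" "i < n" "j < n" "c <: K" for xs i j c
    unfolding p(3)[OF that] ..
qed

end

section \<open>Linear algebra over a field\<close>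

locale vector_sp = K?: field K for K (structure) +
  fixes V :: "('k, 'v, 'r, 'z) bimod_scheme"
  assumes lm: "left_module K V"
begin

sublocale V: comm_group V by (rule lm_comm_group[OF lm])

lemmas l_closed [simp, intro] = lm_closed[OF lm]
lemmas l_dist = lm_dist[OF lm]
lemmas l_add = lm_add[OF lm]
lemmas l_assoc = lm_assoc[OF lm]
lemmas l_one [simp] = lm_one[OF lm]

lemma l_one_right [simp]: "c <: K ==> lact V c 1\<^sub>V = 1\<^sub>V"
  using l_dist[of c "1\<^sub>V" "1\<^sub>V"] by (simp add: V.l_cancel_one)

lemma l_zero [simp]: "v <: V ==> lact V \<zero> v = 1\<^sub>V"
  using l_add[of \<zero> \<zero> v] by (simp add: V.l_cancel_one)

lemma l_minus: "[|c <: K; v <: V|] ==> lact V (\<ominus> c) v = inv\<^bsub>V\<^esub> (lact V c v)"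
  using l_add[of "\<ominus> c" c v] by (simp add: V.inv_equality K.l_neg)

lemma l_inv: "[|c <: K; v <: V|] ==> lact V c (inv\<^bsub>V\<^esub> v) = inv\<^bsub>V\<^esub> (lact V c v)"
  using l_dist[of c "inv\<^bsub>V\<^esub> v" v] by (simp add: V.inv_equality)

definition subsp :: "'v set => bool" where
  "subsp U \<longleftrightarrow> U \<subseteq> carrier V \<and> 1\<^sub>V \<in> U \<and> (\<forall>x\<in>U. \<forall>y\<in>U. x *\<^sub>V y \<in> U) \<and>
     (\<forall>c\<in>carrier K. \<forall>x\<in>U. lact V c x \<in> U)"

lemma subspD:
  assumes "subsp U"
  shows "x \<in> U ==> x <: V" "1\<^sub>V \<in> U" "[|x \<in> U; y \<in> U|] ==> x *\<^sub>V y \<in> U"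
    "[|c <: K; x \<in> U|] ==> lact V c x \<in> U" "x \<in> U ==> inv\<^bsub>V\<^esub> x \<in> U"
proof -
  show c: "x \<in> U ==> x <: V" "1\<^sub>V \<in> U" "[|x \<in> U; y \<in> U|] ==> x *\<^sub>V y \<in> U"
    "[|c <: K; x \<in> U|] ==> lact V c x \<in> U" for x y c
    using assms by (auto simp: subsp_def)
  show "x \<in> U ==> inv\<^bsub>V\<^esub> x \<in> U"
    using c(4)[of "\<ominus> \<one>" x] l_minus[of \<one> x] c(1)[of x] by simp
qed

text \<open>Zorn's lemma gives a maximal subspace meeting \<open>U\<close> trivially. If some
  \<open>v\<close> were outside its sum with \<open>U\<close>, adjoining the line through
  \<open>v\<close> would produce a larger such subspace.\<close>

lemma ex_complement:
  assumes U: "subsp U"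
  shows "\<exists>C. subsp C \<and> U \<inter> C = {1\<^sub>V} \<and> (\<forall>v\<in>carrier V. \<exists>u\<in>U. \<exists>c\<in>C. v = u *\<^sub>V c)"
proof -
  let ?F = "{C. subsp C \<and> U \<inter> C \<subseteq> {1\<^sub>V}}"
  have "\<exists>M\<in>?F. \<forall>X\<in>?F. M \<subseteq> X \<longrightarrow> X = M"
  proof (rule subset_Zorn_nonempty)
    have "{1\<^sub>V} \<in> ?F" by (auto simp: subsp_def)
    then show "?F \<noteq> {}" by blast
    fix Ch assume ne: "Ch \<noteq> {}" and ch: "subset.chain ?F Ch"
    have sub: "C \<in> Ch ==> subsp C \<and> U \<inter> C \<subseteq> {1\<^sub>V}" for C
      using ch by (auto simp: subset.chain_def)
    have tot: "C \<in> Ch ==> D \<in> Ch ==> C \<subseteq> D \<or> D \<subseteq> C" for C D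
      using ch unfolding subset.chain_def by blast
    have "subsp (\<Union>Ch)" unfolding subsp_def
    proof (intro conjI ballI)
      show "\<Union> Ch \<subseteq> carrier V" using sub unfolding subsp_def by blast
      show "1\<^sub>V \<in> \<Union> Ch" using ne sub unfolding subsp_def by blast
      show "x *\<^sub>V y \<in> \<Union> Ch" if xy: "x \<in> \<Union> Ch" "y \<in> \<Union> Ch" for x y
      proof -
        obtain C D where CD: "C \<in> Ch" "x \<in> C" "D \<in> Ch" "y \<in> D" using xy by blast
        then obtain E where "E \<in> Ch" "x \<in> E" "y \<in> E" using tot[of C D] by blast
        then show ?thesis using sub[of E] subspD(3)[of E x y] by blast
      qed
      show "lact V c x \<in> \<Union> Ch" if cx: "c <: K" "x \<in> \<Union> Ch" for c x
      proof -
        obtain C where "C \<in> Ch" "x \<in> C" using cx(2) by blast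
        then show ?thesis using sub[of C] subspD(4)[of C c x] cx(1) by blast
      qed
    qed
    moreover have "U \<inter> \<Union>Ch \<subseteq> {1\<^sub>V}" using sub by blast
    ultimately show "\<Union>Ch \<in> ?F" by simp
  qed
  then obtain C where M: "C \<in> ?F" "\<forall>X\<in>?F. C \<subseteq> X \<longrightarrow> X = C" by (rule bexE)
  from M(1) have C: "subsp C" "U \<inter> C \<subseteq> {1\<^sub>V}" by simp_all
  have max: "X = C" if "subsp X" "U \<inter> X \<subseteq> {1\<^sub>V}" "C \<subseteq> X" for X
    using M(2)[rule_format, of X] that by simp
  have "\<exists>u\<in>U. \<exists>c\<in>C. v = u *\<^sub>V c" if v: "v <: V" for v
  proof (rule ccontr)
    assume no: "\<not> ?thesis"
    let ?D = "{c *\<^sub>V lact V k v | c k. c \<in> C \<and> k \<in> carrier K}"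
    have "subsp ?D" unfolding subsp_def
    proof (intro conjI ballI)
      show "?D \<subseteq> carrier V" using subspD(1)[OF C(1)] v by auto
      have "1\<^sub>V = 1\<^sub>V *\<^sub>V lact V \<zero> v" using v by simp
      then show "1\<^sub>V \<in> ?D" using subspD(2)[OF C(1)] K.zero_closed by blast
      fix x assume "x \<in> ?D"
      then obtain c k where x: "x = c *\<^sub>V lact V k v" "c \<in> C" "k <: K" by blast
      have cV: "c <: V" using x subspD(1)[OF C(1)] by blast
      { fix y assume "y \<in> ?D"
        then obtain c' k' where y: "y = c' *\<^sub>V lact V k' v" "c' \<in> C" "k' <: K" by blast
        have cV': "c' <: V" using y subspD(1)[OF C(1)] by blast
        have "x *\<^sub>V y = (c *\<^sub>V c') *\<^sub>V lact V (k \<oplus> k') v"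
          using x y cV cV' v by (simp add: l_add V.m_ac)
        then show "x *\<^sub>V y \<in> ?D" using subspD(3)[OF C(1) x(2) y(2)] x(3) y(3) K.a_closed by blast }
      fix a assume a: "a <: K"
      have "lact V a x = lact V a c *\<^sub>V lact V (a \<otimes> k) v"
        using x cV v a by (simp add: l_dist l_assoc)
      then show "lact V a x \<in> ?D" using subspD(4)[OF C(1) a x(2)] x(3) a K.m_closed by blast
    qed
    moreover have "U \<inter> ?D \<subseteq> {1\<^sub>V}"
    proof
      fix u assume "u \<in> U \<inter> ?D"
      then obtain c k where u: "u \<in> U" "u = c *\<^sub>V lact V k v" "c \<in> C" "k <: K" by blast
      have cV: "c <: V" "u <: V" using u subspD(1)[OF C(1)] subspD(1)[OF U] by blast+
      show "u \<in> {1\<^sub>V}"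
      proof (cases "k = \<zero>")
        case True then show ?thesis using u cV v C(2) by auto
      next
        case False
        \<comment> \<open>A nonzero coefficient \<open>k\<close> can be inverted, which would
          express \<open>v\<close> as an element of \<open>U\<close> plus an element of
          \<open>C\<close>.\<close>
        then have ku: "k \<in> Units K" using u(4) K.field_Units by blast
        let ?i = "inv\<^bsub>K\<^esub> k"
        have i: "?i <: K" "?i \<otimes> k = \<one>" using ku K.Units_inv_closed K.Units_l_inv by auto
        have "lact V k v = u *\<^sub>V inv\<^bsub>V\<^esub> c" using V.inv_solve_left[of "lact V k v" c u] u(2,4) cV v by (simp add: V.m_comm)
        then have "lact V ?i (lact V k v) = lact V ?i u *\<^sub>V lact V ?i (inv\<^bsub>V\<^esub> c)"
          using i cV by (simp add: l_dist)
        then have "v = lact V ?i u *\<^sub>V lact V ?i (inv\<^bsub>V\<^esub> c)"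
          using i v u(4) by (simp add: l_assoc[symmetric])
        moreover have "lact V ?i u \<in> U" "lact V ?i (inv\<^bsub>V\<^esub> c) \<in> C"
          using subspD(4)[OF U i(1) u(1)] subspD(4)[OF C(1) i(1)] subspD(5)[OF C(1) u(3)] by auto
        ultimately show ?thesis using no by blast
      qed
    qed
    moreover have "C \<subseteq> ?D"
    proof
      fix c assume c: "c \<in> C"
      then have "c = c *\<^sub>V lact V \<zero> v" using v subspD(1)[OF C(1)] by simp
      then show "c \<in> ?D" using c K.zero_closed by blast
    qed
    ultimately have "?D = C" by (rule max)
    moreover have "v = 1\<^sub>V *\<^sub>V lact V \<one> v" using v by simp
    then have "v \<in> ?D" using subspD(2)[OF C(1)] K.one_closed by blast
    ultimately have "v \<in> C" by simp
    moreover have "v = 1\<^sub>V *\<^sub>V v" using v by simp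
    ultimately show False using no subspD(2)[OF U] by blast
  qed
  then show ?thesis using C subspD(2)[OF U] subspD(2)[OF C(1)] by blast
qed

end

text \<open>With a complement \<open>C\<close> of the kernel of \<open>p\<close> and a complement
  \<open>D\<close> of its image, \<open>\<sigma> w\<close> is the unique element of \<open>C\<close>
  whose image differs from \<open>w\<close> by an element of \<open>D\<close>. This supplies the
  linear choices of cocycles, primitives and lifts made later.\<close>

lemma ex_generalized_inverse:
  fixes V :: "('k, 'v, 'r, 'z) bimod_scheme" and W :: "('k, 'w, 's, 'y) bimod_scheme"
  assumes "field K" "left_module K V" "left_module K W" and p: "p \<in> hom V W"
    and pl: "!!c v. [|c <: K; v <: V|] ==> p (lact V c v) = lact W c (p v)"
  shows "\<exists>\<sigma>. \<sigma> \<in> hom W V \<and> (\<forall>c\<in>carrier K. \<forall>w\<in>carrier W. \<sigma> (lact W c w) = lact V c (\<sigma> w)) \<and>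
    (\<forall>v\<in>carrier V. p (\<sigma> (p v)) = p v)"
proof -
  interpret V: vector_sp K V using assms by (simp add: vector_sp_def vector_sp_axioms_def)
  interpret W: vector_sp K W using assms by (simp add: vector_sp_def vector_sp_axioms_def)
  note pc = hom_closed[OF p] note pm = hom_mult[OF p]
  have p1: "p 1\<^sub>V = 1\<^sub>W" using hom_one[OF p] V.V.is_group W.V.is_group by blast
  have pinv: "v <: V ==> p (inv\<^bsub>V\<^esub> v) = inv\<^bsub>W\<^esub> (p v)" for v
    using hom_inv[OF p V.V.is_group W.V.is_group] .
  have "V.subsp {v \<in> carrier V. p v = 1\<^sub>W}"
    unfolding V.subsp_def using p1 pm pl by auto
  then obtain C where C: "V.subsp C" "{v \<in> carrier V. p v = 1\<^sub>W} \<inter> C = {1\<^sub>V}"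
     "!!v. v <: V ==> \<exists>u\<in>{v \<in> carrier V. p v = 1\<^sub>W}. \<exists>c\<in>C. v = u *\<^sub>V c"
    using V.ex_complement by meson
  have "W.subsp (p ` carrier V)" unfolding W.subsp_def
  proof (intro conjI ballI)
    show "p ` carrier V \<subseteq> carrier W" using pc by blast
    show "1\<^sub>W \<in> p ` carrier V" using p1 V.V.one_closed by force
    show "x *\<^sub>W y \<in> p ` carrier V" if "x \<in> p ` carrier V" "y \<in> p ` carrier V" for x y
      using that pm V.V.m_closed by (metis (no_types, lifting) imageE imageI)
    show "lact W c x \<in> p ` carrier V" if "c <: K" "x \<in> p ` carrier V" for c x
      using that pl V.l_closed by (metis (no_types, lifting) imageE imageI)
  qed
  then obtain D where D: "W.subsp D" "p ` carrier V \<inter> D = {1\<^sub>W}"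
     "!!w. w <: W ==> \<exists>u\<in>p ` carrier V. \<exists>d\<in>D. w = u *\<^sub>W d"
    using W.ex_complement by meson
  note Cc = V.subspD(1)[OF C(1)] note Dc = W.subspD(1)[OF D(1)]
  let ?R = "%w c. c \<in> C \<and> (\<exists>d\<in>D. w = p c *\<^sub>W d)"
  have ex: "\<exists>c. ?R w c" if w: "w <: W" for w
  proof -
    obtain v d where v: "v <: V" "d \<in> D" "w = p v *\<^sub>W d" using D(3)[OF w] by blast
    obtain u c where u: "u <: V" "p u = 1\<^sub>W" "c \<in> C" "v = u *\<^sub>V c" using C(3)[OF v(1)] by blast
    have "p v = p c" using u Cc pm pc by simp
    then show ?thesis using v(2,3) u(3) by metis
  qed
  \<comment> \<open>The images of two candidates differ by an element of \<open>D\<close>, which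
    also lies in the image of \<open>p\<close> and so is trivial. The difference of the candidates
    is then both in the kernel and in \<open>C\<close>.\<close>
  have uniq: "c = c'" if R: "?R w c" "?R w c'" for w c c'
  proof -
    obtain d d' where d: "d \<in> D" "d' \<in> D" "p c *\<^sub>W d = p c' *\<^sub>W d'" using R by metis
    have cc: "c <: V" "c' <: V" "d <: W" "d' <: W" using R Cc d Dc by auto
    then have pcc: "p c <: W" "p c' <: W" using pc by auto
    have "p (c *\<^sub>V inv\<^bsub>V\<^esub> c') = p c *\<^sub>W inv\<^bsub>W\<^esub> (p c')" using cc pm pinv by simp
    also have "p c = (p c' *\<^sub>W d') *\<^sub>W inv\<^bsub>W\<^esub> d"
      using d(3) pcc cc W.V.inv_solve_right[of "p c" "p c' *\<^sub>W d'" d] by simp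
    also have "(p c' *\<^sub>W d') *\<^sub>W inv\<^bsub>W\<^esub> d *\<^sub>W inv\<^bsub>W\<^esub> (p c')
        = (p c' *\<^sub>W inv\<^bsub>W\<^esub> (p c')) *\<^sub>W (d' *\<^sub>W inv\<^bsub>W\<^esub> d)"
      using pcc cc by (simp only: W.V.m_ac W.V.inv_closed W.V.m_closed)
    also have "\<dots> = d' *\<^sub>W inv\<^bsub>W\<^esub> d" using pcc cc by simp
    finally have e: "p (c *\<^sub>V inv\<^bsub>V\<^esub> c') = d' *\<^sub>W inv\<^bsub>W\<^esub> d" .
    have "d' *\<^sub>W inv\<^bsub>W\<^esub> d \<in> D" using W.subspD(3)[OF D(1) d(2) W.subspD(5)[OF D(1) d(1)]] .
    moreover have "c *\<^sub>V inv\<^bsub>V\<^esub> c' <: V" using cc by simp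
    then have "p (c *\<^sub>V inv\<^bsub>V\<^esub> c') \<in> p ` carrier V" by (rule imageI)
    ultimately have "p (c *\<^sub>V inv\<^bsub>V\<^esub> c') \<in> p ` carrier V \<inter> D" using e by simp
    then have "p (c *\<^sub>V inv\<^bsub>V\<^esub> c') = 1\<^sub>W" unfolding D(2) by simp
    moreover have "c *\<^sub>V inv\<^bsub>V\<^esub> c' \<in> C"
      using V.subspD(3)[OF C(1) conjunct1[OF R(1)] V.subspD(5)[OF C(1) conjunct1[OF R(2)]]] .
    ultimately have "c *\<^sub>V inv\<^bsub>V\<^esub> c' \<in> {v \<in> carrier V. p v = 1\<^sub>W} \<inter> C" using cc by simp
    then have "c *\<^sub>V inv\<^bsub>V\<^esub> c' = 1\<^sub>V" unfolding C(2) by simp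
    then show "c = c'" using cc V.V.inv_solve_right[of "1\<^sub>V" c c'] by simp
  qed
  define \<sigma> where "\<sigma> w = (THE c. ?R w c)" for w
  have \<sigma>: "?R w (\<sigma> w)" if w: "w <: W" for w
  proof -
    obtain c where c: "?R w c" using ex[OF w] by (rule exE)
    show ?thesis unfolding \<sigma>_def by (rule theI[where P="?R w", OF c]) (rule uniq[OF _ c])
  qed
  have eqI: "\<sigma> w = c" if "w <: W" "?R w c" for w c by (rule uniq[OF \<sigma>[OF that(1)] that(2)])
  have "\<sigma> \<in> hom W V"
  proof (rule homI)
    show "\<sigma> w <: V" if "w <: W" for w using \<sigma>[OF that] Cc by blast
    show "\<sigma> (x *\<^sub>W y) = \<sigma> x *\<^sub>V \<sigma> y" if xy: "x <: W" "y <: W" for x y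
    proof (rule eqI)
      obtain d e where d: "d \<in> D" "x = p (\<sigma> x) *\<^sub>W d" "e \<in> D" "y = p (\<sigma> y) *\<^sub>W e" using \<sigma>[OF xy(1)] \<sigma>[OF xy(2)] by blast
      have c: "\<sigma> x \<in> C" "\<sigma> y \<in> C" using \<sigma>[OF xy(1)] \<sigma>[OF xy(2)] by auto
      then have c': "p (\<sigma> x) <: W" "p (\<sigma> y) <: W" "\<sigma> x <: V" "\<sigma> y <: V" using Cc pc by auto
      have d': "d <: W" "e <: W" using d Dc by auto
      have "x *\<^sub>W y = (p (\<sigma> x) *\<^sub>W d) *\<^sub>W (p (\<sigma> y) *\<^sub>W e)" using d by simp
      also have "\<dots> = p (\<sigma> x *\<^sub>V \<sigma> y) *\<^sub>W (d *\<^sub>W e)" using c' d' pm by (simp add: W.V.m_ac)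
      finally show "\<sigma> x *\<^sub>V \<sigma> y \<in> C \<and> (\<exists>d\<in>D. x *\<^sub>W y = p (\<sigma> x *\<^sub>V \<sigma> y) *\<^sub>W d)"
        using V.subspD(3)[OF C(1) c] W.subspD(3)[OF D(1) d(1) d(3)] by blast
    qed (use xy in simp)
  qed
  moreover have "\<sigma> (lact W c w) = lact V c (\<sigma> w)" if cw: "c <: K" "w <: W" for c w
  proof (rule eqI)
    obtain d where d: "d \<in> D" "w = p (\<sigma> w) *\<^sub>W d" using \<sigma>[OF cw(2)] by blast
    have c: "\<sigma> w \<in> C" using \<sigma>[OF cw(2)] by auto
    then have c': "p (\<sigma> w) <: W" "\<sigma> w <: V" using Cc pc by auto
    have d': "d <: W" using d Dc by auto
    have "lact W c w = lact W c (p (\<sigma> w) *\<^sub>W d)" using d by simp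
    also have "\<dots> = p (lact V c (\<sigma> w)) *\<^sub>W lact W c d" using c' d' cw pl by (simp add: W.l_dist)
    finally show "lact V c (\<sigma> w) \<in> C \<and> (\<exists>d\<in>D. lact W c w = p (lact V c (\<sigma> w)) *\<^sub>W d)"
      using V.subspD(4)[OF C(1) cw(1) c] W.subspD(4)[OF D(1) cw(1) d(1)] by blast
  qed (use cw in simp)
  moreover have "p (\<sigma> (p v)) = p v" if v: "v <: V" for v
  proof -
    obtain d where d: "d \<in> D" "p v = p (\<sigma> (p v)) *\<^sub>W d" using \<sigma>[OF pc[OF v]] by blast
    have s: "\<sigma> (p v) <: V" using \<sigma>[OF pc[OF v]] Cc by blast
    have d': "d <: W" using d Dc by auto
    \<comment> \<open>The remainder \<open>d\<close> is a difference of two values of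
      \<open>p\<close>, hence lies in the image as well as in \<open>D\<close>.\<close>
    have "d = inv\<^bsub>W\<^esub> p (\<sigma> (p v)) *\<^sub>W p v"
      using d(2) s d' v pc W.V.inv_solve_left[of d "p (\<sigma> (p v))" "p v"] by simp
    also have "\<dots> = p (inv\<^bsub>V\<^esub> \<sigma> (p v) *\<^sub>V v)" using s v pm pinv by simp
    finally have "d \<in> p ` carrier V" using s v by blast
    then have "d = 1\<^sub>W" using D(2) d(1) by blast
    then show ?thesis using d(2) s pc by simp
  qed
  ultimately show ?thesis by blast
qed

section \<open>Homogeneous components\<close>

lemma hom_finprod:
  assumes "comm_group G" "comm_group H" "h \<in> hom G H" "f \<in> S \<rightarrow> carrier G"
  shows "h (finprod G f S) = finprod H (%i. h (f i)) S"
proof -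
  interpret G: comm_group G by fact
  interpret H: comm_group H by fact
  have h1: "h 1\<^sub>G = 1\<^sub>H" using hom_one[OF assms(3)] G.is_group H.is_group by blast
  have c: "(%i. h (f i)) \<in> T \<rightarrow> carrier H" if "f \<in> T \<rightarrow> carrier G" for T
    using that hom_closed[OF assms(3)] by blast
  show ?thesis using assms(4)
  proof (induction S rule: infinite_finite_induct)
    case (infinite A) then show ?case by (simp add: h1)
  next
    case empty then show ?case by (simp add: h1)
  next
    case (insert x F)
    then have f: "f x <: G" "f \<in> F \<rightarrow> carrier G" by auto
    show ?case using insert f c[OF f(2)] hom_closed[OF assms(3) f(1)]
      by (simp add: hom_mult[OF assms(3)])
  qed
qed

lemma signed_add: "group G ==> x <: G ==> signed G a (signed G b x) = signed G (a + b) x"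
  by (auto simp: signed_def group.inv_inv)

lemma signed_closed: "group G ==> x <: G ==> signed G a x <: G"
  by (auto simp: signed_def)

lemma signed_0 [simp]: "signed G 0 x = x"
  by (simp add: signed_def)

lemma signed_cong_parity: "even (a - b) ==> signed G a x = signed G b x"
  by (auto simp: signed_def)

definition component :: "('k, 'a, 'z) graded_alg_scheme => int => 'a => 'a" where
  "component A n x = (THE c. homogeneous_decomposition A x c) n"

text \<open>Glues homomorphisms given on the parts to a homomorphism on the whole algebra. Besides
  \<open>koszul\<close>, this is how maps chosen without regard to degrees are made
  homogeneous.\<close>

definition graded_sum :: "('k, 'a, 'z) graded_alg_scheme => ('h, 'q) monoid_scheme
    => (int => 'a => 'h) => 'a => 'h" where
  "graded_sum A H F x = finprod H (%n. F n (component A n x)) {n. component A n x \<noteq> 0\<^sub>A}"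

lemma koszul_graded_sum:
  "koszul A e x = graded_sum A (add_monoid A) (%n. signed (add_monoid A) (e * n)) x"
  by (simp add: koszul_def graded_sum_def component_def finsum_def Let_def)

context graded_algebra
begin

abbreviation "addA \<equiv> add_monoid A"

lemma comm_group_add: "comm_group addA" and group_add: "group addA"
  using a_comm_group a_group by auto

lemma part_closed: "x \<in> part A n ==> x <: A"
  using part_submodule[THEN submodule.axioms(1), THEN subgroup.subset] by auto

lemma part_subgroup: "subgroup (part A n) addA"
  using part_submodule by (rule submodule.axioms(1))

lemma part_zero [simp]: "0\<^sub>A \<in> part A n"
  using subgroup.one_closed[OF part_subgroup] by simp

lemma part_add: "[|x \<in> part A n; y \<in> part A n|] ==> x +\<^sub>A y \<in> part A n"
  using subgroup.m_closed[OF part_subgroup] by simp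

lemma part_minus: "x \<in> part A n ==> -\<^sub>A x \<in> part A n"
  using subgroup.m_inv_closed[OF part_subgroup] by (simp add: a_inv_def)

lemma part_smult: "[|c <: K; x \<in> part A n|] ==> c \<cdot>\<^sub>A x \<in> part A n"
  using submodule.smult_closed[OF part_submodule] .

lemma decomposition:
  assumes "x <: A"
  shows "homogeneous_decomposition A x (%n. component A n x)"
  using theI'[OF ex1_decomposition[OF assms]] by (simp add: component_def)

lemma component_part: "x <: A ==> component A n x \<in> part A n"
  and finite_support: "x <: A ==> finite {n. component A n x \<noteq> 0\<^sub>A}"
  and component_sum: "x <: A ==> x = finsum A (%n. component A n x) {n. component A n x \<noteq> 0\<^sub>A}"
  using decomposition by (auto simp: homogeneous_decomposition_def)

lemma component_closed: "x <: A ==> component A n x <: A"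
  using component_part part_closed by blast

text \<open>Here \<open>S\<close> may contain degrees in which \<open>c\<close> vanishes, whereas a
  decomposition is summed exactly over its support.\<close>

lemma component_unique:
  assumes S: "finite S" and c: "!!n. n \<in> S ==> c n \<in> part A n" and x: "x = finsum A c S"
  shows "component A n x = (if n \<in> S then c n else 0\<^sub>A)"
proof -
  let ?c = "%n. if n \<in> S then c n else 0\<^sub>A"
  have cS: "c \<in> S \<rightarrow> carrier A" using c part_closed by blast
  then have xc: "x <: A" unfolding x by (rule finsum_closed)
  have "finsum A ?c {n. ?c n \<noteq> 0\<^sub>A} = finsum A c S"
    by (rule add.finprod_mono_neutral_cong_left) (use S cS in auto)
  then have "homogeneous_decomposition A x ?c"
    unfolding homogeneous_decomposition_def using S c x by (auto intro: finite_subset[of _ S])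
  then have "?c = (%n. component A n x)"
    using ex1_decomposition[OF xc] decomposition[OF xc] by blast
  then show ?thesis by metis
qed

lemma component_sum_superset:
  assumes "x <: A" "finite S" "{n. component A n x \<noteq> 0\<^sub>A} \<subseteq> S"
  shows "x = finsum A (%n. component A n x) S"
proof -
  have "finsum A (%n. component A n x) {n. component A n x \<noteq> 0\<^sub>A} = finsum A (%n. component A n x) S"
    by (rule add.finprod_mono_neutral_cong_left) (use assms component_closed in auto)
  then show ?thesis using component_sum[OF assms(1)] by simp
qed

lemma component_of_part:
  assumes "x \<in> part A n"
  shows "component A m x = (if m = n then x else 0\<^sub>A)"
  using component_unique[of "{n}" "%_. x" x m] assms part_closed[OF assms] by simp

lemma component_add:
  assumes "x <: A" "y <: A"
  shows "component A n (x +\<^sub>A y) = component A n x +\<^sub>A component A n y"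
proof -
  \<comment> \<open>Inserting \<open>n\<close> ensures that \<open>component_unique\<close> is
    evaluated inside the index set.\<close>
  let ?S = "insert n ({n. component A n x \<noteq> 0\<^sub>A} \<union> {n. component A n y \<noteq> 0\<^sub>A})"
  have fin: "finite ?S" using finite_support assms by blast
  have sx: "finsum A (%n. component A n x) ?S = x" by (rule component_sum_superset[symmetric]) (use assms fin in auto)
  have sy: "finsum A (%n. component A n y) ?S = y" by (rule component_sum_superset[symmetric]) (use assms fin in auto)
  have "finsum A (%n. component A n x +\<^sub>A component A n y) ?S = x +\<^sub>A y"
    using finsum_addf[of "%n. component A n x" ?S "%n. component A n y"] assms component_closed sx sy by auto
  then show ?thesis
    using component_unique[OF fin, of "%n. component A n x +\<^sub>A component A n y" "x +\<^sub>A y" n]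
      part_add component_part assms by simp
qed

lemma component_hom: "component A n \<in> hom addA addA"
  by (rule homI) (simp_all add: component_closed component_add)

lemma graded_induct [consumes 1, case_names zero add part]:
  assumes x: "x <: A" and 0: "Q 0\<^sub>A"
    and add: "!!x y. [|x <: A; y <: A; Q x; Q y|] ==> Q (x +\<^sub>A y)"
    and part: "!!n x. x \<in> part A n ==> Q x"
  shows "Q x"
proof -
  have "Q (finsum A (%n. component A n x) S)" if "finite S" for S
    using that
  proof (induction S)
    case empty then show ?case using 0 by simp
  next
    case (insert n F)
    have c: "(%n. component A n x) \<in> F \<rightarrow> carrier A" using component_closed[OF x] by blast
    have "Q (component A n x +\<^sub>A finsum A (%n. component A n x) F)"
      by (rule add) (use insert component_closed[OF x] component_part[OF x] part c in \<open>auto simp: finsum_closed\<close>)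
    then show ?case using insert c component_closed[OF x] by (simp add: finsum_insert)
  qed
  then show ?thesis using component_sum[OF x] finite_support[OF x] by metis
qed

lemma graded_hom_eqI:
  assumes "h \<in> hom addA H" "h' \<in> hom addA H" "group H"
    "!!n x. x \<in> part A n ==> h x = h' x" "x <: A"
  shows "h x = h' x"
  using assms(5)
proof (induction rule: graded_induct)
  case zero show ?case using hom_one[OF assms(1) group_add assms(3)] hom_one[OF assms(2) group_add assms(3)] by simp
next
  case (add x y) then show ?case using hom_mult[OF assms(1), of x y] hom_mult[OF assms(2), of x y] by simp
next
  case (part n x) then show ?case by (rule assms(4))
qed

context
  fixes H :: "('h, 'q) monoid_scheme" and F :: "int => 'a => 'h"
  assumes H: "comm_group H" and F: "!!n. F n \<in> hom (addA\<lparr>carrier := part A n\<rparr>) H"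
begin

interpretation H: comm_group H by (rule H)

lemma F_closed: "x \<in> part A n ==> F n x <: H"
  using hom_closed[OF F[of n], of x] by simp

lemma F_add: "[|x \<in> part A n; y \<in> part A n|] ==> F n (x +\<^sub>A y) = F n x *\<^sub>H F n y"
  using hom_mult[OF F[of n], of x y] by simp

lemma F_zero: "F n 0\<^sub>A = 1\<^sub>H"
  using F_add[of "0\<^sub>A" n "0\<^sub>A"] F_closed[of "0\<^sub>A" n] by (simp add: H.l_cancel_one)

lemma graded_sum_superset:
  assumes "x <: A" "finite S" "{n. component A n x \<noteq> 0\<^sub>A} \<subseteq> S"
  shows "graded_sum A H F x = finprod H (%n. F n (component A n x)) S"
  unfolding graded_sum_def
  by (rule H.finprod_mono_neutral_cong_left) (use assms F_zero F_closed component_part in auto)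

lemma graded_sum_closed: "x <: A ==> graded_sum A H F x <: H"
  unfolding graded_sum_def using F_closed component_part by (intro H.finprod_closed) blast

lemma graded_sum_hom: "graded_sum A H F \<in> hom addA H"
proof (rule homI)
  show "graded_sum A H F x <: H" if "x <: addA" for x
    using that graded_sum_closed by simp
  fix x y assume "x <: addA" "y <: addA"
  then have xy: "x <: A" "y <: A" by auto
  let ?S = "{n. component A n x \<noteq> 0\<^sub>A} \<union> {n. component A n y \<noteq> 0\<^sub>A}"
  have fin: "finite ?S" using finite_support xy by blast
  have sub: "{n. component A n (x +\<^sub>A y) \<noteq> 0\<^sub>A} \<subseteq> ?S" using component_add[OF xy] by auto
  have cl: "(%n. F n (component A n x)) \<in> ?S \<rightarrow> carrier H" "(%n. F n (component A n y)) \<in> ?S \<rightarrow> carrier H"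
    using F_closed component_part xy by blast+
  have "graded_sum A H F (x +\<^sub>A y) = finprod H (%n. F n (component A n (x +\<^sub>A y))) ?S"
    using graded_sum_superset[OF _ fin sub] xy by simp
  also have "\<dots> = finprod H (%n. F n (component A n x) *\<^sub>H F n (component A n y)) ?S"
    using component_add[OF xy] F_add component_part xy by simp
  also have "\<dots> = finprod H (%n. F n (component A n x)) ?S *\<^sub>H finprod H (%n. F n (component A n y)) ?S"
    by (rule H.finprod_multf[OF cl])
  also have "\<dots> = graded_sum A H F x *\<^sub>H graded_sum A H F y"
    using graded_sum_superset[OF xy(1) fin] graded_sum_superset[OF xy(2) fin] by simp
  finally show "graded_sum A H F (x *\<^sub>addA y) = graded_sum A H F x *\<^sub>H graded_sum A H F y" by simp
qed

lemma graded_sum_part: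
  assumes "x \<in> part A n" shows "graded_sum A H F x = F n x"
proof -
  have "{m. component A m x \<noteq> 0\<^sub>A} \<subseteq> {n}" using assms by (auto simp: component_of_part)
  then show ?thesis
    using graded_sum_superset[of x "{n}"] part_closed[of x n] F_closed[of x n] assms
    by (simp add: component_of_part)
qed

end

lemma hom_part: "h \<in> hom addA H ==> h \<in> hom (addA\<lparr>carrier := part A n\<rparr>) H"
  using part_closed by (auto simp: hom_def)

lemma component_smult:
  assumes "c <: K" "x <: A"
  shows "component A n (c \<cdot>\<^sub>A x) = c \<cdot>\<^sub>A component A n x"
proof (rule graded_hom_eqI[OF _ _ group_add _ assms(2)])
  have s: "(%x. c \<cdot>\<^sub>A x) \<in> hom addA addA" using assms by (auto simp: hom_def smult_r_distr)
  show "(%x. component A n (c \<cdot>\<^sub>A x)) \<in> hom addA addA" using hom_comp[OF s component_hom] .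
  show "(%x. c \<cdot>\<^sub>A component A n x) \<in> hom addA addA" using hom_comp[OF component_hom s] .
  show "component A n (c \<cdot>\<^sub>A x) = c \<cdot>\<^sub>A component A n x" if "x \<in> part A m" for m x
    using component_of_part[OF that] component_of_part[OF part_smult[OF assms(1) that]] assms
    by (simp add: smult_r_null)
qed

lemma signed_hom: "signed addA e \<in> hom addA addA"
  using hom_signed_fun[OF comm_group_add, of "%x. x" addA e] by (simp add: hom_def)

lemma signed_part: "x \<in> part A n ==> signed addA e x \<in> part A n"
  using subgroup.m_inv_closed[OF part_subgroup] by (simp add: signed_def)

lemma koszul_hom: "koszul A e \<in> hom addA addA"
  unfolding koszul_graded_sum[abs_def] by (rule graded_sum_hom[OF comm_group_add hom_part[OF signed_hom]])

lemma koszul_of_part: "x \<in> part A n ==> koszul A e x = signed addA (e * n) x"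
  unfolding koszul_graded_sum by (rule graded_sum_part[OF comm_group_add hom_part[OF signed_hom]])

lemma koszul_closed [simp]: "x <: A ==> koszul A e x <: A"
  using hom_closed[OF koszul_hom] by simp

lemma koszul_part: "x \<in> part A n ==> koszul A e x \<in> part A n"
  using koszul_of_part signed_part by simp

lemma koszul_add: "[|x <: A; y <: A|] ==> koszul A e (x +\<^sub>A y) = koszul A e x +\<^sub>A koszul A e y"
  using hom_mult[OF koszul_hom, of x y] by simp

lemma koszul_minus: "x <: A ==> koszul A e (-\<^sub>A x) = -\<^sub>A koszul A e x"
  using hom_inv[OF koszul_hom group_add group_add, of x] by (simp add: a_inv_def)

lemma koszul_one: "koszul A e 1\<^sub>A = 1\<^sub>A"
  using koszul_of_part[OF one_part] by simp

lemma koszul_0: "x <: A ==> koszul A 0 x = x"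
  by (rule graded_hom_eqI[OF koszul_hom _ group_add, where h'="%x. x"]) (auto simp: koszul_of_part hom_def)

lemma koszul_koszul: "x <: A ==> koszul A a (koszul A b x) = koszul A (a + b) x"
  by (rule graded_hom_eqI[OF hom_comp[OF koszul_hom koszul_hom] koszul_hom group_add])
     (simp_all add: koszul_of_part koszul_of_part[OF signed_part] part_closed signed_add[OF group_add] distrib_right)

lemma koszul_parity: "[|even (a - b); x <: A|] ==> koszul A a x = koszul A b x"
  by (rule graded_hom_eqI[OF koszul_hom koszul_hom group_add])
     (auto simp: koszul_of_part intro!: signed_cong_parity)

lemma koszul_smult:
  assumes "c <: K" "x <: A"
  shows "koszul A e (c \<cdot>\<^sub>A x) = c \<cdot>\<^sub>A koszul A e x"
proof (rule graded_hom_eqI[OF _ _ group_add _ assms(2)])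
  have s: "(%x. c \<cdot>\<^sub>A x) \<in> hom addA addA" using assms by (auto simp: hom_def smult_r_distr)
  show "(%x. koszul A e (c \<cdot>\<^sub>A x)) \<in> hom addA addA" using hom_comp[OF s koszul_hom] .
  show "(%x. c \<cdot>\<^sub>A koszul A e x) \<in> hom addA addA" using hom_comp[OF koszul_hom s] .
  show "koszul A e (c \<cdot>\<^sub>A x) = c \<cdot>\<^sub>A koszul A e x" if "x \<in> part A m" for m x
    using that part_smult assms hom_signed[OF s group_add group_add] part_closed[OF that]
    by (simp add: koszul_of_part)
qed

lemma mult_hom:
  "y <: A ==> (%x. x *\<^sub>A y) \<in> hom addA addA"
  "x <: A ==> (%y. x *\<^sub>A y) \<in> hom addA addA"
  by (auto simp: hom_def l_distr r_distr)

lemma signed_mult: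
  assumes "x <: A" "y <: A"
  shows "signed addA a x *\<^sub>A signed addA b y = signed addA (a + b) (x *\<^sub>A y)"
  using assms unfolding signed_def a_inv_def[symmetric]
  by (auto simp: l_minus r_minus)

lemma koszul_mult:
  assumes "x <: A" "y <: A"
  shows "koszul A e (x *\<^sub>A y) = koszul A e x *\<^sub>A koszul A e y"
proof (rule graded_hom_eqI[OF _ _ group_add _ assms(1)])
  show "(%x. koszul A e (x *\<^sub>A y)) \<in> hom addA addA" using hom_comp[OF mult_hom(1) koszul_hom] assms by blast
  show "(%x. koszul A e x *\<^sub>A koszul A e y) \<in> hom addA addA"
    using hom_comp[OF koszul_hom mult_hom(1)] assms koszul_closed by blast
  fix n x assume x: "x \<in> part A n"
  then have xc: "x <: A" using part_closed by blast
  show "koszul A e (x *\<^sub>A y) = koszul A e x *\<^sub>A koszul A e y"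
  proof (rule graded_hom_eqI[OF _ _ group_add _ assms(2)])
    show "(%y. koszul A e (x *\<^sub>A y)) \<in> hom addA addA" using hom_comp[OF mult_hom(2) koszul_hom] xc by blast
    show "(%y. koszul A e x *\<^sub>A koszul A e y) \<in> hom addA addA"
      using hom_comp[OF koszul_hom mult_hom(2)] xc koszul_closed by blast
    show "koszul A e (x *\<^sub>A y) = koszul A e x *\<^sub>A koszul A e y" if "y \<in> part A m" for m y
      using x that mult_part[OF x that] xc part_closed[OF that]
      by (simp add: koszul_of_part signed_mult distrib_left)
  qed
qed

lemma smult_one_mult: "[|c <: K; x <: A|] ==> (c \<cdot>\<^sub>A 1\<^sub>A) *\<^sub>A x = c \<cdot>\<^sub>A x"
  and mult_smult_one: "[|c <: K; x <: A|] ==> x *\<^sub>A (c \<cdot>\<^sub>A 1\<^sub>A) = c \<cdot>\<^sub>A x"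
  by (simp_all add: smult_mult_left smult_mult_right)

end

text \<open>The projections provide a decomposition. Applying \<open>\<pi> m\<close> to any other
  decomposition recovers its term of degree \<open>m\<close>, which gives uniqueness.\<close>

lemma graded_algebraI:
  fixes A :: "('k, 'a, 'z) graded_alg_scheme"
  assumes "field_algebra K A" "!!n. submodule (part A n) K A" "1\<^sub>A \<in> part A 0"
    "!!x y m n. [|x \<in> part A m; y \<in> part A n|] ==> x *\<^sub>A y \<in> part A (m + n)"
    and \<pi>: "!!n. \<pi> n \<in> hom (add_monoid A) (add_monoid A)" "!!n x. x <: A ==> \<pi> n x \<in> part A n"
      "!!m n x. x \<in> part A n ==> \<pi> m x = (if m = n then x else 0\<^sub>A)"
      "!!x. x <: A ==> finite {n. \<pi> n x \<noteq> 0\<^sub>A}"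
      "!!x. x <: A ==> x = finsum A (%n. \<pi> n x) {n. \<pi> n x \<noteq> 0\<^sub>A}"
  shows "graded_algebra K A"
proof -
  interpret field_algebra K A by fact
  have "\<exists>!c. homogeneous_decomposition A x c" if x: "x <: A" for x
  proof (rule ex1I)
    show "homogeneous_decomposition A x (%n. \<pi> n x)"
      unfolding homogeneous_decomposition_def using \<pi> x by simp
    fix c assume c: "homogeneous_decomposition A x c"
    have pc: "c n <: A" for n
      using assms(2)[of n, THEN submodule.axioms(1), THEN subgroup.subset] c
      by (auto simp: homogeneous_decomposition_def)
    let ?S = "{n. c n \<noteq> 0\<^sub>A}"
    have c': "c n \<in> part A n" "finite ?S" "x = finsum A c ?S" for n using c by (auto simp: homogeneous_decomposition_def)
    show "c = (%n. \<pi> n x)"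
    proof
      fix m
      have "\<pi> m x = finprod (add_monoid A) (%n. \<pi> m (c n)) ?S"
        unfolding c'(3) finsum_def
        by (rule hom_finprod[OF a_comm_group a_comm_group \<pi>(1)]) (use pc in auto)
      also have "\<dots> = finsum A (%n. if m = n then c n else 0\<^sub>A) ?S"
        unfolding finsum_def using \<pi>(3)[OF c'(1)] by simp
      also have "\<dots> = c m"
      proof (cases "m \<in> ?S")
        case True then show ?thesis using add.finprod_singleton[OF True c'(2), of c] pc by auto
      next
        case False
        then have "finsum A (%n. if m = n then c n else 0\<^sub>A) ?S = 0\<^sub>A"
          by (intro add.finprod_one_eqI) auto
        then show ?thesis using False by simp
      qed
      finally show "c m = \<pi> m x" ..
    qed
  qed
  then show ?thesis using assms by (intro graded_algebra.intro graded_algebra_axioms.intro) auto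
qed

lemma coset_eq_iff:
  assumes "group G" "subgroup H G" "x <: G" "y <: G"
  shows "H #>\<^bsub>G\<^esub> x = H #>\<^bsub>G\<^esub> y \<longleftrightarrow> x *\<^sub>G inv\<^bsub>G\<^esub> y \<in> H"
proof
  assume "H #>\<^bsub>G\<^esub> x = H #>\<^bsub>G\<^esub> y"
  then have "x \<in> H #>\<^bsub>G\<^esub> y" using group.rcos_self[OF assms(1,3,2)] by simp
  then show "x *\<^sub>G inv\<^bsub>G\<^esub> y \<in> H" using subgroup.rcos_module_imp[OF assms(2,1,4)] by simp
next
  assume "x *\<^sub>G inv\<^bsub>G\<^esub> y \<in> H"
  then have "x \<in> H #>\<^bsub>G\<^esub> y" using subgroup.rcos_module_rev[OF assms(2,1,4,3)] by simp
  then show "H #>\<^bsub>G\<^esub> x = H #>\<^bsub>G\<^esub> y" using group.repr_independence[OF assms(1) _ assms(4,2)] by simp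
qed

lemma mem_coset:
  assumes "group G" "subgroup H G" "x <: G" "z \<in> H #>\<^bsub>G\<^esub> x"
  shows "z <: G" "H #>\<^bsub>G\<^esub> z = H #>\<^bsub>G\<^esub> x"
proof -
  show "z <: G" using monoid.r_coset_subset_G[OF group.is_monoid[OF assms(1)] subgroup.subset[OF assms(2)] assms(3)] assms(4) by blast
  show "H #>\<^bsub>G\<^esub> z = H #>\<^bsub>G\<^esub> x" using group.repr_independence[OF assms(1,4,3,2)] by simp
qed

section \<open>The cohomology algebra\<close>

context dg_algebra
begin

abbreviation "d \<equiv> differential A"
abbreviation "Z \<equiv> dg_cocycles A"
abbreviation "HA \<equiv> cohomology A"
abbreviation "cl \<equiv> dg_class A"

lemma d_part: "x \<in> part A n ==> d x \<in> part A (n + 1)"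
  by (rule differential_part)

lemma d_add: "[|x <: A; y <: A|] ==> d (x +\<^sub>A y) = d x +\<^sub>A d y"
  by (rule differential_add)

text \<open>The axioms locate the differential of homogeneous elements only; additivity carries this
  over to sums.\<close>

lemma d_closed [simp]: "x <: A ==> d x <: A"
proof (induction rule: graded_induct)
  case zero then show ?case using part_closed[OF d_part[OF part_zero]] .
next
  case (add x y) then show ?case by (simp add: d_add)
next
  case (part n x) then show ?case using part_closed[OF d_part[of x n]] by simp
qed

lemma d_hom: "d \<in> hom addA addA"
  by (rule homI) (simp_all add: d_add)

lemma d_zero [simp]: "d 0\<^sub>A = 0\<^sub>A"
  using hom_one[OF d_hom group_add group_add] by simp

lemma d_minus: "x <: A ==> d (-\<^sub>A x) = -\<^sub>A d x"
  using hom_inv[OF d_hom group_add group_add, of x] by (simp add: a_inv_def)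

lemma d_d [simp]: "x <: A ==> d (d x) = 0\<^sub>A"
  by (rule differential_square)

lemma d_component: "x <: A ==> component A (n + 1) (d x) = d (component A n x)"
proof (rule graded_hom_eqI[OF hom_comp[OF d_hom component_hom] hom_comp[OF component_hom d_hom] group_add])
  fix m x assume x: "x \<in> part A m"
  show "component A (n + 1) (d x) = d (component A n x)"
    using component_of_part[OF x] component_of_part[OF d_part[OF x]] by simp
qed

lemma minus_hom: "(%x. -\<^sub>A x) \<in> hom addA addA"
  by (rule homI) (simp_all add: minus_add)

text \<open>The differential raises the degree by one, which reverses the sign (-1)^|x|.\<close>

lemma d_koszul: "x <: A ==> d (koszul A 1 x) = -\<^sub>A koszul A 1 (d x)"
proof (rule graded_hom_eqI[OF hom_comp[OF koszul_hom d_hom] hom_comp[OF hom_comp[OF d_hom koszul_hom] minus_hom] group_add])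
  fix m x assume x: "x \<in> part A m"
  show "d (koszul A 1 x) = -\<^sub>A koszul A 1 (d x)"
    using koszul_of_part[OF x] koszul_of_part[OF d_part[OF x]] part_closed[OF x] d_minus
    by (auto simp: signed_def a_inv_def[symmetric])
qed

lemma koszul_1_1: "x <: A ==> koszul A 1 (koszul A 1 x) = x"
  using koszul_koszul[of x 1 1] koszul_parity[of 2 0 x] koszul_0[of x] by simp

text \<open>With the sign hidden in \<open>koszul\<close> the Leibniz rule holds for arbitrary
  elements, so later computations need no decomposition into homogeneous parts.\<close>

lemma Leibniz_koszul:
  assumes "x <: A" "y <: A"
  shows "d (x *\<^sub>A y) = (d x *\<^sub>A y) +\<^sub>A (koszul A 1 x *\<^sub>A d y)"
proof (rule graded_hom_eqI[OF _ _ group_add _ assms(1)])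
  have dy: "d y <: A" using assms by simp
  show "(%x. d (x *\<^sub>A y)) \<in> hom addA addA" by (rule hom_comp[OF mult_hom(1)[OF assms(2)] d_hom])
  show "(%x. (d x *\<^sub>A y) +\<^sub>A (koszul A 1 x *\<^sub>A d y)) \<in> hom addA addA"
    using hom_prod[OF comm_group_add hom_comp[OF d_hom mult_hom(1)[OF assms(2)]] hom_comp[OF koszul_hom mult_hom(1)[OF dy]]]
    by simp
  fix n x assume x: "x \<in> part A n"
  show "d (x *\<^sub>A y) = (d x *\<^sub>A y) +\<^sub>A (koszul A 1 x *\<^sub>A d y)"
    using Leibniz[OF x assms(2)] koszul_of_part[OF x] part_closed[OF x] dy
      signed_mult[of x "d y" n 0] by simp
qed

lemma ZI: "[|x <: A; d x = 0\<^sub>A|] ==> x \<in> Z"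
  and Z_closed: "x \<in> Z ==> x <: A"
  and Z_d: "x \<in> Z ==> d x = 0\<^sub>A"
  by (auto simp: dg_cocycles_def)

lemma Z_add: "[|x \<in> Z; y \<in> Z|] ==> x +\<^sub>A y \<in> Z"
  and Z_minus: "x \<in> Z ==> -\<^sub>A x \<in> Z"
  and Z_mult: "[|x \<in> Z; y \<in> Z|] ==> x *\<^sub>A y \<in> Z"
  and Z_zero: "0\<^sub>A \<in> Z"
  and Z_koszul: "x \<in> Z ==> koszul A 1 x \<in> Z"
  and Z_smult: "[|c <: K; x \<in> Z|] ==> c \<cdot>\<^sub>A x \<in> Z"
  by (auto simp: dg_cocycles_def d_add d_minus Leibniz_koszul d_koszul differential_smult smult_r_null koszul_add
        hom_one[OF koszul_hom group_add group_add, simplified])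

lemma Z_one: "1\<^sub>A \<in> Z"
proof -
  have "d (1\<^sub>A *\<^sub>A 1\<^sub>A) = d 1\<^sub>A +\<^sub>A d 1\<^sub>A"
    by (subst Leibniz_koszul) (simp_all add: koszul_one)
  then have "d 1\<^sub>A = d 1\<^sub>A +\<^sub>A d 1\<^sub>A" by simp
  then have "d 1\<^sub>A = 0\<^sub>A" using add.l_cancel_one'[of "d 1\<^sub>A" "d 1\<^sub>A"] by simp
  then show ?thesis by (simp add: ZI)
qed

lemma Z_component: "x \<in> Z ==> component A n x \<in> Z"
  using d_component[of x n] component_closed[of x] hom_one[OF component_hom group_add group_add]
  by (auto simp: dg_cocycles_def)

lemma coboundaries_subgroup: "subgroup (dg_coboundaries A) addA"
proof (rule group.subgroupI[OF group_add])
  show "dg_coboundaries A \<subseteq> carrier addA" by (auto simp: dg_coboundaries_def)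
  show "dg_coboundaries A \<noteq> {}" using zero_closed by (auto simp: dg_coboundaries_def)
  show "inv\<^bsub>addA\<^esub> a \<in> dg_coboundaries A" if "a \<in> dg_coboundaries A" for a
  proof -
    obtain b where "b <: A" "a = d b" using \<open>a \<in> dg_coboundaries A\<close> by (auto simp: dg_coboundaries_def)
    then have "-\<^sub>A a = d (-\<^sub>A b)" "-\<^sub>A b <: A" by (auto simp: d_minus)
    then show ?thesis unfolding a_inv_def[symmetric] dg_coboundaries_def by blast
  qed
  show "a *\<^sub>addA b \<in> dg_coboundaries A" if ab: "a \<in> dg_coboundaries A" "b \<in> dg_coboundaries A" for a b
  proof -
    obtain x y where "x <: A" "a = d x" "y <: A" "b = d y" using ab by (auto simp: dg_coboundaries_def)
    then have "a +\<^sub>A b = d (x +\<^sub>A y)" "x +\<^sub>A y <: A" by (auto simp: d_add)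
    then show ?thesis unfolding dg_coboundaries_def by auto
  qed
qed

lemma coboundary_Z: "x <: A ==> d x \<in> Z"
  by (rule ZI) auto

lemma cl_def': "cl x = dg_coboundaries A #>\<^bsub>addA\<^esub> x"
  by (simp add: dg_class_def a_r_coset_def)

lemma cl_eqI:
  assumes "x <: A" "y <: A" "b <: A" "x = y +\<^sub>A d b"
  shows "cl x = cl y"
proof -
  have "x *\<^sub>addA inv\<^bsub>addA\<^esub> y = d b"
    using assms a_comm[of y "d b"] by (simp add: a_inv_def[symmetric] a_assoc r_neg)
  then show ?thesis unfolding cl_def'
    using coset_eq_iff[OF group_add coboundaries_subgroup] assms by (auto simp: dg_coboundaries_def)
qed

lemma cl_eqD:
  assumes "x <: A" "y <: A" "cl x = cl y"
  obtains b where "b <: A" "x = y +\<^sub>A d b"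
proof -
  have "x +\<^sub>A (-\<^sub>A y) \<in> dg_coboundaries A"
    using coset_eq_iff[OF group_add coboundaries_subgroup, of x y] assms by (simp add: cl_def' a_inv_def)
  then obtain b where b: "b <: A" "x +\<^sub>A (-\<^sub>A y) = d b" by (auto simp: dg_coboundaries_def)
  then have "x = y +\<^sub>A d b" unfolding b(2)[symmetric] using assms a_comm[of x "-\<^sub>A y"] by (simp add: a_assoc[symmetric] r_neg)
  then show thesis using that b by blast
qed

lemma mem_cl:
  assumes "x <: A" "z \<in> cl x"
  shows "z <: A" "cl z = cl x"
  using mem_coset[OF group_add coboundaries_subgroup, of x z] assms by (auto simp: cl_def')

lemma cl_self: "x <: A ==> x \<in> cl x"
  using group.rcos_self[OF group_add _ coboundaries_subgroup] by (simp add: cl_def')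

lemma mem_cl_Z: "[|x \<in> Z; z \<in> cl x|] ==> z \<in> Z"
proof -
  assume x: "x \<in> Z" and z: "z \<in> cl x"
  note zc = mem_cl[OF Z_closed[OF x] z]
  obtain b where "b <: A" "z = x +\<^sub>A d b" using cl_eqD[OF zc(1) Z_closed[OF x] zc(2)] by blast
  then show "z \<in> Z" using Z_add[OF x coboundary_Z] by simp
qed

lemma carrier_HA: "carrier HA = cl ` Z"
  by (simp add: cohomology_def)

lemma part_HA: "part HA n = cl ` (part A n \<inter> Z)"
  by (simp add: cohomology_def)

lemma cl_closed [simp]: "x \<in> Z ==> cl x <: HA"
  by (simp add: carrier_HA)

lemma HA_one: "1\<^sub>HA = cl 1\<^sub>A"
  by (simp add: cohomology_def)

lemma HA_zero: "0\<^sub>HA = cl 0\<^sub>A"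
  using group.coset_join2[OF group_add _ coboundaries_subgroup, of "0\<^sub>A"] subgroup.one_closed[OF coboundaries_subgroup]
  by (simp add: cohomology_def cl_def')

lemma HA_add: "[|x <: A; y <: A|] ==> cl x +\<^sub>HA cl y = cl (x +\<^sub>A y)"
  using normal.rcos_sum[OF comm_group.subgroup_imp_normal[OF comm_group_add coboundaries_subgroup], of x y]
  by (simp add: cohomology_def cl_def' set_add_def)

text \<open>\<open>rcoset_mult\<close> is a union over all pairs of representatives, so each pair
  has to yield the same class.\<close>

lemma HA_mult:
  assumes "x \<in> Z" "y \<in> Z"
  shows "cl x *\<^sub>HA cl y = cl (x *\<^sub>A y)"
proof -
  have c: "x <: A" "y <: A" using assms Z_closed by auto
  have "cl (a *\<^sub>A b) = cl (x *\<^sub>A y)" if ab: "a \<in> cl x" "b \<in> cl y" for a b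
  proof -
    note a = mem_cl[OF c(1) ab(1)] and b = mem_cl[OF c(2) ab(2)]
    obtain u where u: "u <: A" "a = x +\<^sub>A d u" using cl_eqD[OF a(1) c(1) a(2)] .
    obtain v where v: "v <: A" "b = y +\<^sub>A d v" using cl_eqD[OF b(1) c(2) b(2)] .
    have bZ: "d b = 0\<^sub>A" using mem_cl_Z[OF assms(2) ab(2)] Z_d by blast
    have 1: "d (u *\<^sub>A b) = d u *\<^sub>A b" using u b bZ by (simp add: Leibniz_koszul)
    \<comment> \<open>Applying the sign operator to \<open>x\<close> beforehand cancels the sign
      that the Leibniz rule introduces.\<close>
    have 2: "d (koszul A 1 x *\<^sub>A v) = x *\<^sub>A d v"
      using Z_d[OF Z_koszul[OF assms(1)]] c v by (simp add: Leibniz_koszul koszul_1_1)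
    have "a *\<^sub>A b = x *\<^sub>A b +\<^sub>A d u *\<^sub>A b" using u c b by (simp add: l_distr)
    also have "x *\<^sub>A b = x *\<^sub>A y +\<^sub>A x *\<^sub>A d v" using v c by (simp add: r_distr)
    finally have "a *\<^sub>A b = x *\<^sub>A y +\<^sub>A d (koszul A 1 x *\<^sub>A v +\<^sub>A u *\<^sub>A b)"
      using c u v b 1 2 by (simp add: d_add add.m_assoc)
    then show ?thesis using c u v a b by (intro cl_eqI[of _ _ "koszul A 1 x *\<^sub>A v +\<^sub>A u *\<^sub>A b"]) auto
  qed
  moreover have "x \<in> cl x" "y \<in> cl y" using cl_self c by auto
  ultimately have "(\<Union>a\<in>cl x. \<Union>b\<in>cl y. cl (a *\<^sub>A b)) = cl (x *\<^sub>A y)" by blast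
  then show ?thesis by (simp add: cohomology_def rcoset_mult_def dg_class_def[symmetric])
qed

lemma HA_smult:
  assumes "c <: K" "x <: A"
  shows "c \<cdot>\<^sub>HA cl x = cl (c \<cdot>\<^sub>A x)"
proof -
  have "cl (c \<cdot>\<^sub>A a) = cl (c \<cdot>\<^sub>A x)" if a: "a \<in> cl x" for a
  proof -
    note a = mem_cl[OF assms(2) a]
    obtain u where u: "u <: A" "a = x +\<^sub>A d u" using cl_eqD[OF a(1) assms(2) a(2)] .
    then have "c \<cdot>\<^sub>A a = c \<cdot>\<^sub>A x +\<^sub>A d (c \<cdot>\<^sub>A u)" using assms by (simp add: smult_r_distr differential_smult)
    then show ?thesis using assms a u by (intro cl_eqI[of _ _ "c \<cdot>\<^sub>A u"]) auto
  qed
  then have "(\<Union>a\<in>cl x. cl (c \<cdot>\<^sub>A a)) = cl (c \<cdot>\<^sub>A x)" using cl_self[OF assms(2)] by blast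
  then show ?thesis by (simp add: cohomology_def)
qed

lemma HA_cases: assumes "X <: HA" obtains x where "x \<in> Z" "X = cl x"
  using assms by (auto simp: carrier_HA)

lemma abelian_group_HA: "abelian_group HA"
proof (rule abelian_groupI)
  show "0\<^sub>HA <: HA" using Z_zero by (simp add: HA_zero)
  show "\<exists>Y\<in>carrier HA. Y +\<^sub>HA X = 0\<^sub>HA" if "X <: HA" for X
  proof -
    obtain x where x: "x \<in> Z" "X = cl x" using HA_cases[OF \<open>X <: HA\<close>] .
    have "cl (-\<^sub>A x) +\<^sub>HA X = 0\<^sub>HA" using x Z_closed by (simp add: HA_add HA_zero l_neg)
    then show ?thesis using x Z_minus cl_closed by blast
  qed
qed (auto elim!: HA_cases simp: HA_add HA_zero Z_closed Z_add Z_zero add.m_ac)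

lemma ring_HA: "ring HA"
proof (rule ringI[OF abelian_group_HA])
  show "monoid HA"
    by (rule monoidI) (auto elim!: HA_cases simp: HA_mult HA_one Z_closed Z_mult Z_one m_assoc)
qed (auto elim!: HA_cases simp: HA_mult HA_add Z_closed Z_mult Z_add l_distr r_distr)

lemma field_algebra_HA: "field_algebra K HA"
proof -
  have f: "field K" by unfold_locales
  then have c: "cring K" by (simp add: field_def domain_def)
  have "module K HA"
    by (rule moduleI[OF c abelian_group_HA])
       (auto elim!: HA_cases simp: HA_smult HA_add Z_closed Z_add Z_smult smult_l_distr smult_r_distr smult_assoc1)
  moreover have "field_algebra_axioms K HA"
    by unfold_locales (auto elim!: HA_cases simp: HA_smult HA_mult Z_closed Z_mult Z_smult smult_mult_left smult_mult_right)
  ultimately show ?thesis using f ring_HA by (simp add: field_algebra_def)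
qed

text \<open>The choice of a representative only serves to define a function on cosets. The resulting
  class does not depend on it, because the differential is homogeneous. These are the projections
  that make cohomology graded.\<close>

definition componentH :: "int => 'a set => 'a set" where
  "componentH n X = cl (component A n (SOME x. x \<in> Z \<and> X = cl x))"

lemma componentH_cl:
  assumes "x \<in> Z" shows "componentH n (cl x) = cl (component A n x)"
proof -
  define y where "y = (SOME y. y \<in> Z \<and> cl x = cl y)"
  have y: "y \<in> Z" "cl x = cl y" unfolding y_def using someI_ex[of "%y. y \<in> Z \<and> cl x = cl y"] assms by auto
  have c: "x <: A" "y <: A" using y assms Z_closed by auto
  obtain b where b: "b <: A" "y = x +\<^sub>A d b" using cl_eqD[OF c(2,1) y(2)[symmetric]] .
  have "component A n y = component A n x +\<^sub>A d (component A (n - 1) b)"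
    using b c d_component[OF b(1), of "n - 1"] by (simp add: component_add)
  then have "cl (component A n y) = cl (component A n x)"
    using c b by (intro cl_eqI[of _ _ "component A (n - 1) b"]) (auto simp: component_closed)
  then show ?thesis by (simp add: componentH_def y_def[symmetric])
qed

lemma graded_algebra_HA: "graded_algebra K HA"
proof (rule graded_algebraI[where \<pi> = componentH, OF field_algebra_HA])
  interpret H: ring HA by (rule ring_HA)
  show "submodule (part HA n) K HA" for n
  proof -
    interpret HM: module K HA using field_algebra_HA by (simp add: field_algebra_def)
    show ?thesis
    proof (rule HM.submoduleI)
      show "part HA n \<subseteq> carrier HA" by (auto simp: part_HA)
      show "0\<^sub>HA \<in> part HA n" using Z_zero by (auto simp: part_HA HA_zero)
      fix X assume "X \<in> part HA n"
      then obtain x where x: "x \<in> part A n" "x \<in> Z" "X = cl x" by (auto simp: part_HA)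
      have "-\<^sub>HA X = cl (-\<^sub>A x)"
        using x Z_closed Z_minus by (intro H.minus_equality) (auto simp: HA_add HA_zero l_neg)
      then show "-\<^sub>HA X \<in> part HA n" using x part_minus Z_minus by (auto simp: part_HA)
      show "c \<cdot>\<^sub>HA X \<in> part HA n" if "c <: K" for c
        using x that part_smult Z_smult Z_closed by (auto simp: part_HA HA_smult)
      fix Y assume "Y \<in> part HA n"
      then obtain y where y: "y \<in> part A n" "y \<in> Z" "Y = cl y" by (auto simp: part_HA)
      show "X +\<^sub>HA Y \<in> part HA n" using x y part_add Z_add Z_closed by (auto simp: part_HA HA_add)
    qed
  qed
  show "1\<^sub>HA \<in> part HA 0" using one_part Z_one by (auto simp: part_HA HA_one)
  show "X *\<^sub>HA Y \<in> part HA (m + n)" if "X \<in> part HA m" "Y \<in> part HA n" for X Y m n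
    using that mult_part Z_mult by (auto simp: part_HA HA_mult)
  show "componentH n \<in> hom (add_monoid HA) (add_monoid HA)" for n
    by (rule homI) (auto elim!: HA_cases simp: componentH_cl HA_add Z_component Z_closed Z_add component_add component_closed)
  show "componentH n X \<in> part HA n" if "X <: HA" for n X
    using that component_part Z_component Z_closed by (auto elim!: HA_cases simp: componentH_cl part_HA)
  show "componentH m X = (if m = n then X else 0\<^sub>HA)" if "X \<in> part HA n" for m n X
    using that by (auto simp: part_HA componentH_cl component_of_part HA_zero)
  fix X assume "X <: HA"
  then obtain x where x: "x \<in> Z" "X = cl x" by (rule HA_cases)
  let ?S = "{n. component A n x \<noteq> 0\<^sub>A}"
  have fin: "finite ?S" using finite_support Z_closed[OF x(1)] by blast
  \<comment> \<open>The inclusion may be strict, since a nonzero component of \<open>x\<close> can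
    be a coboundary.\<close>
  have sub: "{n. componentH n X \<noteq> 0\<^sub>HA} \<subseteq> ?S" using x by (auto simp: componentH_cl HA_zero)
  then show "finite {n. componentH n X \<noteq> 0\<^sub>HA}" using fin by (rule finite_subset)
  have cl_sum: "cl (finsum A (%n. component A n x) S) = finsum HA (%n. componentH n X) S" if "finite S" for S
    using that
  proof (induction S)
    case empty then show ?case by (simp add: HA_zero)
  next
    case (insert n F)
    have c: "component A n x \<in> Z" "component A n x <: A" for n
      using Z_component[OF x(1)] Z_closed by auto
    have s: "finsum A (%n. component A n x) F <: A" using c by (intro finsum_closed) auto
    show ?case using insert c s x
      by (simp add: finsum_insert H.finsum_insert componentH_cl HA_add[symmetric] Pi_def)
  qed
  have "X = finsum HA (%n. componentH n X) ?S"
    using cl_sum[OF fin] component_sum[OF Z_closed[OF x(1)]] x(2) by simp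
  also have "\<dots> = finsum HA (%n. componentH n X) {n. componentH n X \<noteq> 0\<^sub>HA}"
    by (rule H.add.finprod_mono_neutral_cong_right)
       (use fin sub x Z_component in \<open>auto simp: componentH_cl\<close>)
  finally show "X = finsum HA (%n. componentH n X) {n. componentH n X \<noteq> 0\<^sub>HA}" .
qed

sublocale H: graded_algebra K HA by (rule graded_algebra_HA)

lemma componentH_hom: "componentH n \<in> hom (add_monoid HA) (add_monoid HA)"
  by (rule homI) (auto elim!: HA_cases simp: componentH_cl HA_add Z_component Z_closed Z_add component_add component_closed)

lemma component_HA:
  assumes "x \<in> Z" shows "component HA n (cl x) = cl (component A n x)"
proof -
  have "component HA n (cl x) = componentH n (cl x)"
  proof (rule H.graded_hom_eqI[OF H.component_hom componentH_hom H.group_add])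
    show "component HA n X = componentH n X" if "X \<in> part HA m" for m X
      using H.component_of_part[OF that] that by (auto simp: part_HA componentH_cl component_of_part HA_zero)
  qed (use assms in simp)
  then show ?thesis using componentH_cl[OF assms] by simp
qed

lemma HA_minus:
  assumes "x \<in> Z" shows "-\<^sub>HA cl x = cl (-\<^sub>A x)"
proof -
  show ?thesis
    using assms Z_closed Z_minus by (intro H.minus_equality) (auto simp: HA_add HA_zero l_neg)
qed

lemma HA_diff: "[|x \<in> Z; y \<in> Z|] ==> cl x -\<^sub>HA cl y = cl (x -\<^sub>A y)"
  using Z_minus Z_closed by (simp add: a_minus_def HA_minus HA_add)

lemma Z_diff: "[|x \<in> Z; y \<in> Z|] ==> x -\<^sub>A y \<in> Z"
  by (simp add: a_minus_def Z_add Z_minus)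

text \<open>The operator on cohomology is defined through decompositions there. Induction over these
  produces one representative for which the formula holds, and \<open>inv\<close> transfers it to
  the given one.\<close>

lemma koszul_HA:
  assumes "x \<in> Z" shows "koszul HA 1 (cl x) = cl (koszul A 1 x)"
proof -
  have inv: "cl (koszul A 1 y) = cl (koszul A 1 x)" if y: "y \<in> Z" "cl y = cl x" for y
  proof -
    have c: "x <: A" "y <: A" using assms y Z_closed by auto
    obtain b where b: "b <: A" "y = x +\<^sub>A d b" using cl_eqD[OF c(2,1) y(2)] .
    have "koszul A 1 y = koszul A 1 x +\<^sub>A d (-\<^sub>A koszul A 1 b)"
      using b c by (simp add: koszul_add d_minus d_koszul)
    then show ?thesis using b c by (intro cl_eqI[of _ _ "-\<^sub>A koszul A 1 b"]) auto
  qed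
  have "cl x <: HA" using assms by simp
  then have "\<exists>y\<in>Z. cl y = cl x \<and> koszul HA 1 (cl x) = cl (koszul A 1 y)"
  proof (induction rule: H.graded_induct)
    case zero
    show ?case
      using Z_zero hom_one[OF H.koszul_hom H.group_add H.group_add, of 1] hom_one[OF koszul_hom group_add group_add, of 1]
      by (intro bexI[of _ "0\<^sub>A"]) (auto simp: HA_zero)
  next
    case (add X Y)
    then obtain x y where "x \<in> Z" "cl x = X" "koszul HA 1 X = cl (koszul A 1 x)"
      "y \<in> Z" "cl y = Y" "koszul HA 1 Y = cl (koszul A 1 y)" by blast
    then show ?case using add(1,2) Z_closed
      by (intro bexI[of _ "x +\<^sub>A y"]) (auto simp: HA_add[symmetric] H.koszul_add koszul_add Z_add)
  next
    case (part n X)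
    then obtain x where x: "x \<in> part A n" "x \<in> Z" "X = cl x" by (auto simp: part_HA)
    have "koszul HA 1 X = cl (koszul A 1 x)"
      using H.koszul_of_part[OF part] koszul_of_part[OF x(1)] x
      by (auto simp: signed_def a_inv_def[symmetric] HA_minus)
    then show ?case using x by blast
  qed
  then show ?thesis using inv by auto
qed

end

section \<open>Sections and homotopies\<close>

text \<open>A submodule in the record format for which the linear algebra over the field was
  developed; the right action is a filler.\<close>

definition scalars :: "('k, 'a, 'z) module_scheme => 'a set => ('k, 'a, unit) bimod" where
  "scalars M U = \<lparr>carrier = U, mult = add M, one = zero M, lact = smult M, ract = (%x _. x)\<rparr>"

lemma scalars_simps [simp]:
  "carrier (scalars M U) = U" "mult (scalars M U) = add M" "one (scalars M U) = zero M" "lact (scalars M U) = smult M"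
  by (simp_all add: scalars_def)

lemma (in module) left_module_scalars:
  assumes U: "submodule U R M"
  shows "left_module R (scalars M U)"
proof -
  interpret U: submodule U R M by fact
  have sub: "x \<in> U ==> x <: M" for x using U.subset by auto
  have m: "[|x \<in> U; y \<in> U|] ==> x +\<^sub>M y \<in> U" for x y using U.m_closed by simp
  have i: "x \<in> U ==> -\<^sub>M x \<in> U" for x using U.m_inv_closed by (simp add: a_inv_def)
  have z: "0\<^sub>M \<in> U" using U.one_closed by simp
  have "comm_group (scalars M U)"
  proof (rule comm_groupI)
    show "\<exists>y\<in>carrier (scalars M U). y *\<^sub>(scalars M U) x = 1\<^sub>(scalars M U)" if "x <: scalars M U" for x
      using that i sub M.l_neg by (intro bexI[of _ "-\<^sub>M x"]) auto
  qed (use sub m z in \<open>auto simp: M.a_ac\<close>)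
  then show ?thesis unfolding left_module_def
    using sub m U.smult_closed by (auto simp: smult_l_distr smult_r_distr smult_assoc1)
qed

context dg_algebra
begin

lemma submodule_Z: "submodule Z K A"
  by (rule submoduleI) (auto simp: Z_closed Z_zero Z_minus Z_add Z_smult)

lemma submodule_carrier: "submodule (carrier A) K A"
  by (rule submoduleI) auto

lemma field_K: "field K"
  by unfold_locales

text \<open>The class map from cocycles to cohomology has a linear section \<open>\<sigma>\<close>.
  On a class of degree \<open>n\<close> only the component of degree \<open>n\<close> of its value
  is kept; this component is a cocycle and still represents the class.\<close>

lemma ex_cocycle_section: "\<exists>f1. cocycle_section K A f1"
proof -
  have carrH: "submodule (carrier HA) K HA" by (rule H.submoduleI) auto
  have "cl \<in> hom (scalars A Z) (scalars HA (carrier HA))"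
    by (rule homI) (auto simp: HA_add Z_closed)
  moreover have "cl (lact (scalars A Z) c v) = lact (scalars HA (carrier HA)) c (cl v)"
    if "c <: K" "v <: scalars A Z" for c v
    using that by (simp add: HA_smult Z_closed)
  ultimately obtain \<sigma> where \<sigma>: "\<sigma> \<in> hom (scalars HA (carrier HA)) (scalars A Z)"
    "\<forall>c\<in>carrier K. \<forall>w\<in>carrier HA. \<sigma> (c \<cdot>\<^sub>HA w) = c \<cdot>\<^sub>A \<sigma> w"
    "\<forall>v\<in>Z. cl (\<sigma> (cl v)) = cl v"
    using ex_generalized_inverse[OF field_K left_module_scalars[OF submodule_Z] H.left_module_scalars[OF carrH], of cl]
    by auto
  have \<sigma>Z: "X <: HA ==> \<sigma> X \<in> Z" and \<sigma>a: "[|X <: HA; Y <: HA|] ==> \<sigma> (X +\<^sub>HA Y) = \<sigma> X +\<^sub>A \<sigma> Y" for X Y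
    using \<sigma>(1) by (auto simp: hom_def)
  have \<sigma>c: "cl (\<sigma> X) = X" if "X <: HA" for X using \<sigma>(3) that by (auto elim!: HA_cases)
  define f1 where "f1 = graded_sum HA addA (%n X. component A n (\<sigma> X))"
  have \<sigma>h: "\<sigma> \<in> hom (add_monoid HA) addA" by (rule homI) (use \<sigma>Z Z_closed \<sigma>a in auto)
  have Fh: "(%X. component A n (\<sigma> X)) \<in> hom (add_monoid HA\<lparr>carrier := part HA n\<rparr>) addA" for n
    by (rule H.hom_part[OF hom_comp[OF \<sigma>h component_hom]])
  have f1h: "f1 \<in> hom (add_monoid HA) addA" unfolding f1_def by (rule H.graded_sum_hom[OF comm_group_add Fh])
  have f1p: "X \<in> part HA n ==> f1 X = component A n (\<sigma> X)" for n X
    unfolding f1_def by (rule H.graded_sum_part[OF comm_group_add Fh])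
  have f1a: "[|X <: HA; Y <: HA|] ==> f1 (X +\<^sub>HA Y) = f1 X +\<^sub>A f1 Y" for X Y
    using hom_mult[OF f1h, of X Y] by simp
  have ex: "f1 X \<in> Z \<and> cl (f1 X) = X" if "X <: HA" for X
    using that
  proof (induction rule: H.graded_induct)
    case zero
    then show ?case using hom_one[OF f1h H.group_add group_add] Z_zero by (simp add: HA_zero)
  next
    case (add X Y)
    then show ?case using f1a Z_add Z_closed by (simp add: HA_add[symmetric])
  next
    case (part n X)
    then have X: "X <: HA" using H.part_closed by blast
    then show ?case
      using f1p[OF part] Z_component[OF \<sigma>Z[OF X]] component_HA[OF \<sigma>Z[OF X], of n] \<sigma>c[OF X] H.component_of_part[OF part, of n]
      by simp
  qed
  have sm: "f1 (c \<cdot>\<^sub>HA X) = c \<cdot>\<^sub>A f1 X" if c: "c <: K" and X: "X <: HA" for c X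
  proof (rule H.graded_hom_eqI[OF hom_comp[OF _ f1h] hom_comp[OF f1h _] group_add _ X])
    show "(%x. c \<cdot>\<^sub>HA x) \<in> hom (add_monoid HA) (add_monoid HA)" using c by (auto simp: hom_def H.smult_r_distr)
    show "(%x. c \<cdot>\<^sub>A x) \<in> hom addA addA" using c by (auto simp: hom_def smult_r_distr)
    show "f1 (c \<cdot>\<^sub>HA X) = c \<cdot>\<^sub>A f1 X" if X: "X \<in> part HA n" for n X
      using f1p[OF H.part_smult[OF c X]] f1p[OF X] \<sigma>(2) H.part_closed[OF X] c \<sigma>Z Z_closed
      by (simp add: component_smult)
  qed
  have "f1 X \<in> part A n" if "X \<in> part HA n" for X n
    using f1p[OF that] component_part \<sigma>Z Z_closed H.part_closed[OF that] by simp
  then have "cocycle_section K A f1"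
    unfolding cocycle_section_def Let_def using ex f1a sm by blast
  then show ?thesis by blast
qed

lemma cocycle_sectionD:
  assumes "cocycle_section K A f1"
  shows "x <: HA ==> f1 x \<in> Z" "x <: HA ==> cl (f1 x) = x"
    "[|x <: HA; y <: HA|] ==> f1 (x +\<^sub>HA y) = f1 x +\<^sub>A f1 y"
    "[|c <: K; x <: HA|] ==> f1 (c \<cdot>\<^sub>HA x) = c \<cdot>\<^sub>A f1 x"
    "x \<in> part HA n ==> f1 x \<in> part A n"
  using assms unfolding cocycle_section_def Let_def by blast+

text \<open>The degree \<open>-1\<close> part of a generalized inverse of the differential. It
  chooses a primitive for every coboundary in a linear and homogeneous way.\<close>

lemma ex_homotopy:
  "\<exists>\<tau>. \<tau> \<in> hom addA addA \<and> (\<forall>c\<in>carrier K. \<forall>x\<in>carrier A. \<tau> (c \<cdot>\<^sub>A x) = c \<cdot>\<^sub>A \<tau> x) \<and>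
     (\<forall>n. \<forall>x\<in>part A n. \<tau> x \<in> part A (n - 1)) \<and> (\<forall>x\<in>carrier A. d (\<tau> (d x)) = d x)"
proof -
  let ?V = "scalars A (carrier A)"
  have hom_eq: "hom ?V ?V = hom addA addA" by (simp add: hom_def)
  obtain \<sigma> where \<sigma>: "\<sigma> \<in> hom addA addA" "\<forall>c\<in>carrier K. \<forall>w\<in>carrier A. \<sigma> (c \<cdot>\<^sub>A w) = c \<cdot>\<^sub>A \<sigma> w"
    "\<forall>v\<in>carrier A. d (\<sigma> (d v)) = d v"
    using ex_generalized_inverse[OF field_K left_module_scalars[OF submodule_carrier] left_module_scalars[OF submodule_carrier], of d]
      d_hom differential_smult unfolding hom_eq by auto
  define \<tau> where "\<tau> = graded_sum A addA (%n x. component A (n - 1) (\<sigma> x))"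
  have \<sigma>c: "x <: A ==> \<sigma> x <: A" for x using hom_closed[OF \<sigma>(1)] by simp
  have Fh: "(%X. component A (n - 1) (\<sigma> X)) \<in> hom (addA\<lparr>carrier := part A n\<rparr>) addA" for n
    by (rule hom_part[OF hom_comp[OF \<sigma>(1) component_hom]])
  have h: "\<tau> \<in> hom addA addA" unfolding \<tau>_def by (rule graded_sum_hom[OF comm_group_add Fh])
  have p: "x \<in> part A n ==> \<tau> x = component A (n - 1) (\<sigma> x)" for n x
    unfolding \<tau>_def by (rule graded_sum_part[OF comm_group_add Fh])
  have "\<tau> (c \<cdot>\<^sub>A x) = c \<cdot>\<^sub>A \<tau> x" if c: "c <: K" and x: "x <: A" for c x
  proof (rule graded_hom_eqI[OF hom_comp[OF _ h] hom_comp[OF h _] group_add _ x])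
    show "(%x. c \<cdot>\<^sub>A x) \<in> hom addA addA" "(%x. c \<cdot>\<^sub>A x) \<in> hom addA addA"
      using c by (auto simp: hom_def smult_r_distr)
    show "\<tau> (c \<cdot>\<^sub>A x) = c \<cdot>\<^sub>A \<tau> x" if x: "x \<in> part A n" for n x
      using p[OF part_smult[OF c x]] p[OF x] \<sigma>(2) part_closed[OF x] c \<sigma>c by (simp add: component_smult)
  qed
  moreover have "\<tau> x \<in> part A (n - 1)" if "x \<in> part A n" for x n
    using p[OF that] component_part \<sigma>c part_closed[OF that] by simp
  moreover have "d (\<tau> (d x)) = d x" if x: "x <: A" for x
  proof (rule graded_hom_eqI[OF hom_comp[OF hom_comp[OF d_hom h] d_hom] d_hom group_add _ x])
    fix n x assume x: "x \<in> part A n"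
    have xc: "x <: A" using part_closed[OF x] .
    have "d (\<tau> (d x)) = d (component A n (\<sigma> (d x)))" using p[OF d_part[OF x]] by simp
    also have "\<dots> = component A (n + 1) (d (\<sigma> (d x)))" using xc \<sigma>c by (simp add: d_component)
    also have "\<dots> = d x" using \<sigma>(3) xc component_of_part[OF d_part[OF x]] by simp
    finally show "d (\<tau> (d x)) = d x" .
  qed
  ultimately show ?thesis using h by blast
qed

text \<open>The defect \<open>g\<close> of multiplicativity of \<open>f1\<close> is bilinear and a
  coboundary, so the primitive chosen by \<open>\<tau>\<close> serves as \<open>f2\<close>.\<close>

lemma ex_multiplicativity_homotopy:
  assumes f1: "cocycle_section K A f1"
  shows "\<exists>f2. multiplicativity_homotopy K A f1 f2"
proof -
  obtain \<tau> where \<tau>: "\<tau> \<in> hom addA addA" "\<forall>c\<in>carrier K. \<forall>x\<in>carrier A. \<tau> (c \<cdot>\<^sub>A x) = c \<cdot>\<^sub>A \<tau> x"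
    "\<forall>n. \<forall>x\<in>part A n. \<tau> x \<in> part A (n - 1)" "\<forall>x\<in>carrier A. d (\<tau> (d x)) = d x"
    using ex_homotopy by auto
  note F = cocycle_sectionD[OF f1]
  define g where "g x y = f1 (x *\<^sub>HA y) -\<^sub>A f1 x *\<^sub>A f1 y" for x y
  have fc: "x <: HA ==> f1 x <: A" for x using F(1) Z_closed by blast
  have gc: "g x y <: A" if "x <: HA" "y <: HA" for x y
    unfolding g_def using that fc H.m_closed by auto
  have \<tau>a: "\<tau> (x +\<^sub>A y) = \<tau> x +\<^sub>A \<tau> y" if "x <: A" "y <: A" for x y
    using hom_mult[OF \<tau>(1), of x y] that by simp
  have gb: "\<exists>b\<in>carrier A. g x y = d b" if xy: "x <: HA" "y <: HA" for x y
  proof -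
    have "cl (f1 (x *\<^sub>HA y)) = cl (f1 x *\<^sub>A f1 y)"
      using F(1,2) xy H.m_closed by (simp add: HA_mult[symmetric])
    then obtain b where "b <: A" "f1 (x *\<^sub>HA y) = f1 x *\<^sub>A f1 y +\<^sub>A d b"
      using cl_eqD[of "f1 (x *\<^sub>HA y)" "f1 x *\<^sub>A f1 y"] fc xy H.m_closed by auto
    moreover have "f1 x *\<^sub>A f1 y +\<^sub>A d b -\<^sub>A f1 x *\<^sub>A f1 y = d b" if "b <: A"
      using a_comm[of "f1 x *\<^sub>A f1 y" "d b"] fc xy that by (simp add: a_minus_def a_assoc r_neg)
    ultimately show ?thesis unfolding g_def by auto
  qed
  have dg: "d (\<tau> (g x y)) = g x y" if "x <: HA" "y <: HA" for x y
    using gb[OF that] \<tau>(4) by auto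
  have g1: "g (x +\<^sub>HA x') y = g x y +\<^sub>A g x' y" "g y (x +\<^sub>HA x') = g y x +\<^sub>A g y x'"
    if "x <: HA" "x' <: HA" "y <: HA" for x x' y
    using that F(3) fc H.m_closed
    by (simp_all add: g_def H.l_distr H.r_distr l_distr r_distr a_minus_def minus_add a_ac)
  have g2: "g (c \<cdot>\<^sub>HA x) y = c \<cdot>\<^sub>A g x y" "g x (c \<cdot>\<^sub>HA y) = c \<cdot>\<^sub>A g x y"
    if "x <: HA" "y <: HA" "c <: K" for x y c
    using that F(4) fc H.m_closed H.smult_mult_left H.smult_mult_right
    by (simp_all add: g_def smult_mult_left smult_mult_right a_minus_def smult_r_distr smult_r_minus)
  have g3: "g x y \<in> part A (m + n)" if "x \<in> part HA m" "y \<in> part HA n" for x y m n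
    using that F(5) H.mult_part mult_part part_add part_minus by (simp add: g_def a_minus_def)
  have "multiplicativity_homotopy K A f1 (%x y. \<tau> (g x y))"
    unfolding multiplicativity_homotopy_def Let_def
    using dg gc g1 g2 g3 \<tau>(2,3) \<tau>a hom_closed[OF \<tau>(1)] by (auto simp: g_def[symmetric])
  then show ?thesis by blast
qed

lemma multiplicativity_homotopyD:
  assumes "multiplicativity_homotopy K A f1 f2"
  shows "[|x <: HA; y <: HA|] ==> f2 x y <: A"
    "[|x <: HA; y <: HA|] ==> d (f2 x y) = f1 (x *\<^sub>HA y) -\<^sub>A f1 x *\<^sub>A f1 y"
    "[|x <: HA; x' <: HA; y <: HA|] ==> f2 (x +\<^sub>HA x') y = f2 x y +\<^sub>A f2 x' y"
    "[|x <: HA; x' <: HA; y <: HA|] ==> f2 y (x +\<^sub>HA x') = f2 y x +\<^sub>A f2 y x'"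
    "[|c <: K; x <: HA; y <: HA|] ==> f2 (c \<cdot>\<^sub>HA x) y = c \<cdot>\<^sub>A f2 x y"
    "[|c <: K; x <: HA; y <: HA|] ==> f2 x (c \<cdot>\<^sub>HA y) = c \<cdot>\<^sub>A f2 x y"
    "[|x \<in> part HA m; y \<in> part HA n|] ==> f2 x y \<in> part A (m + n - 1)"
  using assms unfolding multiplicativity_homotopy_def Let_def by blast+

end

section \<open>The canonical cocycle\<close>

text \<open>The variables \<open>a1\<close>, \<open>a2\<close>, \<open>a12\<close> stand for values
  of \<open>f1\<close> with the sign operator applied, \<open>a3\<close>, \<open>a4\<close>,
  \<open>a34\<close> for values without it, and all other letters for values of \<open>f2\<close>.
  Every term in which \<open>f2\<close> takes a product cancels; what remains are two defects of
  multiplicativity of \<open>f1\<close>, each multiplied by a value of \<open>f2\<close>.\<close>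

lemma (in ring) m3_cocycle_identity:
  assumes "a1 <: R" "a2 <: R" "a3 <: R" "a4 <: R" "a12 <: R" "a34 <: R"
   "F12 <: R" "F23 <: R" "F34 <: R" "P <: R" "Q <: R" "S <: R"
   "U <: R" "V <: R" "W <: R" "R' <: R"
  shows "((((a1 \<otimes> (((a2 \<otimes> F34 \<ominus> F23 \<otimes> a4) \<ominus> U) \<oplus> V)) \<ominus> (((a12 \<otimes> F34 \<ominus> P \<otimes> a4) \<ominus> Q) \<oplus> W))
    \<oplus> (((a1 \<otimes> U \<ominus> R' \<otimes> a4) \<ominus> Q) \<oplus> S)) \<ominus> (((a1 \<otimes> V \<ominus> F12 \<otimes> a34) \<ominus> W) \<oplus> S))
    \<oplus> ((((a1 \<otimes> F23 \<ominus> F12 \<otimes> a3) \<ominus> P) \<oplus> R') \<otimes> a4) = (a1 \<otimes> a2 \<ominus> a12) \<otimes> F34 \<oplus> F12 \<otimes> (a34 \<ominus> a3 \<otimes> a4)"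
  using assms by algebra

text \<open>The left side is the differential of the representative of \<open>m3\<close>, in which
  the defects of \<open>f1\<close> telescope.\<close>

lemma (in ring) m3_closed_identity:
  assumes "a1 <: R" "a2 <: R" "a3 <: R" "a12 <: R" "a23 <: R" "a123 <: R"
  shows "((a1 \<otimes> (a23 \<ominus> a2 \<otimes> a3) \<ominus> (a12 \<ominus> a1 \<otimes> a2) \<otimes> a3) \<ominus> (a123 \<ominus> a12 \<otimes> a3)) \<oplus> (a123 \<ominus> a1 \<otimes> a23) = \<zero>"
  using assms by algebra

context dg_algebra
begin

lemma koszul_diff: "[|x <: A; y <: A|] ==> koszul A e (x -\<^sub>A y) = koszul A e x -\<^sub>A koszul A e y"
  by (simp add: a_minus_def koszul_add koszul_minus)

lemma d_diff: "[|x <: A; y <: A|] ==> d (x -\<^sub>A y) = d x -\<^sub>A d y"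
  by (simp add: a_minus_def d_add d_minus)

lemma d_Z_mult: "[|x \<in> Z; y <: A|] ==> d (koszul A 1 x *\<^sub>A y) = x *\<^sub>A d y"
  using Z_d[OF Z_koszul] Z_closed by (simp add: Leibniz_koszul koszul_1_1)

lemma d_mult_Z: "[|x <: A; y \<in> Z|] ==> d (x *\<^sub>A y) = d x *\<^sub>A y"
  using Z_d Z_closed by (simp add: Leibniz_koszul)

definition m3_rep :: "('a set => 'a) => ('a set => 'a set => 'a) => 'a set => 'a set => 'a set => 'a" where
  "m3_rep f1 f2 x y z = ((koszul A 1 (f1 x) *\<^sub>A f2 y z -\<^sub>A f2 x y *\<^sub>A f1 z)
            -\<^sub>A f2 (x *\<^sub>HA y) z) +\<^sub>A f2 x (y *\<^sub>HA z)"

lemma m3_eq: "m3 A f1 f2 x y z = cl (m3_rep f1 f2 x y z)"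
  by (simp add: m3_def m3_rep_def Let_def)

context
  fixes f1 f2
  assumes f1: "cocycle_section K A f1" and f2: "multiplicativity_homotopy K A f1 f2"
begin

lemmas s1 = cocycle_sectionD[OF f1]
lemmas s2 = multiplicativity_homotopyD[OF f2]

lemma f1c: "x <: HA ==> f1 x <: A"
  using s1(1) Z_closed by blast

lemma m3_rep_Z:
  assumes "x <: HA" "y <: HA" "z <: HA"
  shows "m3_rep f1 f2 x y z \<in> Z"
proof (rule ZI)
  note c = assms f1c s2(1) H.m_closed
  show "m3_rep f1 f2 x y z <: A" unfolding m3_rep_def using c by simp
  have "d (m3_rep f1 f2 x y z) = ((f1 x *\<^sub>A (f1 (y *\<^sub>HA z) -\<^sub>A f1 y *\<^sub>A f1 z)
      -\<^sub>A (f1 (x *\<^sub>HA y) -\<^sub>A f1 x *\<^sub>A f1 y) *\<^sub>A f1 z)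
      -\<^sub>A (f1 (x *\<^sub>HA (y *\<^sub>HA z)) -\<^sub>A f1 (x *\<^sub>HA y) *\<^sub>A f1 z))
      +\<^sub>A (f1 (x *\<^sub>HA (y *\<^sub>HA z)) -\<^sub>A f1 x *\<^sub>A f1 (y *\<^sub>HA z))"
    unfolding m3_rep_def using c s1(1)
    by (simp add: d_add d_diff d_Z_mult d_mult_Z s2(2) H.m_assoc)
  also have "\<dots> = 0\<^sub>A"
    by (rule m3_closed_identity) (use c in auto)
  finally show "d (m3_rep f1 f2 x y z) = 0\<^sub>A" .
qed

lemma m3_closed: "[|x <: HA; y <: HA; z <: HA|] ==> m3 A f1 f2 x y z <: HA"
  unfolding m3_eq using m3_rep_Z by simp

lemma m3_add:
  assumes "x <: HA" "x' <: HA" "y <: HA" "z <: HA"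
  shows "m3 A f1 f2 (x +\<^sub>HA x') y z = m3 A f1 f2 x y z +\<^sub>HA m3 A f1 f2 x' y z"
    "m3 A f1 f2 y (x +\<^sub>HA x') z = m3 A f1 f2 y x z +\<^sub>HA m3 A f1 f2 y x' z"
    "m3 A f1 f2 y z (x +\<^sub>HA x') = m3 A f1 f2 y z x +\<^sub>HA m3 A f1 f2 y z x'"
proof -
  note c = assms f1c s2(1) H.m_closed
  have "m3_rep f1 f2 (x +\<^sub>HA x') y z = m3_rep f1 f2 x y z +\<^sub>A m3_rep f1 f2 x' y z"
    unfolding m3_rep_def using c
    by (simp add: s1(3) s2(3,4) koszul_add H.l_distr H.r_distr l_distr r_distr a_minus_def minus_add a_ac)
  then show "m3 A f1 f2 (x +\<^sub>HA x') y z = m3 A f1 f2 x y z +\<^sub>HA m3 A f1 f2 x' y z"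
    unfolding m3_eq using HA_add m3_rep_Z Z_closed assms by simp
  have "m3_rep f1 f2 y (x +\<^sub>HA x') z = m3_rep f1 f2 y x z +\<^sub>A m3_rep f1 f2 y x' z"
    unfolding m3_rep_def using c
    by (simp add: s1(3) s2(3,4) koszul_add H.l_distr H.r_distr l_distr r_distr a_minus_def minus_add a_ac)
  then show "m3 A f1 f2 y (x +\<^sub>HA x') z = m3 A f1 f2 y x z +\<^sub>HA m3 A f1 f2 y x' z"
    unfolding m3_eq using HA_add m3_rep_Z Z_closed assms by simp
  have "m3_rep f1 f2 y z (x +\<^sub>HA x') = m3_rep f1 f2 y z x +\<^sub>A m3_rep f1 f2 y z x'"
    unfolding m3_rep_def using c
    by (simp add: s1(3) s2(3,4) koszul_add H.l_distr H.r_distr l_distr r_distr a_minus_def minus_add a_ac)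
  then show "m3 A f1 f2 y z (x +\<^sub>HA x') = m3 A f1 f2 y z x +\<^sub>HA m3 A f1 f2 y z x'"
    unfolding m3_eq using HA_add m3_rep_Z Z_closed assms by simp
qed

lemma m3_smult:
  assumes "c <: K" "x <: HA" "y <: HA" "z <: HA"
  shows "m3 A f1 f2 (c \<cdot>\<^sub>HA x) y z = c \<cdot>\<^sub>HA m3 A f1 f2 x y z"
    "m3 A f1 f2 x (c \<cdot>\<^sub>HA y) z = c \<cdot>\<^sub>HA m3 A f1 f2 x y z"
    "m3 A f1 f2 x y (c \<cdot>\<^sub>HA z) = c \<cdot>\<^sub>HA m3 A f1 f2 x y z"
proof -
  note c = assms f1c s2(1) H.m_closed
  note s = s1(4) s2(5,6) koszul_smult H.smult_mult_left H.smult_mult_right smult_mult_left smult_mult_right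
    a_minus_def smult_r_distr smult_r_minus
  have "m3_rep f1 f2 (c \<cdot>\<^sub>HA x) y z = c \<cdot>\<^sub>A m3_rep f1 f2 x y z"
    "m3_rep f1 f2 x (c \<cdot>\<^sub>HA y) z = c \<cdot>\<^sub>A m3_rep f1 f2 x y z"
    "m3_rep f1 f2 x y (c \<cdot>\<^sub>HA z) = c \<cdot>\<^sub>A m3_rep f1 f2 x y z"
    unfolding m3_rep_def using c by (simp_all add: s)
  then show "m3 A f1 f2 (c \<cdot>\<^sub>HA x) y z = c \<cdot>\<^sub>HA m3 A f1 f2 x y z"
    "m3 A f1 f2 x (c \<cdot>\<^sub>HA y) z = c \<cdot>\<^sub>HA m3 A f1 f2 x y z"
    "m3 A f1 f2 x y (c \<cdot>\<^sub>HA z) = c \<cdot>\<^sub>HA m3 A f1 f2 x y z"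
    unfolding m3_eq using HA_smult m3_rep_Z Z_closed assms by simp_all
qed

lemma m3_part:
  assumes "x \<in> part HA i" "y \<in> part HA j" "z \<in> part HA k"
  shows "m3 A f1 f2 x y z \<in> part HA (i + j + k - 1)"
proof -
  have c: "x <: HA" "y <: HA" "z <: HA" using assms H.part_closed by blast+
  have 1: "koszul A 1 (f1 x) *\<^sub>A f2 y z \<in> part A (i + j + k - 1)"
    using mult_part[OF koszul_part[OF s1(5)[OF assms(1)], of 1] s2(7)[OF assms(2,3)]] by (simp add: algebra_simps)
  have 2: "f2 x y *\<^sub>A f1 z \<in> part A (i + j + k - 1)"
    using mult_part[OF s2(7)[OF assms(1,2)] s1(5)[OF assms(3)]] by (simp add: algebra_simps)
  have 3: "f2 (x *\<^sub>HA y) z \<in> part A (i + j + k - 1)"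
    using s2(7)[OF H.mult_part[OF assms(1,2)] assms(3)] by simp
  have 4: "f2 x (y *\<^sub>HA z) \<in> part A (i + j + k - 1)"
    using s2(7)[OF assms(1) H.mult_part[OF assms(2,3)]] by (simp add: algebra_simps)
  have "m3_rep f1 f2 x y z \<in> part A (i + j + k - 1)"
    unfolding m3_rep_def a_minus_def using 1 2 3 4 by (intro part_add part_minus)
  then show ?thesis using m3_rep_Z[OF c] by (auto simp: m3_eq part_HA)
qed

text \<open>By the ring identity the left side is represented by two defects of \<open>f1\<close>,
  each multiplied by a value of \<open>f2\<close>. The defects are differentials of values of
  \<open>f2\<close>, so by the Leibniz rule the sum is the differential of \<open>f2 x1 x2\<close>
  times \<open>f2 x3 x4\<close>, with a sign operator on the first factor.\<close>

lemma m3_hochschild_cocycle: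
  assumes "x1 <: HA" "x2 <: HA" "x3 <: HA" "x4 <: HA"
  shows "(((koszul HA 1 x1 *\<^sub>HA m3 A f1 f2 x2 x3 x4 -\<^sub>HA m3 A f1 f2 (x1 *\<^sub>HA x2) x3 x4)
     +\<^sub>HA m3 A f1 f2 x1 (x2 *\<^sub>HA x3) x4) -\<^sub>HA m3 A f1 f2 x1 x2 (x3 *\<^sub>HA x4))
     +\<^sub>HA m3 A f1 f2 x1 x2 x3 *\<^sub>HA x4 = 0\<^sub>HA" (is "?L = _")
proof -
  let ?m = "m3_rep f1 f2"
  note c = assms f1c s2(1) H.m_closed
  note zm = m3_rep_Z
  have k1: "koszul HA 1 x1 = cl (koszul A 1 (f1 x1))" using koszul_HA[OF s1(1)] s1(2) assms by metis
  have x4: "x4 = cl (f1 x4)" using s1(2) assms by simp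
  have "?L = cl ((((koszul A 1 (f1 x1) *\<^sub>A ?m x2 x3 x4 -\<^sub>A ?m (x1 *\<^sub>HA x2) x3 x4)
     +\<^sub>A ?m x1 (x2 *\<^sub>HA x3) x4) -\<^sub>A ?m x1 x2 (x3 *\<^sub>HA x4))
     +\<^sub>A ?m x1 x2 x3 *\<^sub>A f1 x4)" (is "_ = cl ?E")
  proof -
    have "m3 A f1 f2 x1 x2 x3 *\<^sub>HA x4 = cl (?m x1 x2 x3 *\<^sub>A f1 x4)"
      unfolding m3_eq using HA_mult[OF zm s1(1), of x1 x2 x3 x4] x4 assms by simp
    then show ?thesis unfolding m3_eq k1
      using c zm s1(1) Z_koszul Z_closed Z_diff Z_mult Z_add by (simp add: HA_mult HA_add HA_diff)
  qed
  also have "?E = (koszul A 1 (f1 x1) *\<^sub>A koszul A 1 (f1 x2) -\<^sub>A koszul A 1 (f1 (x1 *\<^sub>HA x2))) *\<^sub>A f2 x3 x4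
     +\<^sub>A f2 x1 x2 *\<^sub>A (f1 (x3 *\<^sub>HA x4) -\<^sub>A f1 x3 *\<^sub>A f1 x4)"
    unfolding m3_rep_def using c
    by (subst m3_cocycle_identity[symmetric]) (simp_all add: H.m_assoc)
  also have "koszul A 1 (f1 x1) *\<^sub>A koszul A 1 (f1 x2) -\<^sub>A koszul A 1 (f1 (x1 *\<^sub>HA x2)) = d (koszul A 1 (f2 x1 x2))"
    using c by (simp add: d_koszul s2(2) koszul_mult koszul_add koszul_minus a_minus_def minus_add a_comm)
  also have "f1 (x3 *\<^sub>HA x4) -\<^sub>A f1 x3 *\<^sub>A f1 x4 = d (f2 x3 x4)"
    using c by (simp add: s2(2))
  also have "d (koszul A 1 (f2 x1 x2)) *\<^sub>A f2 x3 x4 +\<^sub>A f2 x1 x2 *\<^sub>A d (f2 x3 x4)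
      = d (koszul A 1 (f2 x1 x2) *\<^sub>A f2 x3 x4)"
    using c by (simp add: Leibniz_koszul koszul_1_1)
  also have "cl \<dots> = cl 0\<^sub>A"
    using c by (intro cl_eqI[of _ _ "koszul A 1 (f2 x1 x2) *\<^sub>A f2 x3 x4"]) auto
  finally show ?thesis by (simp add: HA_zero)
qed

end

end

section \<open>Naturality of the canonical cocycle\<close>

lemma graded_alg_homD:
  assumes "graded_alg_hom K A B \<phi>"
  shows "\<phi> \<in> ring_hom A B" "[|c <: K; x <: A|] ==> \<phi> (c \<cdot>\<^sub>A x) = c \<cdot>\<^sub>B \<phi> x"
    "x \<in> part A n ==> \<phi> x \<in> part B n" "x <: A ==> \<phi> x <: B"
    "[|x <: A; y <: A|] ==> \<phi> (x +\<^sub>A y) = \<phi> x +\<^sub>B \<phi> y"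
    "[|x <: A; y <: A|] ==> \<phi> (x *\<^sub>A y) = \<phi> x *\<^sub>B \<phi> y"
    "\<phi> 1\<^sub>A = 1\<^sub>B" "\<phi> \<in> hom (add_monoid A) (add_monoid B)"
  using assms unfolding graded_alg_hom_def ring_hom_def hom_def by auto

lemma graded_alg_hom_koszul:
  assumes "graded_algebra K A" "graded_algebra K B" "graded_alg_hom K A B \<phi>" "x <: A"
  shows "\<phi> (koszul A e x) = koszul B e (\<phi> x)"
proof -
  interpret A: graded_algebra K A by fact
  interpret B: graded_algebra K B by fact
  note h = graded_alg_homD[OF assms(3)]
  show ?thesis
  proof (rule A.graded_hom_eqI[OF hom_comp[OF A.koszul_hom h(8)] hom_comp[OF h(8) B.koszul_hom] B.group_add _ assms(4)])
    show "\<phi> (koszul A e x) = koszul B e (\<phi> x)" if "x \<in> part A n" for n x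
      using that A.koszul_of_part[OF that] B.koszul_of_part[OF h(3)[OF that]] A.part_closed[OF that]
        hom_signed[OF h(8) A.group_add B.group_add, of x "e * n"] by simp
  qed
qed

section \<open>Ring identities comparing two canonical cocycles\<close>

context dg_algebra begin

context
  fixes ax ay az bx by' bz axy ayz bxy Fxy Fyz F1 F2 Gxy Gyz G1 G2 ux uy uz uxy uyz uxyz
  assumes c [simp]: "ax <: A" "ay <: A" "az <: A" "bx <: A" "by' <: A" "bz <: A"
    "axy <: A" "ayz <: A" "bxy <: A"
    "Fxy <: A" "Fyz <: A" "F1 <: A" "F2 <: A"
    "Gxy <: A" "Gyz <: A" "G1 <: A" "G2 <: A"
    "ux <: A" "uy <: A" "uz <: A" "uxy <: A" "uyz <: A" "uxyz <: A"
begin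

text \<open>The letters \<open>a\<close>, \<open>F\<close> belong to one choice of
  \<open>f1\<close>, \<open>f2\<close> and \<open>b\<close>, \<open>G\<close> to another;
  \<open>g\<close> and \<open>e\<close> are the signed values at \<open>x\<close>. The difference of
  the two representatives splits into the Hochschild coboundary of \<open>F - G\<close> and an error
  that measures how far \<open>a\<close> is from \<open>b\<close>.\<close>

lemma compare_FG:
  assumes "g <: A" "e <: A"
  shows "(((g *\<^sub>A Fyz -\<^sub>A Fxy *\<^sub>A az) -\<^sub>A F1) +\<^sub>A F2) =
    ((((e *\<^sub>A Gyz -\<^sub>A Gxy *\<^sub>A bz) -\<^sub>A G1) +\<^sub>A G2) +\<^sub>A
     (((e *\<^sub>A (Fyz -\<^sub>A Gyz) -\<^sub>A (F1 -\<^sub>A G1)) +\<^sub>A (F2 -\<^sub>A G2)) -\<^sub>A (Fxy -\<^sub>A Gxy) *\<^sub>A az)) +\<^sub>A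
     ((g -\<^sub>A e) *\<^sub>A Fyz -\<^sub>A Gxy *\<^sub>A (az -\<^sub>A bz))"
  using c assms by algebra

text \<open>The left side applies the Hochschild coboundary twice to the 1-cochain \<open>u\<close>,
  with \<open>b\<close> acting on the left and \<open>a\<close> on the right. It would vanish if
  both were multiplicative; the right side is what their defects leave.\<close>

lemma compare_U:
  assumes "e <: A" "f <: A" "g <: A"
  shows "((e *\<^sub>A ((uy *\<^sub>A az -\<^sub>A uyz) +\<^sub>A f *\<^sub>A uz) -\<^sub>A ((uxy *\<^sub>A az -\<^sub>A uxyz) +\<^sub>A g *\<^sub>A uz))
     +\<^sub>A ((ux *\<^sub>A ayz -\<^sub>A uxyz) +\<^sub>A e *\<^sub>A uyz)) -\<^sub>A ((ux *\<^sub>A ay -\<^sub>A uxy) +\<^sub>A e *\<^sub>A uy) *\<^sub>A az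
    = (e *\<^sub>A f -\<^sub>A g) *\<^sub>A uz +\<^sub>A ux *\<^sub>A (ayz -\<^sub>A ay *\<^sub>A az)"
  using c assms by algebra

end

lemma compare_split:
  assumes "e <: A" "az <: A" "p1 <: A" "p2 <: A" "p3 <: A" "p4 <: A"
    "q1 <: A" "q2 <: A" "q3 <: A" "q4 <: A"
  shows "((e *\<^sub>A (p1 +\<^sub>A q1) -\<^sub>A (p2 +\<^sub>A q2)) +\<^sub>A (p3 +\<^sub>A q3)) -\<^sub>A (p4 +\<^sub>A q4) *\<^sub>A az
    = (((e *\<^sub>A p1 -\<^sub>A p2) +\<^sub>A p3) -\<^sub>A p4 *\<^sub>A az) +\<^sub>A (((e *\<^sub>A q1 -\<^sub>A q2) +\<^sub>A q3) -\<^sub>A q4 *\<^sub>A az)"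
  using assms by algebra

lemma compare_collect:
  assumes "m <: A" "p <: A" "q <: A" "r <: A"
  shows "(m +\<^sub>A p) +\<^sub>A r = (m +\<^sub>A (p +\<^sub>A q)) +\<^sub>A (r -\<^sub>A q)"
  using assms by algebra

text \<open>After substitution of differentials for all differences, the errors of the two preceding
  identities combine by two instances of the Leibniz rule, one for \<open>ux\<close> and
  \<open>F\<close>, the other for \<open>G\<close> and \<open>uz\<close>.\<close>

lemma compare_error:
  assumes [simp]: "ux <: A" "uz <: A" "F <: A" "G <: A"
  shows "(koszul A 1 (d ux) *\<^sub>A F -\<^sub>A G *\<^sub>A d uz) -\<^sub>A ((-\<^sub>A koszul A 1 (d G)) *\<^sub>A uz +\<^sub>A ux *\<^sub>A d F)
    = d (-\<^sub>A (koszul A 1 ux *\<^sub>A F) -\<^sub>A koszul A 1 G *\<^sub>A uz)"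
proof -
  have *: "(p *\<^sub>A F -\<^sub>A G *\<^sub>A q) -\<^sub>A ((-\<^sub>A r) *\<^sub>A uz +\<^sub>A ux *\<^sub>A s)
    = -\<^sub>A ((-\<^sub>A p) *\<^sub>A F +\<^sub>A ux *\<^sub>A s) -\<^sub>A ((-\<^sub>A r) *\<^sub>A uz +\<^sub>A G *\<^sub>A q)"
    if "p <: A" "q <: A" "r <: A" "s <: A" for p q r s
    using assms that by algebra
  show ?thesis
    by (subst *) (simp_all add: d_diff d_minus Leibniz_koszul d_koszul koszul_1_1)
qed

end

locale dg_map = A: dg_algebra K A + B: dg_algebra K B
  for K :: "('k, 'p) ring_scheme" (structure) and A :: "('k, 'a) dg_alg" and B :: "('k, 'b) dg_alg" +
  fixes \<psi> :: "'a => 'b"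
  assumes dg_hom: "dg_hom K A B \<psi>"
begin

abbreviation "\<phi> \<equiv> cohomology_map A B \<psi>"

lemma \<psi>_hom: "graded_alg_hom K A B \<psi>" and \<psi>_d: "x <: A ==> \<psi> (A.d x) = B.d (\<psi> x)"
  using dg_hom by (auto simp: dg_hom_def)

lemmas \<psi> = graded_alg_homD[OF \<psi>_hom]

lemma \<psi>_Z: "x \<in> A.Z ==> \<psi> x \<in> B.Z"
  using A.Z_closed[of x] A.Z_d[of x] \<psi>(4)[of x] \<psi>_d[of x] hom_one[OF \<psi>(8) A.group_add B.group_add] B.ZI by simp

lemma \<psi>_koszul: "x <: A ==> \<psi> (koszul A e x) = koszul B e (\<psi> x)"
  by (rule graded_alg_hom_koszul[OF A.graded_algebra_axioms B.graded_algebra_axioms \<psi>_hom])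

lemma \<psi>_minus: "[|x <: A; y <: A|] ==> \<psi> (x -\<^sub>A y) = \<psi> x -\<^sub>B \<psi> y"
  using hom_inv[OF \<psi>(8) A.group_add B.group_add, of y] \<psi>(5) by (simp add: a_minus_def a_inv_def[symmetric])

lemma \<phi>_cl:
  assumes x: "x \<in> A.Z" shows "\<phi> (A.cl x) = B.cl (\<psi> x)"
proof -
  have xc: "x <: A" using x A.Z_closed by blast
  have "B.cl (\<psi> y) = B.cl (\<psi> x)" if y: "y \<in> A.cl x" for y
  proof -
    note yc = A.mem_cl[OF xc y]
    obtain b where b: "b <: A" "y = x +\<^sub>A A.d b" using A.cl_eqD[OF yc(1) xc yc(2)] .
    then have "\<psi> y = \<psi> x +\<^sub>B B.d (\<psi> b)" using xc \<psi> \<psi>_d by simp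
    then show ?thesis using b xc yc \<psi> by (intro B.cl_eqI[of _ _ "\<psi> b"]) auto
  qed
  then have "(\<Union>y\<in>A.cl x. B.cl (\<psi> y)) = B.cl (\<psi> x)" using A.cl_self[OF xc] by blast
  then show ?thesis using x by (simp add: cohomology_map_def)
qed

lemma \<phi>_hom: "graded_alg_hom K A.HA B.HA \<phi>"
  unfolding graded_alg_hom_def ring_hom_def
  using \<psi>_Z \<psi>(3)
  by (auto elim!: A.HA_cases simp: \<phi>_cl \<psi> A.HA_add A.HA_mult A.HA_smult A.HA_one B.HA_add B.HA_mult B.HA_smult B.HA_one
      A.Z_closed A.Z_add A.Z_mult A.Z_one A.Z_smult A.part_HA B.part_HA B.Z_closed)

lemmas \<phi> = graded_alg_homD[OF \<phi>_hom]

text \<open>The difference \<open>F - G\<close> of the two homotopies need not be closed, because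
  \<open>a\<close> and \<open>b\<close> may represent the same classes by different cocycles. Adding
  the coboundary of a primitive \<open>u\<close> of \<open>a - b\<close>, with \<open>b\<close>
  acting on the left and \<open>a\<close> on the right, repairs this; \<open>\<omega>\<close> is the
  class of the resulting cocycle \<open>w\<close>.\<close>

lemma m3_natural:
  assumes f1: "cocycle_section K A f1" and f2: "multiplicativity_homotopy K A f1 f2"
    and g1: "cocycle_section K B g1" and g2: "multiplicativity_homotopy K B g1 g2"
  shows "\<exists>\<omega>. (\<forall>x\<in>carrier A.HA. \<forall>y\<in>carrier A.HA. \<omega> x y <: B.HA) \<and>
    (\<forall>x\<in>carrier A.HA. \<forall>x'\<in>carrier A.HA. \<forall>y\<in>carrier A.HA.
       \<omega> (x +\<^sub>A.HA x') y = \<omega> x y +\<^sub>B.HA \<omega> x' y \<and> \<omega> y (x +\<^sub>A.HA x') = \<omega> y x +\<^sub>B.HA \<omega> y x') \<and>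
    (\<forall>c\<in>carrier K. \<forall>x\<in>carrier A.HA. \<forall>y\<in>carrier A.HA.
       \<omega> (c \<cdot>\<^sub>A.HA x) y = c \<cdot>\<^sub>B.HA \<omega> x y \<and> \<omega> x (c \<cdot>\<^sub>A.HA y) = c \<cdot>\<^sub>B.HA \<omega> x y) \<and>
    (\<forall>m n. \<forall>x\<in>part A.HA m. \<forall>y\<in>part A.HA n. \<omega> x y \<in> part B.HA (m + n - 1)) \<and>
    (\<forall>x\<in>carrier A.HA. \<forall>y\<in>carrier A.HA. \<forall>z\<in>carrier A.HA.
       \<phi> (m3 A f1 f2 x y z) = m3 B g1 g2 (\<phi> x) (\<phi> y) (\<phi> z) +\<^sub>B.HA
         (((koszul B.HA 1 (\<phi> x) *\<^sub>B.HA \<omega> y z -\<^sub>B.HA \<omega> (x *\<^sub>A.HA y) z) +\<^sub>B.HA \<omega> x (y *\<^sub>A.HA z))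
           -\<^sub>B.HA \<omega> x y *\<^sub>B.HA \<phi> z))"
proof -
  note s1 = A.cocycle_sectionD[OF f1] and s2 = A.multiplicativity_homotopyD[OF f2]
  note t1 = B.cocycle_sectionD[OF g1] and t2 = B.multiplicativity_homotopyD[OF g2]
  obtain \<tau> where \<tau>: "\<tau> \<in> hom B.addA B.addA" "\<forall>c\<in>carrier K. \<forall>x\<in>carrier B. \<tau> (c \<cdot>\<^sub>B x) = c \<cdot>\<^sub>B \<tau> x"
    "\<forall>n. \<forall>x\<in>part B n. \<tau> x \<in> part B (n - 1)" "\<forall>x\<in>carrier B. B.d (\<tau> (B.d x)) = B.d x"
    using B.ex_homotopy by auto
  define a where "a x = \<psi> (f1 x)" for x
  define b where "b x = g1 (\<phi> x)" for x
  define F where "F x y = \<psi> (f2 x y)" for x y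
  define G where "G x y = g2 (\<phi> x) (\<phi> y)" for x y
  \<comment> \<open>\<open>\<tau>\<close> turns the coboundary \<open>a x - b x\<close> into a
    primitive in a linear and homogeneous way.\<close>
  define u where "u x = \<tau> (a x -\<^sub>B b x)" for x
  define w where "w x y = (F x y -\<^sub>B G x y) +\<^sub>B ((u x *\<^sub>B a y -\<^sub>B u (x *\<^sub>A.HA y)) +\<^sub>B koszul B 1 (b x) *\<^sub>B u y)" for x y
  let ?H = "carrier A.HA"
  have aZ: "x \<in> ?H ==> a x \<in> B.Z" and bZ: "x \<in> ?H ==> b x \<in> B.Z" for x
    using s1(1) t1(1) \<psi>_Z \<phi>(4) by (auto simp: a_def b_def)
  have cla: "B.cl (a x) = \<phi> x" and clb: "B.cl (b x) = \<phi> x" if "x \<in> ?H" for x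
    using \<phi>_cl[OF s1(1)[OF that]] s1(2)[OF that] t1(2)[OF \<phi>(4)[OF that]] by (simp_all add: a_def b_def)
  have ac: "x \<in> ?H ==> a x <: B" and bc: "x \<in> ?H ==> b x <: B" for x
    using aZ bZ B.Z_closed by auto
  have Fc: "[|x \<in> ?H; y \<in> ?H|] ==> F x y <: B" and Gc: "[|x \<in> ?H; y \<in> ?H|] ==> G x y <: B" for x y
    using s2(1) t2(1) \<psi>(4) \<phi>(4) by (auto simp: F_def G_def)
  have \<tau>c: "x <: B ==> \<tau> x <: B" for x using hom_closed[OF \<tau>(1)] by simp
  have \<tau>a: "[|x <: B; y <: B|] ==> \<tau> (x +\<^sub>B y) = \<tau> x +\<^sub>B \<tau> y" for x y
    using hom_mult[OF \<tau>(1), of x y] by simp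
  have uc: "x \<in> ?H ==> u x <: B" for x using ac bc \<tau>c by (simp add: u_def)
  have du: "B.d (u x) = a x -\<^sub>B b x" if xH: "x \<in> ?H" for x
  proof -
    have "B.cl (a x) = B.cl (b x)" using cla[OF xH] clb[OF xH] by simp
    then obtain e where e: "e <: B" "a x = b x +\<^sub>B B.d e" by (rule B.cl_eqD[OF ac[OF xH] bc[OF xH]])
    have "a x -\<^sub>B b x = B.d e"
      unfolding e(2) using bc[OF xH] e(1) B.a_comm[of "b x" "B.d e"] by (simp add: a_minus_def B.a_assoc B.r_neg)
    then show ?thesis using \<tau>(4) e(1) by (simp add: u_def)
  qed
  have dF: "B.d (F x y) = a (x *\<^sub>A.HA y) -\<^sub>B a x *\<^sub>B a y" if "x \<in> ?H" "y \<in> ?H" for x y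
    using that s2(1,2) s1(1) A.Z_closed A.H.m_closed \<psi> by (simp add: F_def a_def \<psi>_d[symmetric] \<psi>_minus)
  have dG: "B.d (G x y) = b (x *\<^sub>A.HA y) -\<^sub>B b x *\<^sub>B b y" if "x \<in> ?H" "y \<in> ?H" for x y
    using that t2(2) \<phi> by (simp add: G_def b_def)
  have add: "a (x +\<^sub>A.HA y) = a x +\<^sub>B a y" "b (x +\<^sub>A.HA y) = b x +\<^sub>B b y" if "x \<in> ?H" "y \<in> ?H" for x y
    using that s1(1,3) t1(3) \<phi> \<psi> A.Z_closed by (simp_all add: a_def b_def)
  have uadd: "u (x +\<^sub>A.HA y) = u x +\<^sub>B u y" if "x \<in> ?H" "y \<in> ?H" for x y
    using that ac bc by (simp add: u_def add \<tau>a[symmetric] a_minus_def B.minus_add B.a_ac)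
  have Fadd: "F (x +\<^sub>A.HA x') y = F x y +\<^sub>B F x' y" "F y (x +\<^sub>A.HA x') = F y x +\<^sub>B F y x'"
    "G (x +\<^sub>A.HA x') y = G x y +\<^sub>B G x' y" "G y (x +\<^sub>A.HA x') = G y x +\<^sub>B G y x'"
    if "x \<in> ?H" "x' \<in> ?H" "y \<in> ?H" for x x' y
    using that s2(1,3,4) t2(3,4) \<phi> \<psi> by (simp_all add: F_def G_def)
  have sm: "a (c \<cdot>\<^sub>A.HA x) = c \<cdot>\<^sub>B a x" "b (c \<cdot>\<^sub>A.HA x) = c \<cdot>\<^sub>B b x"
     if "c <: K" "x \<in> ?H" for c x
    using that s1(1,4) t1(4) \<phi> \<psi> A.Z_closed by (simp_all add: a_def b_def)
  have usm: "u (c \<cdot>\<^sub>A.HA x) = c \<cdot>\<^sub>B u x" if "c <: K" "x \<in> ?H" for c x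
    using that ac bc \<tau>(2) by (simp add: u_def sm a_minus_def B.smult_r_distr[symmetric] B.smult_r_minus[symmetric])
  have Fsm: "F (c \<cdot>\<^sub>A.HA x) y = c \<cdot>\<^sub>B F x y" "F x (c \<cdot>\<^sub>A.HA y) = c \<cdot>\<^sub>B F x y"
     "G (c \<cdot>\<^sub>A.HA x) y = c \<cdot>\<^sub>B G x y" "G x (c \<cdot>\<^sub>A.HA y) = c \<cdot>\<^sub>B G x y"
     if "c <: K" "x \<in> ?H" "y \<in> ?H" for c x y
    using that s2(1,5,6) t2(5,6) \<phi> \<psi> by (simp_all add: F_def G_def)
  have pt: "a x \<in> part B n" "b x \<in> part B n" "u x \<in> part B (n - 1)" if "x \<in> part A.HA n" for x n
  proof -
    show 1: "a x \<in> part B n" "b x \<in> part B n" using that s1(5) t1(5) \<phi>(3) \<psi>(3) by (simp_all add: a_def b_def)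
    show "u x \<in> part B (n - 1)"
      unfolding u_def a_minus_def using \<tau>(3) B.part_add[OF 1(1) B.part_minus[OF 1(2)]] by blast
  qed
  note cc = ac bc Fc Gc uc A.H.m_closed
  have wc: "w x y <: B" if "x \<in> ?H" "y \<in> ?H" for x y using that cc by (simp add: w_def)
  have wZ: "w x y \<in> B.Z" if xy: "x \<in> ?H" "y \<in> ?H" for x y
  proof (rule B.ZI[OF wc[OF xy]])
    have *: "(axy -\<^sub>B ax *\<^sub>B ay -\<^sub>B (bxy -\<^sub>B bx *\<^sub>B b'y)) +\<^sub>B
       (((ax -\<^sub>B bx) *\<^sub>B ay -\<^sub>B (axy -\<^sub>B bxy)) +\<^sub>B bx *\<^sub>B (ay -\<^sub>B b'y)) = 0\<^sub>B"
      if "ax <: B" "ay <: B" "axy <: B" "bx <: B" "b'y <: B" "bxy <: B"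
      for ax ay axy bx b'y bxy
      using that by algebra
    have "B.d (w x y) = (a (x *\<^sub>A.HA y) -\<^sub>B a x *\<^sub>B a y -\<^sub>B (b (x *\<^sub>A.HA y) -\<^sub>B b x *\<^sub>B b y)) +\<^sub>B
       (((a x -\<^sub>B b x) *\<^sub>B a y -\<^sub>B (a (x *\<^sub>A.HA y) -\<^sub>B b (x *\<^sub>A.HA y))) +\<^sub>B b x *\<^sub>B (a y -\<^sub>B b y))"
      unfolding w_def using xy cc aZ bZ
      by (simp add: B.d_add B.d_diff B.d_Z_mult B.d_mult_Z dF dG du)
    also have "\<dots> = 0\<^sub>B" by (rule *) (use xy cc in auto)
    finally show "B.d (w x y) = 0\<^sub>B" .
  qed
  define \<omega> where "\<omega> x y = B.cl (w x y)" for x y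
  have 1: "\<omega> x y <: B.HA" if "x \<in> ?H" "y \<in> ?H" for x y
    using wZ that by (simp add: \<omega>_def)
  have 2: "\<omega> (x +\<^sub>A.HA x') y = \<omega> x y +\<^sub>B.HA \<omega> x' y" "\<omega> y (x +\<^sub>A.HA x') = \<omega> y x +\<^sub>B.HA \<omega> y x'"
    if "x \<in> ?H" "x' \<in> ?H" "y \<in> ?H" for x x' y
  proof -
    have "w (x +\<^sub>A.HA x') y = w x y +\<^sub>B w x' y"
      unfolding w_def using that cc
      by (simp add: add uadd Fadd A.H.l_distr B.koszul_add B.l_distr B.r_distr a_minus_def B.minus_add B.a_ac)
    then show "\<omega> (x +\<^sub>A.HA x') y = \<omega> x y +\<^sub>B.HA \<omega> x' y" using that wc by (simp add: \<omega>_def B.HA_add)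
    have "w y (x +\<^sub>A.HA x') = w y x +\<^sub>B w y x'"
      unfolding w_def using that cc
      by (simp add: add uadd Fadd A.H.r_distr B.koszul_add B.l_distr B.r_distr a_minus_def B.minus_add B.a_ac)
    then show "\<omega> y (x +\<^sub>A.HA x') = \<omega> y x +\<^sub>B.HA \<omega> y x'" using that wc by (simp add: \<omega>_def B.HA_add)
  qed
  have 3: "\<omega> (c \<cdot>\<^sub>A.HA x) y = c \<cdot>\<^sub>B.HA \<omega> x y \<and> \<omega> x (c \<cdot>\<^sub>A.HA y) = c \<cdot>\<^sub>B.HA \<omega> x y"
    if "c <: K" "x \<in> ?H" "y \<in> ?H" for c x y
  proof -
    have "w (c \<cdot>\<^sub>A.HA x) y = c \<cdot>\<^sub>B w x y" "w x (c \<cdot>\<^sub>A.HA y) = c \<cdot>\<^sub>B w x y"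
      unfolding w_def using that cc
      by (simp_all add: sm usm Fsm B.koszul_smult A.H.smult_mult_left A.H.smult_mult_right B.smult_mult_left B.smult_mult_right
        a_minus_def B.smult_r_distr B.smult_r_minus)
    then show ?thesis using that wc by (simp add: \<omega>_def B.HA_smult)
  qed
  have 4: "\<omega> x y \<in> part B.HA (m + n - 1)" if xy: "x \<in> part A.HA m" "y \<in> part A.HA n" for x y m n
  proof -
    have H: "x \<in> ?H" "y \<in> ?H" using xy A.H.part_closed by blast+
    have p1: "F x y \<in> part B (m + n - 1)" using s2(7)[OF xy] \<psi>(3) by (simp add: F_def)
    have p2: "G x y \<in> part B (m + n - 1)" using t2(7)[OF \<phi>(3)[OF xy(1)] \<phi>(3)[OF xy(2)]] by (simp add: G_def)
    have p3: "u x *\<^sub>B a y \<in> part B (m + n - 1)"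
      using B.mult_part[OF pt(3)[OF xy(1)] pt(1)[OF xy(2)]] by (simp add: algebra_simps)
    have p4: "u (x *\<^sub>A.HA y) \<in> part B (m + n - 1)" using pt(3)[OF A.H.mult_part[OF xy]] .
    have p5: "koszul B 1 (b x) *\<^sub>B u y \<in> part B (m + n - 1)"
      using B.mult_part[OF B.koszul_part[OF pt(2)[OF xy(1)]] pt(3)[OF xy(2)]] by (simp add: algebra_simps)
    have "w x y \<in> part B (m + n - 1)" unfolding w_def a_minus_def
      by (intro B.part_add B.part_minus p1 p2 p3 p4 p5)
    then show ?thesis using wZ[OF H] by (auto simp: \<omega>_def B.part_HA)
  qed
  have 5: "\<phi> (m3 A f1 f2 x y z) = m3 B g1 g2 (\<phi> x) (\<phi> y) (\<phi> z) +\<^sub>B.HA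
         (((koszul B.HA 1 (\<phi> x) *\<^sub>B.HA \<omega> y z -\<^sub>B.HA \<omega> (x *\<^sub>A.HA y) z) +\<^sub>B.HA \<omega> x (y *\<^sub>A.HA z))
           -\<^sub>B.HA \<omega> x y *\<^sub>B.HA \<phi> z)"
    if H: "x \<in> ?H" "y \<in> ?H" "z \<in> ?H" for x y z
  proof -
    have H2: "x *\<^sub>A.HA y \<in> ?H" "y *\<^sub>A.HA z \<in> ?H" "x *\<^sub>A.HA y *\<^sub>A.HA z \<in> ?H" using H A.H.m_closed by auto
    \<comment> \<open>\<open>?P\<close> is the coboundary of \<open>F - G\<close>, \<open>?Q\<close>
      is what the double coboundary of \<open>u\<close> leaves, and \<open>?R\<close> is the error
      from exchanging \<open>a\<close> and \<open>b\<close>. Adding and subtracting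
      \<open>?Q\<close> completes \<open>?P\<close> to the coboundary \<open>?W\<close> of
      \<open>w\<close>, while \<open>?R - ?Q\<close> is exact.\<close>
    let ?e = "koszul B 1 (b x)" and ?f = "koszul B 1 (b y)" and ?g = "koszul B 1 (b (x *\<^sub>A.HA y))"
    let ?MB = "B.m3_rep g1 g2 (\<phi> x) (\<phi> y) (\<phi> z)"
    let ?W = "((?e *\<^sub>B w y z -\<^sub>B w (x *\<^sub>A.HA y) z) +\<^sub>B w x (y *\<^sub>A.HA z)) -\<^sub>B w x y *\<^sub>B a z"
    let ?P = "((?e *\<^sub>B (F y z -\<^sub>B G y z) -\<^sub>B (F (x *\<^sub>A.HA y) z -\<^sub>B G (x *\<^sub>A.HA y) z)) +\<^sub>B
       (F x (y *\<^sub>A.HA z) -\<^sub>B G x (y *\<^sub>A.HA z))) -\<^sub>B (F x y -\<^sub>B G x y) *\<^sub>B a z"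
    let ?Q = "(?e *\<^sub>B ?f -\<^sub>B ?g) *\<^sub>B u z +\<^sub>B u x *\<^sub>B (a (y *\<^sub>A.HA z) -\<^sub>B a y *\<^sub>B a z)"
    let ?R = "(koszul B 1 (a x) -\<^sub>B ?e) *\<^sub>B F y z -\<^sub>B G x y *\<^sub>B (a z -\<^sub>B b z)"
    have MBeq: "?MB = ((?e *\<^sub>B G y z -\<^sub>B G x y *\<^sub>B b z) -\<^sub>B G (x *\<^sub>A.HA y) z) +\<^sub>B G x (y *\<^sub>A.HA z)"
      using H \<phi> by (simp add: B.m3_rep_def G_def b_def)
    have MBZ: "?MB \<in> B.Z" by (rule B.m3_rep_Z[OF g1 g2]) (use H \<phi> in auto)
    have "\<psi> (A.m3_rep f1 f2 x y z) = ((koszul B 1 (a x) *\<^sub>B F y z -\<^sub>B F x y *\<^sub>B a z) -\<^sub>B F (x *\<^sub>A.HA y) z) +\<^sub>B F x (y *\<^sub>A.HA z)"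
      using H H2 \<psi> s1(1) A.Z_closed s2(1)
      by (simp add: A.m3_rep_def F_def a_def \<psi>_minus \<psi>_koszul)
    also have "\<dots> = (?MB +\<^sub>B ?P) +\<^sub>B ?R"
      unfolding MBeq by (rule B.compare_FG) (use H H2 cc in auto)
    also have "\<dots> = (?MB +\<^sub>B (?P +\<^sub>B ?Q)) +\<^sub>B (?R -\<^sub>B ?Q)"
      by (rule B.compare_collect) (use H H2 cc B.Z_closed[OF MBZ] in auto)
    also have "?P +\<^sub>B ?Q = ?W"
    proof -
      have ass: "x *\<^sub>A.HA (y *\<^sub>A.HA z) = x *\<^sub>A.HA y *\<^sub>A.HA z" using H by (simp add: A.H.m_assoc)
      have 1: "?W = ?P +\<^sub>B (((?e *\<^sub>B ((u y *\<^sub>B a z -\<^sub>B u (y *\<^sub>A.HA z)) +\<^sub>B ?f *\<^sub>B u z)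
         -\<^sub>B ((u (x *\<^sub>A.HA y) *\<^sub>B a z -\<^sub>B u (x *\<^sub>A.HA y *\<^sub>A.HA z)) +\<^sub>B ?g *\<^sub>B u z))
         +\<^sub>B ((u x *\<^sub>B a (y *\<^sub>A.HA z) -\<^sub>B u (x *\<^sub>A.HA y *\<^sub>A.HA z)) +\<^sub>B ?e *\<^sub>B u (y *\<^sub>A.HA z)))
         -\<^sub>B ((u x *\<^sub>B a y -\<^sub>B u (x *\<^sub>A.HA y)) +\<^sub>B ?e *\<^sub>B u y) *\<^sub>B a z)" (is "_ = _ +\<^sub>B ?X")
        unfolding w_def ass by (rule B.compare_split) (simp_all add: H H2 cc)
      have 2: "?X = ?Q" by (rule B.compare_U[where ux="u x" and uy="u y" and uz="u z"
          and uxy="u (x *\<^sub>A.HA y)" and uyz="u (y *\<^sub>A.HA z)" and uxyz="u (x *\<^sub>A.HA y *\<^sub>A.HA z)"]) (rule H H2 cc B.koszul_closed)+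
      show ?thesis unfolding 1 2 ..
    qed
    also have "?R -\<^sub>B ?Q = B.d (-\<^sub>B (koszul B 1 (u x) *\<^sub>B F y z) -\<^sub>B koszul B 1 (G x y) *\<^sub>B u z)" (is "_ = B.d ?E")
    proof -
      have e1: "koszul B 1 (a x) -\<^sub>B ?e = koszul B 1 (B.d (u x))" using H cc by (simp add: du B.koszul_diff)
      have e2: "a z -\<^sub>B b z = B.d (u z)" using H by (simp add: du)
      have e3: "?e *\<^sub>B ?f -\<^sub>B ?g = -\<^sub>B koszul B 1 (B.d (G x y))"
        using H H2 cc by (simp add: dG B.koszul_add B.koszul_minus B.koszul_mult a_minus_def B.minus_add B.a_comm)
      have e4: "a (y *\<^sub>A.HA z) -\<^sub>B a y *\<^sub>B a z = B.d (F y z)" using H by (simp add: dF)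
      show ?thesis unfolding e1 e2 e3 e4 by (rule B.compare_error) (use H cc in auto)
    qed
    finally have eq: "\<psi> (A.m3_rep f1 f2 x y z) = (?MB +\<^sub>B ?W) +\<^sub>B B.d ?E" .
    have WZ: "?W \<in> B.Z" "w x y *\<^sub>B a z \<in> B.Z" "?e *\<^sub>B w y z \<in> B.Z"
      by (intro B.Z_koszul B.Z_mult B.Z_diff B.Z_add wZ aZ bZ H H2)+
    have "\<phi> (m3 A f1 f2 x y z) = B.cl (\<psi> (A.m3_rep f1 f2 x y z))"
      unfolding A.m3_eq by (rule \<phi>_cl[OF A.m3_rep_Z[OF f1 f2 H]])
    also have "\<dots> = B.cl (?MB +\<^sub>B ?W)"
    proof (rule B.cl_eqI[OF _ _ _ eq])
      show "\<psi> (A.m3_rep f1 f2 x y z) <: B" by (rule \<psi>(4)[OF A.Z_closed[OF A.m3_rep_Z[OF f1 f2 H]]])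
      show "?MB +\<^sub>B ?W <: B" by (rule B.a_closed[OF B.Z_closed[OF MBZ] B.Z_closed[OF WZ(1)]])
      show "?E <: B" using H cc by simp
    qed
    also have "\<dots> = B.cl ?MB +\<^sub>B.HA B.cl ?W" by (rule B.HA_add[symmetric, OF B.Z_closed[OF MBZ] B.Z_closed[OF WZ(1)]])
    also have "B.cl ?W = (((B.cl ?e *\<^sub>B.HA \<omega> y z -\<^sub>B.HA \<omega> (x *\<^sub>A.HA y) z) +\<^sub>B.HA \<omega> x (y *\<^sub>A.HA z))
           -\<^sub>B.HA \<omega> x y *\<^sub>B.HA B.cl (a z))"
    proof -
      have z: "w y z \<in> B.Z" "w (x *\<^sub>A.HA y) z \<in> B.Z" "w x (y *\<^sub>A.HA z) \<in> B.Z" "w x y \<in> B.Z" "a z \<in> B.Z" "?e \<in> B.Z"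
        by (intro wZ aZ bZ B.Z_koszul H H2)+
      show ?thesis unfolding \<omega>_def
        using z B.Z_mult[OF z(6,1)] B.Z_mult[OF z(4,5)] B.Z_diff[OF B.Z_mult[OF z(6,1)] z(2)]
          B.Z_add[OF B.Z_diff[OF B.Z_mult[OF z(6,1)] z(2)] z(3)] B.Z_closed
        by (simp add: B.HA_mult B.HA_add B.HA_diff)
    qed
    also have "B.cl ?e = koszul B.HA 1 (\<phi> x)" using B.koszul_HA[OF bZ[OF H(1)]] clb[OF H(1)] by simp
    also have "B.cl (a z) = \<phi> z" using cla H by simp
    finally show ?thesis unfolding B.m3_eq .
  qed
  show ?thesis
    by (intro exI[of _ \<omega>] conjI ballI allI) (simp_all only: 1 2 3 4 5)
qed

end

lemma cohomology_map_id:
  assumes "dg_algebra K A"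
  shows "dg_map K A A id" "X <: cohomology A ==> cohomology_map A A id X = X"
proof -
  interpret dg_algebra K A by fact
  have "dg_hom K A A id" by (simp add: dg_hom_def graded_alg_hom_def ring_hom_def)
  then show 1: "dg_map K A A id" using assms by (simp add: dg_map_def dg_map_axioms_def)
  show "X <: cohomology A ==> cohomology_map A A id X = X"
    using dg_map.\<phi>_cl[OF 1] by (auto elim!: HA_cases)
qed

section \<open>The bar construction\<close>

text \<open>Multilinear maps can be pulled back along such an \<open>F\<close>. The slot that is
  affected depends on \<open>j\<close> alone, whereas the linear map acting there may depend on the
  other entries, as it does when neighbours are multiplied.\<close>

definition slotwise :: "('k, 'p) ring_scheme => ('k, 'a, 'y) module_scheme => ('k, 'b, 'z) module_scheme
    => nat => nat => ('a list => 'b list) => bool" where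
  "slotwise K L L' n m F \<longleftrightarrow> (\<forall>xs\<in>words L n. F xs \<in> words L' m) \<and>
     (\<forall>j < n. \<exists>k < m. \<forall>xs\<in>words L n. \<exists>g. g \<in> hom (add_monoid L) (add_monoid L') \<and>
        (\<forall>c\<in>carrier K. \<forall>x\<in>carrier L. g (c \<cdot>\<^sub>L x) = c \<cdot>\<^sub>L' g x) \<and>
        (\<forall>x\<in>carrier L. F (xs[j := x]) = (F xs)[k := g x]))"

lemma slotwiseI:
  assumes "!!xs. xs \<in> words L n ==> F xs \<in> words L' m"
    "!!j. j < n ==> k j < m"
    "!!j xs. [|j < n; xs \<in> words L n|] ==> g j xs \<in> hom (add_monoid L) (add_monoid L')"
    "!!j xs c x. [|j < n; xs \<in> words L n; c <: K; x <: L|] ==> g j xs (c \<cdot>\<^sub>L x) = c \<cdot>\<^sub>L' g j xs x"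
    "!!j xs x. [|j < n; xs \<in> words L n; x <: L|] ==> F (xs[j := x]) = (F xs)[k j := g j xs x]"
  shows "slotwise K L L' n m F"
  unfolding slotwise_def
proof (intro conjI ballI allI impI)
  show "F xs \<in> words L' m" if "xs \<in> words L n" for xs using assms(1)[OF that] .
  show "\<exists>k<m. \<forall>xs\<in>words L n. \<exists>g. g \<in> hom (add_monoid L) (add_monoid L') \<and>
        (\<forall>c\<in>carrier K. \<forall>x\<in>carrier L. g (c \<cdot>\<^sub>L x) = c \<cdot>\<^sub>L' g x) \<and>
        (\<forall>x\<in>carrier L. F (xs[j := x]) = (F xs)[k := g x])" if "j < n" for j
  proof (intro exI[of _ "k j"] conjI ballI)
    show "k j < m" using assms(2)[OF that] .
    fix xs assume xs: "xs \<in> words L n"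
    show "\<exists>g. g \<in> hom (add_monoid L) (add_monoid L') \<and>
        (\<forall>c\<in>carrier K. \<forall>x\<in>carrier L. g (c \<cdot>\<^sub>L x) = c \<cdot>\<^sub>L' g x) \<and>
        (\<forall>x\<in>carrier L. F (xs[j := x]) = (F xs)[k j := g x])"
      using assms(3-5)[OF that xs] by (intro exI[of _ "g j xs"] conjI ballI)
  qed
qed

text \<open>A scalar in any slot of the word becomes a scalar in some slot of \<open>F xs\<close>,
  and \<open>h\<close> allows it to be moved between those slots.\<close>

lemma multilinear_slotwise:
  assumes h: "multilinear K L' m H h" and F: "slotwise K L L' n m F"
    and sm: "!!c x. [|c <: K; x <: L|] ==> c \<cdot>\<^sub>L x <: L"
    and ad: "!!x y. [|x <: L; y <: L|] ==> x +\<^sub>L y <: L"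
  shows "multilinear K L n H (%xs. h (F xs))"
proof (rule multilinearI)
  note hD = multilinearD[OF h]
  have Fw: "xs \<in> words L n ==> F xs \<in> words L' m" for xs using F unfolding slotwise_def by blast
  have slot: "\<exists>k g. k < m \<and> g \<in> hom (add_monoid L) (add_monoid L') \<and>
        (\<forall>c\<in>carrier K. \<forall>x\<in>carrier L. g (c \<cdot>\<^sub>L x) = c \<cdot>\<^sub>L' g x) \<and>
        (\<forall>x\<in>carrier L. F (xs[j := x]) = (F xs)[k := g x])" if "j < n" "xs \<in> words L n" for j xs
    using F that unfolding slotwise_def by blast
  show "h (F xs) <: H" if "xs \<in> words L n" for xs using hD(1)[OF Fw[OF that]] .
  show "h (F (xs[i := x +\<^sub>L y])) = h (F (xs[i := x])) *\<^sub>H h (F (xs[i := y]))"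
    if w: "xs \<in> words L n" "i < n" "x <: L" "y <: L" for xs i x y
  proof -
    obtain k g where g: "k < m" "g \<in> hom (add_monoid L) (add_monoid L')"
        "\<forall>x\<in>carrier L. F (xs[i := x]) = (F xs)[k := g x]" using slot[OF w(2,1)] by blast
    have "g x <: L'" "g y <: L'" "g (x +\<^sub>L y) = g x +\<^sub>L' g y"
      using hom_closed[OF g(2), of x] hom_closed[OF g(2), of y] hom_mult[OF g(2), of x y] w by auto
    then show ?thesis using g(3) w(3,4) ad[OF w(3,4)] hD(2)[OF Fw[OF w(1)] g(1), of "g x" "g y"] by simp
  qed
  have scale: "\<exists>k < m. h (F (xs[i := c \<cdot>\<^sub>L xs ! i])) = h ((F xs)[k := c \<cdot>\<^sub>L' F xs ! k])"
    if w: "xs \<in> words L n" "i < n" "c <: K" for xs i c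
  proof -
    obtain k g where g: "k < m" "\<forall>c\<in>carrier K. \<forall>x\<in>carrier L. g (c \<cdot>\<^sub>L x) = c \<cdot>\<^sub>L' g x"
        "\<forall>x\<in>carrier L. F (xs[i := x]) = (F xs)[k := g x]" using slot[OF w(2,1)] by blast
    have xi: "xs ! i <: L" using words_nth[OF w(1,2)] .
    have "F xs = (F xs)[k := g (xs ! i)]" using g(3) xi by (metis list_update_id)
    then have "F xs ! k = g (xs ! i)" using g(1) words_length[OF Fw[OF w(1)]] by (metis nth_list_update_eq)
    then show ?thesis using g xi w sm[OF w(3) xi] by auto
  qed
  show "h (F (xs[i := c \<cdot>\<^sub>L xs ! i])) = h (F (xs[j := c \<cdot>\<^sub>L xs ! j]))"
    if w: "xs \<in> words L n" "i < n" "j < n" "c <: K" for xs i j c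
  proof -
    obtain k where k: "k < m" "h (F (xs[i := c \<cdot>\<^sub>L xs ! i])) = h ((F xs)[k := c \<cdot>\<^sub>L' F xs ! k])"
      using scale[OF w(1,2,4)] by blast
    obtain l where l: "l < m" "h (F (xs[j := c \<cdot>\<^sub>L xs ! j])) = h ((F xs)[l := c \<cdot>\<^sub>L' F xs ! l])"
      using scale[OF w(1,3,4)] by blast
    show ?thesis unfolding k(2) l(2) by (rule hD(3)[OF Fw[OF w(1)] k(1) l(1) w(4)])
  qed
qed

lemma multiply_at_words:
  assumes "xs \<in> words L (Suc n)" "i < n" "ring L"
  shows "multiply_at L i xs \<in> words L n"
proof -
  interpret ring L by fact
  have "xs ! i <: L" "xs ! Suc i <: L"
    using words_nth[OF assms(1), of i] words_nth[OF assms(1), of "Suc i"] assms(2) by auto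
  moreover have "length xs = Suc n" using words_length[OF assms(1)] .
  moreover have "set (take i xs) \<subseteq> carrier L" "set (drop (Suc (Suc i)) xs) \<subseteq> carrier L"
    using assms(1) set_take_subset set_drop_subset unfolding words_def by fast+
  ultimately show ?thesis using assms(2) by (auto simp: words_def multiply_at_def)
qed

lemma nth_multiply_at:
  assumes "length xs = Suc n" "i < n" "j < n"
  shows "multiply_at L i xs ! j = (if j < i then xs ! j else if j = i then xs ! i *\<^sub>L xs ! Suc i else xs ! Suc j)"
  using assms by (auto simp: multiply_at_def nth_append nth_Cons split: nat.split) (metis add_Suc_right add_diff_inverse_nat diff_Suc_eq_diff_pred diff_is_0_eq' nat_less_le not_less_eq old.nat.exhaust)

lemma length_multiply_at: "[|length xs = Suc n; i < n|] ==> length (multiply_at L i xs) = n"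
  by (simp add: multiply_at_def)

context graded_algebra
begin

lemma tp: "tensor_powers K A"
  using module_axioms by (simp add: tensor_powers_def)

lemma ring_A: "ring A"
  using field_algebra_axioms by (simp add: field_algebra_def)

lemmas pure_closed = tensor_powers.pure_word_closed[OF tp]

lemma multilinear_comp:
  assumes "multilinear K L' m H h" "slotwise K A L' n m F"
  shows "multilinear K A n H (%xs. h (F xs))"
  by (rule multilinear_slotwise[OF assms]) auto

lemma slotwise_update:
  assumes g: "g \<in> hom addA addA" "!!c x. [|c <: K; x <: A|] ==> g (c \<cdot>\<^sub>A x) = c \<cdot>\<^sub>A g x" and k: "k < n"
  shows "slotwise K A A n n (%xs. xs[k := g (xs ! k)])"
proof (rule slotwiseI[where k="%j. j" and g="%j xs. if j = k then g else (%x. x)"])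
  show "xs[k := g (xs ! k)] \<in> words A n" if "xs \<in> words A n" for xs
    using words_update[OF that] hom_closed[OF g(1)] words_nth[OF that k] by simp
  show "(xs[j := x])[k := g (xs[j := x] ! k)] = (xs[k := g (xs ! k)])[j := (if j = k then g else (%x. x)) x]"
    if "j < n" "xs \<in> words A n" "x <: A" for j xs x
    using that words_length[OF that(2)] by (auto simp: list_update_swap)
qed (use g in \<open>auto simp: hom_def\<close>)

lemma slotwise_multiply:
  assumes i: "i < n"
  shows "slotwise K A A (Suc n) n (multiply_at A i)"
\<comment> \<open>Slots \<open>i\<close> and \<open>Suc i\<close> are merged into slot
  \<open>i\<close>, and all later slots move down by one.\<close>
proof (rule slotwiseI[where k="%j. if j \<le> i then j else j - 1"
      and g="%j xs. if j = i then (%x. x *\<^sub>A xs ! Suc i) else if j = Suc i then (%x. xs ! i *\<^sub>A x) else (%x. x)"])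
  show "multiply_at A i xs \<in> words A n" if "xs \<in> words A (Suc n)" for xs
    using multiply_at_words[OF that i ring_A] .
  fix j xs assume j: "j < Suc n" and xs: "xs \<in> words A (Suc n)"
  have c: "xs ! i <: A" "xs ! Suc i <: A" using words_nth[OF xs] i by auto
  show "(if j = i then (%x. x *\<^sub>A xs ! Suc i) else if j = Suc i then (%x. xs ! i *\<^sub>A x) else (%x. x)) \<in> hom addA addA"
    using mult_hom c by (auto simp: hom_def)
  have len: "length xs = Suc n" using words_length[OF xs] .
  fix x assume x: "x <: A"
  show "multiply_at A i (xs[j := x]) = (multiply_at A i xs)[(if j \<le> i then j else j - 1) :=
      (if j = i then (%x. x *\<^sub>A xs ! Suc i) else if j = Suc i then (%x. xs ! i *\<^sub>A x) else (%x. x)) x]"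
  proof (rule nth_equalityI)
    show "length (multiply_at A i (xs[j := x])) = length ((multiply_at A i xs)[(if j \<le> i then j else j - 1) :=
      (if j = i then (%x. x *\<^sub>A xs ! Suc i) else if j = Suc i then (%x. xs ! i *\<^sub>A x) else (%x. x)) x])"
      using length_multiply_at[of "xs[j := x]" n i A] length_multiply_at[of xs n i A] len i by simp
    fix l assume "l < length (multiply_at A i (xs[j := x]))"
    then have l: "l < n" using length_multiply_at[of "xs[j := x]" n i A] len i by simp
    have len2: "length (multiply_at A i xs) = n" using length_multiply_at[OF len i] .
    show "multiply_at A i (xs[j := x]) ! l = (multiply_at A i xs)[(if j \<le> i then j else j - 1) :=
      (if j = i then (%x. x *\<^sub>A xs ! Suc i) else if j = Suc i then (%x. xs ! i *\<^sub>A x) else (%x. x)) x] ! l"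
      using l i j len len2 nth_multiply_at[of "xs[j := x]" n i l A] nth_multiply_at[of xs n i l A]
      by (auto simp: nth_list_update)
  qed
next
  fix j xs c x
  assume j: "j < Suc n" and xs: "xs \<in> words A (Suc n)" and cx: "c <: K" "x <: A"
  have "xs ! i <: A" "xs ! Suc i <: A" using words_nth[OF xs] i by auto
  then show "(if j = i then (%x. x *\<^sub>A xs ! Suc i) else if j = Suc i then (%x. xs ! i *\<^sub>A x) else (%x. x)) (c \<cdot>\<^sub>A x) =
     c \<cdot>\<^sub>A (if j = i then (%x. x *\<^sub>A xs ! Suc i) else if j = Suc i then (%x. xs ! i *\<^sub>A x) else (%x. x)) x"
    using cx by (auto simp: smult_mult_left smult_mult_right)
qed (use i in auto)

lemma slotwise_append_one: "slotwise K A A n (Suc n) (%xs. xs @ [1\<^sub>A])"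
  by (rule slotwiseI[where k="%j. j" and g="%j xs x. x"])
     (auto simp: words_def hom_def list_update_append)

end

lemma bar_simps [simp]:
  "carrier (bar K L n) = carrier (tensor_power K L (Suc (Suc n)))"
  "mult (bar K L n) = mult (tensor_power K L (Suc (Suc n)))"
  "one (bar K L n) = one (tensor_power K L (Suc (Suc n)))"
  "m_inv (bar K L n) = m_inv (tensor_power K L (Suc (Suc n)))"
  "signed (bar K L n) = signed (tensor_power K L (Suc (Suc n)))"
proof -
  show 1: "m_inv (bar K L n) = m_inv (tensor_power K L (Suc (Suc n)))"
    by (rule m_inv_cong) (simp_all add: bar_def)
  show "signed (bar K L n) = signed (tensor_power K L (Suc (Suc n)))" by (simp add: signed_def fun_eq_iff 1)
qed (simp_all add: bar_def)

lemma hom_bar [simp]: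
  "hom (bar K L n) H = hom (tensor_power K L (Suc (Suc n))) H"
  "hom H (bar K L n) = hom H (tensor_power K L (Suc (Suc n)))"
  by (simp_all add: hom_def)

lemma bar_lact: "lact (bar K L n) a = word_lift K L (Suc (Suc n)) (tensor_power K L (Suc (Suc n)))
      (%xs. pure_word K L (Suc (Suc n)) (xs[0 := a *\<^sub>L xs ! 0]))"
  and bar_ract: "ract (bar K L n) u a = word_lift K L (Suc (Suc n)) (tensor_power K L (Suc (Suc n)))
      (%xs. pure_word K L (Suc (Suc n)) (xs[Suc n := xs ! Suc n *\<^sub>L a])) u"
  and bar_gr: "gr (bar K L n) t = generate (tensor_power K L (Suc (Suc n)))
                  {pure_word K L (Suc (Suc n)) xs | xs. length xs = Suc (Suc n) \<and>
                     (\<exists>e. (\<forall>i < Suc (Suc n). xs ! i \<in> part L (e i)) \<and> (\<Sum>i < Suc (Suc n). e i) = t)}"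
  by (simp_all add: bar_def)

text \<open>Bimodules on which scalars act alike from both sides are the modules over the enveloping
  algebra \<open>T^op \<otimes> T\<close> formed over \<open>K\<close>.\<close>

definition central_bimodule :: "('k, 'p) ring_scheme => ('k, 't, 'y) module_scheme => ('t, 'm, 't, 'z) bimod_scheme => bool" where
  "central_bimodule K T N \<longleftrightarrow> bimodule T T N \<and>
     (\<forall>c\<in>carrier K. \<forall>m\<in>carrier N. lact N (c \<cdot>\<^sub>T 1\<^sub>T) m = ract N m (c \<cdot>\<^sub>T 1\<^sub>T))"

lemma central_bimoduleD:
  assumes "central_bimodule K T N"
  shows "bimodule T T N" "left_module T N" "right_module T N"
    "[|c <: K; m <: N|] ==> lact N (c \<cdot>\<^sub>T 1\<^sub>T) m = ract N m (c \<cdot>\<^sub>T 1\<^sub>T)"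
  using assms by (auto simp: central_bimodule_def bimodule_def)

context graded_algebra
begin

lemma bar_act_multilinear:
  assumes "a <: A"
  shows "multilinear K A (Suc (Suc n)) (tensor_power K A (Suc (Suc n)))
      (%xs. pure_word K A (Suc (Suc n)) (xs[0 := a *\<^sub>A xs ! 0]))"
    "multilinear K A (Suc (Suc n)) (tensor_power K A (Suc (Suc n)))
      (%xs. pure_word K A (Suc (Suc n)) (xs[Suc n := xs ! Suc n *\<^sub>A a]))"
  by (rule multilinear_comp[OF tensor_powers.pure_multilinear[OF tp] slotwise_update];
      use assms mult_hom in \<open>auto simp: smult_mult_left smult_mult_right\<close>)+

lemma bar_comm_group: "comm_group (bar K A n)"
  by (rule comm_group_cong[OF _ _ _ tensor_powers.comm_group_power[OF tp]]) auto

lemma bar_group: "group (tensor_power K A n)"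
  by (rule tensor_powers.group_power[OF tp])

lemma bar_lact_hom: "a <: A ==> lact (bar K A n) a \<in> hom (tensor_power K A (Suc (Suc n))) (tensor_power K A (Suc (Suc n)))"
  unfolding bar_lact
  by (rule tensor_powers.word_lift_hom[OF tp tensor_powers.comm_group_power[OF tp] bar_act_multilinear(1)])

lemma bar_ract_hom: "a <: A ==> (%u. ract (bar K A n) u a) \<in> hom (tensor_power K A (Suc (Suc n))) (tensor_power K A (Suc (Suc n)))"
  unfolding bar_ract
  using tensor_powers.word_lift_hom[OF tp tensor_powers.comm_group_power[OF tp] bar_act_multilinear(2)] by simp

lemma bar_lact_pure: "[|a <: A; xs \<in> words A (Suc (Suc n))|] ==>
    lact (bar K A n) a (pure_word K A (Suc (Suc n)) xs) = pure_word K A (Suc (Suc n)) (xs[0 := a *\<^sub>A xs ! 0])"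
  unfolding bar_lact
  by (rule tensor_powers.word_lift_pure[OF tp tensor_powers.comm_group_power[OF tp] bar_act_multilinear(1)])

lemma bar_ract_pure: "[|a <: A; xs \<in> words A (Suc (Suc n))|] ==>
    ract (bar K A n) (pure_word K A (Suc (Suc n)) xs) a = pure_word K A (Suc (Suc n)) (xs[Suc n := xs ! Suc n *\<^sub>A a])"
  unfolding bar_ract
  by (rule tensor_powers.word_lift_pure[OF tp tensor_powers.comm_group_power[OF tp] bar_act_multilinear(2)])

lemma central_bar: "central_bimodule K A (bar K A n)"
proof -
  let ?B = "bar K A n" and ?n = "Suc (Suc n)"
  let ?G = "tensor_power K A ?n"
  note G = bar_group[of ?n] and cgG = tensor_powers.comm_group_power[OF tp, of ?n]
  note eqI = tensor_powers.hom_eqI[OF tp, of _ ?n ?G]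
  note ml = multilinearD[OF tensor_powers.pure_multilinear[OF tp, of ?n]]
  have wu: "xs[i := x] \<in> words A ?n" if "xs \<in> words A ?n" "x <: A" for xs i x using words_update[OF that] .
  have w0: "xs ! 0 <: A" "xs ! Suc n <: A" if "xs \<in> words A ?n" for xs using words_nth[OF that] by auto
  have len: "xs \<in> words A ?n ==> length xs = ?n" for xs by (rule words_length)
  have hom: "(%u. lact ?B a u *\<^sub>?G lact ?B b u) \<in> hom ?G ?G" if "a <: A" "b <: A" for a b
    using that by (intro hom_prod cgG bar_lact_hom)
  have hom': "(%u. ract ?B u a *\<^sub>?G ract ?B u b) \<in> hom ?G ?G" if "a <: A" "b <: A" for a b
    using that by (intro hom_prod cgG bar_ract_hom)
  have id: "(%u. u) \<in> hom ?G ?G" by (simp add: hom_def)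
  have 1: "lact ?B (r +\<^sub>A s) m = lact ?B r m *\<^sub>?G lact ?B s m"
    if "r <: A" "s <: A" "m <: ?G" for r s m
    by (rule eqI[OF bar_lact_hom hom G _ that(3)]) (use that w0 in \<open>simp_all add: bar_lact_pure l_distr ml(2)\<close>)
  have 2: "lact ?B (r *\<^sub>A s) m = lact ?B r (lact ?B s m)"
    if "r <: A" "s <: A" "m <: ?G" for r s m
    by (rule eqI[OF bar_lact_hom hom_comp[OF bar_lact_hom bar_lact_hom] G _ that(3)])
       (use that w0 wu len in \<open>simp_all add: bar_lact_pure m_assoc\<close>)
  have 3: "lact ?B 1\<^sub>A m = m" if "m <: ?G" for m
    by (rule eqI[OF bar_lact_hom id G _ that]) (use that w0 in \<open>simp_all add: bar_lact_pure\<close>)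
  have 4: "ract ?B m (r +\<^sub>A s) = ract ?B m r *\<^sub>?G ract ?B m s"
    if "r <: A" "s <: A" "m <: ?G" for r s m
    by (rule eqI[OF bar_ract_hom hom' G _ that(3)]) (use that w0 in \<open>simp_all add: bar_ract_pure r_distr ml(2)\<close>)
  have 5: "ract ?B m (r *\<^sub>A s) = ract ?B (ract ?B m r) s"
    if "r <: A" "s <: A" "m <: ?G" for r s m
    by (rule eqI[OF bar_ract_hom hom_comp[OF bar_ract_hom bar_ract_hom] G _ that(3)])
       (use that w0 wu len in \<open>simp_all add: bar_ract_pure m_assoc\<close>)
  have 6: "ract ?B m 1\<^sub>A = m" if "m <: ?G" for m
    by (rule eqI[OF bar_ract_hom id G _ that]) (use that w0 in \<open>simp_all add: bar_ract_pure\<close>)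
  have 7: "lact ?B a (ract ?B m b) = ract ?B (lact ?B a m) b"
    if "a <: A" "b <: A" "m <: ?G" for a b m
    by (rule eqI[OF hom_comp[OF bar_ract_hom bar_lact_hom] hom_comp[OF bar_lact_hom bar_ract_hom] G _ that(3)])
       (use that w0 wu len in \<open>simp_all add: bar_lact_pure bar_ract_pure list_update_swap\<close>)
  \<comment> \<open>Inside the tensor power a scalar moves from the first slot to the last.\<close>
  have 8: "lact ?B (c \<cdot>\<^sub>A 1\<^sub>A) m = ract ?B m (c \<cdot>\<^sub>A 1\<^sub>A)" if "c <: K" "m <: ?G" for c m
    by (rule eqI[OF bar_lact_hom bar_ract_hom G _ that(2)])
       (use that w0 ml(3)[of _ 0 "Suc n" c] in \<open>simp_all add: bar_lact_pure bar_ract_pure smult_one_mult mult_smult_one\<close>)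
  show ?thesis
    unfolding central_bimodule_def bimodule_def left_module_def right_module_def
    using bar_comm_group 1 2 3 4 5 6 7 8 hom_closed[OF bar_lact_hom] hom_closed[OF bar_ract_hom]
      hom_mult[OF bar_lact_hom] hom_mult[OF bar_ract_hom] by simp
qed

end

section \<open>Twisted bimodule maps\<close>

text \<open>The sign rule of a map of degree \<open>e\<close>, without the condition that the map be homogeneous.\<close>

definition twisted :: "('l, 'y) ring_scheme => ('k, 't, 'z) graded_alg_scheme => ('l => 't) => int
    => ('l, 'm, 'l, 'u) bimod_scheme => ('t, 'n, 't, 'v) bimod_scheme => ('m => 'n) set" where
  "twisted R T \<phi> e M N = {f \<in> hom M N. \<forall>a\<in>carrier R. \<forall>m\<in>carrier M.
     f (lact M a m) = lact N (koszul T e (\<phi> a)) (f m) \<and> f (ract M m a) = ract N (f m) (\<phi> a)}"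

lemma twistedI:
  assumes "f \<in> hom M N" "!!a m. [|a <: R; m <: M|] ==> f (lact M a m) = lact N (koszul T e (\<phi> a)) (f m)"
    "!!a m. [|a <: R; m <: M|] ==> f (ract M m a) = ract N (f m) (\<phi> a)"
  shows "f \<in> twisted R T \<phi> e M N"
  using assms by (simp add: twisted_def)

lemma twistedD:
  assumes "f \<in> twisted R T \<phi> e M N"
  shows "f \<in> hom M N" "[|a <: R; m <: M|] ==> f (lact M a m) = lact N (koszul T e (\<phi> a)) (f m)"
    "[|a <: R; m <: M|] ==> f (ract M m a) = ract N (f m) (\<phi> a)"
    "m <: M ==> f m <: N"
    "[|m <: M; m' <: M|] ==> f (m *\<^sub>M m') = f m *\<^sub>N f m'"
  using assms by (auto simp: twisted_def hom_def)

lemma (in graded_algebra) twisted_comp: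
  assumes f: "f \<in> twisted R A \<phi> e M N" and g: "g \<in> twisted A A id e' N P" and \<phi>: "!!a. a <: R ==> \<phi> a <: A"
  shows "(%x. g (f x)) \<in> twisted R A \<phi> (e' + e) M P"
  by (rule twistedI) (use \<phi> twistedD[OF f] twistedD[OF g] hom_comp[OF twistedD(1)[OF f] twistedD(1)[OF g]] in
      \<open>auto simp: koszul_koszul\<close>)

lemma (in graded_algebra) twisted_precomp:
  assumes f: "f \<in> twisted A A id 0 M M'" and g: "g \<in> twisted A T \<phi> e M' N"
  shows "(%x. g (f x)) \<in> twisted A T \<phi> e M N"
  by (rule twistedI) (use twistedD[OF f] twistedD[OF g] hom_comp[OF twistedD(1)[OF f] twistedD(1)[OF g]] in
      \<open>auto simp: koszul_0\<close>)

lemma (in graded_algebra) twisted_mult: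
  assumes N: "bimodule A A N" and f: "f \<in> twisted R A \<phi> e M N" and g: "g \<in> twisted R A \<phi> e M N"
    and \<phi>: "!!a. a <: R ==> \<phi> a <: A"
  shows "(%x. f x *\<^sub>N g x) \<in> twisted R A \<phi> e M N"
  by (rule twistedI)
     (use \<phi> twistedD[OF f] twistedD[OF g] hom_prod[OF lm_comm_group[OF bimodule_left[OF N]] twistedD(1)[OF f] twistedD(1)[OF g]]
       lm_dist[OF bimodule_left[OF N]] rm_dist[OF bimodule_right[OF N]] in auto)

lemma (in graded_algebra) twisted_inv:
  assumes N: "bimodule A A N" and f: "f \<in> twisted R A \<phi> e M N"
    and \<phi>: "!!a. a <: R ==> \<phi> a <: A"
  shows "(%x. inv\<^bsub>N\<^esub> (f x)) \<in> twisted R A \<phi> e M N"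
proof (rule twistedI)
  note G = lm_group[OF bimodule_left[OF N]]
  show "(%x. inv\<^bsub>N\<^esub> (f x)) \<in> hom M N"
    by (rule hom_inverse[OF lm_comm_group[OF bimodule_left[OF N]] twistedD(1)[OF f]])
  fix a m assume a: "a <: R" "m <: M"
  have c: "\<phi> a <: A" "koszul A e (\<phi> a) <: A" "f m <: N" using \<phi> a twistedD(4)[OF f] by auto
  show "inv\<^bsub>N\<^esub> f (lact M a m) = lact N (koszul A e (\<phi> a)) (inv\<^bsub>N\<^esub> f m)"
    using twistedD(2)[OF f a] hom_inv[OF lm_hom[OF bimodule_left[OF N] c(2)] G G c(3)] by simp
  show "inv\<^bsub>N\<^esub> f (ract M m a) = ract N (inv\<^bsub>N\<^esub> f m) (\<phi> a)"
    using twistedD(3)[OF f a] hom_inv[OF rm_hom[OF bimodule_right[OF N] c(1)] G G c(3)] by simp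
qed

lemma words_SucSuc_cases:
  assumes "xs \<in> words L (Suc (Suc n))"
  obtains x ts y where "xs = x # ts @ [y]" "x <: L" "ts \<in> words L n" "y <: L"
proof -
  obtain x zs where x: "xs = x # zs" "length zs = Suc n" "x <: L" "set zs \<subseteq> carrier L"
    using assms by (cases xs) (auto simp: words_def)
  then obtain ts y where "zs = ts @ [y]" by (metis length_0_conv nat.distinct(1) rev_exhaust)
  then show thesis using x that by (auto simp: words_def)
qed

lemma slot_cases [consumes 1]:
  assumes "i < Suc (Suc s)" obtains (1) "i = 0" | (2) j where "i = Suc j" "j < s" | (3) "i = Suc s"
  using assms by (cases i) (auto simp: less_Suc_eq)

lemma words_snoc: "[|xs \<in> words L n; y <: L|] ==> xs @ [y] \<in> words L (Suc n)"
  by (auto simp: words_def)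

context graded_algebra
begin

lemma pure_word_outer:
  assumes "x <: A" "ts \<in> words A n" "y <: A"
  shows "pure_word K A (Suc (Suc n)) (x # ts @ [y])
    = lact (bar K A n) x (ract (bar K A n) (pure_word K A (Suc (Suc n)) (1\<^sub>A # ts @ [1\<^sub>A])) y)"
proof -
  have w: "1\<^sub>A # ts @ [z] \<in> words A (Suc (Suc n))" if "z <: A" for z
    using assms that by (simp add: words_Cons words_snoc)
  have len: "length ts = n" using words_length assms by blast
  show ?thesis
    using assms len w by (simp add: bar_ract_pure bar_lact_pure list_update_append nth_append)
qed

text \<open>As a bimodule, each term of the bar complex is generated by the words with units at both
  ends.\<close>

lemma twisted_bar_eqI:
  assumes f: "f \<in> twisted A T \<phi> e (bar K A n) N" and g: "g \<in> twisted A T \<phi> e (bar K A n) N" and N: "group N"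
    and eq: "!!ts. ts \<in> words A n ==> f (pure_word K A (Suc (Suc n)) (1\<^sub>A # ts @ [1\<^sub>A])) = g (pure_word K A (Suc (Suc n)) (1\<^sub>A # ts @ [1\<^sub>A]))"
    and u: "u <: bar K A n"
  shows "f u = g u"
proof (rule tensor_powers.hom_eqI[OF tp _ _ N])
  show "f \<in> hom (tensor_power K A (Suc (Suc n))) N" "g \<in> hom (tensor_power K A (Suc (Suc n))) N"
    using twistedD(1)[OF f] twistedD(1)[OF g] by simp_all
  show "u <: (tensor_power K A (Suc (Suc n)))" using u by simp
  fix xs assume "xs \<in> words A (Suc (Suc n))"
  then obtain x ts y where xs: "xs = x # ts @ [y]" "x <: A" "ts \<in> words A n" "y <: A"
    by (rule words_SucSuc_cases)
  let ?p = "pure_word K A (Suc (Suc n)) (1\<^sub>A # ts @ [1\<^sub>A])"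
  have p: "?p <: bar K A n" using pure_closed[of "1\<^sub>A # ts @ [1\<^sub>A]"] xs by (simp add: words_Cons words_snoc)
  have r: "ract (bar K A n) ?p y <: bar K A n" using rm_closed[OF central_bimoduleD(3)[OF central_bar] xs(4) p] .
  show "f (pure_word K A (Suc (Suc n)) xs) = g (pure_word K A (Suc (Suc n)) xs)"
    unfolding xs(1) pure_word_outer[OF xs(2-4)]
    using twistedD(2)[OF f xs(2) r] twistedD(2)[OF g xs(2) r] twistedD(3)[OF f xs(4) p] twistedD(3)[OF g xs(4) p] eq[OF xs(3)]
    by simp
qed

end

section \<open>Cochains\<close>

text \<open>In contrast to \<open>multilinear\<close>, scalars are taken out of the value: once two
  outer slots are added, they have to meet the scalars taken out of those.\<close>

definition cochain :: "('k, 'p) ring_scheme => ('k, 'r, 'y) module_scheme => ('k, 't, 'z) module_scheme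
    => ('t, 'n, 't, 'w) bimod_scheme => nat => ('r list => 'n) => bool" where
  "cochain K R T N s f \<longleftrightarrow> (\<forall>xs\<in>words R s. f xs <: N) \<and>
     (\<forall>xs\<in>words R s. \<forall>i < s. \<forall>x\<in>carrier R. \<forall>y\<in>carrier R.
        f (xs[i := x +\<^sub>R y]) = f (xs[i := x]) *\<^sub>N f (xs[i := y])) \<and>
     (\<forall>xs\<in>words R s. \<forall>i < s. \<forall>c\<in>carrier K.
        f (xs[i := c \<cdot>\<^sub>R xs ! i]) = lact N (c \<cdot>\<^sub>T 1\<^sub>T) (f xs))"

lemma cochainI:
  assumes "!!xs. xs \<in> words R s ==> f xs <: N"
    "!!xs i x y. [|xs \<in> words R s; i < s; x <: R; y <: R|] ==>
       f (xs[i := x +\<^sub>R y]) = f (xs[i := x]) *\<^sub>N f (xs[i := y])"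
    "!!xs i c. [|xs \<in> words R s; i < s; c <: K|] ==>
       f (xs[i := c \<cdot>\<^sub>R xs ! i]) = lact N (c \<cdot>\<^sub>T 1\<^sub>T) (f xs)"
  shows "cochain K R T N s f"
  unfolding cochain_def by (intro conjI ballI allI impI assms)

lemma cochainD:
  assumes "cochain K R T N s f"
  shows "xs \<in> words R s ==> f xs <: N"
    "[|xs \<in> words R s; i < s; x <: R; y <: R|] ==>
       f (xs[i := x +\<^sub>R y]) = f (xs[i := x]) *\<^sub>N f (xs[i := y])"
    "[|xs \<in> words R s; i < s; c <: K|] ==>
       f (xs[i := c \<cdot>\<^sub>R xs ! i]) = lact N (c \<cdot>\<^sub>T 1\<^sub>T) (f xs)"
  using assms unfolding cochain_def by blast+

text \<open>The extension of a cochain to the bar complex, with values in an arbitrary bimodule and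
  with words over \<open>R\<close> acting through \<open>\<phi>\<close>. The operator
  \<open>koszul\<close> provides the sign (-1)^(e|x|) of the first entry \<open>x\<close>.\<close>

definition bar_ext :: "('k, 't, 'z) graded_alg_scheme => ('r => 't) => int
    => ('t, 'n, 't, 'w) bimod_scheme => nat => ('r list => 'n) => 'r list => 'n" where
  "bar_ext T \<phi> e N s f xs = ract N (lact N (koszul T e (\<phi> (xs ! 0))) (f (take s (drop 1 xs)))) (\<phi> (xs ! (s + 1)))"

lemma bar_ext_eq: "length ts = s ==>
    bar_ext T \<phi> e N s f (x # ts @ [y]) = ract N (lact N (koszul T e (\<phi> x)) (f ts)) (\<phi> y)"
  by (simp add: bar_ext_def nth_append)

locale alg_map = R: graded_algebra K R + T: graded_algebra K T
  for K :: "('k, 'p) ring_scheme" (structure) and R :: "('k, 'r, 'y) graded_alg_scheme"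
    and T :: "('k, 't, 'z) graded_alg_scheme" +
  fixes \<phi> :: "'r => 't"
  assumes \<phi>: "graded_alg_hom K R T \<phi>"
begin

lemmas hom = graded_alg_homD[OF \<phi>]

lemma koszul_\<phi>: "x <: R ==> \<phi> (koszul R e x) = koszul T e (\<phi> x)"
  by (rule graded_alg_hom_koszul[OF R.graded_algebra_axioms T.graded_algebra_axioms \<phi>])

text \<open>A scalar from the first slot passes through \<open>\<phi>\<close> and
  \<open>koszul\<close>, one from the middle through \<open>f\<close>, and one from the last slot is
  brought to the left by centrality of \<open>N\<close>.\<close>

lemma bar_ext_scale:
  assumes N: "central_bimodule K T N" and f: "cochain K R T N s f"
    and xs: "xs \<in> words R (Suc (Suc s))" and i: "i < Suc (Suc s)" and c: "c <: K"
  shows "bar_ext T \<phi> e N s f (xs[i := c \<cdot>\<^sub>R xs ! i]) = lact N (c \<cdot>\<^sub>T 1\<^sub>T) (bar_ext T \<phi> e N s f xs)"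
proof -
  note NN = central_bimoduleD[OF N]
  obtain x ts y where x: "xs = x # ts @ [y]" "x <: R" "ts \<in> words R s" "y <: R"
    using xs by (rule words_SucSuc_cases)
  have len: "length ts = s" using words_length[OF x(3)] .
  let ?c = "c \<cdot>\<^sub>T 1\<^sub>T" and ?k = "koszul T e (\<phi> x)"
  have cl: "?c <: T" "?k <: T" "\<phi> y <: T" "f ts <: N"
    using c x hom(4) cochainD(1)[OF f] by auto
  have cl2: "lact N ?k (f ts) <: N" "lact N ?c (f ts) <: N" using lm_closed[OF NN(2)] cl by auto
  have cl3: "lact N ?c (lact N ?k (f ts)) <: N" using lm_closed[OF NN(2)] cl cl2 by auto
  have R: "lact N ?c (bar_ext T \<phi> e N s f xs) = ract N (lact N ?c (lact N ?k (f ts))) (\<phi> y)"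
    unfolding x(1) bar_ext_eq[OF len] by (rule bimodule_assoc[OF NN(1)]) (use cl cl2 in auto)
  have ck: "?c *\<^sub>T ?k = c \<cdot>\<^sub>T ?k" "?k *\<^sub>T ?c = c \<cdot>\<^sub>T ?k"
    using T.smult_one_mult T.mult_smult_one c cl by auto
  from i show ?thesis
  proof (cases rule: slot_cases)
    case 1
    have "koszul T e (\<phi> (c \<cdot>\<^sub>R x)) = ?c *\<^sub>T ?k" unfolding ck using hom(2,4) c x by (simp add: T.koszul_smult)
    then show ?thesis unfolding R using 1 len cl
      by (simp add: x(1) bar_ext_eq lm_assoc[OF NN(2)])
  next
    case (2 j)
    have "f (ts[j := c \<cdot>\<^sub>R ts ! j]) = lact N ?c (f ts)" using cochainD(3)[OF f x(3) 2(2) c] .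
    moreover have "lact N ?k (lact N ?c (f ts)) = lact N ?c (lact N ?k (f ts))"
      using cl lm_assoc[OF NN(2), symmetric] ck by simp
    ultimately show ?thesis unfolding R using 2 len
      by (simp add: x(1) bar_ext_eq list_update_append nth_append)
  next
    case 3
    have "\<phi> (c \<cdot>\<^sub>R y) = ?c *\<^sub>T \<phi> y" using hom(2,4) c x T.smult_one_mult by simp
    then have "ract N (lact N ?k (f ts)) (\<phi> (c \<cdot>\<^sub>R y)) = ract N (ract N (lact N ?k (f ts)) ?c) (\<phi> y)"
      using cl cl2 by (simp add: rm_assoc[OF NN(3)])
    also have "ract N (lact N ?k (f ts)) ?c = lact N ?c (lact N ?k (f ts))" using NN(4)[OF c cl2(1)] by simp
    finally show ?thesis unfolding R using 3 len
      by (simp add: x(1) bar_ext_eq list_update_append nth_append)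
  qed
qed

lemma bar_ext_closed:
  assumes N: "central_bimodule K T N" and f: "cochain K R T N s f" and xs: "xs \<in> words R (Suc (Suc s))"
  shows "bar_ext T \<phi> e N s f xs <: N"
proof -
  note NN = central_bimoduleD[OF N]
  obtain x ts y where x: "xs = x # ts @ [y]" "x <: R" "ts \<in> words R s" "y <: R"
    using xs by (rule words_SucSuc_cases)
  show ?thesis unfolding x(1) bar_ext_eq[OF words_length[OF x(3)]]
    by (intro rm_closed[OF NN(3)] lm_closed[OF NN(2)] T.koszul_closed hom(4) cochainD(1)[OF f] x)
qed

lemma bar_ext_multilinear:
  assumes N: "central_bimodule K T N" and f: "cochain K R T N s f"
  shows "multilinear K R (Suc (Suc s)) N (bar_ext T \<phi> e N s f)"
proof (rule multilinearI)
  note NN = central_bimoduleD[OF N]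
  show "bar_ext T \<phi> e N s f xs <: N" if "xs \<in> words R (Suc (Suc s))" for xs
    using bar_ext_closed[OF N f that] .
  show "bar_ext T \<phi> e N s f (xs[i := c \<cdot>\<^sub>R xs ! i]) = bar_ext T \<phi> e N s f (xs[j := c \<cdot>\<^sub>R xs ! j])"
    if "xs \<in> words R (Suc (Suc s))" "i < Suc (Suc s)" "j < Suc (Suc s)" "c <: K" for xs i j c
    using bar_ext_scale[OF N f that(1,2,4)] bar_ext_scale[OF N f that(1,3,4)] by simp
  fix xs i u v assume xs: "xs \<in> words R (Suc (Suc s))" and i: "i < Suc (Suc s)" and u: "u <: R" and v: "v <: R"
  obtain x ts y where x: "xs = x # ts @ [y]" "x <: R" "ts \<in> words R s" "y <: R"
    using xs by (rule words_SucSuc_cases)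
  have len: "length ts = s" using words_length[OF x(3)] .
  have cl: "koszul T e (\<phi> z) <: T" "\<phi> z <: T" if "z <: R" for z using that hom(4) by auto
  have fc: "f zs <: N" if "zs \<in> words R s" for zs using cochainD(1)[OF f that] .
  have lc: "lact N (koszul T e (\<phi> z)) (f zs) <: N" if "z <: R" "zs \<in> words R s" for z zs
    using lm_closed[OF NN(2) cl(1) fc] that by blast
  from i show "bar_ext T \<phi> e N s f (xs[i := u +\<^sub>R v]) = bar_ext T \<phi> e N s f (xs[i := u]) *\<^sub>N bar_ext T \<phi> e N s f (xs[i := v])"
  proof (cases rule: slot_cases)
    case 1
    then show ?thesis using len u v cl x(4) fc[OF x(3)] lc[OF _ x(3)]
      by (simp add: x(1) bar_ext_eq hom(5) T.koszul_add lm_add[OF NN(2)] rm_dist[OF NN(3)])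
  next
    case (2 j)
    have w: "ts[j := z] \<in> words R s" if "z <: R" for z using words_update[OF x(3) that] .
    show ?thesis using 2 len u v cl x(2,4) w[OF u] w[OF v] lc[OF x(2) w[OF u]] lc[OF x(2) w[OF v]] fc
      by (simp add: x(1) bar_ext_eq list_update_append cochainD(2)[OF f x(3) 2(2) u v] lm_dist[OF NN(2)] rm_dist[OF NN(3)])
  next
    case 3
    then show ?thesis using len u v cl x(2) lc[OF x(2) x(3)]
      by (simp add: x(1) bar_ext_eq list_update_append hom(5) rm_add[OF NN(3)])
  qed
qed

lemma bar_ext_pure:
  assumes N: "central_bimodule K T N" and f: "cochain K R T N s f" and xs: "xs \<in> words R (Suc (Suc s))"
  shows "word_lift K R (Suc (Suc s)) N (bar_ext T \<phi> e N s f) (pure_word K R (Suc (Suc s)) xs) = bar_ext T \<phi> e N s f xs"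
  by (rule tensor_powers.word_lift_pure[OF R.tp lm_comm_group[OF central_bimoduleD(2)[OF N]] bar_ext_multilinear[OF N f] xs])

lemma bar_ext_twisted:
  assumes N: "central_bimodule K T N" and f: "cochain K R T N s f"
  shows "word_lift K R (Suc (Suc s)) N (bar_ext T \<phi> e N s f) \<in> twisted R T \<phi> e (bar K R s) N" (is "?h \<in> _")
proof (rule twistedI)
  note NN = central_bimoduleD[OF N]
  note G = lm_group[OF NN(2)]
  have h: "?h \<in> hom (tensor_power K R (Suc (Suc s))) N"
    by (rule tensor_powers.word_lift_hom[OF R.tp lm_comm_group[OF NN(2)] bar_ext_multilinear[OF N f]])
  then show "?h \<in> hom (bar K R s) N" by simp
  fix a m assume a: "a <: R" and "m <: bar K R s"
  then have m: "m <: (tensor_power K R (Suc (Suc s)))" by simp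
  have cl: "koszul T e (\<phi> z) <: T" "\<phi> z <: T" if "z <: R" for z using that hom(4) by auto
  show "?h (lact (bar K R s) a m) = lact N (koszul T e (\<phi> a)) (?h m)"
  proof (rule tensor_powers.hom_eqI[OF R.tp hom_comp[OF R.bar_lact_hom[OF a] h] hom_comp[OF h lm_hom[OF NN(2) cl(1)[OF a]]] G _ m])
    fix xs assume xs: "xs \<in> words R (Suc (Suc s))"
    obtain x ts y where x: "xs = x # ts @ [y]" "x <: R" "ts \<in> words R s" "y <: R"
      using xs by (rule words_SucSuc_cases)
    have fc: "f ts <: N" using cochainD(1)[OF f x(3)] .
    have w: "xs[0 := a *\<^sub>R xs ! 0] \<in> words R (Suc (Suc s))" using words_update[OF xs R.m_closed[OF a words_nth[OF xs, of 0]], of 0] by simp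
    show "?h (lact (bar K R s) a (pure_word K R (Suc (Suc s)) xs)) = lact N (koszul T e (\<phi> a)) (?h (pure_word K R (Suc (Suc s)) xs))"
      unfolding R.bar_lact_pure[OF a xs] bar_ext_pure[OF N f w] bar_ext_pure[OF N f xs]
      using cl a x fc words_length[OF x(3)] lm_closed[OF NN(2)]
      by (simp add: x(1) bar_ext_eq hom(6) T.koszul_mult lm_assoc[OF NN(2)] bimodule_assoc[OF NN(1)])
  qed
  show "?h (ract (bar K R s) m a) = ract N (?h m) (\<phi> a)"
  proof (rule tensor_powers.hom_eqI[OF R.tp hom_comp[OF R.bar_ract_hom[OF a] h] hom_comp[OF h rm_hom[OF NN(3) cl(2)[OF a]]] G _ m])
    fix xs assume xs: "xs \<in> words R (Suc (Suc s))"
    obtain x ts y where x: "xs = x # ts @ [y]" "x <: R" "ts \<in> words R s" "y <: R"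
      using xs by (rule words_SucSuc_cases)
    have fc: "f ts <: N" using cochainD(1)[OF f x(3)] .
    have w: "xs[Suc s := xs ! Suc s *\<^sub>R a] \<in> words R (Suc (Suc s))" using words_update[OF xs R.m_closed[OF words_nth[OF xs, of "Suc s"] a], of "Suc s"] by simp
    show "?h (ract (bar K R s) (pure_word K R (Suc (Suc s)) xs) a) = ract N (?h (pure_word K R (Suc (Suc s)) xs)) (\<phi> a)"
      unfolding R.bar_ract_pure[OF a xs] bar_ext_pure[OF N f w] bar_ext_pure[OF N f xs]
      using cl a x fc words_length[OF x(3)] lm_closed[OF NN(2)]
      by (simp add: x(1) bar_ext_eq hom(6) rm_assoc[OF NN(3)] list_update_append nth_append)
  qed
qed

lemma bar_ext_unit:
  assumes N: "central_bimodule K T N" and f: "cochain K R T N s f" and ts: "ts \<in> words R s"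
  shows "word_lift K R (Suc (Suc s)) N (bar_ext T \<phi> e N s f) (pure_word K R (Suc (Suc s)) (1\<^sub>R # ts @ [1\<^sub>R])) = f ts"
proof -
  note NN = central_bimoduleD[OF N]
  have w: "1\<^sub>R # ts @ [1\<^sub>R] \<in> words R (Suc (Suc s))" using ts by (simp add: words_Cons words_snoc)
  show ?thesis unfolding bar_ext_pure[OF N f w] bar_ext_eq[OF words_length[OF ts]]
    using cochainD(1)[OF f ts] by (simp add: hom(7) T.koszul_one lm_one[OF NN(2)] rm_one[OF NN(3)])
qed

text \<open>Converse to the extension of cochains: twisted maps on the bar complex amount to
  cochains. This is the freeness of its terms as bimodules, on which lifting rests.\<close>

lemma twisted_cochain:
  assumes N: "central_bimodule K T N" and g: "g \<in> twisted R T \<phi> e (bar K R s) N"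
  shows "cochain K R T N s (%ts. g (pure_word K R (Suc (Suc s)) (1\<^sub>R # ts @ [1\<^sub>R])))"
proof (rule cochainI)
  note ml = tensor_powers.hom_multilinear[OF R.tp, of g "Suc (Suc s)" N]
  have gh: "g \<in> hom (tensor_power K R (Suc (Suc s))) N" using twistedD(1)[OF g] by simp
  note mlD = multilinearD[OF ml[OF gh]]
  have w: "1\<^sub>R # ts @ [1\<^sub>R] \<in> words R (Suc (Suc s))" if "ts \<in> words R s" for ts
    using that by (simp add: words_Cons words_snoc)
  have up: "(1\<^sub>R # ts @ [1\<^sub>R])[Suc i := x] = 1\<^sub>R # ts[i := x] @ [1\<^sub>R]" if "ts \<in> words R s" "i < s" for ts i x
    using that words_length[OF that(1)] by (simp add: list_update_append)
  show "g (pure_word K R (Suc (Suc s)) (1\<^sub>R # ts @ [1\<^sub>R])) <: N" if "ts \<in> words R s" for ts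
    using mlD(1)[OF w[OF that]] .
  show "g (pure_word K R (Suc (Suc s)) (1\<^sub>R # ts[i := x +\<^sub>R y] @ [1\<^sub>R])) =
      g (pure_word K R (Suc (Suc s)) (1\<^sub>R # ts[i := x] @ [1\<^sub>R])) *\<^sub>N g (pure_word K R (Suc (Suc s)) (1\<^sub>R # ts[i := y] @ [1\<^sub>R]))"
    if "ts \<in> words R s" "i < s" "x <: R" "y <: R" for ts i x y
    using mlD(2)[OF w[OF that(1)], of "Suc i" x y] that up[OF that(1,2)] by simp
  fix ts i c assume ts: "ts \<in> words R s" "i < s" and c: "c <: K"
  let ?p = "pure_word K R (Suc (Suc s)) (1\<^sub>R # ts @ [1\<^sub>R])"
  have nth: "(1\<^sub>R # ts @ [1\<^sub>R]) ! Suc i = ts ! i" using words_length[OF ts(1)] ts(2) by (simp add: nth_append)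
  have pc: "?p <: bar K R s" using R.pure_closed[OF w[OF ts(1)]] by simp
  have c1: "c \<cdot>\<^sub>R 1\<^sub>R <: R" using c by simp
  \<comment> \<open>The scalar is moved to slot 0, where it is a left multiplication and meets the
    twisting rule.\<close>
  have "g (pure_word K R (Suc (Suc s)) (1\<^sub>R # ts[i := c \<cdot>\<^sub>R ts ! i] @ [1\<^sub>R]))
      = g (pure_word K R (Suc (Suc s)) ((1\<^sub>R # ts @ [1\<^sub>R])[0 := c \<cdot>\<^sub>R (1\<^sub>R # ts @ [1\<^sub>R]) ! 0]))"
    using mlD(3)[OF w[OF ts(1)], of "Suc i" 0 c] ts c up[OF ts] nth by simp
  also have "pure_word K R (Suc (Suc s)) ((1\<^sub>R # ts @ [1\<^sub>R])[0 := c \<cdot>\<^sub>R (1\<^sub>R # ts @ [1\<^sub>R]) ! 0]) = lact (bar K R s) (c \<cdot>\<^sub>R 1\<^sub>R) ?p"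
    using R.bar_lact_pure[OF c1 w[OF ts(1)]] c1 by simp
  also have "g \<dots> = lact N (koszul T e (\<phi> (c \<cdot>\<^sub>R 1\<^sub>R))) (g ?p)" by (rule twistedD(2)[OF g c1 pc])
  also have "koszul T e (\<phi> (c \<cdot>\<^sub>R 1\<^sub>R)) = c \<cdot>\<^sub>T 1\<^sub>T" using c by (simp add: hom(2,7) T.koszul_smult T.koszul_one)
  finally show "g (pure_word K R (Suc (Suc s)) (1\<^sub>R # ts[i := c \<cdot>\<^sub>R ts ! i] @ [1\<^sub>R])) = lact N (c \<cdot>\<^sub>T 1\<^sub>T) (g ?p)" .
qed

end

section \<open>The bar differential\<close>

lemma restricted_bimod_simps [simp]:
  "carrier (restricted_bimod T \<alpha> \<beta>) = carrier T" "mult (restricted_bimod T \<alpha> \<beta>) = add T"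
  "one (restricted_bimod T \<alpha> \<beta>) = zero T" "lact (restricted_bimod T \<alpha> \<beta>) l x = \<alpha> l *\<^sub>T x"
  "ract (restricted_bimod T \<alpha> \<beta>) x r = x *\<^sub>T \<beta> r" "gr (restricted_bimod T \<alpha> \<beta>) = part T"
  "m_inv (restricted_bimod T \<alpha> \<beta>) = a_inv T"
  "signed (restricted_bimod T \<alpha> \<beta>) = signed (add_monoid T)"
proof -
  show 1: "m_inv (restricted_bimod T \<alpha> \<beta>) = a_inv T"
    unfolding a_inv_def[abs_def] by (rule m_inv_cong) (simp_all add: restricted_bimod_def)
  show "signed (restricted_bimod T \<alpha> \<beta>) = signed (add_monoid T)" by (simp add: signed_def fun_eq_iff 1 a_inv_def)
qed (simp_all add: restricted_bimod_def)

lemma hom_restricted [simp]: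
  "hom (restricted_bimod T \<alpha> \<beta>) H = hom (add_monoid T) H"
  "hom H (restricted_bimod T \<alpha> \<beta>) = hom H (add_monoid T)"
  by (simp_all add: hom_def)

lemma multiply_at_snoc: "Suc i < length xs ==> multiply_at L i (xs @ [y]) = multiply_at L i xs @ [y]"
  by (simp add: multiply_at_def nth_append)

lemma multiply_at_last: "length xs = n ==> multiply_at L n (xs @ [x, y]) = xs @ [x *\<^sub>L y]"
  by (simp add: multiply_at_def nth_append)

context graded_algebra
begin

lemma multilinear_finprod:
  assumes H: "comm_group H" and g: "!!i. i \<in> I ==> multilinear K A n H (g i)"
  shows "multilinear K A n H (%xs. finprod H (%i. g i xs) I)"
proof (rule multilinearI)
  interpret H: comm_group H by fact
  have c: "(%i. g i xs) \<in> I \<rightarrow> carrier H" if "xs \<in> words A n" for xs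
    using multilinearD(1)[OF g that] by auto
  show "finprod H (%i. g i xs) I <: H" if "xs \<in> words A n" for xs
    using H.finprod_closed[OF c[OF that]] .
  show "finprod H (%i. g i (xs[j := x +\<^sub>A y])) I = finprod H (%i. g i (xs[j := x])) I *\<^sub>H finprod H (%i. g i (xs[j := y])) I"
    if w: "xs \<in> words A n" "j < n" "x <: A" "y <: A" for xs j x y
  proof -
    have "finprod H (%i. g i (xs[j := x +\<^sub>A y])) I = finprod H (%i. g i (xs[j := x]) *\<^sub>H g i (xs[j := y])) I"
      by (rule H.finprod_cong') (use multilinearD(2)[OF g w] multilinearD(1)[OF g words_update[OF w(1)]] w in auto)
    also have "\<dots> = finprod H (%i. g i (xs[j := x])) I *\<^sub>H finprod H (%i. g i (xs[j := y])) I"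
      by (rule H.finprod_multf) (use c words_update[OF w(1)] w in auto)
    finally show ?thesis .
  qed
  fix xs j k c assume w: "xs \<in> words A n" "j < n" "k < n" "c <: K"
  have wk: "xs[k := c \<cdot>\<^sub>A xs ! k] \<in> words A n"
    by (rule words_update[OF w(1) smult_closed[OF w(4) words_nth[OF w(1,3)]]])
  show "finprod H (%i. g i (xs[j := c \<cdot>\<^sub>A xs ! j])) I = finprod H (%i. g i (xs[k := c \<cdot>\<^sub>A xs ! k])) I"
    by (rule H.finprod_cong'[OF refl c[OF wk] multilinearD(3)[OF g w]])
qed

lemma multilinear_signed:
  assumes H: "comm_group H" and g: "multilinear K A n H g"
  shows "multilinear K A n H (%xs. signed H e (g xs))"
proof (rule multilinearI)
  have G: "group H" using H by (simp add: comm_group_def)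
  have sh: "signed H e \<in> hom H H" using hom_signed_fun[OF H, of "%x. x" H e] by (simp add: hom_def)
  note gD = multilinearD[OF g]
  show "signed H e (g xs) <: H" if "xs \<in> words A n" for xs
    using signed_closed[OF G gD(1)[OF that]] .
  show "signed H e (g (xs[i := x +\<^sub>A y])) = signed H e (g (xs[i := x])) *\<^sub>H signed H e (g (xs[i := y]))"
    if "xs \<in> words A n" "i < n" "x <: A" "y <: A" for xs i x y
    unfolding gD(2)[OF that] by (intro hom_mult[OF sh] gD(1) words_update that)
  show "signed H e (g (xs[i := c \<cdot>\<^sub>A xs ! i])) = signed H e (g (xs[j := c \<cdot>\<^sub>A xs ! j]))"
    if "xs \<in> words A n" "i < n" "j < n" "c <: K" for xs i j c
    unfolding gD(3)[OF that] ..
qed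

abbreviation "B n \<equiv> bar K A n"
abbreviation "pw n \<equiv> pure_word K A n"
abbreviation (input) "bd \<equiv> bar_diff K A"

lemma B_group: "group (B n)"
  using bar_comm_group by (simp add: comm_group_def)

lemma pw_closed: "xs \<in> words A (Suc (Suc n)) ==> pw (Suc (Suc n)) xs <: B n"
  using pure_closed[of xs "Suc (Suc n)"] by simp

lemma pw_multilinear: "multilinear K A (Suc (Suc n)) (B n) (pw (Suc (Suc n)))"
proof -
  have *: "multilinear K A m (B n) g" if "multilinear K A m (tensor_power K A (Suc (Suc n))) g" for m g
    using that unfolding multilinear_def bar_simps .
  show ?thesis by (rule *[OF tensor_powers.pure_multilinear[OF tp]])
qed

lemma mult_at: "[|xs \<in> words A (Suc n); i < n|] ==> multiply_at A i xs \<in> words A n"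
  by (rule multiply_at_words[OF _ _ ring_A])

lemma bar_diff_multilinear:
  "multilinear K A (Suc (Suc (Suc n))) (B n)
     (%xs. finprod (B n) (%i. signed (B n) (int i) (pw (Suc (Suc n)) (multiply_at A i xs))) {..Suc n})"
  by (rule multilinear_finprod[OF bar_comm_group multilinear_signed[OF bar_comm_group multilinear_comp[OF pw_multilinear slotwise_multiply]]])
     simp

lemma bar_diff_eq: "bd n = word_lift K A (Suc (Suc (Suc n))) (B n)
     (%xs. finprod (B n) (%i. signed (B n) (int i) (pw (Suc (Suc n)) (multiply_at A i xs))) {..Suc n})"
  by (simp add: bar_diff_def numeral_3_eq_3)

lemma bar_diff_hom: "bd n \<in> hom (B (Suc n)) (B n)"
  unfolding bar_diff_eq using tensor_powers.word_lift_hom[OF tp bar_comm_group bar_diff_multilinear] by simp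

lemma bar_diff_pure:
  "xs \<in> words A (Suc (Suc (Suc n))) ==> bd n (pw (Suc (Suc (Suc n))) xs) =
     finprod (B n) (%i. signed (B n) (int i) (pw (Suc (Suc n)) (multiply_at A i xs))) {..Suc n}"
  unfolding bar_diff_eq by (rule tensor_powers.word_lift_pure[OF tp bar_comm_group bar_diff_multilinear])

lemma hom_bar_finprod:
  assumes f: "f \<in> hom (B n) H" and H: "comm_group H" and xs: "xs \<in> words A (Suc (Suc (Suc n)))" and m: "m \<le> Suc n"
  shows "f (finprod (B n) (%i. signed (B n) (int i) (pw (Suc (Suc n)) (multiply_at A i xs))) {..m}) =
    finprod H (%i. signed H (int i) (f (pw (Suc (Suc n)) (multiply_at A i xs)))) {..m}"
proof -
  interpret H: comm_group H by fact
  have c: "pw (Suc (Suc n)) (multiply_at A i xs) <: B n" if "i \<in> {..m}" for i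
    using pw_closed mult_at[OF xs] that m by auto
  have "f (finprod (B n) (%i. signed (B n) (int i) (pw (Suc (Suc n)) (multiply_at A i xs))) {..m})
     = finprod H (%i. f (signed (B n) (int i) (pw (Suc (Suc n)) (multiply_at A i xs)))) {..m}"
    by (rule hom_finprod[OF bar_comm_group H f]) (use c signed_closed[OF B_group] in blast)
  also have "\<dots> = finprod H (%i. signed H (int i) (f (pw (Suc (Suc n)) (multiply_at A i xs)))) {..m}"
    by (rule H.finprod_cong') (use hom_signed[OF f B_group H.is_group c] signed_closed[OF H.is_group hom_closed[OF f c]] in auto)
  finally show ?thesis .
qed

lemma multiply_at_lact:
  assumes "xs \<in> words A (Suc (Suc n))" "i < Suc n" "a <: A"
  shows "multiply_at A i (xs[0 := a *\<^sub>A xs ! 0]) = (multiply_at A i xs)[0 := a *\<^sub>A multiply_at A i xs ! 0]"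
proof -
  obtain x ts y where x: "xs = x # ts @ [y]" "x <: A" "ts \<in> words A n" "y <: A"
    using assms(1) by (rule words_SucSuc_cases)
  have x1: "(ts @ [y]) ! 0 <: A" using words_nth[OF assms(1), of 1] by (simp add: x(1))
  show ?thesis
    using x x1 assms(3) by (cases i) (auto simp: multiply_at_def m_assoc)
qed

lemma multiply_at_ract:
  assumes "xs \<in> words A (Suc (Suc n))" "i < Suc n" "a <: A"
  shows "multiply_at A i (xs[Suc n := xs ! Suc n *\<^sub>A a]) = (multiply_at A i xs)[n := multiply_at A i xs ! n *\<^sub>A a]"
proof (rule nth_equalityI)
  have len: "length xs = Suc (Suc n)" using words_length[OF assms(1)] .
  let ?ys = "xs[Suc n := xs ! Suc n *\<^sub>A a]"
  have len': "length ?ys = Suc (Suc n)" using len by simp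
  show "length (multiply_at A i ?ys) = length ((multiply_at A i xs)[n := multiply_at A i xs ! n *\<^sub>A a])"
    using length_multiply_at[OF len' assms(2), of A] length_multiply_at[OF len assms(2), of A] by simp
  fix l assume "l < length (multiply_at A i ?ys)"
  then have l: "l < Suc n" using length_multiply_at[OF len' assms(2), of A] by simp
  have c: "xs ! i <: A" "xs ! Suc i <: A" using words_nth[OF assms(1)] assms(2) by auto
  show "multiply_at A i ?ys ! l = (multiply_at A i xs)[n := multiply_at A i xs ! n *\<^sub>A a] ! l"
    using nth_multiply_at[OF len' assms(2) l, of A] nth_multiply_at[OF len assms(2) l, of A]
      nth_multiply_at[OF len assms(2), of n A] length_multiply_at[OF len assms(2), of A] l len assms(2,3) c
    by (auto simp: nth_list_update m_assoc)
qed

lemma bar_diff_twisted: "bd n \<in> twisted A A id 0 (B (Suc n)) (B n)"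
proof (rule twistedI[OF bar_diff_hom])
  note NN = central_bimoduleD[OF central_bar]
  have dh: "bd n \<in> hom (tensor_power K A (Suc (Suc (Suc n)))) (B n)" using bar_diff_hom by simp
  fix a m assume a: "a <: A" and "m <: B (Suc n)"
  then have m: "m \<in> carrier (tensor_power K A (Suc (Suc (Suc n))))" by simp
  have "bd n (lact (B (Suc n)) a m) = lact (B n) a (bd n m)"
  proof (rule tensor_powers.hom_eqI[OF tp hom_comp[OF bar_lact_hom[OF a] dh] hom_comp[OF dh lm_hom[OF NN(2) a]] B_group _ m])
    fix xs assume xs: "xs \<in> words A (Suc (Suc (Suc n)))"
    have w: "xs[0 := a *\<^sub>A xs ! 0] \<in> words A (Suc (Suc (Suc n)))"
      using words_update[OF xs m_closed[OF a words_nth[OF xs, of 0]]] by simp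
    show "bd n (lact (B (Suc n)) a (pw (Suc (Suc (Suc n))) xs)) = lact (B n) a (bd n (pw (Suc (Suc (Suc n))) xs))"
      unfolding bar_lact_pure[OF a xs] bar_diff_pure[OF w] bar_diff_pure[OF xs] hom_bar_finprod[OF lm_hom[OF NN(2) a] bar_comm_group xs order_refl]
    proof (rule comm_monoid.finprod_cong'[OF comm_group.axioms(1)[OF bar_comm_group] refl])
      show "signed (B n) (int i) (pw (Suc (Suc n)) (multiply_at A i (xs[0 := a *\<^sub>A xs ! 0]))) =
          signed (B n) (int i) (lact (B n) a (pw (Suc (Suc n)) (multiply_at A i xs)))" if "i \<in> {..Suc n}" for i
        using that bar_lact_pure[OF a mult_at[OF xs, of i]] multiply_at_lact[OF xs _ a, of i] by simp
      show "(%i. signed (B n) (int i) (lact (B n) a (pw (Suc (Suc n)) (multiply_at A i xs)))) \<in> {..Suc n} \<rightarrow> carrier (B n)"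
        using signed_closed[OF B_group lm_closed[OF NN(2) a pw_closed[OF mult_at[OF xs]]]] by auto
    qed
  qed
  then show "bd n (lact (B (Suc n)) a m) = lact (B n) (koszul A 0 (id a)) (bd n m)"
    using a by (simp add: koszul_0)
  have "bd n (ract (B (Suc n)) m a) = ract (B n) (bd n m) a"
  proof (rule tensor_powers.hom_eqI[OF tp hom_comp[OF bar_ract_hom[OF a] dh] hom_comp[OF dh rm_hom[OF NN(3) a]] B_group _ m])
    fix xs assume xs: "xs \<in> words A (Suc (Suc (Suc n)))"
    have w: "xs[Suc (Suc n) := xs ! Suc (Suc n) *\<^sub>A a] \<in> words A (Suc (Suc (Suc n)))"
      using words_update[OF xs m_closed[OF words_nth[OF xs, of "Suc (Suc n)"] a]] by simp
    show "bd n (ract (B (Suc n)) (pw (Suc (Suc (Suc n))) xs) a) = ract (B n) (bd n (pw (Suc (Suc (Suc n))) xs)) a"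
      unfolding bar_ract_pure[OF a xs] bar_diff_pure[OF w] bar_diff_pure[OF xs] hom_bar_finprod[OF rm_hom[OF NN(3) a] bar_comm_group xs order_refl]
    proof (rule comm_monoid.finprod_cong'[OF comm_group.axioms(1)[OF bar_comm_group] refl])
      show "signed (B n) (int i) (pw (Suc (Suc n)) (multiply_at A i (xs[Suc (Suc n) := xs ! Suc (Suc n) *\<^sub>A a]))) =
          signed (B n) (int i) (ract (B n) (pw (Suc (Suc n)) (multiply_at A i xs)) a)" if "i \<in> {..Suc n}" for i
        using that bar_ract_pure[OF a mult_at[OF xs, of i]] multiply_at_ract[OF xs _ a, of i] by simp
      show "(%i. signed (B n) (int i) (ract (B n) (pw (Suc (Suc n)) (multiply_at A i xs)) a)) \<in> {..Suc n} \<rightarrow> carrier (B n)"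
        using signed_closed[OF B_group rm_closed[OF NN(3) a pw_closed[OF mult_at[OF xs]]]] by auto
    qed
  qed
  then show "bd n (ract (B (Suc n)) m a) = ract (B n) (bd n m) (id a)" by simp
qed

text \<open>The contracting homotopy of the bar complex. Appending at the right end is linear for
  the left action, so the map remains defined after tensoring with \<open>T\<close> over
  \<open>R\<close> on the left.\<close>

definition append_one :: "nat => ('a list \<Rightarrow>\<^sub>0 int) set => ('a list \<Rightarrow>\<^sub>0 int) set" where
  "append_one n = word_lift K A n (tensor_power K A (Suc n)) (%xs. pw (Suc n) (xs @ [1\<^sub>A]))"

lemma append_one_hom: "append_one n \<in> hom (tensor_power K A n) (tensor_power K A (Suc n))"
  unfolding append_one_def
  by (rule tensor_powers.word_lift_hom[OF tp tensor_powers.comm_group_power[OF tp]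
      multilinear_comp[OF tensor_powers.pure_multilinear[OF tp] slotwise_append_one]])

lemma append_one_pure: "xs \<in> words A n ==> append_one n (pw n xs) = pw (Suc n) (xs @ [1\<^sub>A])"
  unfolding append_one_def
  by (rule tensor_powers.word_lift_pure[OF tp tensor_powers.comm_group_power[OF tp]
      multilinear_comp[OF tensor_powers.pure_multilinear[OF tp] slotwise_append_one]])

lemma append_one_lact:
  assumes a: "a <: A" and u: "u <: B n"
  shows "append_one (Suc (Suc n)) (lact (B n) a u) = lact (B (Suc n)) a (append_one (Suc (Suc n)) u)"
proof (rule tensor_powers.hom_eqI[OF tp hom_comp[OF bar_lact_hom[OF a] append_one_hom] hom_comp[OF append_one_hom bar_lact_hom[OF a]] bar_group])
  show "u <: (tensor_power K A (Suc (Suc n)))" using u by simp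
  fix xs assume xs: "xs \<in> words A (Suc (Suc n))"
  have w: "xs[0 := a *\<^sub>A xs ! 0] \<in> words A (Suc (Suc n))"
    using words_update[OF xs m_closed[OF a words_nth[OF xs, of 0]]] by simp
  have w': "xs @ [1\<^sub>A] \<in> words A (Suc (Suc (Suc n)))" using words_snoc[OF xs] by simp
  show "append_one (Suc (Suc n)) (lact (B n) a (pw (Suc (Suc n)) xs)) = lact (B (Suc n)) a (append_one (Suc (Suc n)) (pw (Suc (Suc n)) xs))"
    unfolding bar_lact_pure[OF a xs] append_one_pure[OF w] append_one_pure[OF xs] bar_lact_pure[OF a w']
    using words_length[OF xs] by (simp add: list_update_append nth_append)
qed

text \<open>The last face multiplies by the appended unit and returns the word, with sign
  (-1)^(n+2). All other faces commute with appending.\<close>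

lemma contraction_Suc:
  assumes u: "u <: B (Suc n)"
  shows "bd (Suc n) (append_one (Suc (Suc (Suc n))) u) =
    signed (B (Suc n)) (int (Suc (Suc n))) u *\<^sub>(B (Suc n)) append_one (Suc (Suc n)) (bd n u)"
proof -
  let ?n = "Suc (Suc (Suc n))"
  have ah: "append_one (Suc (Suc n)) \<in> hom (B n) (B (Suc n))" using append_one_hom by simp
  have d1: "bd (Suc n) \<in> hom (tensor_power K A (Suc ?n)) (B (Suc n))" using bar_diff_hom by simp
  have d2: "bd n \<in> hom (tensor_power K A ?n) (B n)" using bar_diff_hom by simp
  have sh: "(%u. signed (B (Suc n)) (int (Suc (Suc n))) u) \<in> hom (tensor_power K A ?n) (B (Suc n))"
    using hom_signed_fun[OF bar_comm_group, of "%x. x" "B (Suc n)"] by (simp add: hom_def)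
  show ?thesis
  proof (rule tensor_powers.hom_eqI[OF tp hom_comp[OF append_one_hom d1] hom_prod[OF bar_comm_group sh hom_comp[OF d2 ah]] B_group])
    show "u <: (tensor_power K A ?n)" using u by simp
    fix xs assume xs: "xs \<in> words A ?n"
    have len: "length xs = ?n" using words_length[OF xs] .
    have w: "xs @ [1\<^sub>A] \<in> words A (Suc ?n)" using words_snoc[OF xs] by simp
    interpret G: comm_group "B (Suc n)" by (rule bar_comm_group)
    let ?f = "%i. signed (B (Suc n)) (int i) (pw ?n (multiply_at A i (xs @ [1\<^sub>A])))"
    have fc: "?f \<in> {..Suc (Suc n)} \<rightarrow> carrier (B (Suc n))"
      using signed_closed[OF B_group pw_closed[OF mult_at[OF w]]] by auto
    obtain ys x where ys: "xs = ys @ [x]" "length ys = Suc (Suc n)" "x <: A"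
      using len xs by (cases xs rule: rev_cases) (auto simp: words_def)
    have last: "multiply_at A (Suc (Suc n)) (xs @ [1\<^sub>A]) = xs"
      using multiply_at_last[OF ys(2), of A x "1\<^sub>A"] ys by simp
    have "append_one (Suc (Suc n)) (bd n (pw ?n xs)) =
       finprod (B (Suc n)) (%i. signed (B (Suc n)) (int i) (append_one (Suc (Suc n)) (pw (Suc (Suc n)) (multiply_at A i xs)))) {..Suc n}"
      unfolding bar_diff_pure[OF xs] by (rule hom_bar_finprod[OF ah bar_comm_group xs order_refl])
    also have "\<dots> = finprod (B (Suc n)) ?f {..Suc n}"
    proof (rule G.finprod_cong'[OF refl])
      show "signed (B (Suc n)) (int i) (append_one (Suc (Suc n)) (pw (Suc (Suc n)) (multiply_at A i xs))) = ?f i" if "i \<in> {..Suc n}" for i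
        using that append_one_pure[OF mult_at[OF xs, of i]] multiply_at_snoc[of i xs A "1\<^sub>A"] len by simp
    qed (use fc in auto)
    finally have 1: "append_one (Suc (Suc n)) (bd n (pw ?n xs)) = finprod (B (Suc n)) ?f {..Suc n}" .
    show "bd (Suc n) (append_one ?n (pw ?n xs)) =
      signed (B (Suc n)) (int (Suc (Suc n))) (pw ?n xs) *\<^sub>(B (Suc n)) append_one (Suc (Suc n)) (bd n (pw ?n xs))"
      unfolding 1 append_one_pure[OF xs] bar_diff_pure[OF w] G.finprod_Suc[OF fc] last ..
  qed
qed

lemma central_regular: "central_bimodule K A (regular_bimod A)"
proof -
  have "comm_group (regular_bimod A)"
    by (rule comm_group_cong[OF _ _ _ comm_group_add]) (simp_all add: regular_bimod_def)
  then show ?thesis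
    unfolding central_bimodule_def bimodule_def left_module_def right_module_def regular_bimod_def
    by (auto simp: l_distr r_distr m_assoc smult_one_mult mult_smult_one)
qed

text \<open>The multiplication map onto \<open>A\<close>. Written as the extension of the 0-cochain
  1, it obtains its bimodule linearity from the general case.\<close>

definition augmentation :: "('a list \<Rightarrow>\<^sub>0 int) set => 'a" where
  "augmentation = word_lift K A n2 (regular_bimod A) (bar_ext A id 0 (regular_bimod A) 0 (%_. 1\<^sub>A))"

lemma alg_map_id: "alg_map K A A id"
  by unfold_locales (simp add: graded_alg_hom_def ring_hom_def)

lemma unit_cochain: "cochain K A A (regular_bimod A) 0 (%_. 1\<^sub>A)"
  by (rule cochainI) (simp_all add: regular_bimod_def)

lemma augmentation_twisted: "augmentation \<in> twisted A A id 0 (B 0) (regular_bimod A)"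
  unfolding augmentation_def by (rule alg_map.bar_ext_twisted[OF alg_map_id central_regular unit_cochain])

lemma augmentation_pure:
  assumes "x <: A" "y <: A"
  shows "augmentation (pw n2 [x, y]) = x *\<^sub>A y"
  unfolding augmentation_def
  using alg_map.bar_ext_pure[OF alg_map_id central_regular unit_cochain, of "[x, y]" 0] assms
  by (simp add: words_def bar_ext_def koszul_0 regular_bimod_def)

definition unit_tensor :: "'a => ('a list \<Rightarrow>\<^sub>0 int) set" where
  "unit_tensor a = pw n2 [a, 1\<^sub>A]"

lemma unit_tensor_hom: "unit_tensor \<in> hom addA (B 0)"
proof (rule homI)
  have w: "[x, 1\<^sub>A] \<in> words A n2" if "x <: A" for x using that by (simp add: words_def)
  show "unit_tensor x <: B 0" if "x <: addA" for x
    unfolding unit_tensor_def using pw_closed[OF w] that by simp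
  show "unit_tensor (x *\<^sub>addA y) = unit_tensor x *\<^sub>(B 0) unit_tensor y" if "x <: addA" "y <: addA" for x y
    using multilinearD(2)[OF pw_multilinear[of 0] w[of x], of 0 x y] that by (simp add: unit_tensor_def)
qed

text \<open>Only two faces are left in degree zero: the one that absorbs the appended unit returns
  \<open>u\<close> with a minus sign, the other multiplies the two entries of the original
  word.\<close>

lemma contraction_0:
  assumes u: "u <: B 0"
  shows "bd 0 (append_one n2 u) = inv\<^bsub>B 0\<^esub> u *\<^sub>(B 0) unit_tensor (augmentation u)"
proof -
  let ?n = "n2"
  have d1: "bd 0 \<in> hom (tensor_power K A (Suc ?n)) (B 0)" using bar_diff_hom[of 0] by simp
  have ah: "augmentation \<in> hom (tensor_power K A ?n) addA" using twistedD(1)[OF augmentation_twisted] by (simp add: regular_bimod_def)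
  have ih: "(%u. inv\<^bsub>B 0\<^esub> u) \<in> hom (tensor_power K A ?n) (B 0)"
    using hom_inverse[OF bar_comm_group, of "%x. x" "B 0" 0] by (simp add: hom_def)
  show ?thesis
  proof (rule tensor_powers.hom_eqI[OF tp hom_comp[OF append_one_hom d1] hom_prod[OF bar_comm_group ih hom_comp[OF ah unit_tensor_hom]] B_group])
    show "u <: (tensor_power K A ?n)" using u by simp
    fix xs assume xs: "xs \<in> words A ?n"
    then obtain x y where x: "xs = [x, y]" "x <: A" "y <: A"
      by (auto simp: words_def length_Suc_conv)
    have w: "xs @ [1\<^sub>A] \<in> words A (Suc ?n)" using words_snoc[OF xs] by simp
    interpret G: comm_group "B 0" by (rule bar_comm_group)
    let ?f = "%i. signed (B 0) (int i) (pw ?n (multiply_at A i (xs @ [1\<^sub>A])))"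
    have fc: "?f \<in> {..Suc 0} \<rightarrow> carrier (B 0)"
      using signed_closed[OF B_group pw_closed[OF mult_at[OF w]]] by auto
    have fc0: "?f \<in> {0} \<rightarrow> carrier (B 0)" using fc Pi_anti_mono[of "{0}" "{..Suc 0}"] by blast
    show "bd 0 (append_one ?n (pw ?n xs)) = inv\<^bsub>B 0\<^esub> (pw ?n xs) *\<^sub>(B 0) unit_tensor (augmentation (pw ?n xs))"
      unfolding append_one_pure[OF xs] bar_diff_pure[OF w] G.finprod_Suc[OF fc] G.finprod_0[OF fc0]
      using x by (simp add: augmentation_pure unit_tensor_def multiply_at_def signed_def)
  qed
qed

lemma augmentation_diff:
  assumes u: "u <: B (Suc 0)"
  shows "augmentation (bd 0 u) = 0\<^sub>A"
proof -
  let ?n = "n2"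
  have d1: "bd 0 \<in> hom (tensor_power K A (Suc ?n)) (B 0)" using bar_diff_hom[of 0] by simp
  have ah: "augmentation \<in> hom (B 0) addA" using twistedD(1)[OF augmentation_twisted] by (simp add: regular_bimod_def)
  have z: "(%u. 0\<^sub>A) \<in> hom (tensor_power K A (Suc ?n)) addA" using hom_const_one[OF group_add] by simp
  show ?thesis
  proof (rule tensor_powers.hom_eqI[OF tp hom_comp[OF d1 ah] z group_add])
    show "u <: tensor_power K A (Suc ?n)" using u by simp
    fix xs assume xs: "xs \<in> words A (Suc ?n)"
    then obtain x y t where x: "xs = [x, y, t]" "x <: A" "y <: A" "t <: A"
      by (auto simp: words_def length_Suc_conv)
    note cm = comm_group.axioms(1)[OF comm_group_add]
    have "augmentation (bd 0 (pw (Suc ?n) xs)) =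
      finprod addA (%i. signed addA (int i) (augmentation (pw ?n (multiply_at A i xs)))) {..Suc 0}"
      unfolding bar_diff_pure[OF xs] by (rule hom_bar_finprod[OF ah comm_group_add xs order_refl])
    also have "\<dots> = -\<^sub>A (x *\<^sub>A (y *\<^sub>A t)) +\<^sub>A (x *\<^sub>A y *\<^sub>A t)"
    proof -
      have c: "(%i. signed addA (int i) (augmentation (pw ?n (multiply_at A i xs)))) \<in> {..Suc 0} \<rightarrow> carrier addA"
        using signed_closed[OF group_add hom_closed[OF ah pw_closed[OF mult_at[OF xs]]]] by auto
      then have c0: "(%i. signed addA (int i) (augmentation (pw ?n (multiply_at A i xs)))) \<in> {0} \<rightarrow> carrier addA"
        using Pi_anti_mono[of "{0}" "{..Suc 0}"] by blast
      show ?thesis unfolding comm_monoid.finprod_Suc[OF cm c] comm_monoid.finprod_0[OF cm c0]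
        using x by (simp add: multiply_at_def augmentation_pure signed_def a_inv_def)
    qed
    also have "\<dots> = 0\<^sub>A" using x by (simp add: m_assoc l_neg)
    finally show "augmentation (bd 0 (pw (Suc ?n) xs)) = 0\<^sub>A" .
  qed
qed

lemma signed_cancel:
  assumes "comm_group G" "v <: G" "odd (a - b)"
  shows "signed G a v *\<^sub>G signed G b v = 1\<^sub>G"
proof -
  interpret comm_group G by fact
  show ?thesis using assms by (auto simp: signed_def)
qed

lemma bar_diff_hom': "bd n \<in> hom (B (Suc n)) (B n)" and append_one_hom': "append_one (Suc (Suc n)) \<in> hom (B n) (B (Suc n))"
  using bar_diff_hom append_one_hom by simp_all

text \<open>Instead of cancelling faces in pairs, the contraction is used. A word with units at both
  ends has the form \<open>append_one v\<close>, and applying the differential twice to it gives a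
  multiple by a sign of \<open>d v\<close> plus \<open>d (append_one (d v))\<close>, which cancel by
  \<open>c\<close>. Condition \<open>c\<close> in turn follows from the contraction and the
  vanishing of the composite one degree lower, the augmentation taking that role in degree
  zero.\<close>

lemma bar_diff_diff_step:
  assumes c: "!!v. v <: B (Suc n) ==> bd n (append_one (Suc (Suc n)) (bd n v)) = signed (B n) (int (Suc n)) (bd n v)"
    and u: "u <: (B (Suc (Suc n)))"
  shows "bd n (bd (Suc n) u) = 1\<^sub>(B n)"
proof -
  note L = central_bimoduleD(2)[OF central_bar[of n]] and R = central_bimoduleD(3)[OF central_bar[of n]]
  have one: "(%u. 1\<^sub>(B n)) \<in> twisted A A id 0 (B (Suc (Suc n))) (B n)"
    by (rule twistedI[OF hom_const_one[OF B_group]])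
       (simp_all add: hom_one[OF lm_hom[OF L] B_group B_group] hom_one[OF rm_hom[OF R] B_group B_group] del: bar_simps)
  show ?thesis
  proof (rule twisted_bar_eqI[OF twisted_precomp[OF bar_diff_twisted bar_diff_twisted] one B_group _ u])
    fix ts assume ts: "ts \<in> words A (Suc (Suc n))"
    let ?v = "pw (Suc (Suc (Suc n))) (1\<^sub>A # ts)"
    have w: "1\<^sub>A # ts \<in> words A (Suc (Suc (Suc n)))" using ts by (simp add: words_Cons)
    have v: "?v <: B (Suc n)" by (rule pw_closed[OF w])
    have dv: "bd n ?v <: B n" by (rule hom_closed[OF bar_diff_hom v])
    have p: "pw (Suc (Suc (Suc (Suc n)))) (1\<^sub>A # ts @ [1\<^sub>A]) = append_one (Suc (Suc (Suc n))) ?v"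
      using append_one_pure[OF w] by simp
    show "bd n (bd (Suc n) (pw (Suc (Suc (Suc (Suc n)))) (1\<^sub>A # ts @ [1\<^sub>A]))) = 1\<^sub>(B n)"
      unfolding p contraction_Suc[OF v]
        hom_mult[OF bar_diff_hom signed_closed[OF B_group v] hom_closed[OF append_one_hom' dv]] hom_signed[OF bar_diff_hom' B_group B_group v] c[OF v]
      by (rule signed_cancel[OF bar_comm_group dv]) simp
  qed
qed

lemma bar_diff_diff: "u <: (B (Suc (Suc n))) ==> bd n (bd (Suc n) u) = 1\<^sub>(B n)"
proof (induction n arbitrary: u)
  case 0
  show ?case
  proof (rule bar_diff_diff_step[OF _ 0])
    fix v assume v: "v <: B (Suc 0)"
    have w: "bd 0 v <: B 0" by (rule hom_closed[OF bar_diff_hom v])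
    show "bd 0 (append_one n2 (bd 0 v)) = signed (B 0) (int (Suc 0)) (bd 0 v)"
      unfolding contraction_0[OF w] augmentation_diff[OF v] hom_one[OF unit_tensor_hom group_add B_group, simplified]
      using monoid.r_one[OF group.is_monoid[OF B_group] group.inv_closed[OF B_group w]] by (simp add: signed_def)
  qed
next
  case (Suc n)
  show ?case
  proof (rule bar_diff_diff_step[OF _ Suc.prems])
    fix v assume v: "v <: (B (Suc (Suc n)))"
    have w: "bd (Suc n) v <: B (Suc n)" by (rule hom_closed[OF bar_diff_hom v])
    show "bd (Suc n) (append_one (Suc (Suc (Suc n))) (bd (Suc n) v)) = signed (B (Suc n)) (int (Suc (Suc n))) (bd (Suc n) v)"
      unfolding contraction_Suc[OF w] Suc.IH[OF v] hom_one[OF append_one_hom' B_group B_group]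
      by (rule monoid.r_one[OF group.is_monoid[OF B_group] signed_closed[OF B_group w]])
  qed
qed

end

context alg_map
begin

definition bar_map :: "nat => ('r list \<Rightarrow>\<^sub>0 int) set => ('t list \<Rightarrow>\<^sub>0 int) set" where
  "bar_map n = word_lift K R (Suc (Suc n)) (bar K T n) (%xs. pure_word K T (Suc (Suc n)) (map \<phi> xs))"

lemma slotwise_map: "slotwise K R T n n (map \<phi>)"
  by (rule slotwiseI[where k="%j. j" and g="%j xs. \<phi>"])
     (auto simp: words_def hom map_update)

lemma map_words: "xs \<in> words R n ==> map \<phi> xs \<in> words T n"
  by (auto simp: words_def hom(4))

lemma bar_map_hom: "bar_map n \<in> hom (bar K R n) (bar K T n)"
  unfolding bar_map_def
  using tensor_powers.word_lift_hom[OF R.tp T.bar_comm_group R.multilinear_comp[OF T.pw_multilinear slotwise_map]] by simp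

lemma bar_map_pure: "xs \<in> words R (Suc (Suc n)) ==> bar_map n (pure_word K R (Suc (Suc n)) xs) = pure_word K T (Suc (Suc n)) (map \<phi> xs)"
  unfolding bar_map_def
  by (rule tensor_powers.word_lift_pure[OF R.tp T.bar_comm_group R.multilinear_comp[OF T.pw_multilinear slotwise_map]])

lemma bar_map_twisted: "bar_map n \<in> twisted R T \<phi> 0 (bar K R n) (bar K T n)"
proof (rule twistedI[OF bar_map_hom])
  note NN = central_bimoduleD[OF T.central_bar]
  have bh: "bar_map n \<in> hom (tensor_power K R (Suc (Suc n))) (bar K T n)" using bar_map_hom by simp
  fix a m assume a: "a <: R" and "m <: bar K R n"
  then have m: "m <: (tensor_power K R (Suc (Suc n)))" by simp
  have \<phi>a: "\<phi> a <: T" using hom(4)[OF a] .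
  have "bar_map n (lact (bar K R n) a m) = lact (bar K T n) (\<phi> a) (bar_map n m)"
  proof (rule tensor_powers.hom_eqI[OF R.tp hom_comp[OF R.bar_lact_hom[OF a] bh] hom_comp[OF bh lm_hom[OF NN(2) \<phi>a]] T.B_group _ m])
    fix xs assume xs: "xs \<in> words R (Suc (Suc n))"
    have w: "xs[0 := a *\<^sub>R xs ! 0] \<in> words R (Suc (Suc n))"
      using words_update[OF xs R.m_closed[OF a words_nth[OF xs, of 0]]] by simp
    show "bar_map n (lact (bar K R n) a (pure_word K R (Suc (Suc n)) xs)) = lact (bar K T n) (\<phi> a) (bar_map n (pure_word K R (Suc (Suc n)) xs))"
      unfolding R.bar_lact_pure[OF a xs] bar_map_pure[OF w] bar_map_pure[OF xs] T.bar_lact_pure[OF \<phi>a map_words[OF xs]]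
      using words_nth[OF xs, of 0] words_length[OF xs] a by (simp add: map_update hom(6))
  qed
  then show "bar_map n (lact (bar K R n) a m) = lact (bar K T n) (koszul T 0 (\<phi> a)) (bar_map n m)" using \<phi>a by (simp add: T.koszul_0)
  show "bar_map n (ract (bar K R n) m a) = ract (bar K T n) (bar_map n m) (\<phi> a)"
  proof (rule tensor_powers.hom_eqI[OF R.tp hom_comp[OF R.bar_ract_hom[OF a] bh] hom_comp[OF bh rm_hom[OF NN(3) \<phi>a]] T.B_group _ m])
    fix xs assume xs: "xs \<in> words R (Suc (Suc n))"
    have w: "xs[Suc n := xs ! Suc n *\<^sub>R a] \<in> words R (Suc (Suc n))"
      using words_update[OF xs R.m_closed[OF words_nth[OF xs, of "Suc n"] a]] by simp
    show "bar_map n (ract (bar K R n) (pure_word K R (Suc (Suc n)) xs) a) = ract (bar K T n) (bar_map n (pure_word K R (Suc (Suc n)) xs)) (\<phi> a)"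
      unfolding R.bar_ract_pure[OF a xs] bar_map_pure[OF w] bar_map_pure[OF xs] T.bar_ract_pure[OF \<phi>a map_words[OF xs]]
      using words_nth[OF xs, of "Suc n"] words_length[OF xs] a by (simp add: map_update hom(6))
  qed
qed

lemma bar_map_diff:
  assumes u: "u <: bar K R (Suc n)"
  shows "bar_map n (bar_diff K R n u) = bar_diff K T n (bar_map (Suc n) u)"
proof (rule tensor_powers.hom_eqI[OF R.tp _ _ T.B_group])
  show "(%u. bar_map n (bar_diff K R n u)) \<in> hom (tensor_power K R (Suc (Suc (Suc n)))) (bar K T n)"
    using hom_comp[OF R.bar_diff_hom bar_map_hom] by simp
  show "(%u. bar_diff K T n (bar_map (Suc n) u)) \<in> hom (tensor_power K R (Suc (Suc (Suc n)))) (bar K T n)"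
    using hom_comp[OF bar_map_hom T.bar_diff_hom] by simp
  show "u \<in> carrier (tensor_power K R (Suc (Suc (Suc n))))" using u by simp
  fix xs assume xs: "xs \<in> words R (Suc (Suc (Suc n)))"
  interpret G: comm_group "bar K T n" by (rule T.bar_comm_group)
  note mw = map_words[OF xs]
  have len: "length xs = Suc (Suc (Suc n))" using words_length[OF xs] .
  show "bar_map n (bar_diff K R n (pure_word K R (Suc (Suc (Suc n))) xs)) = bar_diff K T n (bar_map (Suc n) (pure_word K R (Suc (Suc (Suc n))) xs))"
    unfolding bar_map_pure[OF xs] R.bar_diff_pure[OF xs] T.bar_diff_pure[OF mw] R.hom_bar_finprod[OF bar_map_hom T.bar_comm_group xs order_refl]
  proof (rule G.finprod_cong'[OF refl])
    show "(%i. signed (bar K T n) (int i) (pure_word K T (Suc (Suc n)) (multiply_at T i (map \<phi> xs)))) \<in> {..Suc n} \<rightarrow> carrier (bar K T n)"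
      using signed_closed[OF T.B_group T.pw_closed[OF T.mult_at[OF mw]]] by auto
    fix i assume i: "i \<in> {..Suc n}"
    then have c: "xs ! i <: R" "xs ! Suc i <: R" using words_nth[OF xs] by auto
    have "map \<phi> (multiply_at R i xs) = multiply_at T i (map \<phi> xs)"
      using i len c by (simp add: multiply_at_def take_map drop_map hom(6))
    then show "signed (bar K T n) (int i) (bar_map n (pure_word K R (Suc (Suc n)) (multiply_at R i xs))) =
        signed (bar K T n) (int i) (pure_word K T (Suc (Suc n)) (multiply_at T i (map \<phi> xs)))"
      using bar_map_pure[OF R.mult_at[OF xs, of i]] i by simp
  qed
qed

end

section \<open>Base change of the bar construction\<close>

lemma bimodule_restricted:
  assumes "ring T" "\<alpha> \<in> ring_hom L T" "\<beta> \<in> ring_hom R T"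
  shows "bimodule L R (restricted_bimod T \<alpha> \<beta>)"
proof -
  interpret ring T by fact
  have "comm_group (restricted_bimod T \<alpha> \<beta>)"
    by (rule comm_group_cong[OF _ _ _ a_comm_group]) simp_all
  then show ?thesis
    using ring_hom_closed[OF assms(2)] ring_hom_add[OF assms(2)] ring_hom_mult[OF assms(2)] ring_hom_one[OF assms(2)]
      ring_hom_closed[OF assms(3)] ring_hom_add[OF assms(3)] ring_hom_mult[OF assms(3)] ring_hom_one[OF assms(3)]
    unfolding bimodule_def left_module_def right_module_def
    by (simp add: l_distr r_distr m_assoc)
qed

context alg_map
begin

abbreviation "Tl \<equiv> restricted_bimod T id \<phi>"
abbreviation "Tr \<equiv> restricted_bimod T \<phi> id"
abbreviation "BR n \<equiv> bar K R n"
abbreviation "M n \<equiv> half_base_change K R T \<phi> n"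
abbreviation "X n \<equiv> base_change K R T \<phi> n"
abbreviation "pM n \<equiv> pure_tensor R Tl (BR n)"
abbreviation "pX n \<equiv> pure_tensor R (M n) Tr"

lemma id_ring_hom: "id \<in> ring_hom T T"
  by (simp add: ring_hom_def)

lemma bimod_Tl: "bimodule T R Tl" and bimod_Tr: "bimodule R T Tr"
  by (intro bimodule_restricted T.ring_A id_ring_hom hom(1))+

lemma bimod_BR: "bimodule R R (BR n)"
  using central_bimoduleD(1)[OF R.central_bar] .

lemma tpM: "tensor_product R Tl (BR n)"
  by (rule tensor_productI[OF bimod_Tl bimod_BR])

lemma M_eq: "M n = tensor R Tl (BR n)"
  by (simp add: half_base_change_def)

lemma bimod_M: "bimodule T R (M n)"
  unfolding M_eq by (rule bimodule_tensor[OF bimod_Tl bimod_BR T.ring_A R.ring_A])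

lemma tpX: "tensor_product R (M n) Tr"
  by (rule tensor_productI[OF bimod_M bimod_Tr])

lemma X_eq: "X n = tensor R (M n) Tr"
  by (simp add: base_change_def)

lemma bimod_X: "bimodule T T (X n)"
  unfolding X_eq by (rule bimodule_tensor[OF bimod_M bimod_Tr T.ring_A T.ring_A])

lemma M_group: "group (M n)" "comm_group (M n)" and X_group: "group (X n)" "comm_group (X n)"
  using lm_group[OF bimodule_left[OF bimod_M]] lm_comm_group[OF bimodule_left[OF bimod_M]]
    lm_group[OF bimodule_left[OF bimod_X]] lm_comm_group[OF bimodule_left[OF bimod_X]] by blast+

lemma pM_closed: "[|t <: T; b <: BR n|] ==> pM n t b <: M n"
  unfolding M_eq using tensor_product.pure_closed[OF tpM, of t b n] by simp

lemma pX_closed: "[|u <: M n; t <: T|] ==> pX n u t <: X n"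
  unfolding X_eq using tensor_product.pure_closed[OF tpX, of u n t] by simp

lemma pM_balanced: "balanced R Tl (BR n) (M n) (pM n)"
  using tensor_product.pure_balanced[OF tpM, of n] by (simp add: balanced_def M_eq)

lemma pX_balanced: "balanced R (M n) Tr (X n) (pX n)"
  using tensor_product.pure_balanced[OF tpX, of n] unfolding balanced_def X_eq hom_tensor .

lemma pM_balance: "[|t <: T; r <: R; b <: BR n|] ==> pM n (t *\<^sub>T \<phi> r) b = pM n t (lact (BR n) r b)"
  using pM_balanced[of n] by (simp add: balanced_def)

lemma pX_balance: "[|u <: M n; r <: R; t <: T|] ==> pX n (ract (M n) u r) t = pX n u (\<phi> r *\<^sub>T t)"
  using pX_balanced[of n] by (simp add: balanced_def)

lemma pM_hom: "b <: BR n ==> (%t. pM n t b) \<in> hom (add_monoid T) (M n)" "t <: T ==> pM n t \<in> hom (BR n) (M n)"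
  using pM_balanced[of n] unfolding balanced_def by simp_all

lemma pX_hom: "t <: T ==> (%u. pX n u t) \<in> hom (M n) (X n)" "u <: M n ==> pX n u \<in> hom (add_monoid T) (X n)"
  using pX_balanced[of n] unfolding balanced_def by simp_all

lemma M_lact: "[|a <: T; t <: T; b <: BR n|] ==> lact (M n) a (pM n t b) = pM n (a *\<^sub>T t) b"
  unfolding M_eq using tensor_lact_pure[OF bimod_Tl bimod_BR, of a t b n] by simp

lemma M_ract: "[|a <: R; t <: T; b <: BR n|] ==> ract (M n) (pM n t b) a = pM n t (ract (BR n) b a)"
  unfolding M_eq using tensor_ract_pure[OF bimod_Tl bimod_BR, of a t b n] by simp

lemma X_lact: "[|a <: T; u <: M n; t <: T|] ==> lact (X n) a (pX n u t) = pX n (lact (M n) a u) t"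
  unfolding X_eq using tensor_lact_pure[OF bimod_M bimod_Tr, of a u n t] by simp

lemma X_ract: "[|a <: T; u <: M n; t <: T|] ==> ract (X n) (pX n u t) a = pX n u (t *\<^sub>T a)"
  unfolding X_eq using tensor_ract_pure[OF bimod_M bimod_Tr, of a u n t] by simp

lemma M_hom_eqI:
  assumes "h \<in> hom (M n) H" "h' \<in> hom (M n) H" "group H"
    "!!t b. [|t <: T; b <: BR n|] ==> h (pM n t b) = h' (pM n t b)" "u <: M n"
  shows "h u = h' u"
proof (rule tensor_product.hom_eqI[OF tpM])
  show "h \<in> hom (tensor_group R Tl (BR n)) H" "h' \<in> hom (tensor_group R Tl (BR n)) H" "u <: tensor_group R Tl (BR n)"
    using assms(1,2,5) unfolding M_eq by simp_all
qed (use assms(3,4) in simp_all)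

lemma X_hom_eqI':
  assumes "h \<in> hom (X n) H" "h' \<in> hom (X n) H" "group H"
    "!!u t. [|u <: M n; t <: T|] ==> h (pX n u t) = h' (pX n u t)" "x <: X n"
  shows "h x = h' x"
proof (rule tensor_product.hom_eqI[OF tpX])
  show "h \<in> hom (tensor_group R (M n) Tr) H" "h' \<in> hom (tensor_group R (M n) Tr) H" "x <: tensor_group R (M n) Tr"
    using assms(1,2,5) unfolding X_eq by simp_all
qed (use assms(3,4) in simp_all)

lemma X_hom_eqI:
  assumes "h \<in> hom (X n) H" "h' \<in> hom (X n) H" "group H"
    "!!t b t'. [|t <: T; b <: BR n; t' <: T|] ==> h (pX n (pM n t b) t') = h' (pX n (pM n t b) t')"
    "x <: X n"
  shows "h x = h' x"
proof (rule X_hom_eqI'[OF assms(1-3) _ assms(5)])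
  fix u t assume u: "u <: M n" and t: "t <: T"
  show "h (pX n u t) = h' (pX n u t)"
    by (rule M_hom_eqI[OF hom_comp[OF pX_hom(1)[OF t] assms(1)] hom_comp[OF pX_hom(1)[OF t] assms(2)] assms(3) _ u])
       (rule assms(4)[OF _ _ t])
qed

definition unit_gen :: "nat => _" where
  "unit_gen n b = pX n (pM n 1\<^sub>T b) 1\<^sub>T"

lemma unit_gen_closed: "b <: BR n ==> unit_gen n b <: X n"
  unfolding unit_gen_def by (intro pX_closed pM_closed) auto

lemma gen_eq:
  assumes "t <: T" "b <: BR n" "t' <: T"
  shows "pX n (pM n t b) t' = lact (X n) t (ract (X n) (unit_gen n b) t')"
  unfolding unit_gen_def using assms pM_closed[OF T.one_closed assms(2)]
  by (simp add: X_ract X_lact M_lact)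

text \<open>As a bimodule over \<open>T\<close>, each term is generated by the elements
  \<open>1 \<otimes> b \<otimes> 1\<close>.\<close>

lemma X_twisted_eqI:
  assumes f: "f \<in> twisted T T id e (X n) N" and g: "g \<in> twisted T T id e (X n) N" and N: "group N"
    and eq: "!!b. b <: BR n ==> f (unit_gen n b) = g (unit_gen n b)" and x: "x <: X n"
  shows "f x = g x"
proof (rule X_hom_eqI[OF twistedD(1)[OF f] twistedD(1)[OF g] N _ x])
  fix t b t' assume t: "t <: T" "b <: BR n" "t' <: T"
  have c: "unit_gen n b <: X n" using unit_gen_closed[OF t(2)] .
  have c2: "ract (X n) (unit_gen n b) t' <: X n" using rm_closed[OF bimodule_right[OF bimod_X] t(3) c] .
  show "f (pX n (pM n t b) t') = g (pX n (pM n t b) t')"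
    unfolding gen_eq[OF t] twistedD(2)[OF f t(1) c2] twistedD(2)[OF g t(1) c2] twistedD(3)[OF f t(3) c] twistedD(3)[OF g t(3) c]
      eq[OF t(2)] ..
qed

text \<open>A scalar crosses the first tensor sign by balancing, the bar term by its centrality, and
  the second tensor sign by balancing again.\<close>

lemma central_X: "central_bimodule K T (X n)"
  unfolding central_bimodule_def
proof (intro conjI ballI bimod_X)
  fix c x assume c: "c <: K" and x: "x <: X n"
  have cT: "c \<cdot>\<^sub>T 1\<^sub>T <: T" and cR: "c \<cdot>\<^sub>R 1\<^sub>R <: R" using c by auto
  have \<phi>c: "\<phi> (c \<cdot>\<^sub>R 1\<^sub>R) = c \<cdot>\<^sub>T 1\<^sub>T" using c hom(2,7) by simp
  show "lact (X n) (c \<cdot>\<^sub>T 1\<^sub>T) x = ract (X n) x (c \<cdot>\<^sub>T 1\<^sub>T)"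
  proof (rule X_hom_eqI[OF lm_hom[OF bimodule_left[OF bimod_X] cT] rm_hom[OF bimodule_right[OF bimod_X] cT] X_group(1) _ x])
    fix t b t' assume t: "t <: T" "b <: BR n" "t' <: T"
    have u: "pM n t b <: M n" using pM_closed t by blast
    have "lact (X n) (c \<cdot>\<^sub>T 1\<^sub>T) (pX n (pM n t b) t') = pX n (pM n (t *\<^sub>T \<phi> (c \<cdot>\<^sub>R 1\<^sub>R)) b) t'"
      unfolding X_lact[OF cT u t(3)] M_lact[OF cT t(1,2)] \<phi>c using c t T.smult_one_mult T.mult_smult_one by simp
    also have "\<dots> = pX n (pM n t (lact (BR n) (c \<cdot>\<^sub>R 1\<^sub>R) b)) t'" unfolding pM_balance[OF t(1) cR t(2)] ..
    also have "lact (BR n) (c \<cdot>\<^sub>R 1\<^sub>R) b = ract (BR n) b (c \<cdot>\<^sub>R 1\<^sub>R)"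
      by (rule central_bimoduleD(4)[OF R.central_bar c t(2)])
    also have "pX n (pM n t (ract (BR n) b (c \<cdot>\<^sub>R 1\<^sub>R))) t' = pX n (pM n t b) (\<phi> (c \<cdot>\<^sub>R 1\<^sub>R) *\<^sub>T t')"
      unfolding M_ract[OF cR t(1,2), symmetric] by (rule pX_balance[OF u cR t(3)])
    also have "\<dots> = ract (X n) (pX n (pM n t b) t') (c \<cdot>\<^sub>T 1\<^sub>T)"
      unfolding X_ract[OF cT u t(3)] \<phi>c using c t T.smult_one_mult T.mult_smult_one by simp
    finally show "lact (X n) (c \<cdot>\<^sub>T 1\<^sub>T) (pX n (pM n t b) t') = ract (X n) (pX n (pM n t b) t') (c \<cdot>\<^sub>T 1\<^sub>T)" .
  qed
qed

section \<open>Maps out of the base-changed complex\<close>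

context
  fixes N :: "('t, 'n, 't) gr_bimod" and n e \<alpha>
  assumes N: "central_bimodule K T N" and \<alpha>: "\<alpha> \<in> twisted R T \<phi> e (BR n) N"
begin

abbreviation "inner \<equiv> tensor_lift R Tl (BR n) N (%t b. lact N (koszul T e t) (\<alpha> b))"

lemma NN: "left_module T N" "right_module T N" "comm_group N" "group N"
  using central_bimoduleD[OF N] lm_comm_group lm_group by blast+

lemma inner_balanced: "balanced R Tl (BR n) N (%t b. lact N (koszul T e t) (\<alpha> b))"
proof (rule balancedI)
  show "(%t. lact N (koszul T e t) (\<alpha> b)) \<in> hom Tl N" if "b <: BR n" for b
    using hom_comp[OF T.koszul_hom lm_act_hom[OF NN(1) twistedD(4)[OF \<alpha> that]]] by simp
  show "(%b. lact N (koszul T e t) (\<alpha> b)) \<in> hom (BR n) N" if "t <: Tl" for t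
    using hom_comp[OF twistedD(1)[OF \<alpha>] lm_hom[OF NN(1)]] that by simp
  fix t r b assume t: "t <: Tl" and r: "r <: R" and b: "b <: BR n"
  show "lact N (koszul T e (ract Tl t r)) (\<alpha> b) = lact N (koszul T e t) (\<alpha> (lact (BR n) r b))"
    unfolding twistedD(2)[OF \<alpha> r b] using t hom(4)[OF r] twistedD(4)[OF \<alpha> b]
    by (simp add: T.koszul_mult lm_assoc[OF NN(1)])
qed

lemma inner_hom: "inner \<in> hom (M n) N"
  and inner_pure: "[|t <: T; b <: BR n|] ==> inner (pM n t b) = lact N (koszul T e t) (\<alpha> b)"
  using tensor_product.tensor_lift_hom[OF tpM NN(3) inner_balanced]
    tensor_product.tensor_lift_pure[OF tpM NN(3) inner_balanced, of t b] by (simp_all add: M_eq)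

lemma inner_lact:
  assumes "a <: T" "u <: M n"
  shows "inner (lact (M n) a u) = lact N (koszul T e a) (inner u)"
proof (rule M_hom_eqI[OF hom_comp[OF lm_hom[OF bimodule_left[OF bimod_M] assms(1)] inner_hom]
      hom_comp[OF inner_hom lm_hom[OF NN(1) T.koszul_closed[OF assms(1)]]] NN(4) _ assms(2)])
  fix t b assume t: "t <: T" "b <: BR n"
  have at: "a *\<^sub>T t <: T" using assms t by simp
  show "inner (lact (M n) a (pM n t b)) = lact N (koszul T e a) (inner (pM n t b))"
    unfolding M_lact[OF assms(1) t] inner_pure[OF at t(2)] inner_pure[OF t]
    using assms(1) t(1) twistedD(4)[OF \<alpha> t(2)] by (simp add: T.koszul_mult lm_assoc[OF NN(1)])
qed

lemma inner_ract:
  assumes "a <: R" "u <: M n"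
  shows "inner (ract (M n) u a) = ract N (inner u) (\<phi> a)"
proof (rule M_hom_eqI[OF hom_comp[OF rm_hom[OF bimodule_right[OF bimod_M] assms(1)] inner_hom]
      hom_comp[OF inner_hom rm_hom[OF NN(2) hom(4)[OF assms(1)]]] NN(4) _ assms(2)])
  fix t b assume t: "t <: T" "b <: BR n"
  have rb: "ract (BR n) b a <: BR n" using rm_closed[OF bimodule_right[OF bimod_BR] assms(1) t(2)] .
  show "inner (ract (M n) (pM n t b) a) = ract N (inner (pM n t b)) (\<phi> a)"
    unfolding M_ract[OF assms(1) t] inner_pure[OF t(1) rb] inner_pure[OF t] twistedD(3)[OF \<alpha> assms(1) t(2)]
    by (rule bimodule_assoc[OF central_bimoduleD(1)[OF N] T.koszul_closed[OF t(1)] hom(4)[OF assms(1)] twistedD(4)[OF \<alpha> t(2)]])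
qed

lemma outer_balanced: "balanced R (M n) Tr N (%u t'. ract N (inner u) t')"
proof (rule balancedI)
  note ic = hom_closed[OF inner_hom]
  show "(%u. ract N (inner u) t') \<in> hom (M n) N" if "t' <: Tr" for t'
    using hom_comp[OF inner_hom rm_hom[OF NN(2)]] that by simp
  show "(%t'. ract N (inner u) t') \<in> hom Tr N" if "u <: M n" for u
    using rm_act_hom[OF NN(2) ic[OF that]] by simp
  fix u r t' assume u: "u <: M n" and r: "r <: R" and t: "t' <: Tr"
  show "ract N (inner (ract (M n) u r)) t' = ract N (inner u) (lact Tr r t')"
    unfolding inner_ract[OF r u] using rm_assoc[OF NN(2) hom(4)[OF r] _ ic[OF u], of t'] t by simp
qed

lemma sandwich_eq: "sandwich K R T \<phi> n N e \<alpha> = tensor_lift R (M n) Tr N (%u t'. ract N (inner u) t')"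
  by (simp add: sandwich_def)

lemma sandwich_hom: "sandwich K R T \<phi> n N e \<alpha> \<in> hom (X n) N"
  unfolding sandwich_eq X_eq using tensor_product.tensor_lift_hom[OF tpX NN(3) outer_balanced] by simp

lemma sandwich_extensional: "sandwich K R T \<phi> n N e \<alpha> \<in> extensional (carrier (X n))"
  unfolding sandwich_eq X_eq using tensor_product.tensor_lift_extensional[OF tpX NN(3) outer_balanced] by simp

lemma sandwich_pX: "[|u <: M n; t' <: T|] ==> sandwich K R T \<phi> n N e \<alpha> (pX n u t') = ract N (inner u) t'"
  unfolding sandwich_eq using tensor_product.tensor_lift_pure[OF tpX NN(3) outer_balanced, of u t'] by simp

lemma sandwich_pure: "[|t <: T; b <: BR n; t' <: T|] ==>
   sandwich K R T \<phi> n N e \<alpha> (pX n (pM n t b) t') = ract N (lact N (koszul T e t) (\<alpha> b)) t'"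
  using sandwich_pX[OF pM_closed] inner_pure by simp

lemma sandwich_unit: "b <: BR n ==> sandwich K R T \<phi> n N e \<alpha> (unit_gen n b) = \<alpha> b"
  unfolding unit_gen_def using sandwich_pure[OF T.one_closed _ T.one_closed] twistedD(4)[OF \<alpha>]
  by (simp add: T.koszul_one lm_one[OF NN(1)] rm_one[OF NN(2)])

lemma sandwich_twisted: "sandwich K R T \<phi> n N e \<alpha> \<in> twisted T T id e (X n) N" (is "?s \<in> _")
proof (rule twistedI[OF sandwich_hom])
  fix a x assume a: "a <: T" and x: "x <: X n"
  have ka: "koszul T e a <: T" using a by simp
  note ic = hom_closed[OF inner_hom]
  have "?s (lact (X n) a x) = lact N (koszul T e a) (?s x)"
  proof (rule X_hom_eqI'[OF hom_comp[OF lm_hom[OF bimodule_left[OF bimod_X] a] sandwich_hom] hom_comp[OF sandwich_hom lm_hom[OF NN(1) ka]] NN(4) _ x])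
    fix u t assume u: "u <: M n" and t: "t <: T"
    have lu: "lact (M n) a u <: M n" using lm_closed[OF bimodule_left[OF bimod_M] a u] .
    show "?s (lact (X n) a (pX n u t)) = lact N (koszul T e a) (?s (pX n u t))"
      unfolding X_lact[OF a u t] sandwich_pX[OF lu t] sandwich_pX[OF u t] inner_lact[OF a u]
      by (rule bimodule_assoc[symmetric, OF central_bimoduleD(1)[OF N] ka t ic[OF u]])
  qed
  then show "?s (lact (X n) a x) = lact N (koszul T e (id a)) (?s x)" by simp
  have "?s (ract (X n) x a) = ract N (?s x) a"
  proof (rule X_hom_eqI'[OF hom_comp[OF rm_hom[OF bimodule_right[OF bimod_X] a] sandwich_hom] hom_comp[OF sandwich_hom rm_hom[OF NN(2) a]] NN(4) _ x])
    fix u t assume u: "u <: M n" and t: "t <: T"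
    have ta: "t *\<^sub>T a <: T" using t a by simp
    show "?s (ract (X n) (pX n u t) a) = ract N (?s (pX n u t)) a"
      unfolding X_ract[OF a u t] sandwich_pX[OF u ta] sandwich_pX[OF u t] by (rule rm_assoc[OF NN(2) t a ic[OF u]])
  qed
  then show "?s (ract (X n) x a) = ract N (?s x) (id a)" by simp
qed

end

section \<open>The base-changed differential and the comparison map\<close>

definition M_diff :: "nat => _" where
  "M_diff n = tensor_map R Tl (BR (Suc n)) Tl (BR n) id (bar_diff K R n)"

abbreviation "D n \<equiv> base_change_diff K R T \<phi> n"

lemma D_eq: "D n = tensor_map R (M (Suc n)) Tr (M n) Tr (M_diff n) id"
  by (simp add: base_change_diff_def M_diff_def)

lemma bar_diff_lact: "[|r <: R; b <: BR (Suc n)|] ==> bar_diff K R n (lact (BR (Suc n)) r b) = lact (BR n) r (bar_diff K R n b)"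
  using twistedD(2)[OF R.bar_diff_twisted, of r b n] by (simp add: R.koszul_0)

lemma bar_diff_ract: "[|r <: R; b <: BR (Suc n)|] ==> bar_diff K R n (ract (BR (Suc n)) b r) = ract (BR n) (bar_diff K R n b) r"
  using twistedD(3)[OF R.bar_diff_twisted, of r b n] by simp

lemma id_Tl: "id \<in> hom Tl Tl" "id \<in> hom Tr Tr"
  by (simp_all add: hom_def)

lemma M_diff_hom: "M_diff n \<in> hom (M (Suc n)) (M n)"
  and M_diff_pure: "[|t <: T; b <: BR (Suc n)|] ==> M_diff n (pM (Suc n) t b) = pM n t (bar_diff K R n b)"
proof -
  have *: "bar_diff K R n \<in> hom (BR (Suc n)) (BR n)" using R.bar_diff_hom .
  show "M_diff n \<in> hom (M (Suc n)) (M n)"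
    using tensor_map_hom[OF tpM tpM id_Tl(1) _ * bar_diff_lact] by (simp add: M_eq M_diff_def)
  show "[|t <: T; b <: BR (Suc n)|] ==> M_diff n (pM (Suc n) t b) = pM n t (bar_diff K R n b)"
    using tensor_map_pure[OF tpM tpM id_Tl(1) _ * bar_diff_lact, of t b] by (simp add: M_diff_def)
qed

lemma M_diff_ract:
  assumes "r <: R" "u <: M (Suc n)"
  shows "M_diff n (ract (M (Suc n)) u r) = ract (M n) (M_diff n u) r"
proof (rule M_hom_eqI[OF hom_comp[OF rm_hom[OF bimodule_right[OF bimod_M] assms(1)] M_diff_hom]
    hom_comp[OF M_diff_hom rm_hom[OF bimodule_right[OF bimod_M] assms(1)]] M_group(1) _ assms(2)])
  fix t b assume t: "t <: T" "b <: BR (Suc n)"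
  have c: "ract (BR (Suc n)) b r <: BR (Suc n)" "bar_diff K R n b <: BR n"
    using rm_closed[OF bimodule_right[OF bimod_BR] assms(1) t(2)] hom_closed[OF R.bar_diff_hom t(2)] .
  show "M_diff n (ract (M (Suc n)) (pM (Suc n) t b) r) = ract (M n) (M_diff n (pM (Suc n) t b)) r"
    unfolding M_ract[OF assms(1) t] M_diff_pure[OF t(1) c(1)] M_diff_pure[OF t] M_ract[OF assms(1) t(1) c(2)] bar_diff_ract[OF assms(1) t(2)] ..
qed

lemma M_diff_lact:
  assumes "a <: T" "u <: M (Suc n)"
  shows "M_diff n (lact (M (Suc n)) a u) = lact (M n) a (M_diff n u)"
proof (rule M_hom_eqI[OF hom_comp[OF lm_hom[OF bimodule_left[OF bimod_M] assms(1)] M_diff_hom]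
    hom_comp[OF M_diff_hom lm_hom[OF bimodule_left[OF bimod_M] assms(1)]] M_group(1) _ assms(2)])
  fix t b assume t: "t <: T" "b <: BR (Suc n)"
  have c: "a *\<^sub>T t <: T" "bar_diff K R n b <: BR n"
    using assms(1) t hom_closed[OF R.bar_diff_hom t(2)] by auto
  show "M_diff n (lact (M (Suc n)) a (pM (Suc n) t b)) = lact (M n) a (M_diff n (pM (Suc n) t b))"
    unfolding M_lact[OF assms(1) t] M_diff_pure[OF c(1) t(2)] M_diff_pure[OF t] M_lact[OF assms(1) t(1) c(2)] ..
qed

lemma D_hom: "D n \<in> hom (X (Suc n)) (X n)"
  and D_pX: "[|u <: M (Suc n); t <: T|] ==> D n (pX (Suc n) u t) = pX n (M_diff n u) t"
proof -
  show "D n \<in> hom (X (Suc n)) (X n)"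
    using tensor_map_hom[OF tpX tpX M_diff_hom M_diff_ract id_Tl(2)] by (simp add: X_eq D_eq)
  show "[|u <: M (Suc n); t <: T|] ==> D n (pX (Suc n) u t) = pX n (M_diff n u) t"
    using tensor_map_pure[OF tpX[of "Suc n"] tpX[of n] M_diff_hom M_diff_ract id_Tl(2), of u t] by (simp add: D_eq)
qed

lemma D_twisted: "D n \<in> twisted T T id 0 (X (Suc n)) (X n)"
proof (rule twistedI[OF D_hom])
  fix a x assume a: "a <: T" and x: "x <: X (Suc n)"
  note lX = lm_hom[OF bimodule_left[OF bimod_X] a] note rX = rm_hom[OF bimodule_right[OF bimod_X] a]
  have "D n (lact (X (Suc n)) a x) = lact (X n) a (D n x)"
  proof (rule X_hom_eqI'[OF hom_comp[OF lX D_hom] hom_comp[OF D_hom lX] X_group(1) _ x])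
    fix u t assume u: "u <: M (Suc n)" and t: "t <: T"
    have lu: "lact (M (Suc n)) a u <: M (Suc n)" using lm_closed[OF bimodule_left[OF bimod_M] a u] .
    show "D n (lact (X (Suc n)) a (pX (Suc n) u t)) = lact (X n) a (D n (pX (Suc n) u t))"
      unfolding X_lact[OF a u t] D_pX[OF lu t] D_pX[OF u t] M_diff_lact[OF a u] X_lact[OF a hom_closed[OF M_diff_hom u] t] ..
  qed
  then show "D n (lact (X (Suc n)) a x) = lact (X n) (koszul T 0 (id a)) (D n x)" using a by (simp add: T.koszul_0)
  have "D n (ract (X (Suc n)) x a) = ract (X n) (D n x) a"
  proof (rule X_hom_eqI'[OF hom_comp[OF rX D_hom] hom_comp[OF D_hom rX] X_group(1) _ x])
    fix u t assume u: "u <: M (Suc n)" and t: "t <: T"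
    have ta: "t *\<^sub>T a <: T" using t a by simp
    show "D n (ract (X (Suc n)) (pX (Suc n) u t) a) = ract (X n) (D n (pX (Suc n) u t)) a"
      unfolding X_ract[OF a u t] D_pX[OF u ta] D_pX[OF u t] X_ract[OF a hom_closed[OF M_diff_hom u] t] ..
  qed
  then show "D n (ract (X (Suc n)) x a) = ract (X n) (D n x) (id a)" by simp
qed

lemma D_unit: "b <: BR (Suc n) ==> D n (unit_gen (Suc n) b) = unit_gen n (bar_diff K R n b)"
  unfolding unit_gen_def by (simp add: D_pX pM_closed M_diff_pure del: bar_simps)

abbreviation "cmp n \<equiv> comparison K R T \<phi> n"

lemma comp_eq: "cmp n = sandwich K R T \<phi> n (bar K T n) 0 (bar_map n)"
  by (simp add: comparison_def bar_map_def)

lemma comp_twisted: "cmp n \<in> twisted T T id 0 (X n) (bar K T n)"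
  unfolding comp_eq by (rule sandwich_twisted[OF T.central_bar bar_map_twisted])

lemma comp_unit: "b <: BR n ==> cmp n (unit_gen n b) = bar_map n b"
  unfolding comp_eq by (rule sandwich_unit[OF T.central_bar bar_map_twisted])

lemma comp_D:
  assumes x: "x <: X (Suc n)"
  shows "cmp n (D n x) = bar_diff K T n (cmp (Suc n) x)"
proof (rule X_twisted_eqI[OF T.twisted_precomp[OF D_twisted comp_twisted] _ T.B_group _ x])
  show "(%x. bar_diff K T n (cmp (Suc n) x)) \<in> twisted T T id 0 (X (Suc n)) (bar K T n)"
    using T.twisted_comp[OF comp_twisted T.bar_diff_twisted] by simp
  show "cmp n (D n (unit_gen (Suc n) b)) = bar_diff K T n (cmp (Suc n) (unit_gen (Suc n) b))" if b: "b <: BR (Suc n)" for b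
    unfolding D_unit[OF b] comp_unit[OF hom_closed[OF R.bar_diff_hom b]] comp_unit[OF b] by (rule bar_map_diff[OF b])
qed

end

section \<open>Flatness and exactness\<close>

definition rlin :: "('r, 'p) ring_scheme => ('l, 'm, 'r, 'y) bimod_scheme => ('s, 'n, 'r, 'z) bimod_scheme => ('m => 'n) => bool" where
  "rlin R M N f \<longleftrightarrow> (\<forall>m\<in>carrier M. \<forall>r\<in>carrier R. f (ract M m r) = ract N (f m) r)"

lemma rlinI: "(!!m r. [|m <: M; r <: R|] ==> f (ract M m r) = ract N (f m) r) ==> rlin R M N f"
  by (simp add: rlin_def)

lemma rlinD: "[|rlin R M N f; m <: M; r <: R|] ==> f (ract M m r) = ract N (f m) r"
  by (simp add: rlin_def)

lemma tensor_map_left: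
  assumes M: "right_module R M" and M': "right_module R M'" and N: "left_module R N"
    and f: "f \<in> hom M M'" "rlin R M M' f"
  shows "tensor_map R M N M' N f id \<in> hom (tensor_group R M N) (tensor_group R M' N)"
    "[|m <: M; n <: N|] ==> tensor_map R M N M' N f id (pure_tensor R M N m n) = pure_tensor R M' N (f m) n"
proof -
  have tp: "tensor_product R M N" "tensor_product R M' N" using M M' N by (simp_all add: tensor_product_def)
  have id: "id \<in> hom N N" by (simp add: hom_def)
  show "tensor_map R M N M' N f id \<in> hom (tensor_group R M N) (tensor_group R M' N)"
    by (rule tensor_map_hom[OF tp f(1) _ id]) (simp_all add: rlinD[OF f(2)])
  show "[|m <: M; n <: N|] ==> tensor_map R M N M' N f id (pure_tensor R M N m n) = pure_tensor R M' N (f m) n"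
    using tensor_map_pure[OF tp f(1) _ id, of m n] rlinD[OF f(2)] by simp
qed

lemma tensor_map_left_comp:
  assumes M: "right_module R M" and M': "right_module R M'" and M'': "right_module R M''" and N: "left_module R N"
    and f: "f \<in> hom M M'" "rlin R M M' f"
    and g: "g \<in> hom M' M''" "rlin R M' M'' g"
    and h: "h \<in> hom M M''" "rlin R M M'' h"
    and gf: "\<forall>m\<in>carrier M. g (f m) = h m" and x: "x <: tensor_group R M N"
  shows "tensor_map R M' N M'' N g id (tensor_map R M N M' N f id x) = tensor_map R M N M'' N h id x"
proof -
  have tp: "tensor_product R M N" "tensor_product R M'' N" using M M'' N by (simp_all add: tensor_product_def)
  show ?thesis
  proof (rule tensor_product.hom_eqI[OF tp(1) hom_comp[OF tensor_map_left(1)[OF M M' N f] tensor_map_left(1)[OF M' M'' N g]]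
        tensor_map_left(1)[OF M M'' N h] tensor_product.group_tensor[OF tp(2)] _ x])
    fix m n assume m: "m <: M" and n: "n <: N"
    show "tensor_map R M' N M'' N g id (tensor_map R M N M' N f id (pure_tensor R M N m n)) = tensor_map R M N M'' N h id (pure_tensor R M N m n)"
      unfolding tensor_map_left(2)[OF M M' N f m n] tensor_map_left(2)[OF M' M'' N g hom_closed[OF f(1) m] n]
        tensor_map_left(2)[OF M M'' N h m n] bspec[OF gf m] ..
  qed
qed

text \<open>Transport of a right module structure along an injection into the test type, to which
  the flatness hypothesis is confined. The left action is a filler.\<close>

definition image_rmod :: "('m => 'u) => ('l, 'm, 'r, 'z) bimod_scheme => (unit, 'u, 'r) bimod" where
  "image_rmod e M = \<lparr>carrier = e ` carrier M,
     mult = (%x y. e (inv_into (carrier M) e x *\<^sub>M inv_into (carrier M) e y)), one = e 1\<^sub>M,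
     lact = (%_ x. x), ract = (%x r. e (ract M (inv_into (carrier M) e x) r))\<rparr>"

lemma image_rmod:
  assumes M: "right_module R M" and e: "inj_on e (carrier M)"
  shows "right_module R (image_rmod e M)" "e \<in> hom M (image_rmod e M)"
    "m <: M ==> ract (image_rmod e M) (e m) r = e (ract M m r)"
    "inv_into (carrier M) e \<in> hom (image_rmod e M) M"
    "[|u <: image_rmod e M; r <: R|] ==> inv_into (carrier M) e (ract (image_rmod e M) u r) = ract M (inv_into (carrier M) e u) r"
proof -
  interpret G: comm_group M by (rule rm_comm_group[OF M])
  let ?I = "image_rmod e M" and ?i = "inv_into (carrier M) e"
  have i: "m <: M ==> ?i (e m) = m" for m using e by simp
  have car: "carrier ?I = e ` carrier M" and one: "1\<^sub>?I = e 1\<^sub>M" by (simp_all add: image_rmod_def)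
  have mul: "[|x <: M; y <: M|] ==> e x *\<^sub>?I e y = e (x *\<^sub>M y)" for x y
    using i by (simp add: image_rmod_def)
  show act: "m <: M ==> ract ?I (e m) r = e (ract M m r)" for m r
    using i by (simp add: image_rmod_def)
  show "e \<in> hom M ?I" by (rule homI) (simp_all add: car mul)
  show "?i \<in> hom ?I M" by (rule homI) (auto simp: car mul i)
  show "[|u <: ?I; r <: R|] ==> ?i (ract ?I u r) = ract M (?i u) r"
    using rm_closed[OF M] by (auto simp: car act i)
  have "comm_group ?I"
  proof (rule comm_groupI)
    show "\<exists>y\<in>carrier ?I. y *\<^sub>?I x = 1\<^sub>?I" if "x <: ?I" for x
    proof -
      obtain m where m: "m <: M" "x = e m" using \<open>x <: ?I\<close> car by auto
      show ?thesis using m by (intro bexI[of _ "e (inv\<^bsub>M\<^esub> m)"]) (auto simp: car mul one)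
    qed
  qed (auto simp: car mul one G.m_ac)
  then show "right_module R ?I"
    unfolding right_module_def using rm_closed[OF M]
    by (auto simp: car act mul rm_dist[OF M] rm_add[OF M] rm_assoc[OF M] rm_one[OF M])
qed

text \<open>Both modules are copied into the test type, where flatness applies to the conjugate of
  \<open>f\<close>; the conclusion is carried back along the copies.\<close>

lemma flat_left_transfer:
  fixes e :: "'m => 'u" and e' :: "'n => 'u"
  assumes flat: "flat_as_left_module TYPE('u) R N" and N: "left_module R N"
    and M: "right_module R M" and M': "right_module R M'"
    and f: "f \<in> hom M M'" "rlin R M M' f"
    and inj: "inj_on f (carrier M)" and e: "inj_on e (carrier M)" and e': "inj_on e' (carrier M')"
  shows "inj_on (tensor_map R M N M' N f id) (carrier (tensor_group R M N))"
proof -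
  let ?I = "image_rmod e M" and ?I' = "image_rmod e' M'" and ?i = "inv_into (carrier M) e"
  note I = image_rmod[OF M e] and I' = image_rmod[OF M' e']
  define g where "g u = e' (f (?i u))" for u
  note fi = hom_comp[OF I(4) f(1)]
  have gh: "g \<in> hom ?I ?I'" unfolding g_def[abs_def] by (rule hom_comp[OF fi I'(2)])
  have gr: "rlin R ?I ?I' g"
  proof (rule rlinI)
    show "g (ract ?I u r) = ract ?I' (g u) r" if "u <: ?I" "r <: R" for u r
      unfolding g_def I(5)[OF that] rlinD[OF f(2) hom_closed[OF I(4) that(1)] that(2)] using I'(3)[OF hom_closed[OF fi that(1)]] by simp
  qed
  have "inj_on g (carrier ?I)"
  proof (rule inj_onI)
    fix x y assume xy: "x <: ?I" "y <: ?I" "g x = g y"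
    note c = hom_closed[OF I(4) xy(1)] hom_closed[OF I(4) xy(2)]
    have "f (?i x) = f (?i y)" using inj_onD[OF e' xy(3)[unfolded g_def]] hom_closed[OF f(1)] c by blast
    then have "?i x = ?i y" using inj_onD[OF inj] c by blast
    then show "x = y" using xy(1,2) by (auto simp: image_rmod_def inv_into_injective)
  qed
  then have tinj: "inj_on (tensor_map R ?I N ?I' N g id) (carrier (tensor_group R ?I N))"
    using flat gh gr I(1) I'(1) unfolding flat_as_left_module_def rlin_def by blast
  have er: "rlin R M ?I e" using I(3) by (simp add: rlin_def)
  have er': "rlin R M' ?I' e'" using I'(3) by (simp add: rlin_def)
  have efr: "rlin R M ?I' (%m. e' (f m))"
    by (rule rlinI) (simp add: rlinD[OF f(2)] rlinD[OF er'] hom_closed[OF f(1)])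
  note ef = hom_comp[OF f(1) I'(2)]
  have gi: "\<forall>m\<in>carrier M. g (e m) = e' (f m)" using e by (simp add: g_def)
  have gi': "\<forall>m\<in>carrier M. e' (f m) = e' (f m)" by simp
  show ?thesis
  proof (rule inj_onI)
    fix x y assume xy: "x <: tensor_group R M N" "y <: tensor_group R M N"
      "tensor_map R M N M' N f id x = tensor_map R M N M' N f id y"
    have "tensor_map R ?I N ?I' N g id (tensor_map R M N ?I N e id z) = tensor_map R M' N ?I' N e' id (tensor_map R M N M' N f id z)"
      if z: "z <: tensor_group R M N" for z
      using tensor_map_left_comp[OF M I(1) I'(1) N I(2) er gh gr ef efr gi z]
        tensor_map_left_comp[OF M M' I'(1) N f I'(2) er' ef efr gi' z] by simp
    then have "tensor_map R ?I N ?I' N g id (tensor_map R M N ?I N e id x) = tensor_map R ?I N ?I' N g id (tensor_map R M N ?I N e id y)"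
      using xy by simp
    then have eq: "tensor_map R M N ?I N e id x = tensor_map R M N ?I N e id y"
      using inj_onD[OF tinj] hom_closed[OF tensor_map_left(1)[OF M I(1) N I(2) er]] xy(1,2) by blast
    have id: "(%x. x) \<in> hom M M" by (simp add: hom_def)
    have ie: "\<forall>m\<in>carrier M. ?i (e m) = m" using e by simp
    have ir: "rlin R ?I M ?i" using I(5) by (simp add: rlin_def)
    have idr: "rlin R M M (%x. x)" by (simp add: rlin_def)
    \<comment> \<open>The inverse of the copying map induces a retraction, so nothing is identified
      by tensoring with \<open>e\<close>.\<close>
    have bck: "tensor_map R ?I N M N ?i id (tensor_map R M N ?I N e id z) = z" if z: "z <: tensor_group R M N" for z
    proof -
      have tp: "tensor_product R M N" using M N by (simp add: tensor_product_def)
      have 1: "tensor_map R ?I N M N ?i id (tensor_map R M N ?I N e id z) = tensor_map R M N M N (%x. x) id z"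
        by (rule tensor_map_left_comp[OF M I(1) M N I(2) er I(4) ir id idr ie z])
      have idh: "(%x. x) \<in> hom (tensor_group R M N) (tensor_group R M N)" by (simp add: hom_def)
      have 2: "tensor_map R M N M N (%x. x) id z = z"
        using tensor_product.hom_eqI[OF tp tensor_map_left(1)[OF M M N id idr] idh tensor_product.group_tensor[OF tp] tensor_map_left(2)[OF M M N id idr] z] .
      show ?thesis unfolding 1 by (rule 2)
    qed
    show "x = y" by (rule trans[OF trans[OF bck[OF xy(1), symmetric] arg_cong[OF eq, of "tensor_map R ?I N M N ?i id"]] bck[OF xy(2)]])
  qed
qed

lemma hom_image_subgroup:
  assumes "f \<in> hom G H" "group G" "group H" shows "subgroup (f ` carrier G) H"
  using group_hom.img_is_subgroup[of G H f] assms by (simp add: group_hom_def group_hom_axioms_def)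

text \<open>Let \<open>I\<close> be the image of \<open>M2 \<otimes> N\<close>. The quotient of
  \<open>M \<otimes> N\<close> by \<open>I\<close> receives a map from \<open>Z \<otimes> N\<close>
  that sends \<open>z \<otimes> n\<close> to the class of \<open>m \<otimes> n\<close> for any
  preimage \<open>m\<close> of \<open>z\<close>. Its composite with \<open>q \<otimes> id\<close> is
  the projection, so the kernel of \<open>q \<otimes> id\<close> lies in \<open>I\<close>.\<close>

lemma tensor_right_exact:
  assumes M2: "right_module R M2" and M: "right_module R M" and Z: "right_module R Z" and N: "left_module R N"
    and p: "p \<in> hom M2 M" "rlin R M2 M p"
    and q: "q \<in> hom M Z" "rlin R M Z q"
    and surj: "q ` carrier M = carrier Z"
    and ker: "\<forall>m\<in>carrier M. q m = 1\<^sub>Z \<longrightarrow> m \<in> p ` carrier M2"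
    and x: "x <: tensor_group R M N" "tensor_map R M N Z N q id x = 1\<^sub>(tensor_group R Z N)"
  shows "x \<in> tensor_map R M2 N M N p id ` carrier (tensor_group R M2 N)"
proof -
  have tp2: "tensor_product R M2 N" and tp: "tensor_product R M N" and tpz: "tensor_product R Z N"
    using M2 M Z N by (simp_all add: tensor_product_def)
  let ?G = "tensor_group R M N"
  define I where "I = tensor_map R M2 N M N p id ` carrier (tensor_group R M2 N)"
  interpret G: comm_group ?G by (rule tensor_product.comm_group_tensor[OF tp])
  interpret gM: comm_group M by (rule rm_comm_group[OF M])
  interpret gZ: comm_group Z by (rule rm_comm_group[OF Z])
  have I: "subgroup I ?G" unfolding I_def
    by (rule hom_image_subgroup[OF tensor_map_left(1)[OF M2 M N p] tensor_product.group_tensor[OF tp2] G.is_group])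
  then have nI: "I \<lhd> ?G" using G.normal_iff_subgroup by blast
  let ?C = "?G Mod I"
  have C: "comm_group ?C" by (rule G.abelian_FactGroup[OF I])
  have grC: "group ?C" using C by (simp add: comm_group_def)
  let ?pr = "%x. I #>\<^bsub>?G\<^esub> x"
  have pr: "?pr \<in> hom ?G ?C" by (rule normal.r_coset_hom_Mod[OF nI])
  note pc = tensor_product.pure_closed[OF tp]
  note bal = tensor_product.pure_balanced[OF tp, unfolded balanced_def]
  have pm: "pure_tensor R M N (a *\<^sub>M b) n = pure_tensor R M N a n *\<^sub>?G pure_tensor R M N b n"
    if "a <: M" "b <: M" "n <: N" for a b n
    using bal that hom_mult[of "%m. pure_tensor R M N m n" M ?G a b] by blast
  \<comment> \<open>Two preimages of the same element differ by some \<open>p k\<close>, and pure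
    tensors formed with \<open>p k\<close> lie in \<open>I\<close>.\<close>
  have indep: "?pr (pure_tensor R M N m n) = ?pr (pure_tensor R M N m' n)"
    if m: "m <: M" "m' <: M" "n <: N" "q m = q m'" for m m' n
  proof -
    have "q (m *\<^sub>M inv\<^bsub>M\<^esub> m') = 1\<^sub>Z"
      using m hom_mult[OF q(1)] hom_inv[OF q(1) gM.is_group gZ.is_group] hom_closed[OF q(1)] by simp
    moreover have "m *\<^sub>M inv\<^bsub>M\<^esub> m' <: M" using m by simp
    ultimately obtain k where k: "k <: M2" "m *\<^sub>M inv\<^bsub>M\<^esub> m' = p k" using ker by blast
    have "pure_tensor R M N (p k) n \<in> I"
      unfolding I_def tensor_map_left(2)[OF M2 M N p k(1) m(3), symmetric]
      by (rule imageI[OF tensor_product.pure_closed[OF tp2 k(1) m(3)]])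
    moreover have "m = p k *\<^sub>M m'" unfolding k(2)[symmetric] using m by (simp add: gM.m_assoc)
    then have "pure_tensor R M N m n = pure_tensor R M N (p k) n *\<^sub>?G pure_tensor R M N m' n"
      using pm[OF hom_closed[OF p(1) k(1)] m(2,3)] by simp
    ultimately have "pure_tensor R M N m n *\<^sub>?G inv\<^bsub>?G\<^esub> pure_tensor R M N m' n \<in> I"
      using pc[OF hom_closed[OF p(1) k(1)] m(3)] pc[OF m(2,3)] by (simp add: G.m_assoc)
    then show ?thesis using coset_eq_iff[OF G.is_group I pc[OF m(1,3)] pc[OF m(2,3)]] by blast
  qed
  \<comment> \<open>\<open>s\<close> is an arbitrary section of \<open>q\<close>. Additivity and
    linearity of the map built from it hold modulo \<open>I\<close>, by
    \<open>indep\<close>.\<close>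
  define s where "s z = (SOME m. m <: M \<and> q m = z)" for z
  have s': "s z <: M \<and> q (s z) = z" if "z <: Z" for z
  proof -
    have "\<exists>m. m <: M \<and> q m = z" using that unfolding surj[symmetric] by auto
    then show ?thesis unfolding s_def by (rule someI_ex)
  qed
  have s: "s z <: M" "q (s z) = z" if "z <: Z" for z using s'[OF that] by auto
  have sbal: "balanced R Z N ?C (%z n. ?pr (pure_tensor R M N (s z) n))"
  proof (rule balancedI)
    show "(%z. ?pr (pure_tensor R M N (s z) n)) \<in> hom Z ?C" if n: "n <: N" for n
    proof (rule homI)
      show "?pr (pure_tensor R M N (s z) n) <: ?C" if "z <: Z" for z
        using hom_closed[OF pr pc[OF s(1)[OF that] n]] .
      fix z z' assume z: "z <: Z" "z' <: Z"
      have "?pr (pure_tensor R M N (s (z *\<^sub>Z z')) n) = ?pr (pure_tensor R M N (s z *\<^sub>M s z') n)"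
        by (rule indep) (simp_all add: z s n hom_mult[OF q(1)])
      also have "\<dots> = ?pr (pure_tensor R M N (s z) n) *\<^sub>?C ?pr (pure_tensor R M N (s z') n)"
        unfolding pm[OF s(1)[OF z(1)] s(1)[OF z(2)] n] by (rule hom_mult[OF pr pc[OF s(1)[OF z(1)] n] pc[OF s(1)[OF z(2)] n]])
      finally show "?pr (pure_tensor R M N (s (z *\<^sub>Z z')) n) = ?pr (pure_tensor R M N (s z) n) *\<^sub>?C ?pr (pure_tensor R M N (s z') n)" .
    qed
    show "(%n. ?pr (pure_tensor R M N (s z) n)) \<in> hom N ?C" if "z <: Z" for z
      using hom_comp[OF _ pr, of "pure_tensor R M N (s z)" N] bal s(1)[OF that] by blast
    show "?pr (pure_tensor R M N (s (ract Z z r)) n) = ?pr (pure_tensor R M N (s z) (lact N r n))"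
      if zrn: "z <: Z" "r <: R" "n <: N" for z r n
    proof -
      have "?pr (pure_tensor R M N (s (ract Z z r)) n) = ?pr (pure_tensor R M N (ract M (s z) r) n)"
        by (rule indep) (simp_all add: zrn s rlinD[OF q(2)] rm_closed[OF Z] rm_closed[OF M])
      also have "pure_tensor R M N (ract M (s z) r) n = pure_tensor R M N (s z) (lact N r n)"
        using bal zrn s(1)[OF zrn(1)] by blast
      finally show ?thesis .
    qed
  qed
  let ?\<tau> = "tensor_lift R Z N ?C (%z n. ?pr (pure_tensor R M N (s z) n))"
  have \<tau>h: "?\<tau> \<in> hom (tensor_group R Z N) ?C" by (rule tensor_product.tensor_lift_hom[OF tpz C sbal])
  have "?pr x = ?\<tau> (tensor_map R M N Z N q id x)"
  proof (rule tensor_product.hom_eqI[OF tp pr hom_comp[OF tensor_map_left(1)[OF M Z N q] \<tau>h] grC _ x(1)])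
    fix m n assume m: "m <: M" and n: "n <: N"
    note qm = hom_closed[OF q(1) m]
    show "?pr (pure_tensor R M N m n) = ?\<tau> (tensor_map R M N Z N q id (pure_tensor R M N m n))"
      unfolding tensor_map_left(2)[OF M Z N q m n] tensor_product.tensor_lift_pure[OF tpz C sbal qm n]
      by (rule indep[OF m s(1)[OF qm] n s(2)[OF qm, symmetric]])
  qed
  also have "\<dots> = I" unfolding x(2) using hom_one[OF \<tau>h tensor_product.group_tensor[OF tpz] grC] by simp
  finally have "?pr x = I" .
  then have "x \<in> I" by (rule G.coset_join1[OF _ x(1) I])
  then show ?thesis by (simp add: I_def)
qed

text \<open>Factor \<open>q\<close> through its image \<open>Z\<close>. Flatness makes
  \<open>Z \<otimes> N \<rightarrow> M' \<otimes> N\<close> injective, and right exactness applies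
  to \<open>M2 \<rightarrow> M \<rightarrow> Z\<close>. The module \<open>Z\<close> inherits its
  embedding into the test type from \<open>M'\<close>.\<close>

lemma tensor_flat_exact:
  fixes e :: "'n => 'u"
  assumes flat: "flat_as_left_module TYPE('u) R N" and N: "left_module R N"
    and M2: "right_module R M2" and M: "right_module R M" and M': "right_module R M'"
    and p: "p \<in> hom M2 M" "rlin R M2 M p"
    and q: "q \<in> hom M M'" "rlin R M M' q"
    and ker: "\<forall>m\<in>carrier M. q m = 1\<^sub>M' \<longrightarrow> m \<in> p ` carrier M2"
    and e: "inj_on e (carrier M')"
    and x: "x <: tensor_group R M N" "tensor_map R M N M' N q id x = 1\<^sub>(tensor_group R M' N)"
  shows "x \<in> tensor_map R M2 N M N p id ` carrier (tensor_group R M2 N)"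
proof -
  define Z where "Z = M'\<lparr>carrier := q ` carrier M\<rparr>"
  interpret gM: comm_group M by (rule rm_comm_group[OF M])
  interpret gM': comm_group M' by (rule rm_comm_group[OF M'])
  have sub: "subgroup (q ` carrier M) M'" by (rule hom_image_subgroup[OF q(1) gM.is_group gM'.is_group])
  have car: "carrier Z = q ` carrier M" and mZ: "mult Z = mult M'" "one Z = one M'" "ract Z = ract M'"
    by (simp_all add: Z_def)
  have zM: "z <: M'" if "z <: Z" for z using that hom_closed[OF q(1)] car by auto
  have "comm_group Z"
  proof (rule comm_groupI)
    show "\<exists>y\<in>carrier Z. y *\<^sub>Z x = 1\<^sub>Z" if "x <: Z" for x
      using that zM[OF that] subgroup.m_inv_closed[OF sub] by (intro bexI[of _ "inv\<^bsub>M'\<^esub> x"]) (auto simp: car mZ)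
    show "x *\<^sub>Z y <: Z" if "x <: Z" "y <: Z" for x y
      using that subgroup.m_closed[OF sub] by (simp add: car mZ)
    show "1\<^sub>Z <: Z" using subgroup.one_closed[OF sub] by (simp add: car mZ)
    show "x *\<^sub>Z y *\<^sub>Z z = x *\<^sub>Z (y *\<^sub>Z z)" if "x <: Z" "y <: Z" "z <: Z" for x y z
      using zM[OF that(1)] zM[OF that(2)] zM[OF that(3)] by (simp add: mZ gM'.m_assoc)
    show "x *\<^sub>Z y = y *\<^sub>Z x" if "x <: Z" "y <: Z" for x y
      using zM[OF that(1)] zM[OF that(2)] by (simp add: mZ gM'.m_comm)
    show "1\<^sub>Z *\<^sub>Z x = x" if "x <: Z" for x using zM[OF that] by (simp add: mZ)
  qed
  moreover have "ract Z z r <: Z" if "z <: Z" "r <: R" for z r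
  proof -
    obtain m where m: "m <: M" "z = q m" using \<open>z <: Z\<close> car by auto
    have "ract Z z r = q (ract M m r)" unfolding m(2) mZ rlinD[OF q(2) m(1) \<open>r <: R\<close>] ..
    then show ?thesis using rm_closed[OF M \<open>r <: R\<close> m(1)] by (simp add: car)
  qed
  ultimately have Zr: "right_module R Z"
    unfolding right_module_def using zM
    by (simp add: mZ rm_dist[OF M'] rm_add[OF M'] rm_assoc[OF M'] rm_one[OF M'])
  have qZ: "q \<in> hom M Z" using q(1) by (auto simp: hom_def car mZ)
  have qZr: "rlin R M Z q" using q(2) by (simp add: mZ rlin_def)
  have inc: "(%z. z) \<in> hom Z M'" using zM by (auto simp: hom_def mZ)
  have incr: "rlin R Z M' (%z. z)" by (simp add: mZ rlin_def)
  have inc2: "\<forall>m\<in>carrier M. (%z. z) (q m) = q m" by simp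
  have injinc: "inj_on (%z. z) (carrier Z)" by simp
  have eZ: "inj_on e (carrier Z)" using e zM by (meson inj_on_subset subsetI)
  have inj: "inj_on (tensor_map R Z N M' N (%z. z) id) (carrier (tensor_group R Z N))"
    by (rule flat_left_transfer[OF flat N Zr M' inc incr injinc eZ e])
  have tpz: "tensor_product R Z N" "tensor_product R M' N" using Zr M' N by (simp_all add: tensor_product_def)
  have tc: "tensor_map R M N Z N q id x <: tensor_group R Z N"
    by (rule hom_closed[OF tensor_map_left(1)[OF M Zr N qZ qZr] x(1)])
  have "tensor_map R Z N M' N (%z. z) id (tensor_map R M N Z N q id x) = 1\<^sub>(tensor_group R M' N)"
    unfolding tensor_map_left_comp[OF M Zr M' N qZ qZr inc incr q inc2 x(1)] by (rule x(2))
  also have "\<dots> = tensor_map R Z N M' N (%z. z) id 1\<^sub>(tensor_group R Z N)"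
    using hom_one[OF tensor_map_left(1)[OF Zr M' N inc incr] tensor_product.group_tensor[OF tpz(1)] tensor_product.group_tensor[OF tpz(2)]] by simp
  finally have "tensor_map R M N Z N q id x = 1\<^sub>(tensor_group R Z N)"
    using inj_onD[OF inj _ tc] group.is_monoid[OF tensor_product.group_tensor[OF tpz(1)]] by (simp add: monoid.one_closed)
  then show ?thesis
    using ker by (intro tensor_right_exact[OF M2 M Zr N p qZ qZr _ _ x(1)]) (auto simp: car mZ)
qed

text \<open>The free abelian group on the indices surjects onto \<open>G\<close>. Sending an element
  to its fibre, that is to the set of all its representatives, is injective.\<close>

lemma ex_embedding:
  fixes F :: "'x => 'm"
  assumes G: "comm_group G" and F: "!!w. F w <: G"
    and gen: "!!W. [|subgroup W G; !!w. F w \<in> W|] ==> carrier G \<subseteq> W"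
  shows "\<exists>e :: 'm => ('x \<Rightarrow>\<^sub>0 int) set. inj_on e (carrier G)"
proof -
  interpret G: comm_group G by fact
  obtain h where h: "h \<in> hom (free_Abelian_group UNIV) G" "!!w. w \<in> UNIV ==> h (frag_of w) = F w"
    using G.free_Abelian_group_universal[of F UNIV] F by blast
  have "carrier G \<subseteq> h ` carrier (free_Abelian_group UNIV)"
  proof (rule gen[OF hom_image_subgroup[OF h(1) group_free_Abelian_group G.is_group]])
    show "F w \<in> h ` carrier (free_Abelian_group UNIV)" for w
      using h(2)[of w] by (metis UNIV_I carrier_free_Abelian_group_iff imageI subset_UNIV)
  qed
  then have "inj_on (%m. {w. h w = m}) (carrier G)"
    by (auto simp: inj_on_def)
  then show ?thesis by blast
qed

lemma (in graded_algebra) presentation_words: "presentation (words A n) (tensor_power_rels K A n)"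
proof -
  interpret tensor_powers K A n by (rule tp)
  show ?thesis by (rule pres.presentation_axioms)
qed

context alg_map
begin

lemma M_right: "right_module R (M n)"
  using bimodule_right[OF bimod_M] .

lemma Tr_left: "left_module R Tr"
  using bimodule_left[OF bimod_Tr] .

lemma ex_embedding_M: "\<exists>e :: _ => ('r, 't) test_universe. inj_on e (carrier (M n))"
proof (rule ex_embedding[OF M_group(2)])
  \<comment> \<open>A word codes the pure tensor of its head with the bar word given by its tail;
    words of any other shape are sent to the unit.\<close>
  define ok where "ok w \<longleftrightarrow> (\<exists>t xs. w = Inr t # map Inl xs \<and> t <: T \<and> xs \<in> words R (Suc (Suc n)))" for w :: "('r + 't) list"
  define F where "F w = (if ok w then pM n (projr (hd w)) (pure_word K R (Suc (Suc n)) (map projl (tl w))) else 1\<^sub>(M n))" for w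
  have Fv: "F (Inr t # map Inl xs) = pM n t (pure_word K R (Suc (Suc n)) xs)" if "t <: T" "xs \<in> words R (Suc (Suc n))" for t xs
    using that by (auto simp: F_def ok_def comp_def)
  show "F w <: M n" for w
  proof (cases "ok w")
    case True
    then obtain t xs where w: "w = Inr t # map Inl xs" "t <: T" "xs \<in> words R (Suc (Suc n))" by (auto simp: ok_def)
    show ?thesis unfolding w(1) Fv[OF w(2,3)] by (rule pM_closed[OF w(2) R.pw_closed[OF w(3)]])
  next
    case False then show ?thesis using group.is_monoid[OF M_group(1)] by (simp add: F_def monoid.one_closed)
  qed
  fix W assume W: "subgroup W (M n)" and FW: "!!w. F w \<in> W"
  have gen: "pM n t b \<in> W" if t: "t <: T" and b: "b <: BR n" for t b
  proof -
    have b': "b <: (tensor_power K R (Suc (Suc n)))" using b by simp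
    have h: "pM n t \<in> hom (presented_group (words R (Suc (Suc n))) (tensor_power_rels K R (Suc (Suc n)))) (M n)"
      using pM_hom(2)[OF t] by (simp add: tensor_power_def[symmetric])
    show ?thesis
    proof (rule presentation.hom_in_subgroup[OF _ h W M_group(1)])
      show "presentation (words R (Suc (Suc n))) (tensor_power_rels K R (Suc (Suc n)))"
        by (rule R.presentation_words)
      show "b \<in> carrier (presented_group (words R (Suc (Suc n))) (tensor_power_rels K R (Suc (Suc n))))"
        using b' by (simp add: tensor_power_def)
      show "pM n t (generator (words R (Suc (Suc n))) (tensor_power_rels K R (Suc (Suc n))) xs) \<in> W" if xs: "xs \<in> words R (Suc (Suc n))" for xs
        using FW[of "Inr t # map Inl xs"] Fv[OF t xs] by (simp add: pure_word_def)
    qed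
  qed
  show "carrier (M n) \<subseteq> W"
  proof
    fix u assume u: "u <: M n"
    have "(%x. x) u \<in> W"
      by (rule tensor_product.hom_in_subgroup[OF tpM _ W M_group(1), of "%x. x"]) (use gen u in \<open>auto simp: M_eq hom_def\<close>)
    then show "u \<in> W" by simp
  qed
qed

end

section \<open>Trivial extensions and ring epimorphisms\<close>

definition trivial_extension :: "('t, 'z) ring_scheme => ('t, 'q, 't, 'w) bimod_scheme => ('t \<times> 'q) ring" where
  "trivial_extension T Q = \<lparr>carrier = carrier T \<times> carrier Q,
     mult = (%x y. (fst x *\<^sub>T fst y, lact Q (fst x) (snd y) *\<^sub>Q ract Q (snd x) (fst y))), one = (1\<^sub>T, 1\<^sub>Q),
     zero = (0\<^sub>T, 1\<^sub>Q), add = (%x y. (fst x +\<^sub>T fst y, snd x *\<^sub>Q snd y))\<rparr>"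

lemma trivial_extension_simps [simp]:
  "carrier (trivial_extension T Q) = carrier T \<times> carrier Q"
  "mult (trivial_extension T Q) x y = (fst x *\<^sub>T fst y, lact Q (fst x) (snd y) *\<^sub>Q ract Q (snd x) (fst y))"
  "one (trivial_extension T Q) = (1\<^sub>T, 1\<^sub>Q)" "zero (trivial_extension T Q) = (0\<^sub>T, 1\<^sub>Q)"
  "add (trivial_extension T Q) x y = (fst x +\<^sub>T fst y, snd x *\<^sub>Q snd y)"
  by (simp_all add: trivial_extension_def)

lemma ring_trivial_extension:
  assumes "ring T" and Q: "bimodule T T Q"
  shows "ring (trivial_extension T Q)"
proof -
  interpret ring T by fact
  note L = bimodule_left[OF Q] and R = bimodule_right[OF Q]
  interpret Q: comm_group Q by (rule lm_comm_group[OF L])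
  note cl = lm_closed[OF L] rm_closed[OF R]
  note as = bimodule_assoc[OF Q]
  have l1: "lact Q a 1\<^sub>Q = 1\<^sub>Q" if "a <: T" for a using hom_one[OF lm_hom[OF L that] Q.is_group Q.is_group] .
  have r1: "ract Q 1\<^sub>Q a = 1\<^sub>Q" if "a <: T" for a using hom_one[OF rm_hom[OF R that] Q.is_group Q.is_group] .
  let ?S = "trivial_extension T Q"
  have "abelian_group ?S"
  proof (rule abelian_groupI)
    show "\<exists>y\<in>carrier ?S. y +\<^sub>?S x = 0\<^sub>?S" if "x <: ?S" for x
      using that by (intro bexI[of _ "(-\<^sub>T fst x, inv\<^bsub>Q\<^esub> snd x)"]) (auto simp: l_neg)
  qed (auto simp: a_ac Q.m_ac)
  moreover have "monoid ?S"
    by (rule monoidI) (auto simp: m_assoc cl l1 r1 lm_one[OF L] rm_one[OF R] lm_dist[OF L] rm_dist[OF R] lm_assoc[OF L] rm_assoc[OF R] as Q.m_assoc)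
  ultimately show ?thesis
    by (rule ringI) (auto simp: l_distr r_distr cl lm_dist[OF L] rm_dist[OF R] lm_add[OF L] rm_add[OF R] Q.m_ac)
qed

context alg_map
begin

abbreviation "Q \<equiv> tensor R Tl Tr"
abbreviation "pQ \<equiv> pure_tensor R Tl Tr"

lemma bimod_Q: "bimodule T T Q"
  by (rule bimodule_tensor[OF bimod_Tl bimod_Tr T.ring_A T.ring_A])

lemma tpQ: "tensor_product R Tl Tr"
  by (rule tensor_productI[OF bimod_Tl bimod_Tr])

lemma Q_comm_group: "comm_group Q" and Q_group: "group Q"
  using lm_comm_group[OF bimodule_left[OF bimod_Q]] by (simp_all add: comm_group_def)

lemma pQ_closed: "[|t <: T; t' <: T|] ==> pQ t t' <: Q"
  using tensor_product.pure_closed[OF tpQ, of t t'] by simp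

lemma pQ_lact: "[|a <: T; t <: T; t' <: T|] ==> lact Q a (pQ t t') = pQ (a *\<^sub>T t) t'"
  using tensor_lact_pure[OF bimod_Tl bimod_Tr, of a t t'] by simp

lemma pQ_ract: "[|a <: T; t <: T; t' <: T|] ==> ract Q (pQ t t') a = pQ t (t' *\<^sub>T a)"
  using tensor_ract_pure[OF bimod_Tl bimod_Tr, of a t t'] by simp

lemma ex_embedding_extension: "\<exists>e :: _ => ('r, 't) test_universe. inj_on e (carrier (trivial_extension T Q))"
proof -
  let ?S = "trivial_extension T Q"
  interpret S: ring ?S by (rule ring_trivial_extension[OF T.ring_A bimod_Q])
  interpret Q: comm_group Q by (rule Q_comm_group)
  \<comment> \<open>Words with one letter from \<open>T\<close> code elements of \<open>T\<close>,
    words with two such letters code pure tensors, and all others are sent to zero.\<close>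
  define F where "F w = (if \<exists>t\<in>carrier T. w = [Inr t] then (projr (hd w), 1\<^sub>Q)
    else if \<exists>t\<in>carrier T. \<exists>t'\<in>carrier T. w = [Inr t, Inr t'] then (0\<^sub>T, pQ (projr (hd w)) (projr (w ! 1)))
    else (0\<^sub>T, 1\<^sub>Q))" for w :: "('r + 't) list"
  have F1: "F [Inr t] = (t, 1\<^sub>Q)" if "t <: T" for t using that by (simp add: F_def)
  have F2: "F [Inr t, Inr t'] = (0\<^sub>T, pQ t t')" if "t <: T" "t' <: T" for t t' using that by (simp add: F_def)
  have "\<exists>e :: _ => ('r, 't) test_universe. inj_on e (carrier (add_monoid ?S))"
  proof (rule ex_embedding[of "add_monoid ?S" F])
    show "comm_group (add_monoid ?S)" by (rule S.a_comm_group)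
    have "F w \<in> carrier T \<times> carrier Q" for w
      unfolding F_def using pQ_closed Q.one_closed by (auto simp del: tensor_simps)
    then show "F w <: (add_monoid ?S)" for w by simp
    fix W assume W: "subgroup W (add_monoid ?S)" and FW: "!!w. F w \<in> W"
    have sub: "subgroup {q \<in> carrier Q. (0\<^sub>T, q) \<in> W} Q"
    proof (rule Q.subgroupI)
      show "{q \<in> carrier Q. (0\<^sub>T, q) \<in> W} \<noteq> {}" using subgroup.one_closed[OF W] Q.one_closed by auto
      fix a assume a: "a \<in> {q \<in> carrier Q. (0\<^sub>T, q) \<in> W}"
      then have ac: "a <: Q" by blast
      have "-\<^sub>?S (0\<^sub>T, a) = (0\<^sub>T, inv\<^bsub>Q\<^esub> a)"
        by (rule S.minus_equality) (use ac Q.l_inv[OF ac] Q.inv_closed[OF ac] in \<open>simp_all del: tensor_simps\<close>)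
      then show "inv\<^bsub>Q\<^esub> a \<in> {q \<in> carrier Q. (0\<^sub>T, q) \<in> W}"
        using subgroup.m_inv_closed[OF W, of "(0\<^sub>T, a)"] a Q.inv_closed[OF ac] by (simp add: a_inv_def del: tensor_simps)
      fix b assume b: "b \<in> {q \<in> carrier Q. (0\<^sub>T, q) \<in> W}"
      show "a *\<^sub>Q b \<in> {q \<in> carrier Q. (0\<^sub>T, q) \<in> W}"
        using subgroup.m_closed[OF W, of "(0\<^sub>T, a)" "(0\<^sub>T, b)"] a b Q.m_closed[of a b] by (simp del: tensor_simps)
    qed blast
    have QW: "(0\<^sub>T, q) \<in> W" if q: "q <: Q" for q
    proof -
      have id: "(%q. q) \<in> hom (tensor_group R Tl Tr) Q" by (simp add: hom_def)
      have "q \<in> {q \<in> carrier Q. (0\<^sub>T, q) \<in> W}"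
        by (rule tensor_product.hom_in_subgroup[OF tpQ id sub Q_group])
           (use q FW F2 pQ_closed in \<open>auto simp: \<close>, metis F2 FW)
      then show ?thesis by blast
    qed
    show "carrier (add_monoid ?S) \<subseteq> W"
    proof
      fix x assume "x <: (add_monoid ?S)"
      then obtain t q where x: "x = (t, q)" "t <: T" "q <: Q" by auto
      have "(t, 1\<^sub>Q) *\<^sub>(add_monoid ?S) (0\<^sub>T, q) \<in> W"
        by (rule subgroup.m_closed[OF W FW[of "[Inr t]", unfolded F1[OF x(2)]] QW[OF x(3)]])
      moreover have "(t, 1\<^sub>Q) *\<^sub>(add_monoid ?S) (0\<^sub>T, q) = x"
        using x(2) Q.l_one[OF x(3)] by (simp add: x(1) del: tensor_simps)
      ultimately show "x \<in> W" by simp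
    qed
  qed
  then show ?thesis by simp
qed

text \<open>
  Right cancellation is applied to the two ring homomorphisms \<open>t \<mapsto> (t, 0)\<close> and
  \<open>t \<mapsto> (t, t \<otimes> 1 - 1 \<otimes> t)\<close> into the trivial extension of \<open>T\<close> by \<open>T \<otimes>\<^sub>R T\<close>.
\<close>

lemma epi_central:
  assumes epi: "ring_epimorphism TYPE(('r, 't) test_universe) R T \<phi>" and t: "t <: T"
  shows "pQ t 1\<^sub>T = pQ 1\<^sub>T t"
proof -
  let ?S = "trivial_extension T Q"
  interpret S: ring ?S by (rule ring_trivial_extension[OF T.ring_A bimod_Q])
  interpret Q: comm_group Q by (rule Q_comm_group)
  note L = bimodule_left[OF bimod_Q] and RQ = bimodule_right[OF bimod_Q]
  \<comment> \<open>Right cancellation is available for rings inside the test universe, so the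
    extension is replaced by its copy under \<open>e\<close>.\<close>
  obtain e :: "_ => ('r, 't) test_universe" where e: "inj_on e (carrier ?S)" using ex_embedding_extension by blast
  let ?I = "image_ring e ?S"
  have I: "ring ?I" by (rule S.inj_imp_image_ring_is_ring[OF e])
  have eh: "e \<in> ring_hom ?S ?I" using inj_imp_image_ring_iso[OF e] by (simp add: ring_iso_def)
  let ?m = "pQ 1\<^sub>T 1\<^sub>T"
  have m: "?m <: Q" by (rule pQ_closed) auto
  let ?g = "%t. (t, 1\<^sub>Q)" and ?h = "%t. (t, lact Q t ?m *\<^sub>Q inv\<^bsub>Q\<^esub> (ract Q ?m t))"
  have l1: "lact Q a 1\<^sub>Q = 1\<^sub>Q" if "a <: T" for a using hom_one[OF lm_hom[OF L that] Q_group Q_group] .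
  have r1: "ract Q 1\<^sub>Q a = 1\<^sub>Q" if "a <: T" for a using hom_one[OF rm_hom[OF RQ that] Q_group Q_group] .
  have g: "?g \<in> ring_hom T ?S"
    by (rule ring_hom_memI) (use l1 r1 Q.one_closed in \<open>simp_all del: tensor_simps\<close>)
  have h: "?h \<in> ring_hom T ?S"
  proof (rule ring_hom_memI)
    have c: "lact Q t ?m <: Q" "ract Q ?m t <: Q" if "t <: T" for t
      using lm_closed[OF L that m] rm_closed[OF RQ that m] .
    show "?h t <: ?S" if "t <: T" for t using c[OF that] that by (simp del: tensor_simps)
    show "?h 1\<^sub>T = 1\<^sub>?S" using lm_one[OF L m] rm_one[OF RQ m] m by (simp del: tensor_simps)
    fix x y assume x: "x <: T" and y: "y <: T"
    note cx = c[OF x] and cy = c[OF y]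
    show "?h (x +\<^sub>T y) = ?h x +\<^sub>?S ?h y"
      using cx cy lm_add[OF L x y m] rm_add[OF RQ x y m] by (simp add: Q.inv_mult Q.m_ac del: tensor_simps)
    have 1: "lact Q x (lact Q y ?m) <: Q" "lact Q x (ract Q ?m y) <: Q" "ract Q (ract Q ?m x) y <: Q"
      using lm_closed[OF L x] rm_closed[OF RQ y] cx cy by auto
    have 2: "lact Q x (lact Q y ?m *\<^sub>Q inv\<^bsub>Q\<^esub> (ract Q ?m y)) = lact Q x (lact Q y ?m) *\<^sub>Q inv\<^bsub>Q\<^esub> (lact Q x (ract Q ?m y))"
      unfolding lm_dist[OF L x cy(1) Q.inv_closed[OF cy(2)]] hom_inv[OF lm_hom[OF L x] Q_group Q_group cy(2)] ..
    have 3: "ract Q (lact Q x ?m *\<^sub>Q inv\<^bsub>Q\<^esub> (ract Q ?m x)) y = lact Q x (ract Q ?m y) *\<^sub>Q inv\<^bsub>Q\<^esub> (ract Q (ract Q ?m x) y)"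
      unfolding rm_dist[OF RQ y cx(1) Q.inv_closed[OF cx(2)]] hom_inv[OF rm_hom[OF RQ y] Q_group Q_group cx(2)]
        bimodule_assoc[OF bimod_Q x y m] ..
    \<comment> \<open>In the product of two values of \<open>?h\<close> the middle terms
      \<open>x (1 \<otimes> 1) y\<close> cancel, which is the derivation rule for
      \<open>t \<mapsto> t \<otimes> 1 - 1 \<otimes> t\<close>.\<close>
    have 4: "a *\<^sub>Q inv\<^bsub>Q\<^esub> b *\<^sub>Q (b *\<^sub>Q inv\<^bsub>Q\<^esub> c) = a *\<^sub>Q inv\<^bsub>Q\<^esub> c" if "a <: Q" "b <: Q" "c <: Q" for a b c
    proof -
      have "a *\<^sub>Q inv\<^bsub>Q\<^esub> b *\<^sub>Q (b *\<^sub>Q inv\<^bsub>Q\<^esub> c) = a *\<^sub>Q ((inv\<^bsub>Q\<^esub> b *\<^sub>Q b) *\<^sub>Q inv\<^bsub>Q\<^esub> c)"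
        using that by (simp only: Q.m_assoc Q.m_closed Q.inv_closed)
      then show ?thesis unfolding Q.l_inv[OF that(2)] Q.l_one[OF Q.inv_closed[OF that(3)]] .
    qed
    show "?h (x *\<^sub>T y) = ?h x *\<^sub>?S ?h y"
      unfolding trivial_extension_simps fst_conv snd_conv 2 3 4[OF 1] lm_assoc[OF L x y m] rm_assoc[OF RQ x y m] ..
  qed
  have agree: "?g (\<phi> r) = ?h (\<phi> r)" if r: "r <: R" for r
  proof -
    have \<phi>r: "\<phi> r <: T" using hom(4)[OF r] .
    have "pQ (\<phi> r) 1\<^sub>T = pQ 1\<^sub>T (\<phi> r)"
      using tensor_product.pure_balanced[OF tpQ] r \<phi>r T.one_closed
      by (auto simp: balanced_def dest!: bspec[where x="1\<^sub>T"] bspec[where x=r])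
    then have "lact Q (\<phi> r) ?m = ract Q ?m (\<phi> r)" using \<phi>r by (simp add: pQ_lact pQ_ract)
    then show ?thesis using Q.r_inv[OF rm_closed[OF RQ \<phi>r m]] by simp
  qed
  have "\<forall>t\<in>carrier T. (e \<circ> ?g) t = (e \<circ> ?h) t"
  proof -
    have "e \<circ> ?g \<in> ring_hom T ?I" "e \<circ> ?h \<in> ring_hom T ?I" using ring_hom_trans[OF g eh] ring_hom_trans[OF h eh] .
    moreover have "\<forall>r\<in>carrier R. (e \<circ> ?g) (\<phi> r) = (e \<circ> ?h) (\<phi> r)" using agree unfolding comp_def by metis
    ultimately show ?thesis using epi I unfolding ring_epimorphism_def by blast
  qed
  then have "e (?g t) = e (?h t)" using t unfolding comp_def by blast
  moreover have "?g t <: ?S" "?h t <: ?S" using ring_hom_closed[OF g t] ring_hom_closed[OF h t] .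
  ultimately have "?g t = ?h t" using inj_onD[OF e] by blast
  then have "lact Q t ?m *\<^sub>Q inv\<^bsub>Q\<^esub> (ract Q ?m t) = 1\<^sub>Q" by (metis prod.inject)
  then have "lact Q t ?m = ract Q ?m t"
    using Q.inv_equality[of "lact Q t ?m" "inv\<^bsub>Q\<^esub> (ract Q ?m t)"] lm_closed[OF L t m] rm_closed[OF RQ t m]
    by (metis Q.inv_closed Q.inv_inv)
  then show ?thesis using t by (simp add: pQ_lact pQ_ract)
qed

definition mult_T :: "_ => 't" where
  "mult_T = tensor_lift R Tl Tr (add_monoid T) (%t t'. t *\<^sub>T t')"

lemma mult_T_hom: "mult_T \<in> hom (tensor_group R Tl Tr) (add_monoid T)"
  and mult_T_pure: "[|t <: T; t' <: T|] ==> mult_T (pQ t t') = t *\<^sub>T t'"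
proof -
  have b: "balanced R Tl Tr (add_monoid T) (%t t'. t *\<^sub>T t')"
    by (rule balancedI) (use T.mult_hom hom(4) in \<open>simp_all add: T.m_assoc\<close>)
  show "mult_T \<in> hom (tensor_group R Tl Tr) (add_monoid T)"
    unfolding mult_T_def by (rule tensor_product.tensor_lift_hom[OF tpQ T.comm_group_add b])
  show "[|t <: T; t' <: T|] ==> mult_T (pQ t t') = t *\<^sub>T t'"
    unfolding mult_T_def using tensor_product.tensor_lift_pure[OF tpQ T.comm_group_add b, of t t'] by simp
qed

text \<open>By centrality \<open>t \<otimes> t'\<close> equals \<open>1 \<otimes> t t'\<close>, so
  every element \<open>x\<close> is \<open>1 \<otimes> mult_T x\<close>.\<close>

lemma epi_tensor:
  assumes epi: "ring_epimorphism TYPE(('r, 't) test_universe) R T \<phi>"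
    and x: "x <: tensor_group R Tl Tr" "mult_T x = 0\<^sub>T"
  shows "x = 1\<^sub>(tensor_group R Tl Tr)"
proof -
  note G = tensor_product.group_tensor[OF tpQ]
  have p1: "pQ 1\<^sub>T \<in> hom (add_monoid T) (tensor_group R Tl Tr)"
    using tensor_product.pure_balanced[OF tpQ] by (simp add: balanced_def)
  have id: "(%x. x) \<in> hom (tensor_group R Tl Tr) (tensor_group R Tl Tr)" by (simp add: hom_def)
  have "x = pQ 1\<^sub>T (mult_T x)"
  proof (rule tensor_product.hom_eqI[OF tpQ id hom_comp[OF mult_T_hom p1] G _ x(1)])
    fix t t' assume "t <: Tl" "t' <: Tr"
    then have t: "t <: T" "t' <: T" by simp_all
    have "pQ t t' = ract Q (pQ t 1\<^sub>T) t'" using t by (simp add: pQ_ract)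
    also have "\<dots> = pQ 1\<^sub>T (t *\<^sub>T t')" unfolding epi_central[OF epi t(1)] using t by (simp add: pQ_ract)
    finally show "pQ t t' = pQ 1\<^sub>T (mult_T (pQ t t'))" unfolding mult_T_pure[OF t] .
  qed
  also have "\<dots> = 1\<^sub>(tensor_group R Tl Tr)" unfolding x(2) using hom_one[OF p1 T.group_add G] by simp
  finally show ?thesis .
qed

section \<open>Exactness of the base-changed bar construction\<close>

text \<open>The contraction \<open>append_one\<close> tensored with \<open>T\<close>; it respects
  the balancing because it is left linear.\<close>

definition M_append :: "nat => _" where
  "M_append n = tensor_map R Tl (BR n) Tl (BR (Suc n)) id (R.append_one (Suc (Suc n)))"

lemma M_append_hom: "M_append n \<in> hom (M n) (M (Suc n))"
  and M_append_pure: "[|t <: T; b <: BR n|] ==> M_append n (pM n t b) = pM (Suc n) t (R.append_one (Suc (Suc n)) b)"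
proof -
  have *: "R.append_one (Suc (Suc n)) \<in> hom (BR n) (BR (Suc n))" using R.append_one_hom by simp
  show "M_append n \<in> hom (M n) (M (Suc n))"
    using tensor_map_hom[OF tpM tpM id_Tl(1) _ * R.append_one_lact] by (simp add: M_eq M_append_def)
  show "[|t <: T; b <: BR n|] ==> M_append n (pM n t b) = pM (Suc n) t (R.append_one (Suc (Suc n)) b)"
    using tensor_map_pure[OF tpM tpM id_Tl(1) _ * R.append_one_lact, of t b] by (simp add: M_append_def)
qed

lemma M_contraction:
  assumes u: "u <: M (Suc n)"
  shows "M_diff (Suc n) (M_append (Suc n) u) = signed (M (Suc n)) (int (Suc (Suc n))) u *\<^sub>(M (Suc n)) M_append n (M_diff n u)"
proof (rule M_hom_eqI[OF hom_comp[OF M_append_hom M_diff_hom] hom_prod[OF M_group(2) _ hom_comp[OF M_diff_hom M_append_hom]] M_group(1) _ u])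
  show "signed (M (Suc n)) (int (Suc (Suc n))) \<in> hom (M (Suc n)) (M (Suc n))"
    using hom_signed_fun[OF M_group(2), of "%x. x" "M (Suc n)" "Suc n"] by (simp add: hom_def)
  fix t b assume t: "t <: T" and b: "b <: BR (Suc n)"
  have c: "R.append_one (Suc (Suc (Suc n))) b <: (BR (Suc (Suc n)))" "bar_diff K R n b <: BR n"
    using hom_closed[OF R.append_one_hom, of b] b hom_closed[OF R.bar_diff_hom b] by simp_all
  have c2: "R.append_one (Suc (Suc n)) (bar_diff K R n b) <: BR (Suc n)"
    using hom_closed[OF R.append_one_hom, of "bar_diff K R n b" "Suc (Suc n)"] c(2) by simp
  show "M_diff (Suc n) (M_append (Suc n) (pM (Suc n) t b)) =
      signed (M (Suc n)) (int (Suc (Suc n))) (pM (Suc n) t b) *\<^sub>(M (Suc n)) M_append n (M_diff n (pM (Suc n) t b))"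
    unfolding M_append_pure[OF t b] M_diff_pure[OF t c(1)] R.contraction_Suc[OF b] M_diff_pure[OF t b] M_append_pure[OF t c(2)]
      hom_mult[OF pM_hom(2)[OF t] signed_closed[OF R.B_group b] c2] hom_signed[OF pM_hom(2)[OF t] R.B_group M_group(1) b] ..
qed

text \<open>The contraction exhibits a cycle as a boundary up to a sign, which is then moved inside
  the differential.\<close>

lemma M_exact:
  assumes u: "u <: M (Suc n)" and ker: "M_diff n u = 1\<^sub>(M n)"
  shows "u \<in> M_diff (Suc n) ` carrier (M (Suc (Suc n)))"
proof -
  interpret G: comm_group "M (Suc n)" by (rule M_group(2))
  let ?k = "int (Suc (Suc n))"
  have ac: "M_append (Suc n) u <: (M (Suc (Suc n)))" using hom_closed[OF M_append_hom u] .
  have sc: "signed (M (Suc n)) ?k u <: M (Suc n)" using signed_closed[OF M_group(1) u] .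
  have "M_diff (Suc n) (M_append (Suc n) u) = signed (M (Suc n)) ?k u"
    unfolding M_contraction[OF u] ker hom_one[OF M_append_hom M_group(1) M_group(1)] by (rule G.r_one[OF sc])
  then have "M_diff (Suc n) (signed (M (Suc (Suc n))) ?k (M_append (Suc n) u)) = signed (M (Suc n)) ?k (signed (M (Suc n)) ?k u)"
    unfolding hom_signed[OF M_diff_hom M_group(1) M_group(1) ac] by simp
  also have "\<dots> = signed (M (Suc n)) (?k + ?k) u" by (rule signed_add[OF M_group(1) u])
  also have "\<dots> = u" by (simp add: signed_def)
  finally show ?thesis using signed_closed[OF M_group(1) ac] by (metis imageI)
qed

definition aug :: "_ => 't" where "aug b = \<phi> (R.augmentation b)"

lemma aug_twisted: "aug \<in> twisted R T \<phi> 0 (BR 0) (regular_bimod T)"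
proof -
  have "\<phi> \<in> twisted R T \<phi> 0 (regular_bimod R) (regular_bimod T)"
    by (rule twistedI) (simp_all add: regular_bimod_def hom(6,8) hom(4) T.koszul_0)
  then show ?thesis unfolding aug_def[abs_def] by (rule R.twisted_precomp[OF R.augmentation_twisted])
qed

text \<open>Written in the shape of the inner part of \<open>sandwich\<close>, with a sign that is
  trivial in degree zero, so that the lemmas on that part apply directly.\<close>

definition augM :: "_ => 't" where
  "augM = tensor_lift R Tl (BR 0) (regular_bimod T) (%t b. lact (regular_bimod T) (koszul T 0 t) (aug b))"

definition augX :: "_ => 't" where
  "augX = sandwich K R T \<phi> 0 (regular_bimod T) 0 aug"

lemma hom_regular: "hom G (regular_bimod T) = hom G (add_monoid T)"
  by (simp add: regular_bimod_def)

lemma augM_hom: "augM \<in> hom (M 0) (add_monoid T)"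
  unfolding augM_def using inner_hom[OF T.central_regular aug_twisted] by (simp add: hom_regular)

lemma augM_pure: "[|t <: T; b <: BR 0|] ==> augM (pM 0 t b) = t *\<^sub>T aug b"
  unfolding augM_def using inner_pure[OF T.central_regular aug_twisted, of t b] by (simp add: regular_bimod_def T.koszul_0)

lemma augM_ract: "[|u <: M 0; r <: R|] ==> augM (ract (M 0) u r) = augM u *\<^sub>T \<phi> r"
  unfolding augM_def using inner_ract[OF T.central_regular aug_twisted, of r u] by (simp add: regular_bimod_def)

lemma M_contraction_0:
  assumes u: "u <: M 0"
  shows "M_diff 0 (M_append 0 u) = inv\<^bsub>M 0\<^esub> u *\<^sub>(M 0) pM 0 (augM u) (R.unit_tensor 1\<^sub>R)"
proof -
  have ut: "R.unit_tensor a <: BR 0" if "a <: R" for a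
    using hom_closed[OF R.unit_tensor_hom, of a] that by simp
  \<comment> \<open>As \<open>unit_tensor a\<close> is \<open>a\<close> acting on
    \<open>unit_tensor 1\<close>, the element \<open>R.augmentation b\<close> can be moved across
    the tensor sign into \<open>T\<close>.\<close>
  have ul: "R.unit_tensor a = lact (BR 0) a (R.unit_tensor 1\<^sub>R)" if a: "a <: R" for a
    using R.bar_lact_pure[OF a, of "[1\<^sub>R, 1\<^sub>R]" 0] a by (simp add: R.unit_tensor_def words_def)
  have ih: "(%u. inv\<^bsub>M 0\<^esub> u) \<in> hom (M 0) (M 0)"
    using hom_inverse[OF M_group(2), of "%x. x" "M 0" 0] by (simp add: hom_def)
  show ?thesis
  proof (rule M_hom_eqI[OF hom_comp[OF M_append_hom M_diff_hom]
        hom_prod[OF M_group(2) ih hom_comp[OF augM_hom pM_hom(1)[OF ut[OF R.one_closed]]]] M_group(1) _ u])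
    fix t b assume t: "t <: T" and b: "b <: BR 0"
    have c: "R.append_one n2 b <: BR (Suc 0)"
      using hom_closed[OF R.append_one_hom, of b "n2"] b by simp
    have ac: "R.augmentation b <: R" using twistedD(4)[OF R.augmentation_twisted b] by (simp add: regular_bimod_def)
    have "pM 0 t (R.unit_tensor (R.augmentation b)) = pM 0 (t *\<^sub>T aug b) (R.unit_tensor 1\<^sub>R)"
      unfolding ul[OF ac] aug_def by (rule pM_balance[OF t ac ut[OF R.one_closed], symmetric])
    then show "M_diff 0 (M_append 0 (pM 0 t b)) = inv\<^bsub>M 0\<^esub> (pM 0 t b) *\<^sub>(M 0) pM 0 (augM (pM 0 t b)) (R.unit_tensor 1\<^sub>R)"
      unfolding M_append_pure[OF t b] M_diff_pure[OF t c] R.contraction_0[OF b] augM_pure[OF t b]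
        hom_mult[OF pM_hom(2)[OF t] group.inv_closed[OF R.B_group b] ut[OF ac]] hom_inv[OF pM_hom(2)[OF t] R.B_group M_group(1) b]
      by simp
  qed
qed

lemma M_exact_0:
  assumes u: "u <: M 0" and ker: "augM u = 0\<^sub>T"
  shows "u \<in> M_diff 0 ` carrier (M (Suc 0))"
proof -
  interpret G: comm_group "M 0" by (rule M_group(2))
  have ut: "R.unit_tensor 1\<^sub>R <: BR 0" using hom_closed[OF R.unit_tensor_hom, of "1\<^sub>R"] by simp
  have ac: "M_append 0 u <: M (Suc 0)" using hom_closed[OF M_append_hom u] .
  have "pM 0 0\<^sub>T (R.unit_tensor 1\<^sub>R) = 1\<^sub>(M 0)" using hom_one[OF pM_hom(1)[OF ut] T.group_add M_group(1)] by simp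
  then have "M_diff 0 (M_append 0 u) = inv\<^bsub>M 0\<^esub> u"
    unfolding M_contraction_0[OF u] ker using G.r_one[OF G.inv_closed[OF u]] by simp
  then have "M_diff 0 (inv\<^bsub>M (Suc 0)\<^esub> (M_append 0 u)) = u"
    unfolding hom_inv[OF M_diff_hom M_group(1) M_group(1) ac] using G.inv_inv[OF u] by simp
  then show ?thesis using group.inv_closed[OF M_group(1) ac] by (metis imageI)
qed

lemma M_diff_rlin: "rlin R (M (Suc n)) (M n) (M_diff n)"
  by (rule rlinI) (rule M_diff_ract)

lemma X_carrier: "carrier (X n) = carrier (tensor_group R (M n) Tr)" and X_one: "1\<^sub>(X n) = 1\<^sub>(tensor_group R (M n) Tr)"
  by (simp_all add: X_eq)

text \<open>The contraction makes the half-changed complex \<open>M\<close> exact, and tensoring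
  with the flat module \<open>Tr\<close> preserves this.\<close>

lemma X_exact:
  assumes flat: "flat_as_left_module TYPE(('r, 't) test_universe) R Tr"
    and x: "x <: X (Suc n)" "D n x = 1\<^sub>(X n)"
  shows "x \<in> D (Suc n) ` carrier (X (Suc (Suc n)))"
proof -
  obtain e :: "_ => ('r, 't) test_universe" where e: "inj_on e (carrier (M n))" using ex_embedding_M by blast
  have ker: "\<forall>m\<in>carrier (M (Suc n)). M_diff n m = 1\<^sub>(M n) \<longrightarrow> m \<in> M_diff (Suc n) ` carrier (M (Suc (Suc n)))"
    using M_exact by blast
  show ?thesis
    using tensor_flat_exact[OF flat Tr_left M_right M_right M_right M_diff_hom M_diff_rlin M_diff_hom M_diff_rlin ker e] x
    unfolding X_carrier X_one D_eq by blast
qed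

lemma augM_surj: "augM ` carrier (M 0) = carrier T"
proof
  show "augM ` carrier (M 0) \<subseteq> carrier T" using hom_closed[OF augM_hom] by auto
  show "carrier T \<subseteq> augM ` carrier (M 0)"
  proof
    fix t assume t: "t <: T"
    have ut: "R.unit_tensor 1\<^sub>R <: BR 0" using hom_closed[OF R.unit_tensor_hom, of "1\<^sub>R"] by simp
    have "aug (R.unit_tensor 1\<^sub>R) = 1\<^sub>T" by (simp add: aug_def R.unit_tensor_def R.augmentation_pure hom(7))
    then have "augM (pM 0 t (R.unit_tensor 1\<^sub>R)) = t" using augM_pure[OF t ut] t by simp
    then show "t \<in> augM ` carrier (M 0)" using pM_closed[OF t ut] by (metis imageI)
  qed
qed

lemma augX_pX: "[|u <: M 0; t <: T|] ==> augX (pX 0 u t) = augM u *\<^sub>T t"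
  unfolding augX_def augM_def using sandwich_pX[OF T.central_regular aug_twisted, of u t] by (simp add: regular_bimod_def)

lemma augX_twisted: "augX \<in> twisted T T id 0 (X 0) (regular_bimod T)"
  unfolding augX_def by (rule sandwich_twisted[OF T.central_regular aug_twisted])

text \<open>The sequence \<open>M 1 \<rightarrow> M 0 \<rightarrow> T \<rightarrow> 0\<close> is
  exact and stays so after tensoring with \<open>Tr\<close>. Since \<open>augX\<close> is
  \<open>mult_T\<close> after \<open>augM \<otimes> id\<close>, and \<open>mult_T\<close> has
  trivial kernel for an epimorphism, the kernel of \<open>augX\<close> is covered by
  \<open>D 0\<close>.\<close>

lemma X_exact_0:
  assumes epi: "ring_epimorphism TYPE(('r, 't) test_universe) R T \<phi>"
    and x: "x <: X 0" "augX x = 0\<^sub>T"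
  shows "x \<in> D 0 ` carrier (X (Suc 0))"
proof -
  have Tlr: "right_module R Tl" using bimodule_right[OF bimod_Tl] .
  have ah: "augM \<in> hom (M 0) Tl" using augM_hom by simp
  have ar: "rlin R (M 0) Tl augM" by (rule rlinI) (simp add: augM_ract)
  note tm = tensor_map_left[OF M_right Tlr Tr_left ah ar]
  let ?y = "tensor_map R (M 0) Tr Tl Tr augM id x"
  have xc: "x <: tensor_group R (M 0) Tr" using x(1) by (simp add: X_carrier)
  have axh: "augX \<in> hom (tensor_group R (M 0) Tr) (add_monoid T)"
    using twistedD(1)[OF augX_twisted] by (simp add: X_eq hom_regular)
  have "mult_T ?y = augX x"
  proof (rule tensor_product.hom_eqI[OF tpX hom_comp[OF tm(1) mult_T_hom] axh T.group_add _ xc])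
    fix u t assume u: "u <: M 0" and "t <: Tr"
    then have t: "t <: T" by simp
    show "mult_T (tensor_map R (M 0) Tr Tl Tr augM id (pX 0 u t)) = augX (pX 0 u t)"
      unfolding tm(2)[OF u \<open>t <: Tr\<close>] augX_pX[OF u t]
      using mult_T_pure[OF _ t, of "augM u"] hom_closed[OF augM_hom u] by simp
  qed
  then have y: "?y = 1\<^sub>(tensor_group R Tl Tr)" using epi_tensor[OF epi hom_closed[OF tm(1) xc]] x(2) by simp
  have surj: "augM ` carrier (M 0) = carrier Tl" using augM_surj by simp
  have ker: "\<forall>m\<in>carrier (M 0). augM m = 1\<^sub>Tl \<longrightarrow> m \<in> M_diff 0 ` carrier (M (Suc 0))" using M_exact_0 by simp
  show ?thesis
    using tensor_right_exact[OF M_right M_right Tlr Tr_left M_diff_hom M_diff_rlin ah ar surj ker xc y]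
    unfolding X_carrier D_eq .
qed

end

section \<open>Lifting maps out of the bar construction\<close>

text \<open>Restriction of scalars to \<open>K\<close>, which makes the generalized inverse over the
  field available for bimodules.\<close>

definition scalar_module :: "('k, 't, 'z) module_scheme => ('t, 'm, 't, 'w) bimod_scheme => ('k, 'm, unit) bimod" where
  "scalar_module T N = \<lparr>carrier = carrier N, mult = mult N, one = one N,
     lact = (%c. lact N (c \<cdot>\<^sub>T 1\<^sub>T)), ract = (%m _. m)\<rparr>"

lemma scalar_module_simps [simp]:
  "carrier (scalar_module T N) = carrier N" "mult (scalar_module T N) = mult N" "one (scalar_module T N) = one N"
  "lact (scalar_module T N) c m = lact N (c \<cdot>\<^sub>T 1\<^sub>T) m"
  by (simp_all add: scalar_module_def)

lemma hom_scalar_module: "hom (scalar_module T N) (scalar_module T' N') = hom N N'"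
  by (simp add: hom_def)

lemma hom_diff:
  assumes "f \<in> hom G H" "group G" "group H" "x <: G" "y <: G"
  shows "f (x *\<^sub>G inv\<^bsub>G\<^esub> y) = f x *\<^sub>H inv\<^bsub>H\<^esub> (f y)"
  using assms by (simp add: hom_mult hom_inv group.inv_closed)

context graded_algebra
begin

lemma left_module_scalar_module:
  assumes N: "left_module A N"
  shows "left_module K (scalar_module A N)"
proof -
  have s: "c \<cdot>\<^sub>A 1\<^sub>A <: A" if "c <: K" for c using that by simp
  have "comm_group (scalar_module A N)" by (rule comm_group_cong[OF _ _ _ lm_comm_group[OF N]]) simp_all
  moreover have "(c *\<^sub>K d) \<cdot>\<^sub>A 1\<^sub>A = (c \<cdot>\<^sub>A 1\<^sub>A) *\<^sub>A (d \<cdot>\<^sub>A 1\<^sub>A)" if "c <: K" "d <: K" for c d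
    using that by (simp add: smult_one_mult smult_assoc1)
  ultimately show ?thesis
    unfolding left_module_def
    using lm_closed[OF N s] lm_dist[OF N s] lm_add[OF N s s] lm_assoc[OF N s s] lm_one[OF N]
    by (simp add: smult_l_distr)
qed

text \<open>The bar term is free on words with units at both ends. On these, the lift is a
  \<open>K\<close>-linear partial section \<open>\<sigma>\<close> of \<open>p\<close> applied to
  \<open>f\<close>; since \<open>f\<close> takes values in the image of \<open>p\<close>, composing
  with \<open>p\<close> returns \<open>f\<close> there and hence everywhere.\<close>

lemma bar_lift:
  assumes M: "central_bimodule K A M" and N: "central_bimodule K A N"
    and f: "f \<in> twisted A A id 0 (B n) N" and p: "p \<in> twisted A A id 0 M N"
    and im: "!!u. u <: B n ==> f u \<in> p ` carrier M"
  shows "\<exists>g. g \<in> twisted A A id 0 (B n) M \<and> (\<forall>u\<in>carrier (B n). p (g u) = f u)"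
proof -
  note MM = central_bimoduleD[OF M] and NN = central_bimoduleD[OF N]
  have fK: "field K" by (rule field_algebra.axioms(1)[OF field_algebra_axioms])
  have ph: "p \<in> hom (scalar_module A M) (scalar_module A N)" using twistedD(1)[OF p] by (simp add: hom_scalar_module)
  have pl: "p (lact (scalar_module A M) c v) = lact (scalar_module A N) c (p v)" if "c <: K" "v <: scalar_module A M" for c v
    using twistedD(2)[OF p, of "c \<cdot>\<^sub>A 1\<^sub>A" v] that by (simp add: koszul_0)
  obtain \<sigma> where \<sigma>: "\<sigma> \<in> hom (scalar_module A N) (scalar_module A M)"
    "\<forall>c\<in>carrier K. \<forall>w\<in>carrier (scalar_module A N). \<sigma> (lact (scalar_module A N) c w) = lact (scalar_module A M) c (\<sigma> w)"
    "\<forall>v\<in>carrier (scalar_module A M). p (\<sigma> (p v)) = p v"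
    using ex_generalized_inverse[OF fK left_module_scalar_module[OF MM(2)] left_module_scalar_module[OF NN(2)] ph pl] by blast
  have \<sigma>h: "\<sigma> \<in> hom N M" using \<sigma>(1) by (simp add: hom_scalar_module)
  let ?u = "%ts. pw (Suc (Suc n)) (1\<^sub>A # ts @ [1\<^sub>A])"
  note fc = cochainD[OF alg_map.twisted_cochain[OF alg_map_id N f]]
  have c: "cochain K A A M n (%ts. \<sigma> (f (?u ts)))"
  proof (rule cochainI)
    show "\<sigma> (f (?u ts)) <: M" if "ts \<in> words A n" for ts using hom_closed[OF \<sigma>h fc(1)[OF that]] .
    show "\<sigma> (f (?u (ts[i := x +\<^sub>A y]))) = \<sigma> (f (?u (ts[i := x]))) *\<^sub>M \<sigma> (f (?u (ts[i := y])))"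
      if "ts \<in> words A n" "i < n" "x <: A" "y <: A" for ts i x y
      unfolding fc(2)[OF that] by (rule hom_mult[OF \<sigma>h fc(1)[OF words_update[OF that(1,3)]] fc(1)[OF words_update[OF that(1,4)]]])
    show "\<sigma> (f (?u (ts[i := c \<cdot>\<^sub>A ts ! i]))) = lact M (c \<cdot>\<^sub>A 1\<^sub>A) (\<sigma> (f (?u ts)))"
      if "ts \<in> words A n" "i < n" "c <: K" for ts i c
      unfolding fc(3)[OF that] using \<sigma>(2) that(3) fc(1)[OF that(1)] by simp
  qed
  let ?g = "word_lift K A (Suc (Suc n)) M (bar_ext A id 0 M n (%ts. \<sigma> (f (?u ts))))"
  have g: "?g \<in> twisted A A id 0 (B n) M" by (rule alg_map.bar_ext_twisted[OF alg_map_id M c])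
  have pg: "(%u. p (?g u)) \<in> twisted A A id 0 (B n) N" by (rule twisted_precomp[OF g p])
  have "p (?g u) = f u" if u: "u <: B n" for u
  proof (rule twisted_bar_eqI[OF pg f lm_group[OF NN(2)] _ u])
    fix ts assume ts: "ts \<in> words A n"
    have w: "?u ts <: B n" using pw_closed[of "1\<^sub>A # ts @ [1\<^sub>A]" n] ts by (simp add: words_Cons words_snoc)
    obtain v where v: "v <: M" "f (?u ts) = p v" using im[OF w] by blast
    show "p (?g (?u ts)) = f (?u ts)"
      unfolding alg_map.bar_ext_unit[OF alg_map_id M c ts] v(2) using \<sigma>(3) v(1) by simp
  qed
  then show ?thesis using g by blast
qed

lemma bar_exact:
  assumes u: "u <: B (Suc n)" "bd n u = 1\<^sub>(B n)"
  shows "u \<in> bd (Suc n) ` carrier (B (Suc (Suc n)))"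
proof -
  interpret G: group "B (Suc n)" by (rule B_group)
  let ?a = "append_one (Suc (Suc (Suc n))) u"
  have a: "?a <: (B (Suc (Suc n)))" by (rule hom_closed[OF append_one_hom' u(1)])
  have "bd (Suc n) ?a = signed (B (Suc n)) (int (Suc (Suc n))) u"
    using contraction_Suc[OF u(1)] hom_one[OF append_one_hom' B_group B_group] G.r_one[OF signed_closed[OF B_group u(1)]] u(2)
    by (simp del: bar_simps)
  then have "signed (B (Suc n)) (int (Suc (Suc n))) (bd (Suc n) ?a) = u"
    using signed_add[OF B_group u(1), of "int (Suc (Suc n))" "int (Suc (Suc n))"] signed_cong_parity[of "int (Suc (Suc n)) + int (Suc (Suc n))" 0 "B (Suc n)" u]
    by (simp del: bar_simps)
  then have "u = bd (Suc n) (signed (B (Suc (Suc n))) (int (Suc (Suc n))) ?a)"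
    using hom_signed[OF bar_diff_hom' B_group B_group a] by (simp del: bar_simps)
  then show ?thesis using signed_closed[OF B_group a] by (rule image_eqI)
qed

lemma bar_exact_0:
  assumes u: "u <: B 0" "augmentation u = 0\<^sub>A"
  shows "u \<in> bd 0 ` carrier (B (Suc 0))"
proof -
  interpret G: group "B 0" by (rule B_group)
  let ?a = "append_one n2 u"
  have a: "?a <: B (Suc 0)" by (rule hom_closed[OF append_one_hom' u(1)])
  have 1: "unit_tensor 0\<^sub>A = 1\<^sub>(B 0)" using hom_one[OF unit_tensor_hom group_add B_group] by (simp del: bar_simps)
  have "bd 0 ?a = inv\<^bsub>B 0\<^esub> u"
    using contraction_0[OF u(1)] G.r_one[OF G.inv_closed[OF u(1)]] unfolding u(2) 1 by (simp del: bar_simps)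
  then have "u = bd 0 (inv\<^bsub>B (Suc 0)\<^esub> ?a)"
    using hom_inv[OF bar_diff_hom' B_group B_group a] G.inv_inv[OF u(1)] by (simp del: bar_simps)
  then show ?thesis using group.inv_closed[OF B_group a] by (rule image_eqI)
qed

lemma id_twisted: "bimodule A A N ==> (%u. u) \<in> twisted A A id 0 N N"
  by (rule twistedI) (simp_all add: koszul_0 hom_def)

lemma twisted_postcomp:
  assumes "f \<in> twisted A A id e M N" "g \<in> twisted A A id 0 N P"
  shows "(%x. g (f x)) \<in> twisted A A id e M P"
  using twisted_comp[OF assms] by simp

lemma twisted_diff:
  assumes "bimodule A A N" "f \<in> twisted A A id e M N" "g \<in> twisted A A id e M N"
  shows "(%x. f x *\<^sub>N inv\<^bsub>N\<^esub> (g x)) \<in> twisted A A id e M N"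
  by (rule twisted_mult[OF assms(1,2) twisted_inv[OF assms(1,3)]]) simp_all

end

context alg_map
begin

abbreviation "BT n \<equiv> bar K T n"
abbreviation "dT n \<equiv> bar_diff K T n"

text \<open>This is the sense in which \<open>cmp\<close> covers the identity of \<open>T\<close>.
  On generators it amounts to multiplicativity of \<open>\<phi>\<close>.\<close>

lemma augmentation_comparison:
  assumes x: "x <: X 0"
  shows "T.augmentation (cmp 0 x) = augX x"
proof -
  have h: "(%x. T.augmentation (cmp 0 x)) \<in> twisted T T id 0 (X 0) (regular_bimod T)"
    by (rule T.twisted_postcomp[OF comp_twisted T.augmentation_twisted])
  have G: "group (regular_bimod T)" by (rule lm_group[OF central_bimoduleD(2)[OF T.central_regular]])
  show ?thesis
  proof (rule X_twisted_eqI[OF h augX_twisted G _ x])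
    fix b assume b: "b <: BR 0"
    have "T.augmentation (bar_map 0 b) = aug b"
    proof (rule tensor_powers.hom_eqI[OF R.tp])
      show "(%b. T.augmentation (bar_map 0 b)) \<in> hom (tensor_power K R n2) (regular_bimod T)"
        using hom_comp[OF bar_map_hom twistedD(1)[OF T.augmentation_twisted]] by simp
      show "aug \<in> hom (tensor_power K R n2) (regular_bimod T)" using twistedD(1)[OF aug_twisted] by simp
      show "group (regular_bimod T)" by (rule G)
      show "b <: tensor_power K R n2" using b by simp
      fix xs assume xs: "xs \<in> words R n2"
      then obtain y z where y: "xs = [y, z]" "y <: R" "z <: R" by (auto simp: words_def length_Suc_conv)
      show "T.augmentation (bar_map 0 (pure_word K R n2 xs)) = aug (pure_word K R n2 xs)"
        unfolding bar_map_pure[OF xs] aug_def using y by (simp add: T.augmentation_pure R.augmentation_pure hom)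
    qed
    then show "T.augmentation (cmp 0 (unit_gen 0 b)) = augX (unit_gen 0 b)"
      unfolding comp_unit[OF b] augX_def sandwich_unit[OF T.central_regular aug_twisted b] .
  qed
qed

text \<open>\<open>g\<close> and \<open>h\<close> are consecutive components of a chain map from the
  bar complex back to \<open>X\<close>, and \<open>s\<close> is a component of a homotopy from its
  composite with \<open>cmp\<close> to the identity. The homotopy relation in degree
  \<open>n\<close> is recorded after composition with \<open>dT n\<close>, where the summand with
  the preceding component of the homotopy has vanished, so one component suffices.\<close>

definition homotopy_inverse :: "nat => _ => _ => _ => bool" where
  "homotopy_inverse n g h s \<longleftrightarrow> g \<in> twisted T T id 0 (BT n) (X n) \<and> h \<in> twisted T T id 0 (BT (Suc n)) (X (Suc n)) \<and>
     s \<in> twisted T T id 0 (BT n) (BT (Suc n)) \<and>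
     (\<forall>u\<in>carrier (BT (Suc n)). D n (h u) = g (dT n u) \<and>
        dT n (s (dT n u)) = dT n u *\<^sub>(BT n) inv\<^bsub>BT n\<^esub> (cmp n (g (dT n u))))"

lemma one_twisted:
  assumes "f \<in> twisted T T id e N P" "group N" "group P" shows "f 1\<^sub>N = 1\<^sub>P"
  using hom_one[OF twistedD(1)[OF assms(1)] assms(2,3)] .

lemma bimod_BT: "bimodule T T (BT n)"
  by (rule central_bimoduleD(1)[OF T.central_bar])

text \<open>Each new component is supplied by \<open>T.bar_lift\<close>. The image condition comes
  from exactness of \<open>X\<close> for the chain map and from exactness of the bar complex for the
  homotopy.\<close>

lemma ex_homotopy_inverse:
  assumes flat: "flat_as_left_module TYPE(('r, 't) test_universe) R Tr"
    and epi: "ring_epimorphism TYPE(('r, 't) test_universe) R T \<phi>"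
  shows "\<exists>g h s. homotopy_inverse n g h s"
proof (induction n)
  case 0
  note CB = T.central_bar and CX = central_X and CR = T.central_regular
  have "T.augmentation u \<in> augX ` carrier (X 0)" if "u <: BT 0" for u
  proof -
    have "T.augmentation u <: T" using twistedD(4)[OF T.augmentation_twisted that] by (simp add: regular_bimod_def)
    then obtain v where v: "v <: M 0" "T.augmentation u = augM v" using augM_surj by (metis (no_types) imageE)
    have "augX (pX 0 v 1\<^sub>T) = augM v" using augX_pX[OF v(1), of "1\<^sub>T"] hom_closed[OF augM_hom v(1)] by simp
    then show ?thesis using v(2) pX_closed[OF v(1) T.one_closed] by (metis (no_types) imageI)
  qed
  then obtain g where g: "g \<in> twisted T T id 0 (BT 0) (X 0)" "\<forall>u\<in>carrier (BT 0). augX (g u) = T.augmentation u"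
    using T.bar_lift[OF CX CR T.augmentation_twisted augX_twisted] by blast
  have gd: "(%u. g (dT 0 u)) \<in> twisted T T id 0 (BT (Suc 0)) (X 0)" by (rule T.twisted_precomp[OF T.bar_diff_twisted g(1)])
  have "g (dT 0 u) \<in> D 0 ` carrier (X (Suc 0))" if u: "u <: BT (Suc 0)" for u
  proof (rule X_exact_0[OF epi twistedD(4)[OF gd u]])
    show "augX (g (dT 0 u)) = 0\<^sub>T" using bspec[OF g(2) twistedD(4)[OF T.bar_diff_twisted u]] T.augmentation_diff[OF u] by (rule trans)
  qed
  then obtain h where h: "h \<in> twisted T T id 0 (BT (Suc 0)) (X (Suc 0))" "\<forall>u\<in>carrier (BT (Suc 0)). D 0 (h u) = g (dT 0 u)"
    using T.bar_lift[OF CX CX gd D_twisted] by blast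
  have cg: "(%u. cmp 0 (g u)) \<in> twisted T T id 0 (BT 0) (BT 0)" by (rule T.twisted_precomp[OF g(1) comp_twisted])
  \<comment> \<open>The augmentation kills \<open>u - cmp 0 (g u)\<close>, so this map lifts along
    the bar differential and starts the homotopy.\<close>
  let ?f = "%u. u *\<^sub>(BT 0) inv\<^bsub>BT 0\<^esub> (cmp 0 (g u))"
  have f: "?f \<in> twisted T T id 0 (BT 0) (BT 0)" by (rule T.twisted_diff[OF bimod_BT T.id_twisted[OF bimod_BT] cg])
  have ah: "T.augmentation \<in> hom (BT 0) (add_monoid T)" using twistedD(1)[OF T.augmentation_twisted] by (simp add: hom_regular)
  have "?f u \<in> dT 0 ` carrier (BT (Suc 0))" if u: "u <: BT 0" for u
  proof (rule T.bar_exact_0[OF twistedD(4)[OF f u]])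
    have a: "T.augmentation u <: T" using hom_closed[OF ah u] by simp
    have "T.augmentation (cmp 0 (g u)) = T.augmentation u"
      using augmentation_comparison[OF twistedD(4)[OF g(1) u]] bspec[OF g(2) u] by (rule trans)
    then have "T.augmentation (?f u) = T.augmentation u *\<^sub>(add_monoid T) inv\<^bsub>add_monoid T\<^esub> (T.augmentation u)"
      unfolding hom_diff[OF ah T.B_group T.group_add u twistedD(4)[OF cg u]] by (rule arg_cong)
    then show "T.augmentation (?f u) = 0\<^sub>T" using group.r_inv[OF T.group_add, of "T.augmentation u"] a by simp
  qed
  then obtain s where s: "s \<in> twisted T T id 0 (BT 0) (BT (Suc 0))" "\<forall>u\<in>carrier (BT 0). dT 0 (s u) = ?f u"
    using T.bar_lift[OF CB CB f T.bar_diff_twisted] by blast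
  have "homotopy_inverse 0 g h s"
    unfolding homotopy_inverse_def using g(1) h s(1) bspec[OF s(2) twistedD(4)[OF T.bar_diff_twisted]] by blast
  then show ?case by blast
next
  case (Suc n)
  note CB = T.central_bar and CX = central_X
  obtain g h s where "homotopy_inverse n g h s" using Suc.IH by blast
  then have g: "g \<in> twisted T T id 0 (BT n) (X n)" and h: "h \<in> twisted T T id 0 (BT (Suc n)) (X (Suc n))"
    and s: "s \<in> twisted T T id 0 (BT n) (BT (Suc n))"
    and Dh: "!!u. u <: BT (Suc n) ==> D n (h u) = g (dT n u)"
    and ds: "!!u. u <: BT (Suc n) ==> dT n (s (dT n u)) = dT n u *\<^sub>(BT n) inv\<^bsub>BT n\<^esub> (cmp n (g (dT n u)))"
    unfolding homotopy_inverse_def by blast+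
  note dc = twistedD(4)[OF T.bar_diff_twisted]
  have hd: "(%u. h (dT (Suc n) u)) \<in> twisted T T id 0 (BT (Suc (Suc n))) (X (Suc n))" by (rule T.twisted_precomp[OF T.bar_diff_twisted h])
  have "h (dT (Suc n) u) \<in> D (Suc n) ` carrier (X (Suc (Suc n)))" if u: "u <: (BT (Suc (Suc n)))" for u
  proof (rule X_exact[OF flat twistedD(4)[OF hd u]])
    show "D n (h (dT (Suc n) u)) = 1\<^sub>(X n)"
      unfolding Dh[OF dc[OF u]] T.bar_diff_diff[OF u] by (rule one_twisted[OF g T.B_group X_group(1)])
  qed
  then obtain h' where h': "h' \<in> twisted T T id 0 (BT (Suc (Suc n))) (X (Suc (Suc n)))"
    "\<forall>u\<in>carrier (BT (Suc (Suc n))). D (Suc n) (h' u) = h (dT (Suc n) u)"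
    using T.bar_lift[OF CX CX hd D_twisted] by blast
  have ch: "(%u. cmp (Suc n) (h u)) \<in> twisted T T id 0 (BT (Suc n)) (BT (Suc n))" by (rule T.twisted_precomp[OF h comp_twisted])
  have sd: "(%u. s (dT n u)) \<in> twisted T T id 0 (BT (Suc n)) (BT (Suc n))" by (rule T.twisted_precomp[OF T.bar_diff_twisted s])
  \<comment> \<open>By the relation in degree \<open>n\<close>, \<open>?e u\<close> and
    \<open>s (dT n u)\<close> have the same differential. Their difference \<open>?f u\<close> is a
    cycle, and its lift is the next component of the homotopy.\<close>
  let ?e = "%u. u *\<^sub>(BT (Suc n)) inv\<^bsub>BT (Suc n)\<^esub> (cmp (Suc n) (h u))"
  let ?f = "%u. ?e u *\<^sub>(BT (Suc n)) inv\<^bsub>BT (Suc n)\<^esub> (s (dT n u))"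
  have e: "?e \<in> twisted T T id 0 (BT (Suc n)) (BT (Suc n))" by (rule T.twisted_diff[OF bimod_BT T.id_twisted[OF bimod_BT] ch])
  have f: "?f \<in> twisted T T id 0 (BT (Suc n)) (BT (Suc n))" by (rule T.twisted_diff[OF bimod_BT e sd])
  have "?f u \<in> dT (Suc n) ` carrier (BT (Suc (Suc n)))" if u: "u <: BT (Suc n)" for u
  proof (rule T.bar_exact[OF twistedD(4)[OF f u]])
    note dh = twistedD(1)[OF T.bar_diff_twisted[of n]]
    have "dT n (cmp (Suc n) (h u)) = cmp n (g (dT n u))"
      unfolding comp_D[OF twistedD(4)[OF h u], symmetric] Dh[OF u] ..
    then have de: "dT n (?e u) = dT n (s (dT n u))"
      unfolding hom_diff[OF dh T.B_group T.B_group u twistedD(4)[OF ch u]] ds[OF u] by (rule arg_cong)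
    show "dT n (?f u) = 1\<^sub>(BT n)"
      unfolding hom_diff[OF dh T.B_group T.B_group twistedD(4)[OF e u] twistedD(4)[OF sd u]] de
      by (rule group.r_inv[OF T.B_group dc[OF twistedD(4)[OF sd u]]])
  qed
  then obtain s' where s': "s' \<in> twisted T T id 0 (BT (Suc n)) (BT (Suc (Suc n)))" "\<forall>u\<in>carrier (BT (Suc n)). dT (Suc n) (s' u) = ?f u"
    using T.bar_lift[OF CB CB f T.bar_diff_twisted] by blast
  \<comment> \<open>Composition with \<open>dT (Suc n)\<close> removes the summand containing
    \<open>s\<close>, which restores the form of the relation.\<close>
  have "dT (Suc n) (s' (dT (Suc n) u)) = ?e (dT (Suc n) u)" if u: "u <: (BT (Suc (Suc n)))" for u
  proof -
    interpret G: group "BT (Suc n)" by (rule T.B_group)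
    have "s (dT n (dT (Suc n) u)) = 1\<^sub>(BT (Suc n))"
      unfolding T.bar_diff_diff[OF u] by (rule one_twisted[OF s T.B_group T.B_group])
    then have "?f (dT (Suc n) u) = ?e (dT (Suc n) u) *\<^sub>(BT (Suc n)) inv\<^bsub>BT (Suc n)\<^esub> 1\<^sub>(BT (Suc n))" by (rule arg_cong)
    also have "\<dots> = ?e (dT (Suc n) u)" unfolding G.inv_one by (rule G.r_one[OF twistedD(4)[OF e dc[OF u]]])
    finally show ?thesis using bspec[OF s'(2) dc[OF u]] by (rule trans[rotated])
  qed
  then have "homotopy_inverse (Suc n) h h' s'"
    unfolding homotopy_inverse_def using h h' s'(1) by blast
  then show ?case by blast
qed

text \<open>The element \<open>u - cmp (h u) - s (d u)\<close> is a boundary and is killed by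
  \<open>\<eta>\<close>, so \<open>\<eta> u\<close> is the sum of \<open>\<eta> (s (d u))\<close>
  and \<open>\<eta> (cmp (h u))\<close>. The latter equals \<open>\<beta> (g (d u))\<close>, which
  dictates the choice of \<open>\<theta>\<close>.\<close>

lemma comparison_injective:
  assumes flat: "flat_as_left_module TYPE(('r, 't) test_universe) R Tr"
    and epi: "ring_epimorphism TYPE(('r, 't) test_universe) R T \<phi>"
    and N: "central_bimodule K T N"
    and \<eta>: "\<eta> \<in> twisted T T id e (BT (Suc n)) N" "!!u. u <: (BT (Suc (Suc n))) ==> \<eta> (dT (Suc n) u) = 1\<^sub>N"
    and \<beta>: "\<beta> \<in> twisted T T id e (X n) N" "!!x. x <: X (Suc n) ==> \<eta> (cmp (Suc n) x) = \<beta> (D n x)"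
  shows "\<exists>\<theta>. \<theta> \<in> twisted T T id e (BT n) N \<and> (\<forall>u\<in>carrier (BT (Suc n)). \<eta> u = \<theta> (dT n u))"
proof -
  note NN = central_bimoduleD[OF N]
  interpret G: comm_group N by (rule lm_comm_group[OF NN(2)])
  obtain g h s where "homotopy_inverse n g h s" using ex_homotopy_inverse[OF flat epi] by blast
  then have g: "g \<in> twisted T T id 0 (BT n) (X n)" and h: "h \<in> twisted T T id 0 (BT (Suc n)) (X (Suc n))"
    and s: "s \<in> twisted T T id 0 (BT n) (BT (Suc n))"
    and Dh: "!!u. u <: BT (Suc n) ==> D n (h u) = g (dT n u)"
    and ds: "!!u. u <: BT (Suc n) ==> dT n (s (dT n u)) = dT n u *\<^sub>(BT n) inv\<^bsub>BT n\<^esub> (cmp n (g (dT n u)))"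
    unfolding homotopy_inverse_def by blast+
  let ?\<theta> = "%u. \<eta> (s u) *\<^sub>N \<beta> (g u)"
  have "?\<theta> \<in> twisted T T id e (BT n) N"
    by (rule T.twisted_mult[OF NN(1) T.twisted_precomp[OF s \<eta>(1)] T.twisted_precomp[OF g \<beta>(1)]]) simp_all
  moreover have "\<eta> u = ?\<theta> (dT n u)" if u: "u <: BT (Suc n)" for u
  proof -
    note dc = twistedD(4)[OF T.bar_diff_twisted]
    let ?c = "cmp (Suc n) (h u)"
    let ?e = "u *\<^sub>(BT (Suc n)) inv\<^bsub>BT (Suc n)\<^esub> ?c"
    let ?sd = "s (dT n u)"
    have hu: "h u <: X (Suc n)" by (rule twistedD(4)[OF h u])
    have c: "?c <: BT (Suc n)" by (rule twistedD(4)[OF comp_twisted hu])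
    have sd: "?sd <: BT (Suc n)" by (rule twistedD(4)[OF s dc[OF u]])
    have e: "?e <: BT (Suc n)"
      by (rule monoid.m_closed[OF group.is_monoid[OF T.B_group] u group.inv_closed[OF T.B_group c]])
    have f: "?e *\<^sub>(BT (Suc n)) inv\<^bsub>BT (Suc n)\<^esub> ?sd <: BT (Suc n)"
      by (rule monoid.m_closed[OF group.is_monoid[OF T.B_group] e group.inv_closed[OF T.B_group sd]])
    note dh = twistedD(1)[OF T.bar_diff_twisted[of n]] and \<eta>h = twistedD(1)[OF \<eta>(1)]
    have "dT n ?c = cmp n (g (dT n u))" unfolding comp_D[OF hu, symmetric] Dh[OF u] ..
    then have de: "dT n ?e = dT n ?sd" unfolding hom_diff[OF dh T.B_group T.B_group u c] ds[OF u] by (rule arg_cong)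
    have "dT n (?e *\<^sub>(BT (Suc n)) inv\<^bsub>BT (Suc n)\<^esub> ?sd) = 1\<^sub>(BT n)"
      unfolding hom_diff[OF dh T.B_group T.B_group e sd] de by (rule group.r_inv[OF T.B_group dc[OF sd]])
    from T.bar_exact[OF f this] obtain v where v: "v <: (BT (Suc (Suc n)))" "?e *\<^sub>(BT (Suc n)) inv\<^bsub>BT (Suc n)\<^esub> ?sd = dT (Suc n) v"
      by (rule imageE)
    have cc: "\<eta> u <: N" "\<eta> ?c <: N" "\<eta> ?sd <: N" using hom_closed[OF \<eta>h u] hom_closed[OF \<eta>h c] hom_closed[OF \<eta>h sd] .
    have "\<eta> (dT (Suc n) v) = (\<eta> u *\<^sub>N inv\<^bsub>N\<^esub> (\<eta> ?c)) *\<^sub>N inv\<^bsub>N\<^esub> (\<eta> ?sd)"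
      unfolding v(2)[symmetric] hom_diff[OF \<eta>h T.B_group G.is_group e sd] hom_diff[OF \<eta>h T.B_group G.is_group u c] ..
    then have "(\<eta> u *\<^sub>N inv\<^bsub>N\<^esub> (\<eta> ?c)) *\<^sub>N inv\<^bsub>N\<^esub> (\<eta> ?sd) = 1\<^sub>N" unfolding \<eta>(2)[OF v(1)] by (rule sym)
    then have "\<eta> u = \<eta> ?sd *\<^sub>N \<eta> ?c"
      using cc by (metis G.inv_closed G.inv_equality G.inv_inv G.m_closed G.inv_solve_right')
    also have "\<eta> ?c = \<beta> (g (dT n u))" unfolding \<beta>(2)[OF hu] Dh[OF u] ..
    finally show ?thesis .
  qed
  ultimately show ?thesis by blast
qed

end

section \<open>Homogeneous maps\<close>

definition homogeneous_map :: "int => ('l, 'm, 'r, 'z) gr_bimod_scheme => ('l', 'n, 'r', 'w) gr_bimod_scheme => ('m => 'n) => bool" where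
  "homogeneous_map t M N f \<longleftrightarrow> (\<forall>n. \<forall>m\<in>gr M n. f m \<in> gr N (n + t))"

lemma homogeneous_mapD: "[|homogeneous_map t M N f; m \<in> gr M n|] ==> f m \<in> gr N (n + t)"
  by (simp add: homogeneous_map_def)

lemma homogeneous_map_comp:
  "[|homogeneous_map 0 M N f; homogeneous_map t N P g|] ==> homogeneous_map t M P (%x. g (f x))"
  by (simp add: homogeneous_map_def)

definition graded_bimodule :: "('k, 'a, 'y) graded_alg_scheme => ('a, 'n, 'a, 'z) gr_bimod_scheme => bool" where
  "graded_bimodule A N \<longleftrightarrow> (\<forall>n. subgroup (gr N n) N) \<and>
     (\<forall>i j. \<forall>a\<in>part A i. \<forall>m\<in>gr N j. lact N a m \<in> gr N (i + j) \<and> ract N m a \<in> gr N (j + i))"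

lemma graded_bimoduleD:
  assumes "graded_bimodule A N"
  shows "subgroup (gr N n) N" "[|a \<in> part A i; m \<in> gr N j|] ==> lact N a m \<in> gr N (i + j)"
    "[|a \<in> part A i; m \<in> gr N j|] ==> ract N m a \<in> gr N (j + i)"
  using assms by (auto simp: graded_bimodule_def)

lemma tensor_gr_subset:
  assumes tp: "tensor_product R M N" and M: "!!i. gr M i \<subseteq> carrier M" and N: "!!i. gr N i \<subseteq> carrier N"
  shows "gr (tensor R M N) d \<subseteq> carrier (tensor R M N)"
  and tensor_gr_hom: "[|h \<in> hom (tensor_group R M N) H; subgroup W H; group H;
     !!m n i j. [|m \<in> gr M i; n \<in> gr N j; i + j = d|] ==> h (pure_tensor R M N m n) \<in> W; x \<in> gr (tensor R M N) d|] ==> h x \<in> W"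
proof -
  let ?S = "{pure_tensor R M N m n | m n. \<exists>i j. m \<in> gr M i \<and> n \<in> gr N j \<and> i + j = d}"
  have S: "?S \<subseteq> carrier (tensor_group R M N)" using tensor_product.pure_closed[OF tp] M N by blast
  have gr: "gr (tensor R M N) d = generate (tensor_group R M N) ?S" by (simp add: tensor_def)
  show "gr (tensor R M N) d \<subseteq> carrier (tensor R M N)"
    unfolding gr tensor_simps using group.generate_incl[OF tensor_product.group_tensor[OF tp] S] .
  show "h x \<in> W" if "h \<in> hom (tensor_group R M N) H" "subgroup W H" "group H"
     "!!m n i j. [|m \<in> gr M i; n \<in> gr N j; i + j = d|] ==> h (pure_tensor R M N m n) \<in> W" "x \<in> gr (tensor R M N) d"
    by (rule hom_generate[OF that(1) tensor_product.group_tensor[OF tp] that(3) S that(2) _ that(5)[unfolded gr]])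
       (use that(4) in blast)
qed

lemma pure_tensor_gr:
  assumes "m \<in> gr M i" "n \<in> gr N j"
  shows "pure_tensor R M N m n \<in> gr (tensor R M N) (i + j)"
  using assms by (auto simp: tensor_def intro!: generate.incl)

text \<open>The summands on the left are the degrees of the entries after a face has been applied;
  hence the bar differential preserves the total degree.\<close>

lemma sum_multiply_at:
  fixes e :: "nat => int"
  assumes "i \<le> m"
  shows "(\<Sum>l < Suc m. if l < i then e l else if l = i then e i + e (Suc i) else e (Suc l)) = (\<Sum>l < Suc (Suc m). e l)"
  using assms
proof (induction m)
  case 0 then show ?case by simp
next
  case (Suc m)
  show ?case
  proof (cases "i \<le> m")
    case True then show ?thesis using Suc.IH by simp
  next
    case False
    then have i: "i = Suc m" using Suc.prems by simp
    have "(\<Sum>l < Suc m. if l < i then e l else if l = i then e i + e (Suc i) else e (Suc l)) = (\<Sum>l < Suc m. e l)"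
      by (rule sum.cong) (auto simp: i)
    then show ?thesis by (simp add: i)
  qed
qed

context graded_algebra
begin

text \<open>Homogeneity is released slot by slot: in step \<open>k\<close> the entries below
  \<open>k\<close> are arbitrary and the others homogeneous. Additivity in slot \<open>k\<close>
  leads from one step to the next.\<close>

lemma homogeneous_hom_eqI:
  assumes h: "h \<in> hom (tensor_power K A n) H" and h': "h' \<in> hom (tensor_power K A n) H" and H: "group H"
    and eq: "!!xs e. [|xs \<in> words A n; \<forall>i<n. xs ! i \<in> part A (e i)|] ==> h (pw n xs) = h' (pw n xs)"
    and u: "u <: tensor_power K A n"
  shows "h u = h' u"
proof (rule tensor_powers.hom_eqI[OF tp h h' H _ u])
  have *: "\<forall>xs e. xs \<in> words A n \<longrightarrow> (\<forall>i. k \<le> i \<and> i < n \<longrightarrow> xs ! i \<in> part A (e i)) \<longrightarrow> h (pw n xs) = h' (pw n xs)" if "k \<le> n" for k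
    using that
  proof (induction k)
    case 0 then show ?case using eq by blast
  next
    case (Suc k)
    show ?case
    proof (intro allI impI)
      fix xs and e :: "nat => int" assume xs: "xs \<in> words A n" and e: "\<forall>i. Suc k \<le> i \<and> i < n \<longrightarrow> xs ! i \<in> part A (e i)"
      have k: "k < n" using Suc.prems by simp
      have lin: "(%x. g (pw n (xs[k := x]))) \<in> hom addA H" if "g \<in> hom (tensor_power K A n) H" for g
      proof -
        note ml = multilinearD[OF tensor_powers.hom_multilinear[OF tp that]]
        show ?thesis by (rule homI) (use ml(1)[OF words_update[OF xs]] ml(2)[OF xs k] in auto)
      qed
      have "h (pw n (xs[k := x])) = h' (pw n (xs[k := x]))" if x: "x <: A" for x
      proof (rule graded_hom_eqI[OF lin[OF h] lin[OF h'] H _ x])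
        fix m y assume y: "y \<in> part A m"
        have "\<forall>i. k \<le> i \<and> i < n \<longrightarrow> xs[k := y] ! i \<in> part A ((e(k := m)) i)"
          using e y words_length[OF xs] by (auto simp: nth_list_update)
        then show "h (pw n (xs[k := y])) = h' (pw n (xs[k := y]))"
          using Suc.IH Suc.prems words_update[OF xs part_closed[OF y]] by (meson Suc_leD)
      qed
      from this[OF words_nth[OF xs k]] show "h (pw n xs) = h' (pw n xs)" by simp
    qed
  qed
  show "h (pw n xs) = h' (pw n xs)" if "xs \<in> words A n" for xs using *[OF order_refl, THEN spec, THEN spec, of xs "%_. 0"] that by auto
qed

lemma homogeneous_words: "[|length xs = n; \<forall>i<n. xs ! i \<in> part A (e i)|] ==> xs \<in> words A n"
  by (auto simp: words_def in_set_conv_nth) (blast intro: part_closed)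

lemma pw_gr: "[|xs \<in> words A (Suc (Suc n)); \<forall>i < Suc (Suc n). xs ! i \<in> part A (e i)|]
    ==> pw (Suc (Suc n)) xs \<in> gr (B n) (\<Sum>i < Suc (Suc n). e i)"
  unfolding bar_gr using words_length by (blast intro: generate.incl)

lemma bar_gr_generators: "{pw (Suc (Suc n)) xs | xs. length xs = Suc (Suc n) \<and>
    (\<exists>e. (\<forall>i < Suc (Suc n). xs ! i \<in> part A (e i)) \<and> (\<Sum>i < Suc (Suc n). e i) = t)} \<subseteq> carrier (B n)"
  using pw_closed homogeneous_words by blast

lemma bar_gr_subset: "gr (B n) t \<subseteq> carrier (B n)"
  unfolding bar_gr bar_simps using group.generate_incl[OF bar_group bar_gr_generators[unfolded bar_simps]] .

lemma bar_gr_hom: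
  assumes "h \<in> hom (B n) H" "subgroup W H" "group H"
    "!!xs e. [|xs \<in> words A (Suc (Suc n)); \<forall>i < Suc (Suc n). xs ! i \<in> part A (e i); (\<Sum>i < Suc (Suc n). e i) = t|] ==> h (pw (Suc (Suc n)) xs) \<in> W"
    "u \<in> gr (B n) t"
  shows "h u \<in> W"
  by (rule hom_generate[OF assms(1)[unfolded hom_bar] bar_group assms(3) bar_gr_generators[unfolded bar_simps] assms(2) _ assms(5)[unfolded bar_gr]])
     (use assms(4) homogeneous_words in blast)

lemma subgroup_bar: "subgroup W (B n) \<longleftrightarrow> subgroup W (tensor_power K A (Suc (Suc n)))"
  by (simp add: subgroup_def)

lemma graded_bar: "graded_bimodule A (B n)"
proof -
  have sub: "subgroup (gr (B n) d) (B n)" for d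
    unfolding subgroup_bar bar_gr by (rule group.generate_is_subgroup[OF bar_group bar_gr_generators[unfolded bar_simps]])
  have l: "lact (B n) a m \<in> gr (B n) (i + j)" if a: "a \<in> part A i" and m: "m \<in> gr (B n) j" for a m i j
  proof (rule bar_gr_hom[OF _ sub B_group _ m])
    show "lact (B n) a \<in> hom (B n) (B n)" using bar_lact_hom[OF part_closed[OF a]] by simp
    fix xs e assume xs: "xs \<in> words A (Suc (Suc n))" "\<forall>l < Suc (Suc n). xs ! l \<in> part A (e l)" "(\<Sum>l < Suc (Suc n). e l) = j"
    have w: "xs[0 := a *\<^sub>A xs ! 0] \<in> words A (Suc (Suc n))"
      using words_update[OF xs(1)] part_closed[OF a] words_nth[OF xs(1), of 0] by simp
    have "xs[0 := a *\<^sub>A xs ! 0] ! l \<in> part A ((e(0 := i + e 0)) l)" if "l < Suc (Suc n)" for l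
      using xs(2) that words_length[OF xs(1)] mult_part[OF a, of "xs ! 0" "e 0"] by (auto simp: nth_list_update)
    moreover have "(\<Sum>l < Suc (Suc n). (e(0 := i + e 0)) l) = i + j"
      unfolding xs(3)[symmetric] by (simp add: sum.lessThan_Suc_shift del: sum.lessThan_Suc)
    ultimately show "lact (B n) a (pw (Suc (Suc n)) xs) \<in> gr (B n) (i + j)"
      unfolding bar_lact_pure[OF part_closed[OF a] xs(1)] using pw_gr[OF w, of "e(0 := i + e 0)"] by metis
  qed
  have r: "ract (B n) m a \<in> gr (B n) (j + i)" if a: "a \<in> part A i" and m: "m \<in> gr (B n) j" for a m i j
  proof (rule bar_gr_hom[OF _ sub B_group _ m])
    show "(%u. ract (B n) u a) \<in> hom (B n) (B n)" using bar_ract_hom[OF part_closed[OF a]] by simp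
    fix xs e assume xs: "xs \<in> words A (Suc (Suc n))" "\<forall>l < Suc (Suc n). xs ! l \<in> part A (e l)" "(\<Sum>l < Suc (Suc n). e l) = j"
    have w: "xs[Suc n := xs ! Suc n *\<^sub>A a] \<in> words A (Suc (Suc n))"
      using words_update[OF xs(1)] part_closed[OF a] words_nth[OF xs(1), of "Suc n"] by simp
    have "xs[Suc n := xs ! Suc n *\<^sub>A a] ! l \<in> part A ((e(Suc n := e (Suc n) + i)) l)" if "l < Suc (Suc n)" for l
      using xs(2) that words_length[OF xs(1)] mult_part[OF _ a, of "xs ! Suc n" "e (Suc n)"] by (auto simp: nth_list_update)
    moreover have "(\<Sum>l < Suc (Suc n). (e(Suc n := e (Suc n) + i)) l) = j + i"
    proof -
      have "(\<Sum>l < Suc n. (e(Suc n := e (Suc n) + i)) l) = (\<Sum>l < Suc n. e l)" by (rule sum.cong) auto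
      then show ?thesis unfolding xs(3)[symmetric] sum.lessThan_Suc[of _ "Suc n"] by simp
    qed
    ultimately show "ract (B n) (pw (Suc (Suc n)) xs) a \<in> gr (B n) (j + i)"
      unfolding bar_ract_pure[OF part_closed[OF a] xs(1)] using pw_gr[OF w, of "e(Suc n := e (Suc n) + i)"] by metis
  qed
  show ?thesis unfolding graded_bimodule_def using sub l r by blast
qed

lemma graded_regular: "graded_bimodule A (regular_bimod A)"
proof -
  have "subgroup (part A n) (restricted_bimod A id id)" for n
    using part_subgroup[of n] by (simp add: subgroup_def a_inv_def)
  then show ?thesis unfolding graded_bimodule_def regular_bimod_def using mult_part by simp
qed

lemma multiply_at_part:
  assumes xs: "xs \<in> words A (Suc (Suc n))" "\<forall>l < Suc (Suc n). xs ! l \<in> part A (e l)" and i: "i \<le> n" and l: "l < Suc n"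
  shows "multiply_at A i xs ! l \<in> part A (if l < i then e l else if l = i then e i + e (Suc i) else e (Suc l))"
  unfolding nth_multiply_at[OF words_length[OF xs(1)] le_imp_less_Suc[OF i] l]
  using xs(2) i l mult_part by auto

lemma pw_multiply_at_gr:
  assumes "xs \<in> words A (Suc (Suc (Suc n)))" "\<forall>l < Suc (Suc (Suc n)). xs ! l \<in> part A (e l)" "i \<le> Suc n"
  shows "pw (Suc (Suc n)) (multiply_at A i xs) \<in> gr (B n) (\<Sum>l < Suc (Suc (Suc n)). e l)"
proof -
  have w: "multiply_at A i xs \<in> words A (Suc (Suc n))" by (rule mult_at[OF assms(1)]) (use assms(3) in simp)
  show ?thesis
    using pw_gr[OF w, of "%l. if l < i then e l else if l = i then e i + e (Suc i) else e (Suc l)"] multiply_at_part[OF assms]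
    unfolding sum_multiply_at[OF assms(3)] by blast
qed

lemma finprod_in_subgroup:
  assumes "comm_group G" "subgroup W G" "!!i. i \<in> I ==> f i \<in> W"
  shows "finprod G f I \<in> W"
proof -
  interpret comm_group G by fact
  have "finprod G f J \<in> W" if "f \<in> J \<rightarrow> W" for J
    using that
  proof (induction J rule: infinite_finite_induct)
    case (insert x F)
    have "f \<in> F \<rightarrow> carrier G" "f x <: G" using insert.prems subgroup.mem_carrier[OF assms(2)] by auto
    then show ?case using insert subgroup.m_closed[OF assms(2)] by (simp add: Pi_iff)
  qed (simp_all add: subgroup.one_closed[OF assms(2)])
  then show ?thesis using assms(3) by blast
qed

lemma signed_in_subgroup: "[|subgroup W G; x \<in> W|] ==> signed G e x \<in> W"
  by (simp add: signed_def subgroup.m_inv_closed)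

lemma bar_diff_homogeneous: "homogeneous_map 0 (B (Suc n)) (B n) (bd n)"
  unfolding homogeneous_map_def
proof (intro allI ballI)
  fix t u assume u: "u \<in> gr (B (Suc n)) t"
  have "bd n u \<in> gr (B n) t"
  proof (rule bar_gr_hom[OF bar_diff_hom' graded_bimoduleD(1)[OF graded_bar] B_group _ u])
    fix xs e assume xs: "xs \<in> words A (Suc (Suc (Suc n)))" "\<forall>l < Suc (Suc (Suc n)). xs ! l \<in> part A (e l)"
      "(\<Sum>l < Suc (Suc (Suc n)). e l) = t"
    show "bd n (pw (Suc (Suc (Suc n))) xs) \<in> gr (B n) t"
      unfolding bar_diff_pure[OF xs(1)]
      by (rule finprod_in_subgroup[OF bar_comm_group graded_bimoduleD(1)[OF graded_bar]
            signed_in_subgroup[OF graded_bimoduleD(1)[OF graded_bar] pw_multiply_at_gr[OF xs(1,2), unfolded xs(3)]]]) simp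
  qed
  then show "bd n u \<in> gr (B n) (t + 0)" by simp
qed

section \<open>Homogeneous parts of bilinear maps\<close>

lemma component_mult_left:
  assumes a: "a \<in> part A i" and z: "z <: A"
  shows "component A (i + d) (a *\<^sub>A z) = a *\<^sub>A component A d z"
proof (rule graded_hom_eqI[OF _ _ group_add _ z])
  note ac = part_closed[OF a]
  have m: "(%z. a *\<^sub>A z) \<in> hom addA addA" using ac by (simp add: hom_def r_distr)
  show "(%z. component A (i + d) (a *\<^sub>A z)) \<in> hom addA addA" "(%z. a *\<^sub>A component A d z) \<in> hom addA addA"
    by (rule hom_comp[OF m component_hom] hom_comp[OF component_hom m])+
  show "component A (i + d) (a *\<^sub>A x) = a *\<^sub>A component A d x" if "x \<in> part A n" for n x
    using component_of_part[OF mult_part[OF a that]] component_of_part[OF that] ac by simp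
qed

lemma component_mult_right:
  assumes a: "a \<in> part A i" and z: "z <: A"
  shows "component A (d + i) (z *\<^sub>A a) = component A d z *\<^sub>A a"
proof (rule graded_hom_eqI[OF _ _ group_add _ z])
  note ac = part_closed[OF a]
  have m: "(%z. z *\<^sub>A a) \<in> hom addA addA" using ac by (simp add: hom_def l_distr)
  show "(%z. component A (d + i) (z *\<^sub>A a)) \<in> hom addA addA" "(%z. component A d z *\<^sub>A a) \<in> hom addA addA"
    by (rule hom_comp[OF m component_hom] hom_comp[OF component_hom m])+
  show "component A (d + i) (x *\<^sub>A a) = component A d x *\<^sub>A a" if "x \<in> part A n" for n x
    using component_of_part[OF mult_part[OF that a]] component_of_part[OF that] ac by simp
qed

definition biadditive :: "('h, 'q) monoid_scheme => ('a => 'a => 'h) => bool" where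
  "biadditive H f \<longleftrightarrow> (\<forall>y\<in>carrier A. (%x. f x y) \<in> hom addA H) \<and> (\<forall>x\<in>carrier A. f x \<in> hom addA H)"

lemma biadditiveI:
  assumes "!!y. y <: A ==> (%x. f x y) \<in> hom addA H" "!!x. x <: A ==> f x \<in> hom addA H"
  shows "biadditive H f"
  using assms by (simp add: biadditive_def)

lemma biadditiveD:
  assumes "biadditive H f"
  shows "y <: A ==> (%x. f x y) \<in> hom addA H" "x <: A ==> f x \<in> hom addA H"
  using assms by (auto simp: biadditive_def)

lemma biadditive_eqI:
  assumes f: "biadditive H f" and g: "biadditive H g" and H: "group H"
    and eq: "!!i j x y. [|x \<in> part A i; y \<in> part A j|] ==> f x y = g x y"
    and x: "x <: A" and y: "y <: A"
  shows "f x y = g x y"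
proof (rule graded_hom_eqI[OF biadditiveD(1)[OF f y] biadditiveD(1)[OF g y] H _ x])
  fix n x assume x: "x \<in> part A n"
  show "f x y = g x y"
    by (rule graded_hom_eqI[OF biadditiveD(2)[OF f part_closed[OF x]] biadditiveD(2)[OF g part_closed[OF x]] H eq[OF x] y])
qed

text \<open>The part of \<open>f\<close> that is homogeneous of degree \<open>t\<close>, glued first
  in the second and then in the first argument so that it is defined on all elements.\<close>

definition bilinear_part :: "int => ('a => 'a => 'a) => 'a => 'a => 'a" where
  "bilinear_part t f x y =
     graded_sum A addA (%i x. graded_sum A addA (%j y. component A (i + j + t) (f x y)) y) x"

lemma bilinear_part:
  assumes f: "biadditive addA f"
  shows "biadditive addA (bilinear_part t f)"
    and "[|x \<in> part A i; y \<in> part A j|] ==> bilinear_part t f x y = component A (i + j + t) (f x y)"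
proof -
  let ?I = "%i x y. graded_sum A addA (%j y. component A (i + j + t) (f x y)) y"
  have F: "(%y. component A d (f x y)) \<in> hom addA addA" if "x <: A" for x d
    by (rule hom_comp[OF biadditiveD(2)[OF f that] component_hom])
  have Iy: "?I i x \<in> hom addA addA" if "x <: A" for i x
    by (rule graded_sum_hom[OF comm_group_add hom_part[OF F[OF that]]])
  have Ip: "?I i x y = component A (i + j + t) (f x y)" if "x <: A" "y \<in> part A j" for i x y j
    by (rule graded_sum_part[OF comm_group_add hom_part[OF F[OF that(1)]] that(2)])
  have Ix: "(%x. ?I i x y) \<in> hom addA addA" if y: "y <: A" for i y
  proof (rule homI)
    show "?I i x y <: addA" if "x <: addA" for x using hom_closed[OF Iy, of x y i] that y by simp
    fix x x' assume "x <: addA" "x' <: addA"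
    then have x: "x <: A" "x' <: A" "x +\<^sub>A x' <: A" by auto
    have "?I i (x +\<^sub>A x') y = ?I i x y *\<^sub>addA ?I i x' y"
    proof (rule graded_hom_eqI[OF Iy[OF x(3)] hom_prod[OF comm_group_add Iy[OF x(1)] Iy[OF x(2)]] group_add _ y])
      fix n y assume y: "y \<in> part A n"
      show "?I i (x +\<^sub>A x') y = ?I i x y *\<^sub>addA ?I i x' y"
        unfolding Ip[OF x(1) y] Ip[OF x(2) y] Ip[OF x(3) y]
        using hom_mult[OF hom_comp[OF biadditiveD(1)[OF f part_closed[OF y]] component_hom], of x x' "i + n + t"] x by simp
    qed
    then show "?I i (x *\<^sub>addA x') y = ?I i x y *\<^sub>addA ?I i x' y" by simp
  qed
  have Px: "(%x. bilinear_part t f x y) \<in> hom addA addA" if "y <: A" for y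
    unfolding bilinear_part_def by (rule graded_sum_hom[OF comm_group_add hom_part[OF Ix[OF that]]])
  have Pp: "bilinear_part t f x y = ?I i x y" if "x \<in> part A i" "y <: A" for x y i
    unfolding bilinear_part_def by (rule graded_sum_part[OF comm_group_add hom_part[OF Ix[OF that(2)]] that(1)])
  show "bilinear_part t f x y = component A (i + j + t) (f x y)" if "x \<in> part A i" "y \<in> part A j"
    unfolding Pp[OF that(1) part_closed[OF that(2)]] by (rule Ip[OF part_closed[OF that(1)] that(2)])
  show "biadditive addA (bilinear_part t f)"
  proof (rule biadditiveI[OF Px])
    fix x assume x: "x <: A"
    show "bilinear_part t f x \<in> hom addA addA"
    proof (rule homI)
      show "bilinear_part t f x y <: addA" if "y <: addA" for y using hom_closed[OF Px, of y x] that x by simp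
      fix y y' assume "y <: addA" "y' <: addA"
      then have y: "y <: A" "y' <: A" "y +\<^sub>A y' <: A" by auto
      have "bilinear_part t f x (y +\<^sub>A y') = bilinear_part t f x y *\<^sub>addA bilinear_part t f x y'"
      proof (rule graded_hom_eqI[OF Px[OF y(3)] hom_prod[OF comm_group_add Px[OF y(1)] Px[OF y(2)]] group_add _ x])
        fix i x assume x: "x \<in> part A i"
        show "bilinear_part t f x (y +\<^sub>A y') = bilinear_part t f x y *\<^sub>addA bilinear_part t f x y'"
          unfolding Pp[OF x y(1)] Pp[OF x y(2)] Pp[OF x y(3)] using hom_mult[OF Iy[OF part_closed[OF x]], of y y' i] y by simp
      qed
      then show "bilinear_part t f x (y *\<^sub>addA y') = bilinear_part t f x y *\<^sub>addA bilinear_part t f x y'" by simp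
    qed
  qed
qed

definition bilinear :: "('a => 'a => 'a) => bool" where
  "bilinear f \<longleftrightarrow> biadditive addA f \<and> (\<forall>c\<in>carrier K. \<forall>x\<in>carrier A. \<forall>y\<in>carrier A.
     f (c \<cdot>\<^sub>A x) y = c \<cdot>\<^sub>A f x y \<and> f x (c \<cdot>\<^sub>A y) = c \<cdot>\<^sub>A f x y)"

lemma bilinear_part_bilinear:
  assumes "bilinear f"
  shows "bilinear (bilinear_part t f)"
proof -
  have f: "biadditive addA f" and fs: "!!c x y. [|c <: K; x <: A; y <: A|] ==>
    f (c \<cdot>\<^sub>A x) y = c \<cdot>\<^sub>A f x y \<and> f x (c \<cdot>\<^sub>A y) = c \<cdot>\<^sub>A f x y" using assms by (auto simp: bilinear_def)
  let ?g = "bilinear_part t f"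
  have fc: "f x y <: A" if "x <: A" "y <: A" for x y using hom_closed[OF biadditiveD(2)[OF f that(1)], of y] that(2) by simp
  have s: "(%x. c \<cdot>\<^sub>A x) \<in> hom addA addA" if "c <: K" for c using that by (simp add: hom_def smult_r_distr)
  have b: "biadditive addA (%x y. c \<cdot>\<^sub>A ?g x y)" "biadditive addA (%x y. ?g (c \<cdot>\<^sub>A x) y)" "biadditive addA (%x y. ?g x (c \<cdot>\<^sub>A y))"
    if c: "c <: K" for c
  proof -
    note D = biadditiveD[OF bilinear_part(1)[OF f, of t]]
    show "biadditive addA (%x y. c \<cdot>\<^sub>A ?g x y)"
      by (rule biadditiveI[OF hom_comp[OF D(1) s[OF c]] hom_comp[OF D(2) s[OF c]]])
    show "biadditive addA (%x y. ?g (c \<cdot>\<^sub>A x) y)"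
      by (rule biadditiveI[OF hom_comp[OF s[OF c] D(1)] D(2)]) (use c in simp_all)
    show "biadditive addA (%x y. ?g x (c \<cdot>\<^sub>A y))"
      by (rule biadditiveI[OF D(1) hom_comp[OF s[OF c] D(2)]]) (use c in simp_all)
  qed
  have 1: "?g (c \<cdot>\<^sub>A x) y = c \<cdot>\<^sub>A ?g x y" if c: "c <: K" and xy: "x <: A" "y <: A" for c x y
  proof (rule biadditive_eqI[OF b(2)[OF c] b(1)[OF c] group_add _ xy])
    fix i j x y assume x: "x \<in> part A i" and y: "y \<in> part A j"
    note c' = part_closed[OF x] part_closed[OF y]
    show "?g (c \<cdot>\<^sub>A x) y = c \<cdot>\<^sub>A ?g x y"
      unfolding bilinear_part(2)[OF f x y] bilinear_part(2)[OF f part_smult[OF c x] y] conjunct1[OF fs[OF c c']] by (rule component_smult[OF c fc[OF c']])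
  qed
  have 2: "?g x (c \<cdot>\<^sub>A y) = c \<cdot>\<^sub>A ?g x y" if c: "c <: K" and xy: "x <: A" "y <: A" for c x y
  proof (rule biadditive_eqI[OF b(3)[OF c] b(1)[OF c] group_add _ xy])
    fix i j x y assume x: "x \<in> part A i" and y: "y \<in> part A j"
    note c' = part_closed[OF x] part_closed[OF y]
    show "?g x (c \<cdot>\<^sub>A y) = c \<cdot>\<^sub>A ?g x y"
      unfolding bilinear_part(2)[OF f x y] bilinear_part(2)[OF f x part_smult[OF c y]] conjunct2[OF fs[OF c c']] by (rule component_smult[OF c fc[OF c']])
  qed
  show ?thesis unfolding bilinear_def using bilinear_part(1)[OF f] 1 2 by blast
qed

end

lemma (in alg_map) bar_ext_homogeneous:
  assumes f: "cochain K R T (regular_bimod T) s f"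
    and fh: "!!ts e. [|ts \<in> words R s; \<forall>i<s. ts ! i \<in> part R (e i)|] ==> f ts \<in> part T ((\<Sum>i<s. e i) + t)"
  shows "homogeneous_map t (bar K R s) (regular_bimod T) (word_lift K R (Suc (Suc s)) (regular_bimod T) (bar_ext T \<phi> t (regular_bimod T) s f))"
  unfolding homogeneous_map_def
proof (intro allI ballI)
  note N = T.central_regular
  let ?h = "word_lift K R (Suc (Suc s)) (regular_bimod T) (bar_ext T \<phi> t (regular_bimod T) s f)"
  fix d u assume u: "u \<in> gr (bar K R s) d"
  show "?h u \<in> gr (regular_bimod T) (d + t)"
  proof (rule R.bar_gr_hom[OF twistedD(1)[OF bar_ext_twisted[OF N f]] graded_bimoduleD(1)[OF T.graded_regular] lm_group[OF central_bimoduleD(2)[OF N]] _ u])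
    fix xs e assume xs: "xs \<in> words R (Suc (Suc s))" "\<forall>i < Suc (Suc s). xs ! i \<in> part R (e i)" "(\<Sum>i < Suc (Suc s). e i) = d"
    obtain x ts y where ts: "xs = x # ts @ [y]" "ts \<in> words R s" by (rule words_SucSuc_cases[OF xs(1)])
    note len = words_length[OF ts(2)]
    have x: "x \<in> part R (e 0)" using xs(2)[rule_format, of 0] by (simp add: ts(1))
    have y: "y \<in> part R (e (Suc s))" using xs(2)[rule_format, of "Suc s"] len by (simp add: ts(1) nth_append)
    have m: "\<forall>i<s. ts ! i \<in> part R (e (Suc i))"
    proof (intro allI impI)
      fix i assume "i < s" then show "ts ! i \<in> part R (e (Suc i))" using xs(2)[rule_format, of "Suc i"] len by (simp add: ts(1) nth_append)
    qed
    have d: "d + t = (e 0 + ((\<Sum>i<s. e (Suc i)) + t)) + e (Suc s)"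
      unfolding xs(3)[symmetric] sum.lessThan_Suc[of e "Suc s"] sum.lessThan_Suc_shift[of e s] by (simp only: add_ac)
    have "(koszul T t (\<phi> x) *\<^sub>T f ts) *\<^sub>T \<phi> y \<in> part T (d + t)"
      unfolding d by (rule T.mult_part[OF T.mult_part[OF T.koszul_part[OF hom(3)[OF x]] fh[OF ts(2) m]] hom(3)[OF y]])
    then show "?h (pure_word K R (Suc (Suc s)) xs) \<in> gr (regular_bimod T) (d + t)"
      unfolding bar_ext_pure[OF N f xs(1)] unfolding ts(1) bar_ext_eq[OF len] by (simp add: regular_bimod_def)
  qed
qed

lemma (in graded_algebra) words_2: "xs \<in> words A n2 \<longleftrightarrow> (\<exists>x y. xs = [x, y] \<and> x <: A \<and> y <: A)"
  by (auto simp: words_def length_Suc_conv)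

lemma (in alg_map) cochain_2:
  assumes "!!x y. [|x <: R; y <: R|] ==> f x y <: T"
    "!!x x' y. [|x <: R; x' <: R; y <: R|] ==> f (x +\<^sub>R x') y = f x y +\<^sub>T f x' y"
    "!!x x' y. [|x <: R; x' <: R; y <: R|] ==> f y (x +\<^sub>R x') = f y x +\<^sub>T f y x'"
    "!!c x y. [|c <: K; x <: R; y <: R|] ==> f (c \<cdot>\<^sub>R x) y = c \<cdot>\<^sub>T f x y"
    "!!c x y. [|c <: K; x <: R; y <: R|] ==> f x (c \<cdot>\<^sub>R y) = c \<cdot>\<^sub>T f x y"
  shows "cochain K R T (regular_bimod T) n2 (%ts. f (ts ! 0) (ts ! 1))"
proof (rule cochainI)
  show "f (ts ! 0) (ts ! 1) <: regular_bimod T" if "ts \<in> words R n2" for ts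
    using that assms(1) by (auto simp: regular_bimod_def R.words_2)
  show "f (ts[i := x +\<^sub>R y] ! 0) (ts[i := x +\<^sub>R y] ! 1) = f (ts[i := x] ! 0) (ts[i := x] ! 1) *\<^sub>(regular_bimod T) f (ts[i := y] ! 0) (ts[i := y] ! 1)"
    if "ts \<in> words R n2" "i < n2" "x <: R" "y <: R" for ts i x y
    using that(1,3,4) assms(2,3) less_2_cases[of i] that(2) by (auto simp: regular_bimod_def R.words_2 numeral_2_eq_2)
  show "f (ts[i := c \<cdot>\<^sub>R ts ! i] ! 0) (ts[i := c \<cdot>\<^sub>R ts ! i] ! 1) = lact (regular_bimod T) (c \<cdot>\<^sub>T 1\<^sub>T) (f (ts ! 0) (ts ! 1))"
    if "ts \<in> words R n2" "i < n2" "c <: K" for ts i c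
    using that(1,3) assms(1,4,5) less_2_cases[of i] that(2) by (auto simp: regular_bimod_def R.words_2 numeral_2_eq_2 T.smult_one_mult)
qed

context graded_algebra
begin

text \<open>The bar differential preserves the total degree. On a homogeneous word the coboundary of
  the degree \<open>t\<close> part of \<open>\<theta>\<close> is therefore a component of the
  coboundary of \<open>\<theta>\<close>, that is of \<open>\<eta>\<close>, and taking this component
  does not change the homogeneous map \<open>\<eta>\<close>.\<close>

lemma homogeneous_coboundary:
  assumes \<theta>: "\<theta> \<in> twisted A A id t (B n2) (regular_bimod A)"
    and \<eta>: "\<eta> \<in> twisted A A id t (B n3) (regular_bimod A)" "homogeneous_map t (B n3) (regular_bimod A) \<eta>"
    and eq: "!!u. u \<in> carrier (B n3) ==> \<eta> u = \<theta> (bd n2 u)"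
  shows "\<exists>\<theta>'. \<theta>' \<in> twisted A A id t (B n2) (regular_bimod A) \<and> homogeneous_map t (B n2) (regular_bimod A) \<theta>' \<and>
    (\<forall>u\<in>carrier (B n3). \<eta> u = \<theta>' (bd n2 u))"
proof -
  let ?m = "n2" let ?l = "Suc (Suc ?m)" let ?N = "regular_bimod A"
  note N = central_regular and ai = alg_map_id
  define f where "f x y = \<theta> (pw ?l [1\<^sub>A, x, y, 1\<^sub>A])" for x y
  note fc = cochainD[OF alg_map.twisted_cochain[OF ai N \<theta>]]
  have fcl: "f x y <: A" if "x <: A" "y <: A" for x y
    using fc(1)[of "[x, y]"] that by (simp add: f_def words_2 regular_bimod_def)
  have fadd: "f (x +\<^sub>A x') y = f x y +\<^sub>A f x' y" "f y (x +\<^sub>A x') = f y x +\<^sub>A f y x'"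
    if "x <: A" "x' <: A" "y <: A" for x x' y
    using fc(2)[of "[x, y]" 0 x x'] fc(2)[of "[y, x]" 1 x x'] that by (simp_all add: f_def words_2 regular_bimod_def)
  have fs: "f (c \<cdot>\<^sub>A x) y = c \<cdot>\<^sub>A f x y" "f x (c \<cdot>\<^sub>A y) = c \<cdot>\<^sub>A f x y"
    if "c <: K" "x <: A" "y <: A" for c x y
    using fc(3)[of "[x, y]" 0 c] fc(3)[of "[x, y]" 1 c] fcl[OF that(2,3)] that
    by (simp_all add: f_def words_2 regular_bimod_def smult_one_mult)
  have fb: "biadditive addA f" by (rule biadditiveI; rule homI) (use fcl fadd in simp_all)
  then have fbl: "bilinear f" unfolding bilinear_def using fs by blast
  let ?g = "bilinear_part t f"
  have gb: "biadditive addA ?g" by (rule bilinear_part(1)[OF fb])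
  have gs: "?g (c \<cdot>\<^sub>A x) y = c \<cdot>\<^sub>A ?g x y" "?g x (c \<cdot>\<^sub>A y) = c \<cdot>\<^sub>A ?g x y"
    if "c <: K" "x <: A" "y <: A" for c x y
    using bilinear_part_bilinear[OF fbl, of t] that unfolding bilinear_def by blast+
  have gcl: "?g x y <: A" if "x <: A" "y <: A" for x y
    using hom_closed[OF biadditiveD(2)[OF gb that(1)], of y] that(2) by simp
  have gadd: "?g (x +\<^sub>A x') y = ?g x y +\<^sub>A ?g x' y" "?g y (x +\<^sub>A x') = ?g y x +\<^sub>A ?g y x'"
    if "x <: A" "x' <: A" "y <: A" for x x' y
    using hom_mult[OF biadditiveD(1)[OF gb that(3)], of x x'] hom_mult[OF biadditiveD(2)[OF gb that(3)], of x x'] that by simp_all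
  have gc: "cochain K A A ?N ?m (%ts. ?g (ts ! 0) (ts ! 1))"
    by (rule alg_map.cochain_2[OF ai gcl gadd(1) gadd(2) gs(1) gs(2)])
  let ?\<theta> = "word_lift K A ?l ?N (bar_ext A id t ?N ?m (%ts. ?g (ts ! 0) (ts ! 1)))"
  have \<theta>': "?\<theta> \<in> twisted A A id t (B ?m) ?N" by (rule alg_map.bar_ext_twisted[OF ai N gc])
  have \<theta>'h: "homogeneous_map t (B ?m) ?N ?\<theta>"
  proof (rule alg_map.bar_ext_homogeneous[OF ai gc])
    fix ts e assume ts: "ts \<in> words A ?m" "\<forall>i<?m. ts ! i \<in> part A (e i)"
    then have p: "ts ! 0 \<in> part A (e 0)" "ts ! 1 \<in> part A (e 1)" by auto
    show "?g (ts ! 0) (ts ! 1) \<in> part A ((\<Sum>i<?m. e i) + t)"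
      using component_part[OF fcl[OF part_closed[OF p(1)] part_closed[OF p(2)]]] unfolding bilinear_part(2)[OF fb p] by simp
  qed
  \<comment> \<open>On a homogeneous word the outer entries only shift the degree in which the
    component is taken, so the extension of \<open>?g\<close> is a component of
    \<open>\<theta>\<close>.\<close>
  have key: "?\<theta> (pw ?l xs) = component A ((\<Sum>i<?l. e i) + t) (\<theta> (pw ?l xs))"
    if xs: "xs \<in> words A ?l" "\<forall>i<?l. xs ! i \<in> part A (e i)" for xs e
  proof -
    obtain a ts b where ts: "xs = a # ts @ [b]" "a <: A" "ts \<in> words A ?m" "b <: A" by (rule words_SucSuc_cases[OF xs(1)])
    then obtain x y where xy: "ts = [x, y]" "x <: A" "y <: A" by (auto simp: words_2)
    have xse: "xs = [a, x, y, b]" by (simp add: ts xy)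
    have p: "a \<in> part A (e 0)" "x \<in> part A (e 1)" "y \<in> part A (e 2)" "b \<in> part A (e 3)"
      using xs(2)[rule_format, of 0] xs(2)[rule_format, of 1] xs(2)[rule_format, of 2] xs(2)[rule_format, of 3] by (simp_all add: xse)
    let ?p = "pw ?l (1\<^sub>A # ts @ [1\<^sub>A])"
    have pc: "?p <: (B ?m)" using pw_closed[of "1\<^sub>A # ts @ [1\<^sub>A]" ?m] ts by (simp add: words_Cons words_snoc)
    have rp: "ract (B ?m) ?p b <: (B ?m)" by (rule rm_closed[OF central_bimoduleD(3)[OF central_bar] ts(4) pc])
    have fp: "\<theta> ?p = f x y" by (simp add: f_def xy)
    note kp = koszul_part[OF p(1), of t]
    note c = fcl[OF xy(2,3)] part_closed[OF kp]
    have 1: "\<theta> (pw ?l xs) = koszul A t a *\<^sub>A (f x y *\<^sub>A b)"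
      unfolding ts(1) pure_word_outer[OF ts(2-4)] twistedD(2)[OF \<theta> ts(2) rp] twistedD(3)[OF \<theta> ts(4) pc] fp
      by (simp add: regular_bimod_def)
    have 2: "?\<theta> (pw ?l xs) = koszul A t a *\<^sub>A (?g x y *\<^sub>A b)"
      unfolding alg_map.bar_ext_pure[OF ai N gc xs(1)] unfolding ts(1) bar_ext_eq[OF words_length[OF ts(3)]]
      using c ts gcl[OF xy(2,3)] by (simp add: regular_bimod_def xy m_assoc)
    have s: "(\<Sum>i<?l. e i) + t = e 0 + ((e 1 + e 2 + t) + e 3)" by (simp add: numeral_2_eq_2 numeral_3_eq_3)
    show ?thesis unfolding 1 2 s
      using component_mult_left[OF kp m_closed[OF c(1) ts(4)], of "(e 1 + e 2 + t) + e 3"] component_mult_right[OF p(4) c(1), of "e 1 + e 2 + t"]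
      by (simp add: bilinear_part(2)[OF fb p(2,3)])
  qed
  have reg: "hom G ?N = hom G addA" for G :: "('g, 'u) monoid_scheme" by (simp add: regular_bimod_def)
  have \<theta>hom: "\<theta> \<in> hom (B ?m) addA" "?\<theta> \<in> hom (B ?m) addA" using twistedD(1)[OF \<theta>] twistedD(1)[OF \<theta>'] unfolding reg .
  have "\<eta> u = ?\<theta> (bd ?m u)" if u: "u <: B (Suc ?m)" for u
  proof -
    have h1: "\<eta> \<in> hom (tensor_power K A (Suc ?l)) addA" using twistedD(1)[OF \<eta>(1)] by (simp add: reg)
    have h2: "(%u. ?\<theta> (bd ?m u)) \<in> hom (tensor_power K A (Suc ?l)) addA"
      using hom_comp[OF bar_diff_hom \<theta>hom(2)] by simp
    have uc: "u <: tensor_power K A (Suc ?l)" using u by simp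
    show ?thesis
    proof (rule homogeneous_hom_eqI[OF h1 h2 group_add _ uc])
    fix xs and e :: "nat => int" assume xs: "xs \<in> words A (Suc ?l)" "\<forall>i<Suc ?l. xs ! i \<in> part A (e i)"
    let ?d = "(\<Sum>i<Suc ?l. e i) + t"
    have p: "pw (Suc ?l) xs <: B (Suc ?m)" by (rule pw_closed[OF xs(1)])
    have \<eta>p: "\<eta> (pw (Suc ?l) xs) \<in> part A ?d"
      using homogeneous_mapD[OF \<eta>(2) pw_gr[OF xs]] by (simp add: regular_bimod_def)
    have ch: "(%u. component A ?d (\<theta> u)) \<in> hom (B ?m) addA" by (rule hom_comp[OF \<theta>hom(1) component_hom])
    have each: "?\<theta> (pw ?l (multiply_at A i xs)) = component A ?d (\<theta> (pw ?l (multiply_at A i xs)))" if i: "i \<le> Suc ?m" for i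
    proof -
      have w: "multiply_at A i xs \<in> words A ?l" by (rule mult_at[OF xs(1)]) (use i in simp)
      show ?thesis using key[OF w, of "%l. if l < i then e l else if l = i then e i + e (Suc i) else e (Suc l)"] multiply_at_part[OF xs i]
        unfolding sum_multiply_at[OF i] by blast
    qed
    have "?\<theta> (bd ?m (pw (Suc ?l) xs)) = finprod addA (%i. signed addA (int i) (?\<theta> (pw ?l (multiply_at A i xs)))) {..Suc ?m}"
      unfolding bar_diff_pure[OF xs(1)] by (rule hom_bar_finprod[OF \<theta>hom(2) comm_group_add xs(1) order_refl])
    also have "\<dots> = finprod addA (%i. signed addA (int i) (component A ?d (\<theta> (pw ?l (multiply_at A i xs))))) {..Suc ?m}"
    proof (rule comm_monoid.finprod_cong'[OF comm_group.axioms(1)[OF comm_group_add] refl])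
      show "(%i. signed addA (int i) (component A ?d (\<theta> (pw ?l (multiply_at A i xs))))) \<in> {..Suc ?m} \<rightarrow> carrier addA"
        by (intro funcsetI signed_closed[OF group_add] hom_closed[OF ch] pw_closed mult_at[OF xs(1)]) simp
    qed (use each in simp)
    also have "\<dots> = component A ?d (\<theta> (bd ?m (pw (Suc ?l) xs)))"
      unfolding bar_diff_pure[OF xs(1)] by (rule hom_bar_finprod[OF ch comm_group_add xs(1) order_refl, symmetric])
    also have "\<dots> = component A ?d (\<eta> (pw (Suc ?l) xs))" unfolding eq[OF p] ..
    also have "\<dots> = \<eta> (pw (Suc ?l) xs)" using component_of_part[OF \<eta>p] by simp
    finally show "\<eta> (pw (Suc ?l) xs) = ?\<theta> (bd ?m (pw (Suc ?l) xs))" by (rule sym)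
    qed
  qed
  then show ?thesis using \<theta>' \<theta>'h by blast
qed

end

section \<open>Gradings on the base-changed complex\<close>

context alg_map
begin

lemma M_gr_subset: "gr (M n) d \<subseteq> carrier (M n)"
  unfolding M_eq by (rule tensor_gr_subset[OF tpM]) (use T.part_closed R.bar_gr_subset in auto)

lemma Tr_gr_subset: "gr Tr d \<subseteq> carrier Tr" and Tl_gr_subset: "gr Tl d \<subseteq> carrier Tl"
  using T.part_closed by auto

lemma X_gr_subset: "gr (X n) d \<subseteq> carrier (X n)"
  unfolding X_eq by (rule tensor_gr_subset[OF tpX M_gr_subset Tr_gr_subset])

lemmas M_gr_hom = tensor_gr_hom[OF tpM Tl_gr_subset R.bar_gr_subset, folded M_eq]
lemmas X_gr_hom = tensor_gr_hom[OF tpX M_gr_subset Tr_gr_subset, folded X_eq]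

lemma sandwich_homogeneous:
  assumes N: "central_bimodule K T N" "graded_bimodule T N" and \<alpha>: "\<alpha> \<in> twisted R T \<phi> e (BR n) N" "homogeneous_map t (BR n) N \<alpha>"
  shows "homogeneous_map t (X n) N (sandwich K R T \<phi> n N e \<alpha>)"
  unfolding homogeneous_map_def
proof (intro allI ballI)
  note GD = graded_bimoduleD[OF N(2)] and G = lm_group[OF central_bimoduleD(2)[OF N(1)]]
  let ?i = "tensor_lift R Tl (BR n) N (%t b. lact N (koszul T e t) (\<alpha> b))"
  have ih: "?i \<in> hom (tensor_group R Tl (BR n)) N" using inner_hom[OF N(1) \<alpha>(1)] by (simp add: M_eq)
  have sh: "sandwich K R T \<phi> n N e \<alpha> \<in> hom (tensor_group R (M n) Tr) N" using sandwich_hom[OF N(1) \<alpha>(1)] by (simp add: X_eq)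
  have i: "?i u \<in> gr N (d + t)" if "u \<in> gr (M n) d" for u d
  proof (rule M_gr_hom[OF ih GD(1) G _ that])
    fix x b i j assume x: "x \<in> gr Tl i" and b: "b \<in> gr (BR n) j" and d: "i + j = d"
    have xp: "x \<in> part T i" using x by simp
    have bc: "b <: BR n" using b R.bar_gr_subset by blast
    show "?i (pM n x b) \<in> gr N (d + t)"
      unfolding inner_pure[OF N(1) \<alpha>(1) T.part_closed[OF xp] bc] d[symmetric] add.assoc
      by (rule GD(2)[OF T.koszul_part[OF xp] homogeneous_mapD[OF \<alpha>(2) b]])
  qed
  fix d x assume x: "x \<in> gr (X n) d"
  show "sandwich K R T \<phi> n N e \<alpha> x \<in> gr N (d + t)"
  proof (rule X_gr_hom[OF sh GD(1) G _ x])
    fix u y i' j assume u: "u \<in> gr (M n) i'" and y: "y \<in> gr Tr j" and d: "i' + j = d"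
    have yp: "y \<in> part T j" using y by simp
    have uc: "u <: M n" using u M_gr_subset by blast
    have "ract N (?i u) y \<in> gr N (i' + t + j)" by (rule GD(3)[OF yp i[OF u]])
    moreover have "i' + t + j = d + t" using d by simp
    ultimately show "sandwich K R T \<phi> n N e \<alpha> (pX n u y) \<in> gr N (d + t)"
      unfolding sandwich_pX[OF N(1) \<alpha>(1) uc T.part_closed[OF yp]] by simp
  qed
qed

lemma bar_map_homogeneous: "homogeneous_map 0 (BR n) (bar K T n) (bar_map n)"
  unfolding homogeneous_map_def
proof (intro allI ballI)
  fix d u assume u: "u \<in> gr (BR n) d"
  show "bar_map n u \<in> gr (bar K T n) (d + 0)"
  proof (rule R.bar_gr_hom[OF bar_map_hom graded_bimoduleD(1)[OF T.graded_bar] T.B_group _ u])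
    fix xs e assume xs: "xs \<in> words R (Suc (Suc n))" "\<forall>i < Suc (Suc n). xs ! i \<in> part R (e i)" "(\<Sum>i < Suc (Suc n). e i) = d"
    have "\<forall>i < Suc (Suc n). map \<phi> xs ! i \<in> part T (e i)" using xs(2) words_length[OF xs(1)] hom(3) by simp
    from T.pw_gr[OF map_words[OF xs(1)] this] show "bar_map n (pure_word K R (Suc (Suc n)) xs) \<in> gr (bar K T n) (d + 0)"
      unfolding bar_map_pure[OF xs(1)] xs(3) by simp
  qed
qed

lemma comp_homogeneous: "homogeneous_map 0 (X n) (bar K T n) (cmp n)"
  unfolding comp_eq by (rule sandwich_homogeneous[OF T.central_bar T.graded_bar bar_map_twisted bar_map_homogeneous])

lemma subgroup_tensor: "subgroup W (tensor R' M' N') \<longleftrightarrow> subgroup W (tensor_group R' M' N')"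
  by (simp add: subgroup_def)

lemma M_gr_subgroup: "subgroup (gr (M n) d) (M n)" and X_gr_subgroup: "subgroup (gr (X n) d) (X n)"
proof -
  have 1: "{pM n m b | m b. \<exists>i j. m \<in> gr Tl i \<and> b \<in> gr (BR n) j \<and> i + j = d} \<subseteq> carrier (tensor_group R Tl (BR n))"
    using tensor_product.pure_closed[OF tpM] Tl_gr_subset R.bar_gr_subset by blast
  have 2: "{pX n m b | m b. \<exists>i j. m \<in> gr (M n) i \<and> b \<in> gr Tr j \<and> i + j = d} \<subseteq> carrier (tensor_group R (M n) Tr)"
    using tensor_product.pure_closed[OF tpX] Tr_gr_subset M_gr_subset by blast
  show "subgroup (gr (M n) d) (M n)"
    using group.generate_is_subgroup[OF tensor_product.group_tensor[OF tpM] 1] unfolding M_eq subgroup_tensor by (simp add: tensor_def)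
  show "subgroup (gr (X n) d) (X n)"
    using group.generate_is_subgroup[OF tensor_product.group_tensor[OF tpX] 2] unfolding X_eq subgroup_tensor by (simp add: tensor_def)
qed

lemma D_homogeneous: "homogeneous_map 0 (X (Suc n)) (X n) (D n)"
  unfolding homogeneous_map_def
proof (intro allI ballI)
  have mh: "M_diff n \<in> hom (tensor_group R Tl (BR (Suc n))) (M n)" using M_diff_hom[of n] by (simp add: M_eq)
  have dh: "D n \<in> hom (tensor_group R (M (Suc n)) Tr) (X n)" using D_hom[of n] by (simp add: X_eq)
  have i: "M_diff n u \<in> gr (M n) d" if "u \<in> gr (M (Suc n)) d" for u d
  proof (rule M_gr_hom[OF mh M_gr_subgroup M_group(1) _ that])
    fix x b i j assume x: "x \<in> gr Tl i" and b: "b \<in> gr (BR (Suc n)) j" and d: "i + j = d"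
    have xc: "x <: T" using x T.part_closed by simp
    have bc: "b <: BR (Suc n)" using b R.bar_gr_subset by blast
    have "bar_diff K R n b \<in> gr (BR n) j" using homogeneous_mapD[OF R.bar_diff_homogeneous b] by simp
    from pure_tensor_gr[where R=R, OF x this] show "M_diff n (pM (Suc n) x b) \<in> gr (M n) d"
      unfolding M_diff_pure[OF xc bc] d M_eq .
  qed
  fix d x assume x: "x \<in> gr (X (Suc n)) d"
  show "D n x \<in> gr (X n) (d + 0)"
  proof (rule X_gr_hom[OF dh X_gr_subgroup X_group(1) _ x])
    fix u y i' j assume u: "u \<in> gr (M (Suc n)) i'" and y: "y \<in> gr Tr j" and d: "i' + j = d"
    have yc: "y <: T" using y T.part_closed by simp
    have uc: "u <: M (Suc n)" using u M_gr_subset by blast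
    from pure_tensor_gr[where R=R, OF i[OF u] y] show "D n (pX (Suc n) u y) \<in> gr (X n) (d + 0)"
      unfolding D_pX[OF uc yc] d X_eq by simp
  qed
qed

end

section \<open>Cohomology classes\<close>

context graded_algebra
begin

abbreviation "NA \<equiv> regular_bimod A"

lemma NA_simps [simp]:
  "carrier NA = carrier A" "mult NA = add A" "one NA = 0\<^sub>A" "lact NA a x = a *\<^sub>A x" "ract NA x a = x *\<^sub>A a"
  "gr NA = part A" "m_inv NA = a_inv A"
  by (simp_all add: regular_bimod_def)

lemma NA_module: "left_module A NA" "bimodule A A NA" "group NA"
  using central_bimoduleD[OF central_regular] lm_group by blast+

lemma twisted_restrict:
  assumes "bimodule A A M" "f \<in> twisted A A id t M N"
  shows "restrict f (carrier M) \<in> twisted A A id t M N"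
proof (rule twistedI)
  note l = bimodule_left[OF assms(1)] and r = bimodule_right[OF assms(1)]
  show "restrict f (carrier M) \<in> hom M N" by (rule hom_restrict[OF twistedD(1)[OF assms(2)] lm_group[OF l]])
  fix a m assume a: "a <: A" "m <: M"
  show "restrict f (carrier M) (lact M a m) = lact N (koszul A t (id a)) (restrict f (carrier M) m)"
    using lm_closed[OF l a] twistedD(2)[OF assms(2) a] a by simp
  show "restrict f (carrier M) (ract M m a) = ract N (restrict f (carrier M) m) (id a)"
    using rm_closed[OF r a] twistedD(3)[OF assms(2) a] a by simp
qed

lemma lact_koszul_part:
  assumes "left_module A N" "a \<in> part A n" "y <: N"
  shows "lact N (koszul A t a) y = signed N (t * n) (lact N a y)"
  unfolding koszul_of_part[OF assms(2)]
  using hom_signed[OF lm_act_hom[OF assms(1,3)] group_add lm_group[OF assms(1)], of a] part_closed[OF assms(2)] by simp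

text \<open>\<open>gr_hom\<close> imposes the sign rule for homogeneous scalars. Both sides of the
  rule are additive in the scalar once the sign is written with \<open>koszul\<close>, so it extends
  to all scalars.\<close>

lemma gr_hom_iff:
  assumes M: "left_module A M" and N: "left_module A N"
  shows "f <: gr_hom A t M N \<longleftrightarrow> f \<in> twisted A A id t M N \<and> f \<in> extensional (carrier M) \<and> homogeneous_map t M N f"
proof
  assume f: "f <: gr_hom A t M N"
  then have fh: "f \<in> hom M N" and fe: "f \<in> extensional (carrier M)" and fg: "\<forall>n. \<forall>m\<in>gr M n. f m \<in> gr N (n + t)"
    and fl: "!!n a m. [|a \<in> part A n; m <: M|] ==> f (lact M a m) = signed N (t * n) (lact N a (f m))"
    and fr: "!!a m. [|a <: A; m <: M|] ==> f (ract M m a) = ract N (f m) a"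
    by (simp_all add: gr_hom_def)
  have "f (lact M a m) = lact N (koszul A t a) (f m)" if a: "a <: A" and m: "m <: M" for a m
  proof (rule graded_hom_eqI[OF hom_comp[OF lm_act_hom[OF M m] fh] hom_comp[OF koszul_hom lm_act_hom[OF N hom_closed[OF fh m]]] lm_group[OF N] _ a])
    fix n x assume x: "x \<in> part A n"
    show "f (lact M x m) = lact N (koszul A t x) (f m)" unfolding fl[OF x m] lact_koszul_part[OF N x hom_closed[OF fh m]] ..
  qed
  then have "f \<in> twisted A A id t M N" by (intro twistedI fh) (simp_all add: fr)
  then show "f \<in> twisted A A id t M N \<and> f \<in> extensional (carrier M) \<and> homogeneous_map t M N f"
    using fe fg by (simp add: homogeneous_map_def)
next
  assume f: "f \<in> twisted A A id t M N \<and> f \<in> extensional (carrier M) \<and> homogeneous_map t M N f"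
  then have ft: "f \<in> twisted A A id t M N" by blast
  have "f (lact M a m) = signed N (t * n) (lact N a (f m))" if a: "a \<in> part A n" and m: "m <: M" for a m n
    using twistedD(2)[OF ft part_closed[OF a] m] lact_koszul_part[OF N a twistedD(4)[OF ft m]] by simp
  then show "f <: gr_hom A t M N"
    using f twistedD(1)[OF ft] twistedD(3)[OF ft] by (simp add: gr_hom_def homogeneous_map_def)
qed

lemma gr_homI:
  assumes "bimodule A A M" "!!d. gr M d \<subseteq> carrier M" "f \<in> twisted A A id t M NA" "homogeneous_map t M NA f"
  shows "restrict f (carrier M) <: gr_hom A t M NA"
  unfolding gr_hom_iff[OF bimodule_left[OF assms(1)] NA_module(1)]
  using twisted_restrict[OF assms(1,3)] assms(2,4) by (auto simp: homogeneous_map_def subset_iff)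

lemma gr_hom_simps:
  "mult (gr_hom A t M NA) = (%f g. \<lambda>m \<in> carrier M. f m +\<^sub>A g m)" "one (gr_hom A t M NA) = (\<lambda>m \<in> carrier M. 0\<^sub>A)"
  by (simp_all add: gr_hom_def)

lemma gr_homD:
  assumes "bimodule A A M" "f <: gr_hom A t M NA"
  shows "f \<in> twisted A A id t M NA" "f \<in> extensional (carrier M)" "homogeneous_map t M NA f" "m <: M ==> f m <: A"
  using assms(2) unfolding gr_hom_iff[OF bimodule_left[OF assms(1)] NA_module(1)] using twistedD(4)[of f A A id t M NA m] by auto

lemma gr_hom_comm_group:
  assumes M: "bimodule A A M" "!!d. gr M d \<subseteq> carrier M"
  shows "comm_group (gr_hom A t M NA)"
    and "f <: gr_hom A t M NA ==> inv\<^bsub>gr_hom A t M NA\<^esub> f = (\<lambda>m \<in> carrier M. -\<^sub>A f m)"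
proof -
  let ?G = "gr_hom A t M NA"
  note D = gr_homD[OF M(1)] and I = gr_homI[OF M]
  have z: "(%m. 0\<^sub>A) \<in> twisted A A id t M NA" by (rule twistedI) (simp_all add: hom_def)
  have one: "1\<^sub>?G <: ?G" unfolding gr_hom_simps by (rule I[OF z]) (simp add: homogeneous_map_def)
  have mult: "f *\<^sub>?G g <: ?G" if f: "f <: ?G" and g: "g <: ?G" for f g
    unfolding gr_hom_simps
    by (rule I[OF twisted_mult[OF NA_module(2) D(1)[OF f] D(1)[OF g], simplified]])
       (use D(3)[OF f] D(3)[OF g] part_add in \<open>auto simp: homogeneous_map_def\<close>)
  have minus: "(\<lambda>m \<in> carrier M. -\<^sub>A f m) <: ?G" if f: "f <: ?G" for f
    by (rule I[OF twisted_inv[OF NA_module(2) D(1)[OF f], simplified]])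
       (use D(3)[OF f] part_minus in \<open>auto simp: homogeneous_map_def\<close>)
  have inv: "(\<lambda>m \<in> carrier M. -\<^sub>A f m) *\<^sub>?G f = 1\<^sub>?G" if f: "f <: ?G" for f
    unfolding gr_hom_simps by (rule restrict_ext) (use D(4)[OF f] l_neg in simp)
  show G: "comm_group ?G"
  proof (rule comm_groupI)
    show "(f *\<^sub>?G g) *\<^sub>?G h = f *\<^sub>?G (g *\<^sub>?G h)" if "f <: ?G" "g <: ?G" "h <: ?G" for f g h
      unfolding gr_hom_simps by (rule restrict_ext) (use D(4)[OF that(1)] D(4)[OF that(2)] D(4)[OF that(3)] in \<open>simp add: a_assoc\<close>)
    show "f *\<^sub>?G g = g *\<^sub>?G f" if "f <: ?G" "g <: ?G" for f g
      unfolding gr_hom_simps by (rule restrict_ext) (use D(4)[OF that(1)] D(4)[OF that(2)] in \<open>simp add: a_comm\<close>)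
    show "1\<^sub>?G *\<^sub>?G f = f" if "f <: ?G" for f
      unfolding gr_hom_simps by (rule extensionalityI[OF _ D(2)[OF that]]) (use D(4)[OF that] in simp_all)
    show "\<exists>g\<in>carrier ?G. g *\<^sub>?G f = 1\<^sub>?G" if "f <: ?G" for f using minus[OF that] inv[OF that] by blast
  qed (use one mult in simp_all)
  show "inv\<^bsub>?G\<^esub> f = (\<lambda>m \<in> carrier M. -\<^sub>A f m)" if "f <: ?G"
    by (rule group.inv_equality[OF comm_group.axioms(2)[OF G] inv[OF that] that minus[OF that]])
qed

end

text \<open>Both the bar complex and its base change are instances, so classes of cochains are
  treated once for the two of them.\<close>

locale bimod_complex = graded_algebra K A
  for K :: "('k, 'p) ring_scheme" (structure) and A :: "('k, 'a, 'z) graded_alg_scheme" (structure) +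
  fixes X :: "nat => ('a, 'm, 'a) gr_bimod" and D :: "nat => 'm => 'm"
  assumes bimod: "bimodule A A (X n)" and gr_subset: "gr (X n) d \<subseteq> carrier (X n)"
    and diff_twisted: "D n \<in> twisted A A id 0 (X (Suc n)) (X n)"
    and diff_homogeneous: "homogeneous_map 0 (X (Suc n)) (X n) (D n)"
begin

abbreviation "G t n \<equiv> gr_hom A t (X n) NA"
abbreviation "cls t n \<equiv> hom_class A X D NA n t"

lemma G_comm_group: "comm_group (G t n)"
  and G_inv: "f <: G t n ==> inv\<^bsub>G t n\<^esub> f = (\<lambda>m \<in> carrier (X n). -\<^sub>A f m)"
  by (rule gr_hom_comm_group[OF bimod gr_subset]; assumption)+

lemma G_group: "group (G t n)"
  by (rule comm_group.axioms(2)[OF G_comm_group])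

lemmas G_D = gr_homD[OF bimod]

lemma pullback_diff: "f <: G t n ==> compose (carrier (X (Suc n))) f (D n) <: G t (Suc n)"
  unfolding compose_def
  by (rule gr_homI[OF bimod gr_subset twisted_precomp[OF diff_twisted G_D(1)] homogeneous_map_comp[OF diff_homogeneous G_D(3)]])

lemma coboundaries_subgroup: "subgroup (hom_coboundaries A X D NA (Suc n) t) (G t (Suc n))"
proof -
  let ?h = "%f. compose (carrier (X (Suc n))) f (D n)"
  have "?h \<in> hom (G t n) (G t (Suc n))"
  proof (rule homI[OF pullback_diff])
    fix f g assume "f <: G t n" "g <: G t n"
    show "?h (f *\<^sub>(G t n) g) = ?h f *\<^sub>(G t (Suc n)) ?h g"
      unfolding gr_hom_simps compose_def by (rule restrict_ext) (use twistedD(4)[OF diff_twisted] in simp)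
  qed
  then have "group_hom (G t n) (G t (Suc n)) ?h" using G_group by (simp add: group_hom_def group_hom_axioms_def)
  from group_hom.img_is_subgroup[OF this] show ?thesis by (simp add: hom_coboundaries_def)
qed

lemma class_eq_iff:
  assumes f: "f <: G t (Suc n)" and g: "g <: G t (Suc n)"
  shows "cls t (Suc n) f = cls t (Suc n) g \<longleftrightarrow>
    (\<exists>\<beta> \<in> carrier (G t n). \<forall>x\<in>carrier (X (Suc n)). f x = g x +\<^sub>A \<beta> (D n x))"
proof -
  have e: "f *\<^sub>(G t (Suc n)) inv\<^bsub>G t (Suc n)\<^esub> g = (\<lambda>x \<in> carrier (X (Suc n)). f x -\<^sub>A g x)"
    unfolding G_inv[OF g] gr_hom_simps by (rule restrict_ext) (simp add: a_minus_def)
  have iff: "(\<lambda>x \<in> carrier (X (Suc n)). f x -\<^sub>A g x) = compose (carrier (X (Suc n))) \<beta> (D n) \<longleftrightarrow>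
     (\<forall>x\<in>carrier (X (Suc n)). f x = g x +\<^sub>A \<beta> (D n x))" if b: "\<beta> <: G t n" for \<beta>
  proof -
    have "f x -\<^sub>A g x = \<beta> (D n x) \<longleftrightarrow> f x = g x +\<^sub>A \<beta> (D n x)" if x: "x <: X (Suc n)" for x
    proof -
      have c: "f x <: A" "g x <: A" "\<beta> (D n x) <: A"
        using G_D(4)[OF f x] G_D(4)[OF g x] G_D(4)[OF b twistedD(4)[OF diff_twisted x]] .
      show ?thesis using c by (metis a_comm a_minus_def add.inv_closed add.inv_solve_right')
    qed
    then show ?thesis unfolding compose_def by (auto simp: fun_eq_iff restrict_def)
  qed
  show ?thesis
    unfolding hom_class_def coset_eq_iff[OF G_group coboundaries_subgroup f g] e
    using iff by (auto simp: hom_coboundaries_def image_iff)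
qed

lemma class_self: "f <: G t (Suc n) ==> f \<in> cls t (Suc n) f"
  unfolding hom_class_def by (rule group.rcos_self[OF G_group _ coboundaries_subgroup])

lemma class_mem:
  assumes "f <: G t (Suc n)" "g \<in> cls t (Suc n) f"
  shows "g <: G t (Suc n)" "cls t (Suc n) g = cls t (Suc n) f"
  using subgroup.elemrcos_carrier[OF coboundaries_subgroup G_group assms(1), of g]
    group.repr_independence[OF G_group _ assms(1) coboundaries_subgroup, of g] assms(2) unfolding hom_class_def by simp_all

lemma cocycles_iff: "f \<in> hom_cocycles A X D NA n t \<longleftrightarrow> f <: G t n \<and> (\<forall>x\<in>carrier (X (Suc n)). f (D n x) = 0\<^sub>A)"
  unfolding hom_cocycles_def gr_hom_simps compose_def by (auto simp: fun_eq_iff restrict_def)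

lemma cohomology_carrier: "carrier (hom_cohomology A X D NA n t) = cls t n ` hom_cocycles A X D NA n t"
  by (auto simp: hom_cohomology_def FactGroup_def RCOSETS_def hom_class_def r_coset_def)

end

lemma (in graded_algebra) bar_complex: "bimod_complex K A (bar K A) (bd)"
  by unfold_locales (rule central_bimoduleD(1)[OF central_bar] bar_gr_subset bar_diff_twisted bar_diff_homogeneous)+

lemma (in alg_map) base_change_complex: "bimod_complex K T (base_change K R T \<phi>) (base_change_diff K R T \<phi>)"
  by unfold_locales (rule bimod_X X_gr_subset D_twisted D_homogeneous)+

section \<open>Trilinear maps and the bar complex\<close>

lemma (in comm_monoid) finprod_atMost_3:
  assumes "!!i. f i <: G"
  shows "finprod G f {..n3} = f 3 \<otimes> (f 2 \<otimes> (f 1 \<otimes> f 0))"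
  using assms by (simp add: finprod_Suc Pi_def numeral_2_eq_2 numeral_3_eq_3)

lemma (in comm_monoid) finprod_atMost_4:
  assumes "!!i. f i <: G"
  shows "finprod G f {..n4} = f 4 \<otimes> (f 3 \<otimes> (f 2 \<otimes> (f 1 \<otimes> f 0)))"
proof -
  have 4: "(4::nat) = n4" by simp
  show ?thesis unfolding 4 using assms by (simp add: finprod_Suc Pi_def numeral_2_eq_2 numeral_3_eq_3)
qed

context graded_algebra
begin

lemma words_3: "xs \<in> words A n3 \<longleftrightarrow> (\<exists>x y z. xs = [x, y, z] \<and> x <: A \<and> y <: A \<and> z <: A)"
  by (auto simp: words_def length_Suc_conv)

lemma less_SucSucSuc: "i < n3 \<longleftrightarrow> i = 0 \<or> i = Suc 0 \<or> i = n2"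
  by auto

end

context alg_map
begin

abbreviation "NT \<equiv> regular_bimod T"
abbreviation "bext s f \<equiv> word_lift K R (Suc (Suc s)) NT (bar_ext T \<phi> (- 1) NT s f)"

lemma cochain_3:
  assumes "!!x y z. [|x <: R; y <: R; z <: R|] ==> f x y z <: T"
    "!!x x' y z. [|x <: R; x' <: R; y <: R; z <: R|] ==> f (x +\<^sub>R x') y z = f x y z +\<^sub>T f x' y z \<and>
       f y (x +\<^sub>R x') z = f y x z +\<^sub>T f y x' z \<and> f y z (x +\<^sub>R x') = f y z x +\<^sub>T f y z x'"
    "!!c x y z. [|c <: K; x <: R; y <: R; z <: R|] ==> f (c \<cdot>\<^sub>R x) y z = c \<cdot>\<^sub>T f x y z \<and>
       f x (c \<cdot>\<^sub>R y) z = c \<cdot>\<^sub>T f x y z \<and> f x y (c \<cdot>\<^sub>R z) = c \<cdot>\<^sub>T f x y z"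
  shows "cochain K R T NT n3 (%ts. f (ts ! 0) (ts ! 1) (ts ! 2))"
proof (rule cochainI)
  show "f (ts ! 0) (ts ! 1) (ts ! 2) <: NT" if "ts \<in> words R n3" for ts
    using that assms(1) by (auto simp: R.words_3 numeral_2_eq_2)
  show "f (ts[i := x +\<^sub>R y] ! 0) (ts[i := x +\<^sub>R y] ! 1) (ts[i := x +\<^sub>R y] ! 2) =
      f (ts[i := x] ! 0) (ts[i := x] ! 1) (ts[i := x] ! 2) *\<^sub>NT f (ts[i := y] ! 0) (ts[i := y] ! 1) (ts[i := y] ! 2)"
    if "ts \<in> words R n3" "i < n3" "x <: R" "y <: R" for ts i x y
    using that(1,3,4) assms(2) that(2) by (auto simp: R.words_3 R.less_SucSucSuc numeral_2_eq_2)
  show "f (ts[i := c \<cdot>\<^sub>R ts ! i] ! 0) (ts[i := c \<cdot>\<^sub>R ts ! i] ! 1) (ts[i := c \<cdot>\<^sub>R ts ! i] ! 2) =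
      lact NT (c \<cdot>\<^sub>T 1\<^sub>T) (f (ts ! 0) (ts ! 1) (ts ! 2))"
    if "ts \<in> words R n3" "i < n3" "c <: K" for ts i c
    using that(1,3) assms(1,3) that(2) by (auto simp: R.words_3 R.less_SucSucSuc numeral_2_eq_2 T.smult_one_mult)
qed

lemma bext_twisted: "cochain K R T NT s f ==> bext s f \<in> twisted R T \<phi> (- 1) (BR s) NT"
  by (rule bar_ext_twisted[OF T.central_regular])

lemma bext_pure:
  assumes f: "cochain K R T NT s f" and x: "x <: R" "ts \<in> words R s" "y <: R"
  shows "bext s f (pure_word K R (Suc (Suc s)) (x # ts @ [y])) = koszul T 1 (\<phi> x) *\<^sub>T f ts *\<^sub>T \<phi> y"
proof -
  have w: "x # ts @ [y] \<in> words R (Suc (Suc s))" using x by (simp add: words_Cons words_snoc)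
  \<comment> \<open>Only the parity of the degree enters the sign; degree 1 is the form in which the
    cochain identities are stated.\<close>
  have "koszul T (- 1) (\<phi> x) = koszul T 1 (\<phi> x)" by (rule T.koszul_parity) (simp_all add: hom(4)[OF x(1)])
  then show ?thesis unfolding bar_ext_pure[OF T.central_regular f w] bar_ext_eq[OF words_length[OF x(2)]] by simp
qed

lemma bext_hom: "cochain K R T NT s f ==> bext s f \<in> Group.hom (bar K R s) (add_monoid T)"
  using twistedD(1)[OF bext_twisted] by (simp add: hom_regular)

text \<open>On a word with units at both ends the faces of the bar differential are the terms of the
  Hochschild coboundary. The two outer faces produce the actions of \<open>\<phi> x\<close> and
  \<open>\<phi> z\<close>.\<close>

lemma bext_diff_2:
  assumes f: "cochain K R T NT n2 (%ts. f (ts ! 0) (ts ! 1))"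
    and x: "x <: R" "y <: R" "z <: R"
  shows "bext n2 (%ts. f (ts ! 0) (ts ! 1)) (bar_diff K R n2 (pure_word K R n5 [1\<^sub>R, x, y, z, 1\<^sub>R])) =
    ((koszul T 1 (\<phi> x) *\<^sub>T f y z -\<^sub>T f (x *\<^sub>R y) z) +\<^sub>T f x (y *\<^sub>R z)) -\<^sub>T f x y *\<^sub>T \<phi> z"
proof -
  let ?f = "%ts. f (ts ! 0) (ts ! 1)" let ?w = "[1\<^sub>R, x, y, z, 1\<^sub>R]"
  define h where "h = bext n2 ?f"
  have hh: "h \<in> Group.hom (bar K R n2) (add_monoid T)" unfolding h_def by (rule bext_hom[OF f])
  let ?p = "pure_word K R n4"
  have w: "?w \<in> words R n5" using x by (simp add: words_def)
  have fc: "f a b <: T" if "a <: R" "b <: R" for a b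
    using cochainD(1)[OF f, of "[a, b]"] that by (simp add: R.words_2)
  have v: "h (?p [a, b, c, e]) = koszul T 1 (\<phi> a) *\<^sub>T f b c *\<^sub>T \<phi> e" if "a <: R" "b <: R" "c <: R" "e <: R" for a b c e
    unfolding h_def using bext_pure[OF f that(1) _ that(4), of "[b, c]"] that by (simp add: R.words_2)
  \<comment> \<open>The summand is continued by zero because the expansion of the product asks for a
    function with all values in the carrier.\<close>
  let ?s = "%i. if i \<le> n3 then signed (add_monoid T) (int i) (h (?p (multiply_at R i ?w))) else 0\<^sub>T"
  have m: "multiply_at R 0 ?w = [x, y, z, 1\<^sub>R]" "multiply_at R 1 ?w = [1\<^sub>R, x *\<^sub>R y, z, 1\<^sub>R]"
    "multiply_at R 2 ?w = [1\<^sub>R, x, y *\<^sub>R z, 1\<^sub>R]" "multiply_at R 3 ?w = [1\<^sub>R, x, y, z]"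
    using x by (simp_all add: multiply_at_def numeral_2_eq_2 numeral_3_eq_3)
  have sc: "?s i <: add_monoid T" for i
  proof (cases "i \<le> n3")
    case True
    have "h (?p (multiply_at R i ?w)) <: add_monoid T"
      by (rule hom_closed[OF hh R.pw_closed[OF R.mult_at[OF w]]]) (use True in simp)
    then show ?thesis using signed_closed[OF T.group_add] True by simp
  qed simp
  have s: "?s 0 = koszul T 1 (\<phi> x) *\<^sub>T f y z" "?s 1 = -\<^sub>T f (x *\<^sub>R y) z" "?s 2 = f x (y *\<^sub>R z)" "?s 3 = -\<^sub>T (f x y *\<^sub>T \<phi> z)"
    unfolding m using x fc hom(4) by (simp_all add: v hom(7) T.koszul_one signed_def a_inv_def[symmetric])
  have "h (bar_diff K R n2 (pure_word K R n5 ?w)) =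
     finprod (add_monoid T) (%i. signed (add_monoid T) (int i) (h (?p (multiply_at R i ?w)))) {..n3}"
    unfolding R.bar_diff_pure[OF w] by (rule R.hom_bar_finprod[OF hh T.comm_group_add w order_refl])
  also have "\<dots> = finprod (add_monoid T) ?s {..n3}"
    by (rule comm_monoid.finprod_cong'[OF comm_group.axioms(1)[OF T.comm_group_add] refl]) (use sc in auto)
  also have "\<dots> = ?s 3 +\<^sub>T (?s 2 +\<^sub>T (?s 1 +\<^sub>T ?s 0))"
    using comm_monoid.finprod_atMost_3[OF comm_group.axioms(1)[OF T.comm_group_add] sc] by simp
  also have "\<dots> = ((koszul T 1 (\<phi> x) *\<^sub>T f y z -\<^sub>T f (x *\<^sub>R y) z) +\<^sub>T f x (y *\<^sub>R z)) -\<^sub>T f x y *\<^sub>T \<phi> z"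
    unfolding s using x fc hom(4) by (simp add: a_minus_def T.a_ac)
  finally show ?thesis unfolding h_def .
qed

lemma bext_diff_3:
  assumes f: "cochain K R T NT n3 (%ts. f (ts ! 0) (ts ! 1) (ts ! 2))"
    and x: "x1 <: R" "x2 <: R" "x3 <: R" "x4 <: R"
  shows "bext n3 (%ts. f (ts ! 0) (ts ! 1) (ts ! 2)) (bar_diff K R n3
      (pure_word K R n6 [1\<^sub>R, x1, x2, x3, x4, 1\<^sub>R])) =
    (((koszul T 1 (\<phi> x1) *\<^sub>T f x2 x3 x4 -\<^sub>T f (x1 *\<^sub>R x2) x3 x4) +\<^sub>T f x1 (x2 *\<^sub>R x3) x4)
      -\<^sub>T f x1 x2 (x3 *\<^sub>R x4)) +\<^sub>T f x1 x2 x3 *\<^sub>T \<phi> x4"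
proof -
  let ?f = "%ts. f (ts ! 0) (ts ! 1) (ts ! 2)" let ?w = "[1\<^sub>R, x1, x2, x3, x4, 1\<^sub>R]"
  define h where "h = bext n3 ?f"
  have hh: "h \<in> Group.hom (bar K R n3) (add_monoid T)" unfolding h_def by (rule bext_hom[OF f])
  let ?p = "pure_word K R n5"
  have w: "?w \<in> words R n6" using x by (simp add: words_def)
  have fc: "f a b c <: T" if "a <: R" "b <: R" "c <: R" for a b c
    using cochainD(1)[OF f, of "[a, b, c]"] that by (simp add: R.words_3)
  have v: "h (?p [a, b, c, d, e]) = koszul T 1 (\<phi> a) *\<^sub>T f b c d *\<^sub>T \<phi> e"
    if "a <: R" "b <: R" "c <: R" "d <: R" "e <: R" for a b c d e
    unfolding h_def using bext_pure[OF f that(1) _ that(5), of "[b, c, d]"] that by (simp add: R.words_3)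
  have 4: "(4::nat) = n4" by simp
  let ?s = "%i. if i \<le> n4 then signed (add_monoid T) (int i) (h (?p (multiply_at R i ?w))) else 0\<^sub>T"
  have m: "multiply_at R 0 ?w = [x1, x2, x3, x4, 1\<^sub>R]" "multiply_at R 1 ?w = [1\<^sub>R, x1 *\<^sub>R x2, x3, x4, 1\<^sub>R]"
    "multiply_at R 2 ?w = [1\<^sub>R, x1, x2 *\<^sub>R x3, x4, 1\<^sub>R]" "multiply_at R 3 ?w = [1\<^sub>R, x1, x2, x3 *\<^sub>R x4, 1\<^sub>R]"
    "multiply_at R 4 ?w = [1\<^sub>R, x1, x2, x3, x4]"
    using x by (simp_all add: multiply_at_def numeral_2_eq_2 numeral_3_eq_3 4)
  have sc: "?s i <: add_monoid T" for i
  proof (cases "i \<le> n4")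
    case True
    have "h (?p (multiply_at R i ?w)) <: add_monoid T"
      by (rule hom_closed[OF hh R.pw_closed[OF R.mult_at[OF w]]]) (use True in simp)
    then show ?thesis using signed_closed[OF T.group_add] True by simp
  qed simp
  have s: "?s 0 = koszul T 1 (\<phi> x1) *\<^sub>T f x2 x3 x4" "?s 1 = -\<^sub>T f (x1 *\<^sub>R x2) x3 x4" "?s 2 = f x1 (x2 *\<^sub>R x3) x4"
    "?s 3 = -\<^sub>T f x1 x2 (x3 *\<^sub>R x4)" "?s 4 = f x1 x2 x3 *\<^sub>T \<phi> x4"
    unfolding m using x fc hom(4) by (simp_all add: v hom(7) T.koszul_one signed_def a_inv_def[symmetric])
  have "h (bar_diff K R n3 (pure_word K R n6 ?w)) =
     finprod (add_monoid T) (%i. signed (add_monoid T) (int i) (h (?p (multiply_at R i ?w)))) {..n4}"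
    unfolding R.bar_diff_pure[OF w] by (rule R.hom_bar_finprod[OF hh T.comm_group_add w order_refl])
  also have "\<dots> = finprod (add_monoid T) ?s {..n4}"
    by (rule comm_monoid.finprod_cong'[OF comm_group.axioms(1)[OF T.comm_group_add] refl]) (use sc in auto)
  also have "\<dots> = ?s 4 +\<^sub>T (?s 3 +\<^sub>T (?s 2 +\<^sub>T (?s 1 +\<^sub>T ?s 0)))"
    using comm_monoid.finprod_atMost_4[OF comm_group.axioms(1)[OF T.comm_group_add] sc] by simp
  also have "\<dots> = (((koszul T 1 (\<phi> x1) *\<^sub>T f x2 x3 x4 -\<^sub>T f (x1 *\<^sub>R x2) x3 x4) +\<^sub>T f x1 (x2 *\<^sub>R x3) x4)
      -\<^sub>T f x1 x2 (x3 *\<^sub>R x4)) +\<^sub>T f x1 x2 x3 *\<^sub>T \<phi> x4"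
    unfolding s using x fc hom(4) by (simp add: a_minus_def T.a_ac)
  finally show ?thesis unfolding h_def .
qed

end

section \<open>The map induced by a flat epimorphism\<close>

text \<open>Maps on classes are written as unions over all representatives; such a union collapses
  as soon as the family is constant.\<close>

lemma UN_eq: "[|y \<in> Y; !!x. x \<in> Y ==> F x = F y|] ==> (\<Union>x\<in>Y. F x) = F y"
  by blast

context graded_algebra
begin

lemma bar_extension_eq: "bar_extension K A s t f = word_lift K A (Suc (Suc s)) NA (bar_ext A id t NA s f)"
  by (simp add: bar_extension_def bar_ext_def[abs_def])

lemma bar_extension_twisted: "cochain K A A NA s f ==> bar_extension K A s t f \<in> twisted A A id t (B s) NA"
  unfolding bar_extension_eq by (rule alg_map.bar_ext_twisted[OF alg_map_id central_regular])

lemma bar_extension_unit: "[|cochain K A A NA s f; ts \<in> words A s|] ==> bar_extension K A s t f (pw (Suc (Suc s)) (1\<^sub>A # ts @ [1\<^sub>A])) = f ts"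
  unfolding bar_extension_eq by (rule alg_map.bar_ext_unit[OF alg_map_id central_regular])

lemma bar_extension_gr_hom:
  assumes f: "cochain K A A NA s f"
    and h: "!!ts e. [|ts \<in> words A s; \<forall>i<s. ts ! i \<in> part A (e i)|] ==> f ts \<in> part A ((\<Sum>i<s. e i) + t)"
  shows "bar_extension K A s t f <: gr_hom A t (B s) NA"
proof -
  have "bar_extension K A s t f \<in> extensional (carrier (B s))"
    unfolding bar_extension_eq
    using tensor_powers.word_lift_extensional[OF tp lm_comm_group[OF NA_module(1)] alg_map.bar_ext_multilinear[OF alg_map_id central_regular f]] by simp
  then show ?thesis
    unfolding gr_hom_iff[OF central_bimoduleD(2)[OF central_bar] NA_module(1)]
    using bar_extension_twisted[OF f] alg_map.bar_ext_homogeneous[OF alg_map_id f h] unfolding bar_extension_eq by blast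
qed

lemmas HH_eq_iff = bimod_complex.class_eq_iff[OF bar_complex, folded HH_class_def]
lemmas HH_mem = bimod_complex.class_mem[OF bar_complex, folded HH_class_def]
lemmas HH_self = bimod_complex.class_self[OF bar_complex, folded HH_class_def]
lemmas HH_carrier = bimod_complex.cohomology_carrier[OF bar_complex, folded HH_class_def HH_def]
lemmas bar_homD = gr_homD[OF central_bimoduleD(1)[OF central_bar]]

end

context alg_map
begin

abbreviation "NR \<equiv> regular_bimod R"

lemma \<phi>_twisted:
  assumes \<zeta>: "\<zeta> \<in> twisted R R id e (BR n) NR"
  shows "(%b. \<phi> (\<zeta> b)) \<in> twisted R T \<phi> e (BR n) NT"
proof (rule twistedI)
  have "\<zeta> \<in> Group.hom (BR n) (add_monoid R)" using twistedD(1)[OF \<zeta>] by (simp add: regular_bimod_def)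
  then show "(%b. \<phi> (\<zeta> b)) \<in> Group.hom (BR n) NT" unfolding hom_regular by (rule hom_comp[OF _ hom(8)])
  fix a m assume a: "a <: R" "m <: BR n"
  have z: "\<zeta> m <: R" using twistedD(4)[OF \<zeta> a(2)] by simp
  show "\<phi> (\<zeta> (lact (BR n) a m)) = lact NT (koszul T e (\<phi> a)) (\<phi> (\<zeta> m))"
    unfolding twistedD(2)[OF \<zeta> a] using a z by (simp add: hom(6) koszul_\<phi>)
  show "\<phi> (\<zeta> (ract (BR n) m a)) = ract NT (\<phi> (\<zeta> m)) (\<phi> a)"
    unfolding twistedD(3)[OF \<zeta> a] using a z by (simp add: hom(6))
qed

text \<open>The relation \<open>rel\<close> between trilinear maps is the asserted equation on words
  with units at both ends, where the bar differential becomes the Hochschild coboundary of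
  \<open>\<omega>\<close>.\<close>

lemma bar_extension_natural:
  assumes F: "cochain K R R NR n3 (%ts. F (ts ! 0) (ts ! 1) (ts ! 2))"
    and G: "cochain K T T NT n3 (%ts. G (ts ! 0) (ts ! 1) (ts ! 2))"
    and \<omega>: "cochain K R T NT n2 (%ts. \<omega> (ts ! 0) (ts ! 1))"
    and rel: "!!x y z. [|x <: R; y <: R; z <: R|] ==> \<phi> (F x y z) = G (\<phi> x) (\<phi> y) (\<phi> z) +\<^sub>T
      (((koszul T 1 (\<phi> x) *\<^sub>T \<omega> y z -\<^sub>T \<omega> (x *\<^sub>R y) z) +\<^sub>T \<omega> x (y *\<^sub>R z)) -\<^sub>T \<omega> x y *\<^sub>T \<phi> z)"
    and b: "b \<in> carrier (BR n3)"
  shows "\<phi> (bar_extension K R n3 (- 1) (%ts. F (ts ! 0) (ts ! 1) (ts ! 2)) b) =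
    bar_extension K T n3 (- 1) (%ts. G (ts ! 0) (ts ! 1) (ts ! 2)) (bar_map n3 b) +\<^sub>T
    bext n2 (%ts. \<omega> (ts ! 0) (ts ! 1)) (bar_diff K R n2 b)"
proof -
  let ?n = "n3"
  define \<zeta> where "\<zeta> = bar_extension K R ?n (- 1) (%ts. F (ts ! 0) (ts ! 1) (ts ! 2))"
  define \<eta> where "\<eta> = bar_extension K T ?n (- 1) (%ts. G (ts ! 0) (ts ! 1) (ts ! 2))"
  define \<xi> where "\<xi> = bext n2 (%ts. \<omega> (ts ! 0) (ts ! 1))"
  have f: "(%b. \<phi> (\<zeta> b)) \<in> twisted R T \<phi> (- 1) (BR ?n) NT"
    unfolding \<zeta>_def by (rule \<phi>_twisted[OF R.bar_extension_twisted[OF F]])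
  have g1: "(%b. \<eta> (bar_map ?n b)) \<in> twisted R T \<phi> (- 1) (BR ?n) NT"
    using T.twisted_comp[OF bar_map_twisted T.bar_extension_twisted[OF G] hom(4)] unfolding \<eta>_def by simp
  have g2: "(%b. \<xi> (bar_diff K R n2 b)) \<in> twisted R T \<phi> (- 1) (BR ?n) NT"
    unfolding \<xi>_def by (rule R.twisted_precomp[OF R.bar_diff_twisted bext_twisted[OF \<omega>]])
  have g: "(%b. \<eta> (bar_map ?n b) *\<^sub>NT \<xi> (bar_diff K R n2 b)) \<in> twisted R T \<phi> (- 1) (BR ?n) NT"
    by (rule T.twisted_mult[OF T.NA_module(2) g1 g2 hom(4)])
  have "\<phi> (\<zeta> b) = \<eta> (bar_map ?n b) *\<^sub>NT \<xi> (bar_diff K R n2 b)"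
  proof (rule R.twisted_bar_eqI[OF f g T.NA_module(3) _ b])
    fix ts assume ts: "ts \<in> words R ?n"
    then obtain x y z where x: "ts = [x, y, z]" "x <: R" "y <: R" "z <: R" by (auto simp: R.words_3)
    let ?u = "pure_word K R (Suc (Suc ?n)) (1\<^sub>R # ts @ [1\<^sub>R])"
    have w: "1\<^sub>R # ts @ [1\<^sub>R] \<in> words R (Suc (Suc ?n))" using ts by (simp add: words_Cons words_snoc)
    have m: "map \<phi> (1\<^sub>R # ts @ [1\<^sub>R]) = 1\<^sub>T # map \<phi> ts @ [1\<^sub>T]" by (simp add: hom(7))
    have 1: "\<zeta> ?u = F x y z" unfolding \<zeta>_def R.bar_extension_unit[OF F ts] by (simp add: x numeral_2_eq_2)
    have 2: "\<eta> (bar_map ?n ?u) = G (\<phi> x) (\<phi> y) (\<phi> z)"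
      unfolding \<eta>_def bar_map_pure[OF w] m T.bar_extension_unit[OF G map_words[OF ts]] by (simp add: x numeral_2_eq_2)
    have u: "1\<^sub>R # ts @ [1\<^sub>R] = [1\<^sub>R, x, y, z, 1\<^sub>R]" by (simp add: x(1))
    show "\<phi> (\<zeta> ?u) = \<eta> (bar_map ?n ?u) *\<^sub>NT \<xi> (bar_diff K R n2 ?u)"
      unfolding 1 2 rel[OF x(2-4)] unfolding \<xi>_def u bext_diff_2[OF \<omega> x(2-4)] by simp
  qed
  then show ?thesis unfolding \<zeta>_def \<eta>_def \<xi>_def by simp
qed

lemma sandwich_coboundary:
  assumes \<alpha>: "\<alpha> \<in> twisted R T \<phi> e (BR (Suc n)) NT" and \<alpha>0: "\<alpha>0 \<in> twisted R T \<phi> e (BR (Suc n)) NT"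
    and \<gamma>: "\<gamma> \<in> twisted R T \<phi> e (BR n) NT"
    and eq: "!!b. b <: BR (Suc n) ==> \<alpha> b = \<alpha>0 b +\<^sub>T \<gamma> (bar_diff K R n b)"
    and x: "x <: X (Suc n)"
  shows "sandwich K R T \<phi> (Suc n) NT e \<alpha> x = sandwich K R T \<phi> (Suc n) NT e \<alpha>0 x +\<^sub>T sandwich K R T \<phi> n NT e \<gamma> (D n x)"
proof -
  note C = T.central_regular
  note S = sandwich_twisted[OF C \<alpha>] sandwich_twisted[OF C \<alpha>0] T.twisted_precomp[OF D_twisted sandwich_twisted[OF C \<gamma>]]
  have "sandwich K R T \<phi> (Suc n) NT e \<alpha> x = sandwich K R T \<phi> (Suc n) NT e \<alpha>0 x *\<^sub>NT sandwich K R T \<phi> n NT e \<gamma> (D n x)"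
  proof (rule X_twisted_eqI[OF S(1) T.twisted_mult[OF T.NA_module(2) S(2,3)] T.NA_module(3) _ x])
    fix b assume b: "b <: BR (Suc n)"
    show "sandwich K R T \<phi> (Suc n) NT e \<alpha> (unit_gen (Suc n) b) =
        sandwich K R T \<phi> (Suc n) NT e \<alpha>0 (unit_gen (Suc n) b) *\<^sub>NT sandwich K R T \<phi> n NT e \<gamma> (D n (unit_gen (Suc n) b))"
      unfolding D_unit[OF b] sandwich_unit[OF C \<alpha> b] sandwich_unit[OF C \<alpha>0 b] sandwich_unit[OF C \<gamma> hom_closed[OF R.bar_diff_hom b]] eq[OF b] by simp
  qed simp_all
  then show ?thesis by simp
qed

lemma sandwich_gr_hom:
  assumes "\<alpha> \<in> twisted R T \<phi> t (BR n) NT" "homogeneous_map t (BR n) NT \<alpha>"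
  shows "sandwich K R T \<phi> n NT t \<alpha> <: gr_hom T t (X n) NT"
  unfolding T.gr_hom_iff[OF bimodule_left[OF bimod_X] T.NA_module(1)]
  using sandwich_twisted[OF T.central_regular assms(1)] sandwich_extensional[OF T.central_regular assms(1)]
    sandwich_homogeneous[OF T.central_regular T.graded_regular assms] by blast

lemma \<phi>_homogeneous: "homogeneous_map t (BR n) NR \<zeta> ==> homogeneous_map t (BR n) NT (%b. \<phi> (\<zeta> b))"
  by (simp add: homogeneous_map_def hom(3))

abbreviation "BCC s t \<equiv> base_change_class K R T \<phi> s t"

lemmas BC_eq_iff = bimod_complex.class_eq_iff[OF base_change_complex, folded base_change_class_def]

text \<open>Coboundaries of \<open>R\<close> are base changed together with the cocycles, so all
  members of the union occurring in \<open>Gamma\<close> coincide.\<close>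

lemma sandwich_class:
  assumes \<zeta>0: "\<zeta>0 <: (gr_hom R t (BR (Suc n)) NR)"
  shows "(\<Union>\<zeta>\<in>HH_class K R (Suc n) t \<zeta>0. BCC (Suc n) t (sandwich K R T \<phi> (Suc n) NT t (%b. \<phi> (\<zeta> b))))
    = BCC (Suc n) t (sandwich K R T \<phi> (Suc n) NT t (%b. \<phi> (\<zeta>0 b)))"
proof (rule UN_eq[OF R.HH_self[OF \<zeta>0]])
  fix \<zeta> assume "\<zeta> \<in> HH_class K R (Suc n) t \<zeta>0"
  note \<zeta> = R.HH_mem[OF \<zeta>0 this]
  obtain \<beta> where \<beta>: "\<beta> <: gr_hom R t (BR n) NR" "\<forall>u\<in>carrier (BR (Suc n)). \<zeta> u = \<zeta>0 u +\<^sub>R \<beta> (bar_diff K R n u)"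
    using \<zeta>(2) unfolding R.HH_eq_iff[OF \<zeta>(1) \<zeta>0] by blast
  note D1 = R.bar_homD[OF \<zeta>(1)] and D0 = R.bar_homD[OF \<zeta>0] and D2 = R.bar_homD[OF \<beta>(1)]
  have G: "sandwich K R T \<phi> m NT t (%b. \<phi> (\<zeta> b)) <: gr_hom T t (X m) NT" if "\<zeta> <: gr_hom R t (BR m) NR" for \<zeta> m
    by (rule sandwich_gr_hom[OF \<phi>_twisted[OF R.bar_homD(1)[OF that]] \<phi>_homogeneous[OF R.bar_homD(3)[OF that]]])
  have "\<phi> (\<zeta> b) = \<phi> (\<zeta>0 b) +\<^sub>T \<phi> (\<beta> (bar_diff K R n b))" if b: "b <: BR (Suc n)" for b
    using bspec[OF \<beta>(2) b] hom(5)[OF D0(4)[OF b] D2(4)[OF hom_closed[OF R.bar_diff_hom b]]] by simp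
  note sandwich_coboundary[OF \<phi>_twisted[OF D1(1)] \<phi>_twisted[OF D0(1)] \<phi>_twisted[OF D2(1)] this]
  then show "BCC (Suc n) t (sandwich K R T \<phi> (Suc n) NT t (%b. \<phi> (\<zeta> b))) = BCC (Suc n) t (sandwich K R T \<phi> (Suc n) NT t (%b. \<phi> (\<zeta>0 b)))"
    unfolding BC_eq_iff[OF G[OF \<zeta>(1)] G[OF \<zeta>0]] using G[OF \<beta>(1)] by blast
qed

lemma comparison_gr_hom: "\<eta> <: gr_hom T t (BT n) NT ==> compose (carrier (X n)) \<eta> (cmp n) <: gr_hom T t (X n) NT"
  unfolding compose_def
  by (rule T.gr_homI[OF bimod_X X_gr_subset T.twisted_precomp[OF comp_twisted T.bar_homD(1)] homogeneous_map_comp[OF comp_homogeneous T.bar_homD(3)]])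

text \<open>The comparison map commutes with the differentials and so carries coboundaries to
  coboundaries, which makes the union constant.\<close>

lemma comparison_pullback_class:
  assumes \<eta>0: "\<eta>0 <: (gr_hom T t (BT (Suc n)) NT)"
  shows "comparison_pullback K R T \<phi> (Suc n) t (HH_class K T (Suc n) t \<eta>0) = BCC (Suc n) t (compose (carrier (X (Suc n))) \<eta>0 (cmp (Suc n)))"
  unfolding comparison_pullback_def
proof (rule UN_eq[OF T.HH_self[OF \<eta>0]])
  fix \<eta> assume "\<eta> \<in> HH_class K T (Suc n) t \<eta>0"
  note \<eta> = T.HH_mem[OF \<eta>0 this]
  obtain \<beta> where \<beta>: "\<beta> <: gr_hom T t (BT n) NT" "\<forall>u\<in>carrier (BT (Suc n)). \<eta> u = \<eta>0 u +\<^sub>T \<beta> (dT n u)"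
    using \<eta>(2) unfolding T.HH_eq_iff[OF \<eta>(1) \<eta>0] by blast
  have "\<forall>x\<in>carrier (X (Suc n)). compose (carrier (X (Suc n))) \<eta> (cmp (Suc n)) x =
     compose (carrier (X (Suc n))) \<eta>0 (cmp (Suc n)) x +\<^sub>T compose (carrier (X n)) \<beta> (cmp n) (D n x)"
  proof
    fix x assume x: "x <: X (Suc n)"
    show "compose (carrier (X (Suc n))) \<eta> (cmp (Suc n)) x =
     compose (carrier (X (Suc n))) \<eta>0 (cmp (Suc n)) x +\<^sub>T compose (carrier (X n)) \<beta> (cmp n) (D n x)"
      using bspec[OF \<beta>(2) twistedD(4)[OF comp_twisted x]] unfolding comp_D[OF x, symmetric] compose_def restrict_apply'[OF x] restrict_apply'[OF twistedD(4)[OF D_twisted x]] .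
  qed
  then show "BCC (Suc n) t (compose (carrier (X (Suc n))) \<eta> (cmp (Suc n))) = BCC (Suc n) t (compose (carrier (X (Suc n))) \<eta>0 (cmp (Suc n)))"
    unfolding BC_eq_iff[OF comparison_gr_hom[OF \<eta>(1)] comparison_gr_hom[OF \<eta>0]] using comparison_gr_hom[OF \<beta>(1)] by blast
qed

lemma comparison_pullback_inj:
  assumes flat: "flat_as_left_module TYPE(('r, 't) test_universe) R Tr"
    and epi: "ring_epimorphism TYPE(('r, 't) test_universe) R T \<phi>"
  shows "inj_on (comparison_pullback K R T \<phi> n3 t) (carrier (HH K T n3 t))"
proof (rule inj_onI)
  let ?m = "n2" let ?n = "Suc ?m"
  fix Y1 Y2 assume Y: "Y1 <: (HH K T ?n t)" "Y2 <: (HH K T ?n t)"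
    and eq: "comparison_pullback K R T \<phi> ?n t Y1 = comparison_pullback K R T \<phi> ?n t Y2"
  obtain \<eta>1 where 1: "Y1 = HH_class K T ?n t \<eta>1" "\<eta>1 <: gr_hom T t (BT ?n) NT" "\<forall>u\<in>carrier (BT (Suc ?n)). \<eta>1 (dT ?n u) = 0\<^sub>T"
    using Y(1) unfolding T.HH_carrier bimod_complex.cocycles_iff[OF T.bar_complex] by (auto simp: HH_class_def bimod_complex.cocycles_iff[OF T.bar_complex] simp del: bar_simps)
  obtain \<eta>2 where 2: "Y2 = HH_class K T ?n t \<eta>2" "\<eta>2 <: gr_hom T t (BT ?n) NT" "\<forall>u\<in>carrier (BT (Suc ?n)). \<eta>2 (dT ?n u) = 0\<^sub>T"
    using Y(2) unfolding T.HH_carrier bimod_complex.cocycles_iff[OF T.bar_complex] by (auto simp: HH_class_def bimod_complex.cocycles_iff[OF T.bar_complex] simp del: bar_simps)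
  note D1 = T.bar_homD[OF 1(2)] and D2 = T.bar_homD[OF 2(2)]
  obtain \<beta> where \<beta>: "\<beta> <: gr_hom T t (X ?m) NT"
    "\<forall>x\<in>carrier (X ?n). compose (carrier (X ?n)) \<eta>1 (cmp ?n) x = compose (carrier (X ?n)) \<eta>2 (cmp ?n) x +\<^sub>T \<beta> (D ?m x)"
    using eq unfolding 1(1) 2(1) comparison_pullback_class[OF 1(2)] comparison_pullback_class[OF 2(2)]
      BC_eq_iff[OF comparison_gr_hom[OF 1(2)] comparison_gr_hom[OF 2(2)]] by blast
  note Db = T.gr_homD[OF bimod_X \<beta>(1)]
  let ?\<eta> = "%u. \<eta>1 u -\<^sub>T \<eta>2 u"
  have \<eta>: "?\<eta> \<in> twisted T T id t (BT ?n) NT"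
    using T.twisted_diff[OF T.NA_module(2) D1(1) D2(1)] by (simp add: a_minus_def)
  have \<eta>h: "homogeneous_map t (BT ?n) NT ?\<eta>"
    using D1(3) D2(3) T.part_add T.part_minus by (simp add: homogeneous_map_def a_minus_def)
  have solve: "a -\<^sub>T b = c \<longleftrightarrow> a = b +\<^sub>T c" if "a <: T" "b <: T" "c <: T" for a b c
    using that by (metis T.a_comm a_minus_def T.add.inv_closed T.add.inv_solve_right')
  have cocycle: "?\<eta> (dT ?n u) = 1\<^sub>NT" if "u <: BT (Suc ?n)" for u
    unfolding bspec[OF 1(3) that] bspec[OF 2(3) that] by (simp add: a_minus_def)
  have bd: "?\<eta> (cmp ?n x) = \<beta> (D ?m x)" if x: "x <: (X ?n)" for x
  proof -
    note c = twistedD(4)[OF comp_twisted x]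
    show ?thesis
      unfolding solve[OF D1(4)[OF c] D2(4)[OF c] Db(4)[OF twistedD(4)[OF D_twisted x]]]
      using bspec[OF \<beta>(2) x] unfolding compose_def restrict_apply'[OF x] .
  qed
  obtain \<theta> where \<theta>: "\<theta> \<in> twisted T T id t (BT ?m) NT" "\<forall>u\<in>carrier (BT ?n). ?\<eta> u = \<theta> (dT ?m u)"
    using comparison_injective[OF flat epi T.central_regular \<eta> cocycle Db(1) bd] by blast
  obtain \<theta>' where \<theta>': "\<theta>' \<in> twisted T T id t (BT ?m) NT" "homogeneous_map t (BT ?m) NT \<theta>'" "\<forall>u\<in>carrier (BT ?n). ?\<eta> u = \<theta>' (dT ?m u)"
    using T.homogeneous_coboundary[OF \<theta>(1) \<eta> \<eta>h bspec[OF \<theta>(2)]] by blast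
  have r: "restrict \<theta>' (carrier (BT ?m)) <: gr_hom T t (BT ?m) NT"
    by (rule T.gr_homI[OF bimod_BT T.bar_gr_subset \<theta>'(1,2)])
  have "\<forall>u\<in>carrier (BT ?n). \<eta>1 u = \<eta>2 u +\<^sub>T restrict \<theta>' (carrier (BT ?m)) (dT ?m u)"
  proof
    fix u assume u: "u <: (BT ?n)"
    note du = twistedD(4)[OF T.bar_diff_twisted u]
    have tc: "\<theta>' (dT ?m u) <: T" using twistedD(4)[OF \<theta>'(1) du] by simp
    show "\<eta>1 u = \<eta>2 u +\<^sub>T restrict \<theta>' (carrier (BT ?m)) (dT ?m u)"
      unfolding restrict_apply'[OF du] using bspec[OF \<theta>'(3) u] unfolding solve[OF D1(4)[OF u] D2(4)[OF u] tc] .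
  qed
  then show "Y1 = Y2" unfolding 1(1) 2(1) T.HH_eq_iff[OF 1(2) 2(2)] using r by blast
qed

text \<open>\<open>inv_into\<close> returns the class of \<open>\<eta>\<close> because this class
  lies in the domain, the pullback is injective there, and it sends the class to that of the
  sandwich. The last point holds because the base change of \<open>\<xi>\<close> cobounds the
  difference between the sandwich and the pullback of \<open>\<eta>\<close>.\<close>

lemma Gamma_class:
  assumes flat: "flat_as_left_module TYPE(('r, 't) test_universe) R Tr"
    and epi: "ring_epimorphism TYPE(('r, 't) test_universe) R T \<phi>"
    and \<zeta>: "\<zeta> \<in> carrier (gr_hom R t (BR n3) NR)"
    and \<eta>: "\<eta> \<in> carrier (gr_hom T t (BT n3) NT)" "!!u. u \<in> carrier (BT n4) ==> \<eta> (dT n3 u) = 0\<^sub>T"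
    and \<xi>: "\<xi> \<in> twisted R T \<phi> t (BR n2) NT" "homogeneous_map t (BR n2) NT \<xi>"
    and eq: "!!b. b \<in> carrier (BR n3) ==> \<phi> (\<zeta> b) = \<eta> (bar_map n3 b) +\<^sub>T \<xi> (bar_diff K R n2 b)"
  shows "Gamma K R T \<phi> n3 t (HH_class K R n3 t \<zeta>) = HH_class K T n3 t \<eta>"
proof -
  let ?m = "n2" let ?n = "Suc ?m"
  note C = T.central_regular
  let ?S = "sandwich K R T \<phi> ?n NT t (%b. \<phi> (\<zeta> b))"
  have z: "(%b. \<phi> (\<zeta> b)) \<in> twisted R T \<phi> t (BR ?n) NT" by (rule \<phi>_twisted[OF R.bar_homD(1)[OF \<zeta>]])
  have e: "(%b. \<eta> (bar_map ?n b)) \<in> twisted R T \<phi> t (BR ?n) NT"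
    using T.twisted_comp[OF bar_map_twisted T.bar_homD(1)[OF \<eta>(1)] hom(4)] by simp
  have S: "?S <: gr_hom T t (X ?n) NT" by (rule sandwich_gr_hom[OF z \<phi>_homogeneous[OF R.bar_homD(3)[OF \<zeta>]]])
  have "\<forall>x\<in>carrier (X ?n). ?S x = compose (carrier (X ?n)) \<eta> (cmp ?n) x +\<^sub>T sandwich K R T \<phi> ?m NT t \<xi> (D ?m x)"
  proof
    fix x assume x: "x <: (X ?n)"
    have "sandwich K R T \<phi> ?n NT t (%b. \<eta> (bar_map ?n b)) x = \<eta> (cmp ?n x)"
    proof (rule X_twisted_eqI[OF sandwich_twisted[OF C e] T.twisted_precomp[OF comp_twisted T.bar_homD(1)[OF \<eta>(1)]] T.NA_module(3) _ x])
      show "sandwich K R T \<phi> ?n NT t (%b. \<eta> (bar_map ?n b)) (unit_gen ?n b) = \<eta> (cmp ?n (unit_gen ?n b))" if "b <: (BR ?n)" for b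
        unfolding sandwich_unit[OF C e that] comp_unit[OF that] ..
    qed
    moreover have "?S x = sandwich K R T \<phi> ?n NT t (%b. \<eta> (bar_map ?n b)) x +\<^sub>T sandwich K R T \<phi> ?m NT t \<xi> (D ?m x)"
      by (rule sandwich_coboundary[OF z e \<xi>(1) eq x])
    ultimately show "?S x = compose (carrier (X ?n)) \<eta> (cmp ?n) x +\<^sub>T sandwich K R T \<phi> ?m NT t \<xi> (D ?m x)"
      unfolding compose_def restrict_apply'[OF x] by simp
  qed
  then have "BCC ?n t ?S = BCC ?n t (compose (carrier (X ?n)) \<eta> (cmp ?n))"
    unfolding BC_eq_iff[OF S comparison_gr_hom[OF \<eta>(1)]] using sandwich_gr_hom[OF \<xi>] by blast
  then have "(\<Union>\<zeta>\<in>HH_class K R ?n t \<zeta>. BCC ?n t (sandwich K R T \<phi> ?n NT t (%b. \<phi> (\<zeta> b)))) = comparison_pullback K R T \<phi> ?n t (HH_class K T ?n t \<eta>)"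
    unfolding sandwich_class[OF \<zeta>] comparison_pullback_class[OF \<eta>(1)] .
  moreover have "HH_class K T ?n t \<eta> <: (HH K T ?n t)"
    unfolding T.HH_carrier HH_class_def by (rule imageI) (use \<eta> in \<open>simp add: bimod_complex.cocycles_iff[OF T.bar_complex] del: bar_simps\<close>)
  ultimately show ?thesis
    unfolding Gamma_def using inv_into_f_f[OF comparison_pullback_inj[OF flat epi]] by simp
qed

lemma bext_homogeneous:
  assumes \<omega>: "cochain K R T NT n2 (%ts. \<omega> (ts ! 0) (ts ! 1))"
    and h: "!!i j x y. [|x \<in> part R i; y \<in> part R j|] ==> \<omega> x y \<in> part T (i + j - 1)"
  shows "homogeneous_map (- 1) (BR n2) NT (bext n2 (%ts. \<omega> (ts ! 0) (ts ! 1)))"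
proof (rule bar_ext_homogeneous[OF \<omega>])
  fix ts e assume "ts \<in> words R n2" "\<forall>i<n2. ts ! i \<in> part R (e i)"
  then have "ts ! 0 \<in> part R (e 0)" "ts ! 1 \<in> part R (e 1)" by auto
  from h[OF this] show "\<omega> (ts ! 0) (ts ! 1) \<in> part T ((\<Sum>i<n2. e i) + - 1)" by simp
qed

end

section \<open>The canonical class\<close>

context dg_algebra
begin

abbreviation "\<mu> f1 f2 \<equiv> bar_extension K HA n3 (- 1) (%xs. m3 A f1 f2 (xs ! 0) (xs ! 1) (xs ! 2))"

context
  fixes f1 f2
  assumes f: "cocycle_section K A f1" "multiplicativity_homotopy K A f1 f2"
begin

lemma m3_cochain: "cochain K HA HA H.NA n3 (%xs. m3 A f1 f2 (xs ! 0) (xs ! 1) (xs ! 2))"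
  by (rule alg_map.cochain_3[OF H.alg_map_id m3_closed[OF f]]) (simp_all add: m3_add[OF f] m3_smult[OF f])

lemma \<mu>_gr_hom: "\<mu> f1 f2 \<in> carrier (gr_hom HA (- 1) (bar K HA n3) H.NA)"
proof (rule H.bar_extension_gr_hom[OF m3_cochain])
  fix ts e assume "ts \<in> words HA n3" "\<forall>i<n3. ts ! i \<in> part HA (e i)"
  then have "ts ! 0 \<in> part HA (e 0)" "ts ! 1 \<in> part HA (e 1)" "ts ! 2 \<in> part HA (e 2)" by (auto simp: numeral_2_eq_2)
  from m3_part[OF f this] show "m3 A f1 f2 (ts ! 0) (ts ! 1) (ts ! 2) \<in> part HA ((\<Sum>i<n3. e i) + - 1)"
    by (simp add: numeral_2_eq_2)
qed

text \<open>On generating words this is the Hochschild cocycle identity for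
  \<open>m3\<close>.\<close>

lemma \<mu>_cocycle:
  assumes u: "u \<in> carrier (bar K HA n4)"
  shows "\<mu> f1 f2 (bar_diff K HA n3 u) = 0\<^sub>HA"
proof (rule H.twisted_bar_eqI[OF H.twisted_precomp[OF H.bar_diff_twisted H.bar_extension_twisted[OF m3_cochain]] _ H.NA_module(3) _ u])
  show "(%u. 0\<^sub>HA) \<in> twisted HA HA id (- 1) (bar K HA n4) H.NA" by (rule twistedI) (simp_all add: hom_def)
  fix ts assume "ts \<in> words HA n4"
  then obtain x1 x2 x3 x4 where x: "ts = [x1, x2, x3, x4]" "x1 <: HA" "x2 <: HA" "x3 <: HA" "x4 <: HA"
    by (auto simp: words_def length_Suc_conv)
  have u: "1\<^sub>HA # ts @ [1\<^sub>HA] = [1\<^sub>HA, x1, x2, x3, x4, 1\<^sub>HA]" by (simp add: x(1))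
  show "\<mu> f1 f2 (bar_diff K HA n3 (pure_word K HA n6 (1\<^sub>HA # ts @ [1\<^sub>HA]))) = 0\<^sub>HA"
    unfolding u H.bar_extension_eq alg_map.bext_diff_3[OF H.alg_map_id m3_cochain x(2-5)] id_apply by (rule m3_hochschild_cocycle[OF f x(2-5)])
qed

end

end

context dg_map
begin

lemma alg_map: "alg_map K A.HA B.HA \<phi>"
  by unfold_locales (rule \<phi>_hom)

lemma \<mu>_natural:
  assumes f: "cocycle_section K A f1" "multiplicativity_homotopy K A f1 f2"
    and g: "cocycle_section K B g1" "multiplicativity_homotopy K B g1 g2"
  shows "\<exists>\<xi>. \<xi> \<in> twisted A.HA B.HA \<phi> (- 1) (bar K A.HA n2) B.H.NA \<and> homogeneous_map (- 1) (bar K A.HA n2) B.H.NA \<xi> \<and>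
    (\<forall>b\<in>carrier (bar K A.HA n3). \<phi> (A.\<mu> f1 f2 b) =
       B.\<mu> g1 g2 (alg_map.bar_map K A.HA B.HA \<phi> n3 b) +\<^sub>B.HA \<xi> (bar_diff K A.HA n2 b))"
  using m3_natural[OF f g]
proof (elim exE conjE, goal_cases)
  case (1 \<omega>)
  note \<omega> = 1[rule_format]
  have c: "cochain K A.HA B.HA B.H.NA n2 (%ts. \<omega> (ts ! 0) (ts ! 1))"
    by (rule alg_map.cochain_2[OF alg_map]) (use 1(1-3) in blast)+
  show ?case
    using alg_map.bext_twisted[OF alg_map c] alg_map.bext_homogeneous[OF alg_map c \<omega>(4)]
      alg_map.bar_extension_natural[OF alg_map A.m3_cochain[OF f] B.m3_cochain[OF g] c \<omega>(5)] by blast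
qed

end

lemma (in dg_algebra) canonical_class_eq:
  assumes f: "cocycle_section K A f1" "multiplicativity_homotopy K A f1 f2"
  shows "canonical_class K A = HH_class K HA n3 (- 1) (\<mu> f1 f2)"
  unfolding canonical_class_def numeral_3_eq_3
proof (rule the_equality)
  show "\<exists>f1' f2'. cocycle_section K A f1' \<and> multiplicativity_homotopy K A f1' f2' \<and>
    HH_class K HA n3 (- 1) (\<mu> f1 f2) = HH_class K HA n3 (- 1) (\<mu> f1' f2')"
    using f by blast
next
  let ?m = "n2"
  fix Y assume "\<exists>g1 g2. cocycle_section K A g1 \<and> multiplicativity_homotopy K A g1 g2 \<and> Y = HH_class K HA (Suc ?m) (- 1) (\<mu> g1 g2)"
  then obtain g1 g2 where g: "cocycle_section K A g1" "multiplicativity_homotopy K A g1 g2" and Y: "Y = HH_class K HA (Suc ?m) (- 1) (\<mu> g1 g2)"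
    by blast
  interpret I: dg_map K A A id by (rule cohomology_map_id(1)[OF dg_algebra_axioms])
  \<comment> \<open>The map induced by the identity is extensional, hence agrees with the identity
    on the carrier only; the twisting rule and \<open>bar_map\<close> are therefore converted
    separately below.\<close>
  have \<phi>: "I.\<phi> x = x" if "x <: HA" for x by (rule cohomology_map_id(2)[OF dg_algebra_axioms that])
  obtain \<xi> where \<xi>: "\<xi> \<in> twisted HA HA I.\<phi> (- 1) (bar K HA ?m) H.NA" "homogeneous_map (- 1) (bar K HA ?m) H.NA \<xi>"
    "\<forall>b\<in>carrier (bar K HA (Suc ?m)). I.\<phi> (\<mu> g1 g2 b) = \<mu> f1 f2 (alg_map.bar_map K HA HA I.\<phi> (Suc ?m) b) +\<^sub>HA \<xi> (bar_diff K HA ?m b)"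
    using I.\<mu>_natural[OF g f] by blast
  have \<xi>t: "\<xi> \<in> twisted HA HA id (- 1) (bar K HA ?m) H.NA"
    by (rule twistedI[OF twistedD(1)[OF \<xi>(1)]]) (use twistedD(2,3)[OF \<xi>(1)] \<phi> in simp_all)
  note D = H.bar_homD[OF \<mu>_gr_hom[OF g]]
  have bm: "alg_map.bar_map K HA HA I.\<phi> (Suc ?m) b = b" if b: "b <: bar K HA (Suc ?m)" for b
  proof (rule tensor_powers.hom_eqI[OF H.tp])
    show "alg_map.bar_map K HA HA I.\<phi> (Suc ?m) \<in> hom (tensor_power K HA (Suc (Suc (Suc ?m)))) (bar K HA (Suc ?m))"
      using alg_map.bar_map_hom[OF I.alg_map, of "Suc ?m"] by simp
    show "(%u. u) \<in> hom (tensor_power K HA (Suc (Suc (Suc ?m)))) (bar K HA (Suc ?m))" by (simp add: hom_def)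
    show "group (bar K HA (Suc ?m))" by (rule H.B_group)
    show "b \<in> carrier (tensor_power K HA (Suc (Suc (Suc ?m))))" using b by simp
    fix xs assume xs: "xs \<in> words HA (Suc (Suc (Suc ?m)))"
    have "map I.\<phi> xs = xs" by (rule map_idI) (use xs \<phi> in \<open>auto simp: words_def\<close>)
    then show "alg_map.bar_map K HA HA I.\<phi> (Suc ?m) (pure_word K HA (Suc (Suc (Suc ?m))) xs) = pure_word K HA (Suc (Suc (Suc ?m))) xs"
      using alg_map.bar_map_pure[OF I.alg_map xs] by simp
  qed
  have r: "restrict \<xi> (carrier (bar K HA ?m)) <: (gr_hom HA (- 1) (bar K HA ?m) H.NA)"
    by (rule H.gr_homI[OF central_bimoduleD(1)[OF H.central_bar] H.bar_gr_subset \<xi>t \<xi>(2)])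
  have "\<forall>b\<in>carrier (bar K HA (Suc ?m)). \<mu> g1 g2 b = \<mu> f1 f2 b +\<^sub>HA restrict \<xi> (carrier (bar K HA ?m)) (bar_diff K HA ?m b)"
  proof
    fix b assume b: "b <: bar K HA (Suc ?m)"
    show "\<mu> g1 g2 b = \<mu> f1 f2 b +\<^sub>HA restrict \<xi> (carrier (bar K HA ?m)) (bar_diff K HA ?m b)"
      unfolding restrict_apply'[OF hom_closed[OF H.bar_diff_hom b]] using bspec[OF \<xi>(3) b] unfolding \<phi>[OF D(4)[OF b]] bm[OF b] .
  qed
  then show "Y = HH_class K HA (Suc ?m) (- 1) (\<mu> f1 f2)"
    unfolding Y H.HH_eq_iff[OF \<mu>_gr_hom[OF g] \<mu>_gr_hom[OF f]] using r by blast
qed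

theorem theorem12p5:
  fixes K :: "('k, 'p) ring_scheme"
    and A :: "('k, 'a) dg_alg"
    and B :: "('k, 'b) dg_alg"
    and \<psi> :: "'a => 'b"
  assumes "field K"
    and "dg_algebra K A"
    and "dg_algebra K B"
    and "dg_hom K A B \<psi>"
    and "flat_epimorphism K (cohomology A) (cohomology B) (cohomology_map A B \<psi>)"
  shows "Gamma K (cohomology A) (cohomology B) (cohomology_map A B \<psi>) 3 (- 1) (canonical_class K A)
         = canonical_class K B"
proof -
  interpret dg_map K A B \<psi> using assms(2-4) by (simp add: dg_map_def dg_map_axioms_def)
  note flat = assms(5)[unfolded flat_epimorphism_def, THEN conjunct2, THEN conjunct2, THEN conjunct1]
    and epi = assms(5)[unfolded flat_epimorphism_def, THEN conjunct2, THEN conjunct1]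
  obtain f1 f2 where f: "cocycle_section K A f1" "multiplicativity_homotopy K A f1 f2"
    using A.ex_cocycle_section A.ex_multiplicativity_homotopy by blast
  obtain g1 g2 where g: "cocycle_section K B g1" "multiplicativity_homotopy K B g1 g2"
    using B.ex_cocycle_section B.ex_multiplicativity_homotopy by blast
  obtain \<xi> where \<xi>: "\<xi> \<in> twisted A.HA B.HA \<phi> (- 1) (bar K A.HA n2) B.H.NA" "homogeneous_map (- 1) (bar K A.HA n2) B.H.NA \<xi>"
    "\<forall>b\<in>carrier (bar K A.HA n3). \<phi> (A.\<mu> f1 f2 b) =
       B.\<mu> g1 g2 (alg_map.bar_map K A.HA B.HA \<phi> n3 b) +\<^sub>B.HA \<xi> (bar_diff K A.HA n2 b)"
    using \<mu>_natural[OF f g] by blast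
  show ?thesis
    unfolding A.canonical_class_eq[OF f] B.canonical_class_eq[OF g] numeral_3_eq_3
    by (rule alg_map.Gamma_class[OF alg_map flat epi A.\<mu>_gr_hom[OF f] B.\<mu>_gr_hom[OF g] B.\<mu>_cocycle[OF g] \<xi>(1,2) bspec[OF \<xi>(3)]])
qed

end
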